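(* There exists an ordinary elliptic curve over a perfect field $k$ of characteristic $2$, namely $k$ the perfect closure of $\mathbb{F}_2(t)$, which does not admit a finite separable tame morphism to $\mathbb{P}^1_k$. Explicitly, one can take the elliptic curve over $k=\mathbb{F}_2(t^{1/2^\infty})$ given by the equation $$y^2+xy=x^3+tx^2+t^6.$$
   Context: Here $\mathbb{F}_2(t^{1/2^\infty})=\bigcup_{n\ge 0}\mathbb{F}_2(t^{1/2^n})$ is the perfect closure of $\mathbb{F}_2(t)$. A finite separable morphism $f\colon X\to\mathbb{P}^1_k$ of $k$-schemes is tame if for every $x\in X(\overline{k})$ the ramification index $e_x$ of $f$ at $x$ (defined by $f^{-1}\mathfrak{m}_{\mathbb{P}^1_{\overline{k}},f(x)}\cdot\mathcal{O}_{X_{\overline{k}}}=\mathfrak{m}_{X_{\overline{k}},x}^{e_x}$) is not divisible by the characteristic $2$. *)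

theory Defs
  imports
    "HOL-Algebra.Algebraic_Closure_Type"
    "HOL-Algebra.Generated_Fields"
    "HOL-Algebra.Ideal_Product"
    "HOL-Algebra.QuotRing"
    "HOL-Algebra.Polynomial_Divisibility"
    "HOL-Library.Z2"
begin

section \<open>Quasi-projective varieties over a perfect subfield of an algebraically closed field\<close>

text \<open>
  The type \<open>'a\<close> is an algebraically closed field and \<open>K\<close> a perfect subfield whose
  algebraic closure it is.  A geometrically reduced quasi-projective \<open>K\<close>-scheme is represented by
  its set of geometric points in some projective space, together with the topology and the
  sheaf of functions defined by forms with coefficients in \<open>K\<close>.  A morphism of
  such \<open>K\<close>-schemes is the same thing as a map on geometric points that is continuous and pulls
  regular functions back to regular functions.  The base change to the algebraic closure has the
  same points, with \<open>UNIV\<close> in place of \<open>K\<close>.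

  Coordinates are indexed by \<open>nat\<close>, those beyond the dimension being \<open>0\<close>; a point
  of projective space is the set of all its vectors of homogeneous coordinates.  Functions on
  points are total; their values outside the set under consideration are irrelevant.
\<close>

type_synonym 'a ppoint = "(nat \<Rightarrow> 'a) set"

definition proj_point :: "(nat \<Rightarrow> 'a::field) \<Rightarrow> 'a ppoint" where
  "proj_point v = {\<lambda>i. c * v i | c. c \<noteq> 0}"

definition proj_space :: "nat \<Rightarrow> 'a::alg_closed_field ppoint set" where
  "proj_space n = {proj_point v | v. (\<forall>i>n. v i = 0) \<and> (\<exists>i. v i \<noteq> 0)}"

definition monomials :: "nat \<Rightarrow> nat \<Rightarrow> (nat \<Rightarrow> nat) set" where
  "monomials n d = {m. (\<forall>i>n. m i = 0) \<and> (\<Sum>i\<le>n. m i) = d}"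

text \<open>Forms of degree \<open>d\<close>; since \<open>'a\<close> is infinite they are determined by their values.\<close>

definition form :: "'a::alg_closed_field set \<Rightarrow> nat \<Rightarrow> nat \<Rightarrow> ((nat \<Rightarrow> 'a) \<Rightarrow> 'a) set" where
  "form K n d =
     {\<lambda>v. \<Sum>m\<in>monomials n d. c m * (\<Prod>i\<le>n. v i ^ m i) | c. \<forall>m. c m \<in> K}"

definition zar_open ::
  "'a::alg_closed_field set \<Rightarrow> nat \<Rightarrow> 'a ppoint set \<Rightarrow> 'a ppoint set \<Rightarrow> bool" where
  "zar_open K n A U \<longleftrightarrow>
     (\<exists>S \<subseteq> (\<Union>d. form K n d). U = {P \<in> A. \<exists>G\<in>S. \<exists>v\<in>P. G v \<noteq> 0})"

definition proj_closed ::
  "'a::alg_closed_field set \<Rightarrow> nat \<Rightarrow> 'a ppoint set \<Rightarrow> bool" where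
  "proj_closed K n Z \<longleftrightarrow> Z \<subseteq> proj_space n \<and> zar_open K n (proj_space n) (proj_space n - Z)"

definition regular ::
  "'a::alg_closed_field set \<Rightarrow> nat \<Rightarrow> 'a ppoint set \<Rightarrow> ('a ppoint \<Rightarrow> 'a) set" where
  "regular K n U =
     {f. \<forall>P\<in>U. \<exists>V d. \<exists>G\<in>form K n d. \<exists>H\<in>form K n d. zar_open K n U V \<and> P \<in> V \<and>
            (\<forall>Q\<in>V. \<forall>v\<in>Q. H v \<noteq> 0 \<and> f Q = G v / H v)}"

definition morphism ::
  "'a::alg_closed_field set \<Rightarrow> nat \<Rightarrow> 'a ppoint set \<Rightarrow> nat \<Rightarrow> 'a ppoint set \<Rightarrow>
     ('a ppoint \<Rightarrow> 'a ppoint) \<Rightarrow> bool" where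
  "morphism K n A m B \<phi> \<longleftrightarrow> \<phi> ` A \<subseteq> B \<and>
     (\<forall>V. zar_open K m B V \<longrightarrow>
        zar_open K n A {P \<in> A. \<phi> P \<in> V} \<and>
        (\<forall>g \<in> regular K m V. g \<circ> \<phi> \<in> regular K n {P \<in> A. \<phi> P \<in> V}))"

definition isomorphic_var ::
  "'a::alg_closed_field set \<Rightarrow> nat \<Rightarrow> 'a ppoint set \<Rightarrow> nat \<Rightarrow> 'a ppoint set \<Rightarrow> bool" where
  "isomorphic_var K n A m B \<longleftrightarrow>
     (\<exists>\<phi> \<psi>. morphism K n A m B \<phi> \<and> morphism K m B n A \<psi> \<and>
        (\<forall>P\<in>A. \<psi> (\<phi> P) = P) \<and> (\<forall>Q\<in>B. \<phi> (\<psi> Q) = Q))"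

text \<open>Affine \<open>m\<close>-space is the complement of the hyperplane where the coordinate of index \<open>0\<close>
  vanishes.\<close>

definition affine_var :: "'a::alg_closed_field set \<Rightarrow> nat \<Rightarrow> 'a ppoint set \<Rightarrow> bool" where
  "affine_var K n U \<longleftrightarrow>
     (\<exists>m Z. proj_closed K m Z \<and> isomorphic_var K n U m {P \<in> Z. \<forall>v\<in>P. v 0 \<noteq> 0})"

text \<open>The target has an affine open cover by sets \<open>V\<close> with affine preimage whose coordinate ring is
  a finite module over that of \<open>V\<close>.\<close>

definition finite_morphism ::
  "'a::alg_closed_field set \<Rightarrow> nat \<Rightarrow> 'a ppoint set \<Rightarrow> nat \<Rightarrow> 'a ppoint set \<Rightarrow>
     ('a ppoint \<Rightarrow> 'a ppoint) \<Rightarrow> bool" where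
  "finite_morphism K n A m B \<phi> \<longleftrightarrow> morphism K n A m B \<phi> \<and>
     (\<exists>\<V>. \<Union>\<V> = B \<and>
        (\<forall>V\<in>\<V>. zar_open K m B V \<and> affine_var K m V \<and>
           (let U = {P \<in> A. \<phi> P \<in> V} in
              affine_var K n U \<and>
              (\<exists>S. finite S \<and> S \<subseteq> regular K n U \<and>
                 (\<forall>a \<in> regular K n U. \<exists>b. (\<forall>s\<in>S. b s \<in> regular K m V) \<and>
                    (\<forall>P\<in>U. a P = (\<Sum>s\<in>S. b s (\<phi> P) * s P)))))))"


section \<open>Local rings, function fields\<close>

text \<open>For a filtered family \<open>\<U>\<close> of open sets, the colimit over \<open>U \<in> \<U>\<close> of the rings of regular
  functions on \<open>U\<close>: functions regular on some \<open>U \<in> \<U>\<close> modulo those vanishing on some \<open>U \<in> \<U>\<close>.\<close>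

definition fun_ring ::
  "'a::alg_closed_field set \<Rightarrow> nat \<Rightarrow> 'a ppoint set set \<Rightarrow> ('a ppoint \<Rightarrow> 'a) ring" where
  "fun_ring K n \<U> =
     \<lparr>carrier = (\<Union>U\<in>\<U>. regular K n U),
      monoid.mult = (\<lambda>f g P. f P * g P), one = (\<lambda>_. 1),
      ring.zero = (\<lambda>_. 0), add = (\<lambda>f g P. f P + g P)\<rparr>"

definition null_ideal ::
  "'a::alg_closed_field set \<Rightarrow> nat \<Rightarrow> 'a ppoint set set \<Rightarrow> ('a ppoint \<Rightarrow> 'a) set" where
  "null_ideal K n \<U> = {f \<in> carrier (fun_ring K n \<U>). \<exists>U\<in>\<U>. \<forall>P\<in>U. f P = 0}"

definition germ_ring ::
  "'a::alg_closed_field set \<Rightarrow> nat \<Rightarrow> 'a ppoint set set \<Rightarrow> ('a ppoint \<Rightarrow> 'a) set ring" where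
  "germ_ring K n \<U> = fun_ring K n \<U> Quot null_ideal K n \<U>"

definition germ ::
  "'a::alg_closed_field set \<Rightarrow> nat \<Rightarrow> 'a ppoint set set \<Rightarrow> ('a ppoint \<Rightarrow> 'a) \<Rightarrow>
     ('a ppoint \<Rightarrow> 'a) set" where
  "germ K n \<U> f = null_ideal K n \<U> +>\<^bsub>fun_ring K n \<U>\<^esub> f"

definition nbhds ::
  "'a::alg_closed_field set \<Rightarrow> nat \<Rightarrow> 'a ppoint set \<Rightarrow> 'a ppoint \<Rightarrow> 'a ppoint set set" where
  "nbhds K n A P = {U. zar_open K n A U \<and> P \<in> U}"

definition dense_opens ::
  "'a::alg_closed_field set \<Rightarrow> nat \<Rightarrow> 'a ppoint set \<Rightarrow> 'a ppoint set set" where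
  "dense_opens K n A = {U. zar_open K n A U \<and> U \<noteq> {}}"

text \<open>This is the function field when \<open>A\<close> is irreducible.\<close>

definition function_field ::
  "'a::alg_closed_field set \<Rightarrow> nat \<Rightarrow> 'a ppoint set \<Rightarrow> ('a ppoint \<Rightarrow> 'a) set ring" where
  "function_field K n A = germ_ring K n (dense_opens K n A)"

definition local_ring ::
  "nat \<Rightarrow> 'a::alg_closed_field ppoint set \<Rightarrow> 'a ppoint \<Rightarrow> ('a ppoint \<Rightarrow> 'a) set ring" where
  "local_ring n A P = germ_ring UNIV n (nbhds UNIV n A P)"

definition max_ideal_funs ::
  "nat \<Rightarrow> 'a::alg_closed_field ppoint set \<Rightarrow> 'a ppoint \<Rightarrow> ('a ppoint \<Rightarrow> 'a) set" where
  "max_ideal_funs n A P = {f \<in> carrier (fun_ring UNIV n (nbhds UNIV n A P)). f P = 0}"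

definition max_ideal ::
  "nat \<Rightarrow> 'a::alg_closed_field ppoint set \<Rightarrow> 'a ppoint \<Rightarrow> ('a ppoint \<Rightarrow> 'a) set set" where
  "max_ideal n A P = germ UNIV n (nbhds UNIV n A P) ` max_ideal_funs n A P"


section \<open>Tame and separable morphisms\<close>

text \<open>The ideal generated by the pullback of the maximal ideal at \<open>\<phi> P\<close> is the power with exponent
  \<open>e\<close> of the maximal ideal at \<open>P\<close>.\<close>

definition has_ramification_index ::
  "nat \<Rightarrow> 'a::alg_closed_field ppoint set \<Rightarrow> nat \<Rightarrow> 'a ppoint set \<Rightarrow>
     ('a ppoint \<Rightarrow> 'a ppoint) \<Rightarrow> 'a ppoint \<Rightarrow> nat \<Rightarrow> bool" where
  "has_ramification_index n A m B \<phi> P e \<longleftrightarrow>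
     Idl\<^bsub>local_ring n A P\<^esub>
       ((\<lambda>g. germ UNIV n (nbhds UNIV n A P) (g \<circ> \<phi>)) ` max_ideal_funs m B (\<phi> P))
     = max_ideal n A P [^]\<^bsub>ideals_set (local_ring n A P)\<^esub> e"

definition tame ::
  "nat \<Rightarrow> 'a::alg_closed_field ppoint set \<Rightarrow> nat \<Rightarrow> 'a ppoint set \<Rightarrow>
     ('a ppoint \<Rightarrow> 'a ppoint) \<Rightarrow> bool" where
  "tame n A m B \<phi> \<longleftrightarrow>
     (\<forall>P\<in>A. \<exists>e. has_ramification_index n A m B \<phi> P e \<and> \<not> CHAR('a) dvd e)"

text \<open>Polynomials in HOL-Algebra are lists of coefficients, leading coefficient first.\<close>

definition poly_deriv :: "('b, 'c) ring_scheme \<Rightarrow> 'b list \<Rightarrow> 'b list" where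
  "poly_deriv R p =
     ring.normalize R (map (\<lambda>i. add_pow R (length p - 1 - i) (p ! i)) [0..<length p - 1])"

definition separable_poly :: "('b, 'c) ring_scheme \<Rightarrow> 'b set \<Rightarrow> 'b list \<Rightarrow> bool" where
  "separable_poly L F p \<longleftrightarrow> p \<in> carrier (univ_poly L F) \<and>
     (\<exists>u \<in> carrier (univ_poly L F). \<exists>v \<in> carrier (univ_poly L F).
        (u \<otimes>\<^bsub>univ_poly L F\<^esub> p) \<oplus>\<^bsub>univ_poly L F\<^esub> (v \<otimes>\<^bsub>univ_poly L F\<^esub> poly_deriv L p)
          = \<one>\<^bsub>univ_poly L F\<^esub>)"

definition separable_extension :: "('b, 'c) ring_scheme \<Rightarrow> 'b set \<Rightarrow> bool" where
  "separable_extension L F \<longleftrightarrow>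
     (\<forall>a \<in> carrier L. \<exists>p. separable_poly L F p \<and> ring.eval L p a = \<zero>\<^bsub>L\<^esub>)"

text \<open>For irreducible \<open>A\<close> and \<open>B\<close>: the morphism is dominant, and the function field of \<open>A\<close> is
  separable over the image of that of \<open>B\<close>.\<close>

definition separable_morphism ::
  "'a::alg_closed_field set \<Rightarrow> nat \<Rightarrow> 'a ppoint set \<Rightarrow> nat \<Rightarrow> 'a ppoint set \<Rightarrow>
     ('a ppoint \<Rightarrow> 'a ppoint) \<Rightarrow> bool" where
  "separable_morphism K n A m B \<phi> \<longleftrightarrow>
     (\<forall>V \<in> dense_opens K m B. \<exists>P\<in>A. \<phi> P \<in> V) \<and>
     separable_extension (function_field K n A)
       ((\<lambda>g. germ K n (dense_opens K n A) (g \<circ> \<phi>)) ` carrier (fun_ring K m (dense_opens K m B)))"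

definition admits_tame_map_to_P1 ::
  "'a::alg_closed_field set \<Rightarrow> nat \<Rightarrow> 'a ppoint set \<Rightarrow> bool" where
  "admits_tame_map_to_P1 K n A \<longleftrightarrow>
     (\<exists>\<phi>. finite_morphism K n A 1 (proj_space 1) \<phi> \<and>
        separable_morphism K n A 1 (proj_space 1) \<phi> \<and> tame n A 1 (proj_space 1) \<phi>)"


section \<open>Elliptic curves\<close>

text \<open>\<open>y\<^sup>2 + a1 x y + a3 y = x\<^sup>3 + a2 x\<^sup>2 + a4 x + a6\<close>\<close>

record 'a weierstrass =
  a1 :: 'a
  a2 :: 'a
  a3 :: 'a
  a4 :: 'a
  a6 :: 'a

definition weierstrass_curve :: "'a::alg_closed_field weierstrass \<Rightarrow> 'a ppoint set" where
  "weierstrass_curve W = {P \<in> proj_space 2. \<forall>v\<in>P. let x = v 0; y = v 1; z = v 2 in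
     y^2 * z + a1 W * x * y * z + a3 W * y * z^2
       = x^3 + a2 W * x^2 * z + a4 W * x * z^2 + a6 W * z^3}"

text \<open>All partial derivatives of the Weierstrass form vanish.\<close>

definition singular_point :: "'a::alg_closed_field weierstrass \<Rightarrow> 'a ppoint \<Rightarrow> bool" where
  "singular_point W P \<longleftrightarrow> (\<forall>v\<in>P. let x = v 0; y = v 1; z = v 2 in
     a1 W * y * z = 3 * x^2 + 2 * a2 W * x * z + a4 W * z^2 \<and>
     2 * y * z + a1 W * x * z + a3 W * z^2 = 0 \<and>
     y^2 + a1 W * x * y + 2 * a3 W * y * z = a2 W * x^2 + 2 * a4 W * x * z + 3 * a6 W * z^2)"

definition elliptic_curve :: "'a::alg_closed_field set \<Rightarrow> 'a weierstrass \<Rightarrow> bool" where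
  "elliptic_curve K W \<longleftrightarrow> {a1 W, a2 W, a3 W, a4 W, a6 W} \<subseteq> K \<and>
     (\<forall>P \<in> weierstrass_curve W. \<not> singular_point W P)"

text \<open>The group of geometric points: \<open>None\<close> is the point at infinity \<open>[0 : 1 : 0]\<close>, and
  \<open>Some (x, y)\<close> is \<open>[x : y : 1]\<close>.  Addition is the chord-tangent law.\<close>

definition ec_points :: "'a::alg_closed_field weierstrass \<Rightarrow> ('a \<times> 'a) option set" where
  "ec_points W = insert None {Some (x, y) | x y.
     y^2 + a1 W * x * y + a3 W * y = x^3 + a2 W * x^2 + a4 W * x + a6 W}"

fun ec_add ::
  "'a::alg_closed_field weierstrass \<Rightarrow> ('a \<times> 'a) option \<Rightarrow> ('a \<times> 'a) option \<Rightarrow>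
     ('a \<times> 'a) option" where
  "ec_add W None Q = Q"
| "ec_add W (Some p) None = Some p"
| "ec_add W (Some (x1, y1)) (Some (x2, y2)) =
     (if x1 = x2 \<and> y1 + y2 + a1 W * x2 + a3 W = 0 then None
      else let l = (if x1 = x2
                    then (3 * x1^2 + 2 * a2 W * x1 + a4 W - a1 W * y1) / (2 * y1 + a1 W * x1 + a3 W)
                    else (y2 - y1) / (x2 - x1));
               x3 = l^2 + a1 W * l - a2 W - x1 - x2
           in Some (x3, l * (x1 - x3) - y1 - a1 W * x3 - a3 W))"

primrec ec_mult ::
  "'a::alg_closed_field weierstrass \<Rightarrow> nat \<Rightarrow> ('a \<times> 'a) option \<Rightarrow> ('a \<times> 'a) option" where
  "ec_mult W 0 P = None"
| "ec_mult W (Suc n) P = ec_add W P (ec_mult W n P)"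

definition ordinary :: "'a::alg_closed_field weierstrass \<Rightarrow> bool" where
  "ordinary W \<longleftrightarrow> CHAR('a) > 0 \<and>
     card {P \<in> ec_points W. ec_mult W CHAR('a) P = None} = CHAR('a)"


section \<open>The base field\<close>

definition perfect_subfield :: "'a::field set \<Rightarrow> bool" where
  "perfect_subfield K \<longleftrightarrow> subfield K ring_of_type_algebra \<and>
     (CHAR('a) = 0 \<or> (\<forall>x\<in>K. \<exists>y\<in>K. y ^ CHAR('a) = x))"

text \<open>The algebraic closure of \<open>\<bbbF>\<^sub>2(t)\<close>.  It is also that of the perfect closure of \<open>\<bbbF>\<^sub>2(t)\<close>.\<close>

type_synonym F2t_bar = "bit poly fract alg_closure"

definition t_gen :: F2t_bar where
  "t_gen = to_ac (Fract [:0, 1:] 1)"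

text \<open>The union over \<open>n\<close> of the subfields generated by the (unique) root \<open>s\<close> of
  \<open>s\<^bsup>2^n\<^esup> = t\<close>.\<close>

definition F2t_perf :: "F2t_bar set" where
  "F2t_perf = (\<Union>n. \<Union>s\<in>{s. s ^ (2 ^ n) = t_gen}. generate_field ring_of_type_algebra {s})"

definition E_curve :: "F2t_bar weierstrass" where
  "E_curve = \<lparr>a1 = 1, a2 = t_gen, a3 = 0, a4 = 0, a6 = t_gen ^ 6\<rparr>"

end

theory Submission
  imports
    Defs
    "HOL-Computational_Algebra.Formal_Laurent_Series"
    "HOL-Computational_Algebra.Field_as_Ring"
    "HOL-Computational_Algebra.Polynomial_Factorial"
begin

text \<open>Put \<open>c = t\<^bsup>3/2\<^esup>\<close>, let \<open>T = (0, c\<^sup>2)\<close> be the point of order two and \<open>U = (y + c\<^sup>2) / x\<close>, so that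
  \<open>U\<^sup>2 + U = x + c\<^sup>2 / x + t\<close>.  Given a tame function on the curve over \<open>k\<close>, write it up to a fourth
  power as \<open>\<Sum>i\<le>3. A\<^sub>i\<^sup>4 x\<^sup>i\<close>.  Tameness at a point compares the orders there of
  \<open>N = A\<^sub>1 A\<^sub>3 + A\<^sub>2\<^sup>2\<close> and \<open>D = A\<^sub>1\<^sup>2 + A\<^sub>3\<^sup>2 x\<close>, and together these comparisons say that
  \<open>(x N + (x + c) D) / D\<close> has no affine pole, vanishes at \<open>T\<close> and has at most a simple pole at
  infinity; so it is zero.  Thus the conic \<open>x N = (x + c) D\<close> has a nontrivial solution in \<open>k(E)\<close>.

  Let \<open>L = k(\<theta>)\<close> with \<open>\<theta>\<^sup>2 + \<theta> = t\<close>, and \<open>\<sigma>\<close> its conjugation.  A solution makes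
  \<open>x (x + c)\<close> a norm from \<open>L(E)\<close>, hence gives a lattice with a \<open>\<sigma>\<close>-semilinear endomorphism of
  square \<open>x (x + c)\<close>.  Its matrix in a reduced basis produces a point \<open>R\<close> of \<open>E(L)\<close> such that
  \<open>x(R) + x(\<sigma> R) + c = \<rho>\<^sup>2 + \<rho>\<close> with \<open>\<rho> \<in> L\<close>.  As \<open>R + \<sigma> R\<close> is rational over \<open>k\<close>, either \<open>c\<close> or
  \<open>x(P) + c\<close> for some \<open>P \<in> E(k)\<close> is of the form \<open>\<rho>\<^sup>2 + \<rho>\<close>.  A descent over \<open>\<bbbF>\<^sub>2(t)\<close> shows
  that \<open>x(P)\<close> is of this form, whereas \<open>c\<close> is not, because \<open>t\<^sup>3\<close> has odd degree.\<close>

section \<open>Characteristic two\<close>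

text \<open>For a function \<open>A0^4 + A1^4 s + A2^4 s^2 + A3^4 s^3\<close>, the derivative with
  respect to \<open>s\<close> is the square of \<open>D = A1^2 + A3^2 s\<close>. If another
  parameter has derivative \<open>g^2\<close> with respect to \<open>s\<close>, then
  \<open>N / D\<close> for \<open>s\<close> is \<open>g\<close> times the quotient for the other
  parameter plus a term depending on the two parameters alone. Hence \<open>N / D\<close> behaves
  like a section of a torsor under a square root of the canonical bundle. Here that root has the
  class of \<open>T\<close> minus the point at infinity, of degree zero and not trivial, so there is
  at most one section; it is \<open>(x + c) / x\<close>. Every tame function must lead to this
  quotient, which is why a single conic remains. Over an algebraically closed field such a conic has
  a solution by Tsen's theorem, so the obstruction has to come from the arithmetic of
  \<open>k\<close>. The coefficient \<open>t\<close> of \<open>x^2\<close> in the equation of the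
  curve makes the conic a norm equation for \<open>L\<close>, because
  \<open>U^2 + U + t = (x + c)^2 / x\<close>; the coefficient \<open>t^6 = c^4\<close> makes
  \<open>c = t^(3/2)\<close> the constant whose class modulo all \<open>\<rho>^2 + \<rho>\<close>
  obstructs it.\<close>

class char2 = comm_ring_1 +
  assumes one_add_one_eq_0: "1 + 1 = 0"

lemma add_self [simp]: "(x::'a::char2) + x = 0"
proof -
  have "x + x = x * (1 + 1)" by (simp only: distrib_left mult_1_right)
  then show ?thesis by (simp only: one_add_one_eq_0 mult_zero_right)
qed

lemma add_self_left [simp]: "(x::'a::char2) + (x + y) = y"
  by (simp flip: add.assoc)

lemma uminus_eq_self [simp]: "- (x::'a::char2) = x"
  by (metis add_self add.inverse_unique)

lemma minus_eq_plus [simp]: "(x::'a::char2) - y = x + y"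
  by (metis add_uminus_conv_diff uminus_eq_self)

lemma numeral_Bit0_eq_0 [simp]: "numeral (num.Bit0 n) = (0::'a::char2)"
  by (simp only: numeral_Bit0 add_self)

lemma numeral_Bit1_eq_1 [simp]: "numeral (num.Bit1 n) = (1::'a::char2)"
  by (simp only: numeral_Bit1 add_self add_0)

lemma square_add [simp]: "((x::'a::char2) + y)\<^sup>2 = x\<^sup>2 + y\<^sup>2"
  by (simp add: power2_sum)

lemma fourth_power_add [simp]: "((x::'a::char2) + y) ^ 4 = x ^ 4 + y ^ 4"
proof -
  have "((x::'a) + y) ^ 4 = ((x + y)\<^sup>2)\<^sup>2" by (simp only: flip: power_mult) simp
  also have "\<dots> = (x\<^sup>2)\<^sup>2 + (y\<^sup>2)\<^sup>2" by simp
  finally show ?thesis by (simp flip: power_mult)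
qed

lemma frobenius_add: "((x::'a::char2) + y) ^ (2 ^ n) = x ^ (2 ^ n) + y ^ (2 ^ n)"
  by (induction n) (simp_all add: power_mult mult.commute[of 2])

lemma add_eq_0_iff_eq: "(x::'a::char2) + y = 0 \<longleftrightarrow> x = y"
  by (metis minus_eq_plus right_minus_eq)

lemma add_eq_swap: "(x::'a::char2) + y = z \<Longrightarrow> y = x + z"
  by (metis add_self_left)

text \<open>The device for using a known equation \<open>c = d\<close> up to rearrangement: signs
  play no part, so carrying terms across becomes a ring identity that \<open>simp\<close> can
  check.\<close>

lemma char2_eq: "(c::'a::char2) = d \<Longrightarrow> a + b = c + d \<Longrightarrow> a = b"
  by (simp add: add_eq_0_iff_eq)

lemma frobenius_inj: "x ^ (2 ^ n) = y ^ (2 ^ n) \<longleftrightarrow> x = (y :: 'a::{idom, char2})"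
proof
  assume "x ^ (2 ^ n) = y ^ (2 ^ n)"
  then have "(x + y) ^ (2 ^ n) = 0" by (simp add: frobenius_add)
  then show "x = y" by (simp add: add_eq_0_iff_eq)
qed simp

lemma square_inj: "x\<^sup>2 = y\<^sup>2 \<longleftrightarrow> x = (y :: 'a::{idom, char2})"
  using frobenius_inj[of x 1 y] by simp

instance bit :: char2 by standard simp
instance poly :: (char2) char2 by standard (metis add_self one_pCons add_pCons add_0_right pCons_0_0)
instance fract :: ("{idom, char2}") char2
  by standard (simp add: One_fract_def Zero_fract_def)
instance alg_closure :: ("{field, char2}") char2
  by standard (metis to_ac_0 to_ac_1 to_ac_add add_self)
instance fls :: (char2) char2 by standard (rule fls_eqI, simp only: fls_plus_nth add_self fls_zero_nth)

section \<open>Greatest common divisors of polynomials over the field with two elements\<close>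

instantiation bit :: "{unique_euclidean_ring, normalization_euclidean_semiring, normalization_semidom_multiplicative}"
begin
definition [simp]: "normalize_bit = (normalize_field :: bit \<Rightarrow> _)"
definition [simp]: "unit_factor_bit = (unit_factor_field :: bit \<Rightarrow> _)"
definition [simp]: "euclidean_size_bit = (euclidean_size_field :: bit \<Rightarrow> _)"
definition [simp]: "division_segment (x :: bit) = 1"
instance
  by standard (auto simp: dvd_field_iff)
end

instantiation bit :: euclidean_ring_gcd
begin
definition gcd_bit :: "bit \<Rightarrow> bit \<Rightarrow> bit" where
  "gcd_bit = Euclidean_Algorithm.gcd"
definition lcm_bit :: "bit \<Rightarrow> bit \<Rightarrow> bit" where
  "lcm_bit = Euclidean_Algorithm.lcm"
definition Gcd_bit :: "bit set \<Rightarrow> bit" where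
 "Gcd_bit = Euclidean_Algorithm.Gcd"
definition Lcm_bit :: "bit set \<Rightarrow> bit" where
 "Lcm_bit = Euclidean_Algorithm.Lcm"
instance by standard (simp_all add: gcd_bit_def lcm_bit_def Gcd_bit_def Lcm_bit_def)
end

instance bit :: field_gcd ..

lemma to_fract_power [simp]: "to_fract (x ^ n) = to_fract x ^ n"
  by (induction n) simp_all

declare add_bit_eq_xor [simp del] mult_bit_eq_and [simp del]

lemma obtain_coprime_fract:
  fixes u :: "bit poly fract"
  obtains m n where "n \<noteq> 0" "coprime m n" "u = to_fract m / to_fract n"
proof (cases u)
  case (Fract a b)
  let ?g = "gcd a b"
  have g: "?g \<noteq> 0" using Fract by simp
  obtain m where m: "a = ?g * m" by (metis dvdE gcd_dvd1)
  obtain n where n: "b = ?g * n" by (metis dvdE gcd_dvd2)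
  have "coprime m n" using g m n
    by (metis Fract(2) div_gcd_coprime nonzero_mult_div_cancel_left)
  moreover have "n \<noteq> 0" using n Fract by auto
  moreover have "u = to_fract m / to_fract n"
  proof -
    have "a * n = b * m" by (subst m, subst n) (simp only: mult_ac)
    then show ?thesis unfolding Fract(1) to_fract_def
      using \<open>n \<noteq> 0\<close> Fract(2) by (simp add: eq_fract mult_ac)
  qed
  ultimately show thesis using that by blast
qed

section \<open>Rational points over \<open>\<bbbF>\<^sub>2(t)\<close>\<close>

abbreviation X2 :: "bit poly" where "X2 \<equiv> [:0, 1:]"

lemma bit_poly_const_or_linear:
  fixes g :: "bit poly"
  assumes "degree g \<le> 1"
  shows "g \<in> {0, 1, X2, X2 + 1}"
proof -
  obtain a b where g: "g = [:a, b:]"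
    using assms by (metis degree_pCons_eq_if One_nat_def degree_eq_zeroE le_Suc_eq le_zero_eq pCons_cases
        Suc_le_mono pCons_0_0)
  have "X2 + 1 = [:1, 1:]" by (subst one_pCons) simp
  then show ?thesis unfolding g by (cases a; cases b) auto
qed

lemma is_unit_bit_poly: "is_unit (p::bit poly) \<longleftrightarrow> p = 1"
proof
  assume "is_unit p"
  then have "p \<noteq> 0" "degree p = 0" using is_unit_iff_degree[of p] by (metis not_is_unit_0)+
  then obtain c where "p = [:c:]" "c \<noteq> 0" by (metis degree_eq_zeroE pCons_0_0)
  then show "p = 1" by (simp add: one_pCons)
qed simp

lemma coprime_bit_poly_X:
  fixes p :: "bit poly"
  assumes "poly p 0 \<noteq> 0"
  shows "coprime p X2"
proof (rule coprimeI)
  fix h assume "h dvd p" "h dvd X2"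
  obtain a q where p: "p = pCons a q" by (cases p)
  with assms have "a = 1" by simp
  then have "p = 1 + X2 * q" unfolding p by (subst one_pCons) simp
  with \<open>h dvd p\<close> \<open>h dvd X2\<close> show "h dvd 1"
    by (metis add_diff_cancel_right' dvd_diff dvd_mult2)
qed

text \<open>For \<open>u = m / n\<close>, the pole of \<open>u\<^sup>2 + u\<close> at infinity has even order.\<close>

lemma Artin_Schreier_degree:
  fixes m n N D :: "'a::{field, char2} poly"
  assumes "(m\<^sup>2 + m * n) * D = n\<^sup>2 * N" "n \<noteq> 0" "D \<noteq> 0" "degree N > degree D"
  shows "even (degree N + degree D)"
proof -
  have N: "N \<noteq> 0" using assms(4) by auto
  have eq: "m * (m + n) * D = n\<^sup>2 * N" using assms(1) by (simp add: algebra_simps power2_eq_square)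
  then have nz: "m \<noteq> 0" "m + n \<noteq> 0" using N assms(2) by auto
  have deg: "degree m + degree (m + n) + degree D = 2 * degree n + degree N"
    using arg_cong[OF eq, of degree] nz N assms(2,3) by (simp add: degree_mult_eq degree_power_eq)
  show ?thesis
  \<comment> \<open>In the first case \<open>u = m / n\<close> has a pole at infinity, and
    \<open>m\<close> and \<open>m + n\<close> have the same degree. In the second there is no pole,
    against \<open>degree N > degree D\<close>.\<close>
  proof (cases "degree m > degree n")
    case True
    then have "degree (m + n) = degree m" by (simp add: degree_add_eq_left)
    with deg have "2 * degree m + degree D = 2 * degree n + degree N" by simp
    then show ?thesis by presburger
  next
    case False
    then have "degree (m + n) \<le> degree n" by (simp add: degree_add_le)
    with deg False assms(4) show ?thesis by linarith
  qed
qed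

lemma Artin_Schreier_fract_degree:
  fixes u :: "bit poly fract"
  assumes "u\<^sup>2 + u = to_fract N / to_fract D" "D \<noteq> 0" "degree N > degree D"
  shows "even (degree N + degree D)"
proof -
  obtain m n where mn: "n \<noteq> 0" "u = to_fract m / to_fract n" by (rule obtain_coprime_fract)
  have "((to_fract m)\<^sup>2 + to_fract m * to_fract n) / (to_fract n)\<^sup>2 = to_fract N / to_fract D"
    using assms(1) mn(1) unfolding mn(2) by (simp add: add_divide_distrib power_divide power2_eq_square)
  then have "to_fract ((m\<^sup>2 + m * n) * D) = to_fract (n\<^sup>2 * N)"
    using mn(1) assms(2) by (simp add: frac_eq_eq mult_ac)
  then have "(m\<^sup>2 + m * n) * D = n\<^sup>2 * N" by (simp only: to_fract_eq_iff)
  from Artin_Schreier_degree[OF this mn(1) assms(2,3)] show ?thesis .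
qed

lemma Artin_Schreier_odd_degree:
  fixes u :: "bit poly fract"
  assumes "odd (degree N)"
  shows "u\<^sup>2 + u \<noteq> to_fract N"
proof
  assume "u\<^sup>2 + u = to_fract N"
  then have "u\<^sup>2 + u = to_fract N / to_fract 1" by simp
  from Artin_Schreier_fract_degree[OF this] assms show False by (auto elim!: oddE)
qed

text \<open>An odd order of \<open>x\<close> at a prime other than \<open>X2\<close> would be a pole of odd order of \<open>U\<^sup>2 + U\<close>.\<close>

lemma square_class:
  fixes x U :: "bit poly fract"
  assumes "x \<noteq> 0" "U\<^sup>2 + U = x + to_fract (X2 ^ k) / x + to_fract e"
  shows "\<exists>i z. x = to_fract X2 ^ i * z\<^sup>2"
proof -
  obtain a d where ad: "d \<noteq> 0" "coprime a d" "x = to_fract a / to_fract d"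
    by (rule obtain_coprime_fract)
  obtain m n where mn: "n \<noteq> 0" "coprime m n" "U = to_fract m / to_fract n"
    by (rule obtain_coprime_fract)
  have a: "a \<noteq> 0" using assms(1) ad by auto
  let ?A = "a\<^sup>2 + X2 ^ k * d\<^sup>2 + e * a * d"
  have "to_fract (n\<^sup>2 * ?A) = to_fract (a * d * (m\<^sup>2 + m * n))"
    using assms(2) ad mn a by (simp add: field_simps power2_eq_square)
  then have eq: "n\<^sup>2 * ?A = a * d * (m\<^sup>2 + m * n)" by (simp only: to_fract_eq_iff)
  have "coprime n (m\<^sup>2 + m * n)"
  proof -
    have "coprime n (m\<^sup>2)" using mn(2) by (simp add: coprime_commute)
    then show ?thesis by (metis coprime_iff_gcd_eq_1 gcd_add_mult mult.commute add.commute)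
  qed
  then have "coprime (n\<^sup>2) (m\<^sup>2 + m * n)" by simp
  moreover have "n\<^sup>2 dvd a * d * (m\<^sup>2 + m * n)" using eq by (metis dvd_triv_left)
  ultimately have "n\<^sup>2 dvd a * d" by (simp add: coprime_dvd_mult_left_iff)
  then obtain j where j: "a * d = n\<^sup>2 * j" by blast
  have j0: "j \<noteq> 0" using j a ad by auto
  have jA: "?A = j * (m\<^sup>2 + m * n)"
  proof -
    note eq
    also have "a * d * (m\<^sup>2 + m * n) = n\<^sup>2 * (j * (m\<^sup>2 + m * n))" by (simp only: j mult.assoc)
    finally show ?thesis using mn(1) by (metis (no_types) mult_left_cancel power_not_zero)
  qed
  \<comment> \<open>With the power of \<open>X2\<close> removed, the cofactor of \<open>j\<close> is
    prime to both \<open>a\<close> and \<open>d\<close>: it divides \<open>?A\<close>, which is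
    \<open>X2 ^ k * d^2\<close> modulo \<open>a\<close> and \<open>a^2\<close> modulo
    \<open>d\<close>. As it also divides \<open>a * d\<close>, it is a unit.\<close>
  obtain j' where j': "j = [:- 0, 1:] ^ order 0 j * j'" "\<not> [:- 0, 1:] dvd j'"
    using order_decomp[OF j0, of 0] by blast
  have "poly j' 0 \<noteq> 0" using j'(2) by (metis poly_eq_0_iff_dvd)
  then have cX: "coprime j' X2" by (rule coprime_bit_poly_X)
  have "j' dvd ?A" "j' dvd a * d"
    using jA j j'(1) by (metis dvd_triv_right dvd_mult2 dvd_mult)+
  have 1: "coprime j' a"
  proof (rule coprimeI)
    fix h assume h: "h dvd j'" "h dvd a"
    have "h dvd ?A" using h \<open>j' dvd ?A\<close> by (meson dvd_trans)
    moreover have "?A = X2 ^ k * d\<^sup>2 + a * (a + e * d)" by (simp add: algebra_simps power2_eq_square)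
    ultimately have "h dvd X2 ^ k * d\<^sup>2" using h(2) by (metis dvd_add_left_iff dvd_mult2)
    moreover have "coprime h (d\<^sup>2)" using h(2) ad(2) by (meson coprime_divisors coprime_power_right_iff dvd_refl)
    ultimately have "h dvd X2 ^ k" by (simp add: coprime_dvd_mult_left_iff)
    moreover have "coprime h (X2 ^ k)" using cX h(1) by (meson coprime_divisors coprime_power_right_iff dvd_refl)
    ultimately show "is_unit h" by (meson coprime_common_divisor dvd_refl)
  qed
  have 2: "coprime j' d"
  proof (rule coprimeI)
    fix h assume h: "h dvd j'" "h dvd d"
    have "h dvd ?A" using h \<open>j' dvd ?A\<close> by (meson dvd_trans)
    moreover have "?A = a\<^sup>2 + d * (X2 ^ k * d + e * a)" by (simp add: algebra_simps power2_eq_square)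
    ultimately have "h dvd a\<^sup>2" using h(2) by (metis dvd_add_left_iff dvd_mult2)
    moreover have "coprime h (a\<^sup>2)"
      using h(2) ad(2) by (meson coprime_divisors coprime_power_right_iff dvd_refl coprime_commute)
    ultimately show "is_unit h" by (meson coprime_common_divisor dvd_refl)
  qed
  have "is_unit j'" using 1 2 \<open>j' dvd a * d\<close>
    by (meson coprime_common_divisor coprime_mult_right_iff dvd_refl)
  then have "j = X2 ^ order 0 j" using j'(1) is_unit_bit_poly by simp
  then obtain i where "j = X2 ^ i" by blast
  then have "to_fract a * to_fract d = (to_fract n)\<^sup>2 * to_fract X2 ^ i"
    using arg_cong[OF j, of to_fract] by simp
  then have "x = to_fract X2 ^ i * (to_fract n / to_fract d)\<^sup>2"
  proof -
    assume eq: "to_fract a * to_fract d = (to_fract n)\<^sup>2 * to_fract X2 ^ i"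
    have "x = (to_fract a * to_fract d) / (to_fract d)\<^sup>2" using ad by (simp add: power2_eq_square)
    then show ?thesis unfolding eq by (simp add: power_divide)
  qed
  then show ?thesis by blast
qed

text \<open>The first two summands on the right have odd degrees adding up to \<open>6 * q\<close>.
  If they differ, the larger exceeds \<open>2 * q\<close> and gives a pole of odd order at infinity.
  If they agree, both are \<open>3 * q\<close>, so \<open>q\<close> is odd, hence one, and the
  leading terms cancel.\<close>

lemma no_odd_square_class:
  fixes z U :: "bit poly fract"
  assumes "z \<noteq> 0" "q = 1 \<or> even q" "q > 0"
    "U\<^sup>2 + U = to_fract X2 * z\<^sup>2 + to_fract (X2 ^ (6 * q)) / (to_fract X2 * z\<^sup>2) + to_fract (X2 ^ (2 * q))"
  shows False
proof -
  obtain p r where pr: "r \<noteq> 0" "coprime p r" "z = to_fract p / to_fract r"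
    by (rule obtain_coprime_fract)
  have p: "p \<noteq> 0" using assms(1) pr by auto
  let ?D = "p\<^sup>2 * r\<^sup>2"
  let ?P = "X2 * p ^ 4" and ?R = "X2 ^ (6 * q - 1) * r ^ 4"
  have X: "X2 ^ (6 * q) = X2 * X2 ^ (6 * q - 1)"
    using assms(3) by (metis power_minus_mult mult.commute nat_0_less_mult_iff zero_less_numeral)
  have tX: "to_fract X2 \<noteq> 0" by simp
  have main: "U\<^sup>2 + U = to_fract (?P + ?R + X2 ^ (2 * q) * ?D) / to_fract ?D"
  proof -
    have gen: "a * (b / c)\<^sup>2 + a * f / (a * (b / c)\<^sup>2) + e = (a * b ^ 4 + f * c ^ 4 + e * (b\<^sup>2 * c\<^sup>2)) / (b\<^sup>2 * c\<^sup>2)"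
      if "a \<noteq> 0" "b \<noteq> 0" "c \<noteq> 0" for a b c e f :: "bit poly fract"
      using that by (simp add: field_simps power2_eq_square power4_eq_xxxx)
    show ?thesis
      unfolding assms(4) X pr(3) to_fract_mult to_fract_add to_fract_power
      by (rule gen) (use pr p tX in auto)
  qed
  have dP: "degree ?P = 1 + 4 * degree p"
    using p by (subst degree_mult_eq) (auto simp: degree_power_eq)
  have dR: "degree ?R = 6 * q - 1 + 4 * degree r"
    using pr(1) by (subst degree_mult_eq) (auto simp: degree_power_eq)
  have dD: "degree ?D = 2 * degree p + 2 * degree r"
    using p pr(1) by (subst degree_mult_eq) (auto simp: degree_power_eq)
  have dXD: "degree (X2 ^ (2 * q) * ?D) = 2 * q + 2 * degree p + 2 * degree r"
    using p pr(1) by (subst degree_mult_eq) (auto simp: degree_power_eq dD[simplified])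
  show False
  proof (cases "degree ?P = degree ?R")
    case False
    define M where "M = max (degree ?P) (degree ?R)"
    have "degree (a + b) = max (degree a) (degree b)" if "degree a \<noteq> degree b" for a b :: "bit poly"
    proof (cases "degree a < degree b")
      case True
      then show ?thesis using degree_add_eq_right[OF True] by simp
    next
      case False
      then have "degree b < degree a" using that by simp
      then show ?thesis using degree_add_eq_left by fastforce
    qed
    from this[OF False] have "degree (?P + ?R) = M" unfolding M_def .
    moreover have M: "M > degree (X2 ^ (2 * q) * ?D)" "odd M" "M > degree ?D"
      unfolding M_def dP dR dXD dD using assms(3) by (auto simp: max_def)
    ultimately have "degree (?P + ?R + X2 ^ (2 * q) * ?D) = M" by (simp add: degree_add_eq_left)
    with Artin_Schreier_fract_degree[OF main] M p pr(1) show False by (simp add: dD[simplified])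
  next
    case True
    then have q: "q = 1" using assms(2,3) unfolding dP dR by presburger
    with True have dp: "degree p = degree r + 1" unfolding dP dR by simp
    \<comment> \<open>Over the field with two elements all leading coefficients are one, so
      \<open>p\<close> and \<open>X2 * r\<close> cancel at the top; \<open>?P + ?R\<close> is
      \<open>X2 * ?s ^ 4\<close>.\<close>
    let ?s = "p + X2 * r"
    have ds: "degree ?s \<le> degree r"
    proof (rule degree_le, intro allI impI)
      fix i assume i: "degree r < i"
      have lc: "coeff p (degree p) = 1" "coeff r (degree r) = 1"
        using p pr(1) by (metis bit_not_zero_iff leading_coeff_neq_0)+
      show "coeff ?s i = 0"
      proof (cases "i = degree p")
        case True
        then show ?thesis using lc dp by simp
      next
        case False
        with i dp have "i > degree p" by simp
        moreover from this dp have "i - 1 > degree r" by simp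
        ultimately show ?thesis
          by (cases i) (simp_all add: coeff_eq_0)
      qed
    qed
    let ?N = "X2 * ?s ^ 4 + X2 * ?D"
    have eqN: "?P + ?R + X2 ^ (2 * q) * ?D + (X2\<^sup>2 + X2) * ?D = ?N"
    proof -
      have gen: "a * b ^ 4 + a ^ 5 * c ^ 4 + a\<^sup>2 * e + (a\<^sup>2 + a) * e = a * (b + a * c) ^ 4 + a * e"
        for a b c e :: "bit poly"
        by (simp add: algebra_simps power_mult_distrib) (simp add: eval_nat_numeral mult_ac)
      show ?thesis unfolding q using gen[of X2 p r ?D] by simp
    qed
    \<comment> \<open>Adding \<open>X2\<close> to \<open>U\<close> trades the summand
      \<open>X2^2\<close> for \<open>X2\<close>, after which the pole at infinity is simple.\<close>
    have "(U + to_fract X2)\<^sup>2 + (U + to_fract X2) = U\<^sup>2 + U + to_fract ((X2\<^sup>2 + X2) * ?D) / to_fract ?D"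
      using p pr(1) by (simp add: add_ac)
    also have "\<dots> = to_fract ?N / to_fract ?D"
      unfolding main eqN[symmetric] by (simp only: add_divide_distrib to_fract_add)
    finally have U: "(U + to_fract X2)\<^sup>2 + (U + to_fract X2) = to_fract ?N / to_fract ?D" .
    have d1: "degree (X2 * ?s ^ 4) \<le> 1 + 4 * degree r"
    proof -
      have "degree (X2 * ?s ^ 4) \<le> degree X2 + degree (?s ^ 4)" by (rule degree_mult_le)
      also have "\<dots> \<le> 1 + degree ?s * 4" using degree_power_le[of ?s 4] by simp
      finally show ?thesis using ds by simp
    qed
    have d2: "degree (X2 * ?D) = 3 + 4 * degree r"
      using p pr(1) dp by (subst degree_mult_eq) (auto simp: dD[simplified])
    from d1 d2 have "degree (X2 * ?s ^ 4) < degree (X2 * ?D)" by linarith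
    from degree_add_eq_right[OF this] d2 have "degree ?N = 3 + 4 * degree r" by (simp only:)
    with Artin_Schreier_fract_degree[OF U] p pr(1) dp show False by (simp add: dD[simplified])
  qed
qed

text \<open>Over \<open>\<bbbF>\<^sub>2(t)\<close> every point of the curve with parameter \<open>t\<^bsup>2q\<^esup>\<close> is the Frobenius image of a
  point of the curve with parameter \<open>t\<^sup>q\<close>.\<close>

lemma Frobenius_descent:
  fixes x y :: "bit poly fract"
  defines "t \<equiv> to_fract X2"
  assumes "q = 1 \<or> even q" "q > 0" "y\<^sup>2 + x * y = x ^ 3 + t ^ (2 * q) * x\<^sup>2 + t ^ (12 * q)"
  shows "\<exists>x1 y1. x = x1\<^sup>2 \<and> y = y1\<^sup>2 \<and> y1\<^sup>2 + x1 * y1 = x1 ^ 3 + t ^ q * x1\<^sup>2 + t ^ (6 * q)"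
proof -
  have t0: "t \<noteq> 0" unfolding t_def by simp
  have sq: "t ^ (12 * q) = (t ^ (6 * q))\<^sup>2" 
  proof -
    have e: "12 * q = 6 * q * 2" by simp
    show ?thesis by (simp only: e power_mult)
  qed
  have sq2: "t ^ (2 * q) = (t ^ q)\<^sup>2" by (simp only: mult.commute[of 2] power_mult)
  have cube: "(a\<^sup>2) ^ 3 = (a ^ 3)\<^sup>2" for a :: "bit poly fract" by (simp flip: power_mult)
  have ex: "\<exists>x1 y1. x = x1\<^sup>2 \<and> y = y1\<^sup>2"
  proof (cases "x = 0")
    case True
    then have "y\<^sup>2 = (t ^ (6 * q))\<^sup>2" using assms(4) by (simp add: sq)
    then have "y = t ^ (3 * q * 2)" by (simp add: square_inj)
    then have "y = (t ^ (3 * q))\<^sup>2" by (simp only: power_mult)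
    with True show ?thesis by (metis zero_power2)
  next
    case False
    define U where "U = (y + t ^ (6 * q)) / x"
    have xU: "x * U = y + t ^ (6 * q)" using False by (simp add: U_def)
    have "x\<^sup>2 * (U\<^sup>2 + U) = (x * U)\<^sup>2 + x * (x * U)" by (simp add: algebra_simps power2_eq_square)
    also have "\<dots> = (y\<^sup>2 + x * y) + t ^ (12 * q) + x * t ^ (6 * q)"
      unfolding xU by (simp add: distrib_left add_ac sq)
    also have "\<dots> = x ^ 3 + t ^ (2 * q) * x\<^sup>2 + x * t ^ (6 * q)" unfolding assms(4) by (simp add: add_ac)
    finally have "x\<^sup>2 * (U\<^sup>2 + U) = x\<^sup>2 * (x + t ^ (6 * q) / x + t ^ (2 * q))"
      using False by (simp add: algebra_simps power2_eq_square power3_eq_cube)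
    then have U: "U\<^sup>2 + U = x + t ^ (6 * q) / x + t ^ (2 * q)" using False by simp
    then obtain i z where iz: "x = t ^ i * z\<^sup>2"
      using square_class[OF False, of U "6 * q" "X2 ^ (2 * q)"] unfolding t_def by auto
    have "even i"
    proof (rule ccontr)
      assume "odd i"
      then obtain l where "i = 2 * l + 1" by (rule oddE)
      then have x: "x = t * (t ^ l * z)\<^sup>2"
        unfolding iz by (simp add: power_mult_distrib power_add mult_ac flip: power_mult)
      show False
      proof (rule no_odd_square_class[OF _ assms(2,3)])
        show "t ^ l * z \<noteq> 0" using False x by auto
        show "U\<^sup>2 + U = to_fract X2 * (t ^ l * z)\<^sup>2 + to_fract (X2 ^ (6 * q)) / (to_fract X2 * (t ^ l * z)\<^sup>2) + to_fract (X2 ^ (2 * q))"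
          using U unfolding x unfolding t_def by simp
      qed
    qed
    then obtain l where "i = 2 * l" by (rule evenE)
    then have x: "x = (t ^ l * z)\<^sup>2" unfolding iz by (simp add: power_mult_distrib mult_ac flip: power_mult)
    then obtain v where x: "x = v\<^sup>2" by blast
    \<comment> \<open>Once \<open>x\<close> is a square, every term of the equation except
      \<open>x * y\<close> is a square; so \<open>x * y\<close>, and with it \<open>y\<close>, is
      one too.\<close>
    let ?s = "y + v ^ 3 + t ^ q * v\<^sup>2 + t ^ (6 * q)"
    have "x * y = y\<^sup>2 + (x ^ 3 + t ^ (2 * q) * x\<^sup>2 + t ^ (12 * q))"
      using assms(4) by (rule add_eq_swap)
    also have "\<dots> = ?s\<^sup>2"
      unfolding x sq sq2 cube square_add power_mult_distrib by (simp only: add.assoc)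
    finally have "v\<^sup>2 * y = ?s\<^sup>2" unfolding x .
    then have "y = (?s / v)\<^sup>2" using False x by (simp add: power_divide nonzero_eq_divide_eq mult.commute del: square_add)
    with x show ?thesis by blast
  qed
  then obtain x1 y1 where xy: "x = x1\<^sup>2" "y = y1\<^sup>2" by blast
  have "(y1\<^sup>2 + x1 * y1)\<^sup>2 = (x1 ^ 3 + t ^ q * x1\<^sup>2 + t ^ (6 * q))\<^sup>2"
    using assms(4) unfolding xy sq sq2 cube square_add power_mult_distrib .
  then show ?thesis using xy unfolding square_inj by blast
qed

text \<open>At \<open>X2 = 0\<close> the right-hand side takes the value one, whereas
  \<open>a^2 + a\<close> is zero for both elements \<open>a\<close> of the residue field; a pole of
  \<open>u\<close> there is no way out, as it would be a pole of \<open>u^2 + u\<close>.\<close>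

lemma no_unit_Artin_Schreier:
  fixes u :: "bit poly fract"
  assumes "poly r 0 = 1"
  shows "u\<^sup>2 + u \<noteq> 1 + to_fract (X2 * p) / to_fract r"
proof
  assume eq: "u\<^sup>2 + u = 1 + to_fract (X2 * p) / to_fract r"
  obtain m n where mn: "n \<noteq> 0" "coprime m n" "u = to_fract m / to_fract n" by (rule obtain_coprime_fract)
  have "r \<noteq> 0" using assms by auto
  then have "to_fract (r * (m\<^sup>2 + m * n)) = to_fract (n\<^sup>2 * (r + X2 * p))"
  proof -
    have gen: "c * (a\<^sup>2 + a * b) = b\<^sup>2 * (c + e)" if "(a / b)\<^sup>2 + a / b = 1 + e / c" "b \<noteq> 0" "c \<noteq> 0"
      for a b c e :: "bit poly fract"
      using that by (simp add: field_simps power2_eq_square)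
    show ?thesis unfolding to_fract_mult to_fract_add to_fract_power
      by (rule gen) (use eq[unfolded to_fract_mult] mn \<open>r \<noteq> 0\<close> in \<open>auto simp del: mult_pCons_left mult_pCons_right\<close>)
  qed
  then have "r * (m\<^sup>2 + m * n) = n\<^sup>2 * (r + X2 * p)" by (simp only: to_fract_eq_iff)
  from arg_cong[OF this, of "\<lambda>q. poly q 0"] assms
  have *: "(poly m 0)\<^sup>2 + poly m 0 * poly n 0 = (poly n 0)\<^sup>2" by simp
  then have "poly m 0 = 0 \<and> poly n 0 = 0" by (cases "poly m 0"; cases "poly n 0") auto
  then have "X2 dvd m" "X2 dvd n" using poly_eq_0_iff_dvd[of _ 0] by auto
  with mn(2) have "is_unit X2" by (rule coprime_common_divisor)
  then show False unfolding is_unit_bit_poly by (subst (asm) one_pCons) simp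
qed

lemma polynomial_of_coprime_denominators:
  fixes g :: "bit poly fract"
  assumes "g = to_fract p / to_fract d" "g = to_fract q / to_fract e" "coprime d e" "d \<noteq> 0" "e \<noteq> 0"
  shows "\<exists>r. g = to_fract r"
proof -
  have "to_fract (p * e) = to_fract (q * d)" using assms by (simp add: frac_eq_eq)
  then have "p * e = q * d" by (simp only: to_fract_eq_iff)
  then have "d dvd p * e" by simp
  with assms(3) have "d dvd p" by (simp add: coprime_dvd_mult_left_iff)
  then obtain r where "p = d * r" by blast
  with assms(1,4) have "g = to_fract r" by simp
  then show ?thesis by blast
qed

lemma reduce_Artin_Schreier:
  fixes B b :: "bit poly"
  assumes "b \<noteq> 0"
  shows "\<exists>h B'. to_fract B / to_fract b = to_fract h + to_fract B' / to_fract b \<and> (B' = 0 \<or> degree B' < degree b)"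
proof -
  have "to_fract B = to_fract (b * (B div b) + B mod b)" by simp
  also have "\<dots> / to_fract b = to_fract (B div b) + to_fract (B mod b) / to_fract b"
    using assms unfolding to_fract_add to_fract_mult by (simp add: add_divide_distrib)
  finally show ?thesis using degree_mod_less[OF assms, of B] by (intro exI conjI)
qed

lemma Artin_Schreier_add: "((x::'a::char2) + y)\<^sup>2 + (x + y) = (x\<^sup>2 + x) + (y\<^sup>2 + y)"
  by (simp add: add_ac)

text \<open>The class of \<open>x + t\<close> modulo \<open>u\<^sup>2 + u\<close> is the connecting map for the separable isogeny of
  degree 2 (Verschiebung); the lemma bounds its image on the rational points.\<close>

lemma point_Artin_Schreier_class:
  fixes x y :: "bit poly fract"
  defines "t \<equiv> to_fract X2"
  assumes "y\<^sup>2 + x * y = x ^ 3 + t * x\<^sup>2 + t ^ 6"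
  shows "\<exists>w. x = w\<^sup>2 + w \<or> x = w\<^sup>2 + w + t"
proof (cases "x = 0")
  case True
  then show ?thesis by (intro exI[of _ 0]) simp
next
  case False
  have t0: "t \<noteq> 0" unfolding t_def by simp
  define U where "U = (y + t ^ 3) / x"
  have sq: "t ^ 6 = (t ^ 3)\<^sup>2" by (simp flip: power_mult)
  have xU: "x * U = y + t ^ 3" using False by (simp add: U_def)
  have "x\<^sup>2 * (U\<^sup>2 + U) = (x * U)\<^sup>2 + x * (x * U)" by (simp add: algebra_simps power2_eq_square)
  also have "\<dots> = (y\<^sup>2 + x * y) + t ^ 6 + x * t ^ 3"
    unfolding xU by (simp add: distrib_left add_ac flip: sq)
  also have "\<dots> = x ^ 3 + t * x\<^sup>2 + x * t ^ 3" unfolding assms(2) by (simp add: add_ac)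
  finally have "x\<^sup>2 * (U\<^sup>2 + U) = x\<^sup>2 * (x + t ^ 3 / x + t)"
    using False by (simp add: algebra_simps power2_eq_square power3_eq_cube)
  then have U: "U\<^sup>2 + U = x + t ^ 3 / x + t" using False by simp
  obtain a d where ad: "d \<noteq> 0" "coprime a d" "x = to_fract a / to_fract d"
    by (rule obtain_coprime_fract)
  obtain m n where mn: "n \<noteq> 0" "coprime m n" "U = to_fract m / to_fract n"
    by (rule obtain_coprime_fract)
  have a: "a \<noteq> 0" using False ad by auto
  have "n dvd a * d"
  proof -
    let ?A = "a\<^sup>2 + X2 ^ 3 * d\<^sup>2 + X2 * a * d"
    have gen: "n\<^sup>2 * (a\<^sup>2 + s * d\<^sup>2 + r * a * d) = a * d * (m\<^sup>2 + m * n)"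
      if "(m / n)\<^sup>2 + m / n = a / d + s / (a / d) + r" "a \<noteq> 0" "d \<noteq> 0" "n \<noteq> 0" for a d m n s r :: "bit poly fract"
      using that by (simp add: field_simps power2_eq_square)
    have "to_fract (n\<^sup>2 * ?A) = to_fract (a * d * (m\<^sup>2 + m * n))"
      unfolding to_fract_mult to_fract_add to_fract_power
      by (rule gen) (use U a ad mn in \<open>auto simp: t_def\<close>)
    then have eq: "n\<^sup>2 * ?A = a * d * (m\<^sup>2 + m * n)" by (simp only: to_fract_eq_iff)
    have "coprime n (m * (m + n))" using mn(2)
      by (metis coprime_commute coprime_mult_right_iff gcd_add1 coprime_iff_gcd_eq_1 add.commute)
    then have "coprime n (m\<^sup>2 + m * n)" by (simp add: distrib_left power2_eq_square)
    moreover have "n dvd a * d * (m\<^sup>2 + m * n)" using eq by (metis dvd_mult2 dvd_triv_left power2_eq_square)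
    ultimately show ?thesis by (simp add: coprime_dvd_mult_left_iff)
  qed
  \<comment> \<open>The denominator of \<open>U\<close> is shared out between the zeros and the
    poles of \<open>x\<close>; \<open>V\<close> and \<open>W\<close> are the corresponding partial
    fractions of \<open>U\<close>.\<close>
  then obtain \<alpha> \<beta> where \<alpha>\<beta>: "n = \<alpha> * \<beta>" "\<alpha> dvd a" "\<beta> dvd d" by (metis division_decomp)
  have nz: "\<alpha> \<noteq> 0" "\<beta> \<noteq> 0" using mn(1) \<alpha>\<beta>(1) by auto
  have "coprime \<alpha> \<beta>" using ad(2) \<alpha>\<beta> by (meson coprime_divisors)
  then obtain r s where rs: "r * \<alpha> + s * \<beta> = 1"
    by (metis bezout_coefficients_fst_snd coprime_iff_gcd_eq_1)
  define V where "V = to_fract (m * r) / to_fract \<beta>"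
  define W where "W = to_fract (m * s) / to_fract \<alpha>"
  have UVW: "U = V + W"
  proof -
    have "to_fract m = to_fract (m * (r * \<alpha> + s * \<beta>))" unfolding rs by simp
    then show ?thesis unfolding mn(3) V_def W_def \<alpha>\<beta>(1) using nz by (simp add: field_simps)
  qed
  have gVW: "x + (V\<^sup>2 + V) = t ^ 3 / x + t + (W\<^sup>2 + W)"
    by (rule char2_eq[OF U[unfolded UVW Artin_Schreier_add]]) (simp add: add_ac)
  \<comment> \<open>The left side of \<open>gVW\<close> has finite poles only at primes dividing
    \<open>d\<close>, its right side only at primes dividing \<open>a\<close>. As these are coprime,
    the common value is a polynomial.\<close>
  have "\<exists>g. x + (V\<^sup>2 + V) = to_fract g"
  proof (rule polynomial_of_coprime_denominators)
    let ?p = "a * \<beta>\<^sup>2 + d * ((m * r)\<^sup>2 + m * r * \<beta>)"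
    let ?q = "X2 ^ 3 * d * \<alpha>\<^sup>2 + a * (X2 * \<alpha>\<^sup>2 + (m * s)\<^sup>2 + m * s * \<alpha>)"
    have gen1: "a / d + ((v / b)\<^sup>2 + v / b) = (a * b\<^sup>2 + d * (v\<^sup>2 + v * b)) / (d * b\<^sup>2)"
      if "d \<noteq> 0" "b \<noteq> 0" for a b d v :: "bit poly fract"
      using that by (simp add: field_simps power2_eq_square)
    have gen2: "f / (a / d) + e + ((v / b)\<^sup>2 + v / b) = (f * d * b\<^sup>2 + a * (e * b\<^sup>2 + v\<^sup>2 + v * b)) / (a * b\<^sup>2)"
      if "d \<noteq> 0" "b \<noteq> 0" "a \<noteq> 0" for a b d v e f :: "bit poly fract"
      using that by (simp add: field_simps power2_eq_square)
    show "x + (V\<^sup>2 + V) = to_fract ?p / to_fract (d * \<beta>\<^sup>2)"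
      unfolding to_fract_mult to_fract_add to_fract_power ad(3) V_def
      by (rule gen1) (use ad nz in auto)
    show "x + (V\<^sup>2 + V) = to_fract ?q / to_fract (a * \<alpha>\<^sup>2)"
      unfolding gVW unfolding to_fract_mult to_fract_add to_fract_power ad(3) W_def t_def
      by (rule gen2) (use ad nz a in auto)
    have "coprime d a" using ad(2) by (simp add: coprime_commute)
    moreover have "coprime d \<alpha>" "coprime \<beta> a" "coprime \<beta> \<alpha>"
      using \<open>coprime d a\<close> \<alpha>\<beta> by (meson coprime_divisors dvd_refl)+
    ultimately show "coprime (d * \<beta>\<^sup>2) (a * \<alpha>\<^sup>2)" by simp
  qed (use ad a nz in auto)
  then obtain g where g: "x + (V\<^sup>2 + V) = to_fract g" by blast
  obtain h B where B: "V = to_fract h + to_fract B / to_fract \<beta>" "B = 0 \<or> degree B < degree \<beta>"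
    using reduce_Artin_Schreier[OF nz(2), of "m * r"] unfolding V_def by blast
  obtain k A where A: "W = to_fract k + to_fract A / to_fract \<alpha>" "A = 0 \<or> degree A < degree \<alpha>"
    using reduce_Artin_Schreier[OF nz(1), of "m * s"] unfolding W_def by blast
  let ?V = "to_fract B / to_fract \<beta>" and ?W = "to_fract A / to_fract \<alpha>"
  define g1 where "g1 = g + (h\<^sup>2 + h)"
  define g2 where "g2 = g + X2 + (k\<^sup>2 + k)"
  have x1: "x = to_fract g1 + (?V\<^sup>2 + ?V)"
  proof -
    have "x = (V\<^sup>2 + V) + to_fract g" by (rule char2_eq[OF g]) (simp add: add_ac)
    then show ?thesis unfolding B(1) Artin_Schreier_add g1_def by (simp add: add_ac)
  qed
  have x2: "t ^ 3 / x = to_fract g2 + (?W\<^sup>2 + ?W)"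
  proof -
    have "t ^ 3 / x = t + (W\<^sup>2 + W) + to_fract g" by (rule char2_eq[OF g[unfolded gVW]]) (simp add: add_ac)
    then show ?thesis unfolding A(1) Artin_Schreier_add g2_def t_def by (simp add: add_ac del: to_fract_eq_iff)
  qed
  define F where "F = to_fract h + to_fract k"
  have g12: "to_fract g1 = to_fract g2 + t + (F\<^sup>2 + F)"
    unfolding g1_def g2_def t_def F_def by (simp add: add_ac)
  \<comment> \<open>If both degrees were at least two, \<open>x\<close> and \<open>t ^ 3 / x\<close>
    would have poles at infinity of orders \<open>degree g1\<close> and \<open>degree g2\<close>,
    which must add up to three.\<close>
  have "degree g1 \<le> 1 \<or> degree g2 \<le> 1"
  proof (rule ccontr)
    assume "\<not> ?thesis"
    then have dg: "degree g1 \<ge> 2" "degree g2 \<ge> 2" by auto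
    have num: "degree (e * b\<^sup>2 + (C\<^sup>2 + C * b)) = degree e + 2 * degree b"
      if "C = 0 \<or> degree C < degree b" "degree e \<ge> 2" "b \<noteq> 0" for e b C :: "bit poly"
    proof -
      have "e \<noteq> 0" using that(2) by auto
      then have *: "degree (e * b\<^sup>2) = degree e + 2 * degree b"
        using that(3) by (simp add: degree_mult_eq degree_power_eq)
      have "degree (C\<^sup>2) \<le> 2 * degree b" "degree (C * b) \<le> 2 * degree b"
        using that degree_mult_le[of C b] degree_power_le[of C 2] by auto
      then have "degree (C\<^sup>2 + C * b) \<le> 2 * degree b" by (rule degree_add_le)
      with * that(2) have "degree (C\<^sup>2 + C * b) < degree (e * b\<^sup>2)" by linarith
      from degree_add_eq_left[OF this] * show ?thesis by simp
    qed
    let ?P = "g1 * \<beta>\<^sup>2 + (B\<^sup>2 + B * \<beta>)" and ?Q = "g2 * \<alpha>\<^sup>2 + (A\<^sup>2 + A * \<alpha>)"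
    have dP: "degree ?P = degree g1 + 2 * degree \<beta>" by (rule num) (use B dg nz in auto)
    have dQ: "degree ?Q = degree g2 + 2 * degree \<alpha>" by (rule num) (use A dg nz in auto)
    have gen: "e + ((v / b)\<^sup>2 + v / b) = (e * b\<^sup>2 + (v\<^sup>2 + v * b)) / b\<^sup>2"
      if "b \<noteq> 0" for b v e :: "bit poly fract"
      using that by (simp add: field_simps power2_eq_square)
    have p1: "x = to_fract ?P / to_fract (\<beta>\<^sup>2)"
      unfolding x1 to_fract_mult to_fract_add to_fract_power by (rule gen) (use nz in auto)
    have p2: "t ^ 3 / x = to_fract ?Q / to_fract (\<alpha>\<^sup>2)"
      unfolding x2 to_fract_mult to_fract_add to_fract_power by (rule gen) (use nz in auto)
    have "t ^ 3 = x * (t ^ 3 / x)" using False by simp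
    also have "\<dots> = to_fract (?P * ?Q) / to_fract (\<beta>\<^sup>2 * \<alpha>\<^sup>2)"
      unfolding p2 by (subst p1) (simp only: times_divide_times_eq to_fract_mult)
    finally have "to_fract (X2 ^ 3 * (\<beta>\<^sup>2 * \<alpha>\<^sup>2)) = to_fract (?P * ?Q)"
      using nz unfolding t_def to_fract_mult to_fract_power by (simp add: nonzero_eq_divide_eq)
    then have "X2 ^ 3 * (\<beta>\<^sup>2 * \<alpha>\<^sup>2) = ?P * ?Q" by (simp only: to_fract_eq_iff)
    from arg_cong[OF this, of degree]
    have "3 + (2 * degree \<beta> + 2 * degree \<alpha>) = degree ?P + degree ?Q"
      using nz dP dQ dg by (subst (asm) (1 2) degree_mult_eq) (auto simp: degree_mult_eq degree_power_eq)
    then show False using dP dQ dg by linarith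
  qed
  then have "(\<exists>e\<in>{0, 1, X2, X2 + 1}. \<exists>v. x = to_fract e + (v\<^sup>2 + v))"
  proof
    assume "degree g1 \<le> 1"
    then show ?thesis using x1 bit_poly_const_or_linear by blast
  next
    assume "degree g2 \<le> 1"
    then have "g2 + X2 \<in> {0, 1, X2, X2 + 1}"
      using bit_poly_const_or_linear[of g2] by (auto simp: add_ac)
    moreover have "x = to_fract (g2 + X2) + ((F + ?V)\<^sup>2 + (F + ?V))"
      unfolding Artin_Schreier_add using x1 unfolding g12 t_def by (simp add: add_ac)
    ultimately show ?thesis by blast
  qed
  then obtain e v where e: "e \<in> {0, 1, X2, X2 + 1}" "x = to_fract e + (v\<^sup>2 + v)" by blast
  \<comment> \<open>The constant term of \<open>e\<close> is tested at \<open>X2 = 0\<close>: there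
    \<open>x\<close> vanishes if \<open>a\<close> does, and \<open>t ^ 3 / x\<close> vanishes
    otherwise.\<close>
  have "e \<in> {0, X2}"
  proof (rule ccontr)
    assume "e \<notin> {0, X2}"
    then obtain \<epsilon> where \<epsilon>: "e = X2 * \<epsilon> + 1" using e(1)
      by (metis insert_iff singletonD mult_1_right mult_zero_right add_0 empty_iff)
    show False
    proof (cases "poly a 0 = 0")
      case True
      then obtain a' where a': "a = X2 * a'" using poly_eq_0_iff_dvd[of a 0] by auto
      have "poly d 0 = 1"
      proof (rule ccontr)
        assume "poly d 0 \<noteq> 1"
        then have "X2 dvd d" using poly_eq_0_iff_dvd[of d 0] by auto
        moreover have "X2 dvd a" using a' by (metis dvd_triv_left)
        ultimately have "is_unit X2" using ad(2) by (meson coprime_common_divisor)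
        then show False unfolding is_unit_bit_poly by (subst (asm) one_pCons) simp
      qed
      moreover have "v\<^sup>2 + v = 1 + to_fract (X2 * (a' + \<epsilon> * d)) / to_fract d"
      proof -
        have "v\<^sup>2 + v = to_fract e + x" by (rule char2_eq[OF e(2)]) (simp add: add_ac)
        also have "\<dots> = 1 + (to_fract X2 * to_fract \<epsilon> + to_fract X2 * to_fract a' / to_fract d)"
          unfolding \<epsilon> ad(3) a' to_fract_mult to_fract_add to_fract_1 by (simp only: add_ac)
        also have "to_fract X2 * to_fract \<epsilon> + to_fract X2 * to_fract a' / to_fract d = to_fract (X2 * (a' + \<epsilon> * d)) / to_fract d"
          unfolding to_fract_mult to_fract_add using ad(1)
          by (simp add: add_divide_distrib distrib_left add_ac del: to_fract_eq_0_iff) simp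
        finally show ?thesis .
      qed
      ultimately show False using no_unit_Artin_Schreier by blast
    next
      case a0: False
      have "(U + v)\<^sup>2 + (U + v) = 1 + to_fract (X2 * (X2\<^sup>2 * d + (\<epsilon> + 1) * a)) / to_fract a"
      proof -
        have "(U + v)\<^sup>2 + (U + v) = t ^ 3 / x + t + (x + (v\<^sup>2 + v))"
          unfolding Artin_Schreier_add U by (simp only: add_ac)
        also have "x + (v\<^sup>2 + v) = to_fract e" by (rule char2_eq[OF e(2)]) (simp add: add_ac)
        also have "t ^ 3 / x + t + to_fract e = 1 + (t ^ 3 / x + t * (to_fract \<epsilon> + 1))"
          unfolding \<epsilon> t_def to_fract_mult to_fract_add to_fract_1 by (simp only: add_ac distrib_left mult_1_right)
        also have "t ^ 3 / x + t * (to_fract \<epsilon> + 1) = to_fract (X2 * (X2\<^sup>2 * d + (\<epsilon> + 1) * a)) / to_fract a"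
          unfolding to_fract_mult to_fract_add to_fract_power to_fract_1 ad(3) t_def[symmetric]
          using ad(1) a by (simp add: field_simps power3_eq_cube power2_eq_square)
        finally show ?thesis .
      qed
      moreover have "poly a 0 = 1" using a0 by simp
      ultimately show False using no_unit_Artin_Schreier by blast
    qed
  qed
  then show ?thesis using e(2) by (auto simp: t_def add_ac)
qed

section \<open>The perfect closure and a quadratic extension\<close>

abbreviation ratfun_t :: "bit poly fract" where "ratfun_t \<equiv> to_fract X2"

lemma t_gen_eq: "t_gen = to_ac ratfun_t"
  by (simp add: t_gen_def to_fract_def)

lemma CHAR_F2t_bar: "CHAR(F2t_bar) = 2"
proof (rule CHAR_eqI)
  show "of_nat 2 = (0::F2t_bar)" by simp
  show "2 dvd n" if "of_nat n = (0::F2t_bar)" for n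
  proof (rule ccontr)
    assume "\<not> 2 dvd n"
    then obtain m where "n = 2 * m + 1" by (auto elim!: oddE)
    then show False using that by simp
  qed
qed

lemma field_F2t_bar: "field (ring_of_type_algebra :: F2t_bar ring)"
  by (rule field_from_type_algebra)

lemma inv_ring_of_type_algebra:
  assumes "(x::F2t_bar) \<noteq> 0"
  shows "inv\<^bsub>ring_of_type_algebra\<^esub> x = inverse x"
proof -
  interpret field "ring_of_type_algebra :: F2t_bar ring" by (rule field_F2t_bar)
  show ?thesis
    by (rule comm_inv_char) (use assms in \<open>auto simp: ring_of_type_algebra_def\<close>)
qed

lemma a_inv_ring_of_type_algebra: "\<ominus>\<^bsub>ring_of_type_algebra\<^esub> x = - (x::F2t_bar)"
proof -
  interpret field "ring_of_type_algebra :: F2t_bar ring" by (rule field_F2t_bar)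
  show ?thesis
    by (rule minus_equality) (auto simp: ring_of_type_algebra_def)
qed

lemma inverse_range_to_ac: "x \<in> range to_ac \<Longrightarrow> inverse x \<in> range to_ac"
  by (auto simp flip: to_ac_inverse)

text \<open>Raising to the power \<open>2 ^ n\<close> is an injective ring homomorphism taking the
  root \<open>s\<close> to \<open>t_gen\<close>, so the field generated by \<open>s\<close> consists
  of all elements whose power lies in the rational function field.\<close>

lemma in_F2t_perf_iff: "x \<in> F2t_perf \<longleftrightarrow> (\<exists>n. x ^ (2 ^ n) \<in> range to_ac)"
proof
  assume "x \<in> F2t_perf"
  then obtain n s where s: "s ^ (2 ^ n) = t_gen" "x \<in> generate_field ring_of_type_algebra {s}"
    unfolding F2t_perf_def by blast
  from s(2) have "x ^ (2 ^ n) \<in> range to_ac"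
  proof (induction rule: generate_field.induct)
    case one
    then show ?case by (simp add: ring_of_type_algebra_def)
  next
    case (incl h)
    then show ?case using s(1) t_gen_eq by auto
  next
    case (a_inv h)
    then show ?case by (simp add: a_inv_ring_of_type_algebra)
  next
    case (m_inv h)
    then have "h \<noteq> 0" by (simp add: ring_of_type_algebra_def)
    with m_inv show ?case
      by (simp add: inv_ring_of_type_algebra power_inverse inverse_range_to_ac)
  next
    case (eng_add h1 h2)
    then show ?case
      by (simp add: ring_of_type_algebra_def frobenius_add) (metis (no_types) imageE rangeI to_ac_add)
  next
    case (eng_mult h1 h2)
    then show ?case
      by (simp add: ring_of_type_algebra_def power_mult_distrib) (metis (no_types) imageE rangeI to_ac_mult)
  qed
  then show "\<exists>n. x ^ (2 ^ n) \<in> range to_ac" ..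
next
  assume "\<exists>n. x ^ (2 ^ n) \<in> range to_ac"
  then obtain n f where f: "x ^ (2 ^ n) = to_ac f" by auto
  obtain s :: F2t_bar where s: "s ^ (2 ^ n) = t_gen" using nth_root_exists[of "2 ^ n" t_gen] by auto
  interpret field "ring_of_type_algebra :: F2t_bar ring" by (rule field_F2t_bar)
  let ?G = "generate_field ring_of_type_algebra {s}"
  have G: "0 \<in> ?G" "1 \<in> ?G" "\<And>x y. x \<in> ?G \<Longrightarrow> y \<in> ?G \<Longrightarrow> x + y \<in> ?G" "\<And>x y. x \<in> ?G \<Longrightarrow> y \<in> ?G \<Longrightarrow> x * y \<in> ?G" "s \<in> ?G"
    "\<And>x. x \<in> ?G \<Longrightarrow> x \<noteq> 0 \<Longrightarrow> inverse x \<in> ?G"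
    using zero_in_generate[of "{s}"] generate_field.one[of "ring_of_type_algebra :: F2t_bar ring" "{s}"]
      generate_field.eng_add[of _ "ring_of_type_algebra :: F2t_bar ring" "{s}"]
      generate_field.eng_mult[of _ "ring_of_type_algebra :: F2t_bar ring" "{s}"]
      generate_field.incl[of s "{s}" "ring_of_type_algebra :: F2t_bar ring"]
      generate_field.m_inv[of _ "ring_of_type_algebra :: F2t_bar ring" "{s}"] inv_ring_of_type_algebra
    by (auto simp: ring_of_type_algebra_def)
  \<comment> \<open>The coefficients are zero or one and thus their own roots, so the root of
    \<open>p\<close> is obtained by putting \<open>s\<close> for the variable.\<close>
  have poly: "\<exists>g\<in>?G. g ^ (2 ^ n) = to_ac (to_fract p)" for p
  proof (induction p)
    case 0
    then show ?case using G(1) by (intro bexI[of _ 0]) (auto simp: power_0_left)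
  next
    case (pCons a p)
    then obtain g where g: "g \<in> ?G" "g ^ (2 ^ n) = to_ac (to_fract p)" by blast
    have "to_fract (pCons a p) = to_fract [:a:] + ratfun_t * to_fract p"
      by (simp flip: to_fract_mult to_fract_add)
    moreover have "a = 0 \<or> [:a:] = 1" by (cases a) (simp_all add: one_pCons)
    then obtain e where "e \<in> ?G" "e ^ (2 ^ n) = to_ac (to_fract [:a:])"
    proof
      assume "a = 0"
      then show ?thesis by (intro that[of 0]) (auto simp: power_0_left G)
    next
      assume "[:a:] = 1"
      then show ?thesis by (intro that[of 1]) (simp_all add: G)
    qed
    ultimately show ?case using g G s
      by (intro bexI[of _ "e + s * g"]) (auto simp: frobenius_add power_mult_distrib t_gen_eq)
  qed
  obtain p q where pq: "q \<noteq> 0" "f = to_fract p / to_fract q" by (rule obtain_coprime_fract)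
  obtain g h where gh: "g \<in> ?G" "g ^ (2 ^ n) = to_ac (to_fract p)" "h \<in> ?G" "h ^ (2 ^ n) = to_ac (to_fract q)"
    using poly by meson
  have h0: "h \<noteq> 0" using gh(4) pq(1) by (auto simp: power_0_left)
  have "(g * inverse h) ^ (2 ^ n) = x ^ (2 ^ n)"
    unfolding f pq(2) using gh by (simp add: power_mult_distrib power_inverse divide_inverse)
  then have "x = g * inverse h" by (simp add: frobenius_inj)
  then have "x \<in> ?G" using G gh h0 by blast
  then show "x \<in> F2t_perf" unfolding F2t_perf_def using s by blast
qed

lemma range_to_ac_power: "x ^ (2 ^ n) \<in> range to_ac \<Longrightarrow> n \<le> m \<Longrightarrow> x ^ (2 ^ m) \<in> range to_ac"
proof -
  assume "x ^ (2 ^ n) \<in> range to_ac" "n \<le> m"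
  then obtain f where "x ^ (2 ^ n) = to_ac f" by auto
  moreover have "x ^ (2 ^ m) = (x ^ (2 ^ n)) ^ (2 ^ (m - n))"
    using \<open>n \<le> m\<close> by (simp flip: power_mult power_add)
  ultimately show ?thesis by (metis rangeI to_ac_power)
qed

lemma F2t_perf_common:
  assumes "x \<in> F2t_perf" "y \<in> F2t_perf"
  obtains n f g where "x ^ (2 ^ n) = to_ac f" "y ^ (2 ^ n) = to_ac g" "n > 0"
proof -
  obtain a b where "x ^ (2 ^ a) \<in> range to_ac" "y ^ (2 ^ b) \<in> range to_ac"
    using assms in_F2t_perf_iff by blast
  then have "x ^ (2 ^ (a + b + 1)) \<in> range to_ac" "y ^ (2 ^ (a + b + 1)) \<in> range to_ac"
    using range_to_ac_power by (metis le_add1 trans_le_add1, metis le_add1 le_add2 trans_le_add1)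
  then show thesis using that[of "a + b + 1"] by auto
qed

lemma perf_to_ac [simp]: "to_ac f \<in> F2t_perf"
  unfolding in_F2t_perf_iff by (rule exI[of _ 0]) simp

lemma perf_0 [simp]: "0 \<in> F2t_perf" and perf_1 [simp]: "1 \<in> F2t_perf" and perf_t [simp]: "t_gen \<in> F2t_perf"
  using perf_to_ac[of 0] perf_to_ac[of 1] perf_to_ac[of ratfun_t] by (simp_all add: t_gen_eq)

lemma perf_add [simp]:
  assumes "x \<in> F2t_perf" "y \<in> F2t_perf"
  shows "x + y \<in> F2t_perf"
proof -
  obtain n f g where "x ^ (2 ^ n) = to_ac f" "y ^ (2 ^ n) = to_ac g" "n > 0"
    by (rule F2t_perf_common[OF assms])
  then have "(x + y) ^ (2 ^ n) = to_ac (f + g)" by (simp add: frobenius_add)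
  then show ?thesis unfolding in_F2t_perf_iff by (metis rangeI)
qed

lemma perf_mult [simp]:
  assumes "x \<in> F2t_perf" "y \<in> F2t_perf"
  shows "x * y \<in> F2t_perf"
proof -
  obtain n f g where "x ^ (2 ^ n) = to_ac f" "y ^ (2 ^ n) = to_ac g" "n > 0"
    by (rule F2t_perf_common[OF assms])
  then have "(x * y) ^ (2 ^ n) = to_ac (f * g)" by (simp add: power_mult_distrib)
  then show ?thesis unfolding in_F2t_perf_iff by (metis rangeI)
qed

lemma perf_inverse [simp]: "x \<in> F2t_perf \<Longrightarrow> inverse x \<in> F2t_perf"
  unfolding in_F2t_perf_iff power_inverse using inverse_range_to_ac by blast

lemma perf_divide [simp]: "x \<in> F2t_perf \<Longrightarrow> y \<in> F2t_perf \<Longrightarrow> x / y \<in> F2t_perf"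
  by (simp add: divide_inverse)

lemma perf_power [simp]: "x \<in> F2t_perf \<Longrightarrow> x ^ n \<in> F2t_perf"
  by (induction n) auto

lemma perf_sum: "(\<And>a. a \<in> A \<Longrightarrow> f a \<in> F2t_perf) \<Longrightarrow> sum f A \<in> F2t_perf"
  by (induction A rule: infinite_finite_induct) auto

lemma perf_root: "x ^ (2 ^ n) \<in> F2t_perf \<Longrightarrow> x \<in> F2t_perf"
  unfolding in_F2t_perf_iff by (metis power_add power_mult)

lemma perf_sqrt: "x\<^sup>2 \<in> F2t_perf \<Longrightarrow> x \<in> F2t_perf"
  using perf_root[of x 1] by simp

lemma perfect_subfield_F2t_perf: "perfect_subfield F2t_perf"
proof -
  interpret field "ring_of_type_algebra :: F2t_bar ring" by (rule field_F2t_bar)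
  have "subfield F2t_perf (ring_of_type_algebra :: F2t_bar ring)"
  proof (rule subfieldI')
    show "subring F2t_perf (ring_of_type_algebra :: F2t_bar ring)"
      by (rule subringI) (auto simp: a_inv_ring_of_type_algebra, auto simp: ring_of_type_algebra_def)
    show "inv\<^bsub>ring_of_type_algebra\<^esub> k \<in> F2t_perf" if "k \<in> F2t_perf - {\<zero>\<^bsub>ring_of_type_algebra\<^esub>}" for k :: F2t_bar
      using that by (subst inv_ring_of_type_algebra) (auto simp: ring_of_type_algebra_def)
  qed
  moreover have "\<exists>y\<in>F2t_perf. y\<^sup>2 = x" if "x \<in> F2t_perf" for x
  proof -
    obtain y where "y\<^sup>2 = x" using nth_root_exists[of 2 x] by auto
    with that perf_sqrt[of y] show ?thesis by blast
  qed
  ultimately show ?thesis unfolding perfect_subfield_def CHAR_F2t_bar by blast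
qed

text \<open>Squaring is the identity modulo elements \<open>v^2 + v\<close>, because
  \<open>a^2 = a + (a^2 + a)\<close>.\<close>

lemma power_t_Artin_Schreier: "\<exists>v::bit poly fract. ratfun_t ^ (j * 2 ^ n) = ratfun_t ^ j + (v\<^sup>2 + v)"
proof (induction n)
  case 0
  show ?case by (rule exI[of _ 0]) simp
next
  case (Suc n)
  then obtain v :: "bit poly fract" where v: "ratfun_t ^ (j * 2 ^ n) = ratfun_t ^ j + (v\<^sup>2 + v)" by blast
  have "ratfun_t ^ (j * 2 ^ Suc n) = (ratfun_t ^ (j * 2 ^ n))\<^sup>2"
    by (simp add: mult_ac flip: power_mult)
  also have "\<dots> = ratfun_t ^ (j * 2 ^ n) + ((ratfun_t ^ (j * 2 ^ n))\<^sup>2 + ratfun_t ^ (j * 2 ^ n))"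
    by (simp add: add_ac)
  finally show ?case unfolding v using Artin_Schreier_add[of v]
    by (metis (no_types, lifting) add.assoc)
qed

text \<open>A high power of Frobenius brings \<open>a\<close> and \<open>b\<close> into the rational
  function field. There the powers of two in the exponents can be removed modulo elements
  \<open>g^2 + g\<close>, which leaves \<open>t\<close>, \<open>t^3\<close> or
  \<open>t^3 + t\<close>, all of odd degree.\<close>

lemma Artin_Schreier_perf_odd:
  assumes "a \<in> F2t_perf" "a\<^sup>2 + a = b" "b ^ (2 ^ m) = t_gen ^ (3 * 2 ^ n) + e * t_gen ^ (2 ^ l) \<or> b ^ (2 ^ m) = t_gen ^ (2 ^ l)" "e \<in> {0, 1}"
  shows False
proof -
  obtain r where "a ^ (2 ^ r) \<in> range to_ac" using assms(1) in_F2t_perf_iff by blast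
  then have "a ^ (2 ^ (m + r)) \<in> range to_ac" by (rule range_to_ac_power) simp
  then obtain f where f: "a ^ (2 ^ (m + r)) = to_ac f" by auto
  have "to_ac (f\<^sup>2 + f) = (a\<^sup>2 + a) ^ (2 ^ (m + r))"
    by (simp add: f frobenius_add mult_ac flip: power_mult) (metis f mult.commute power_mult)
  also have "\<dots> = (b ^ (2 ^ m)) ^ (2 ^ r)" by (simp add: assms(2) power_add power_mult)
  finally have f2: "to_ac (f\<^sup>2 + f) = (b ^ (2 ^ m)) ^ (2 ^ r)" .
  have "\<exists>d g. (b ^ (2 ^ m)) ^ (2 ^ r) = to_ac (to_fract d + (g\<^sup>2 + g)) \<and> odd (degree d)"
    using assms(3)
  proof
    assume "b ^ (2 ^ m) = t_gen ^ (2 ^ l)"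
    then have "(b ^ (2 ^ m)) ^ (2 ^ r) = to_ac (ratfun_t ^ (1 * 2 ^ (l + r)))"
      by (simp add: t_gen_eq power_add power_mult)
    moreover obtain v where "ratfun_t ^ (1 * 2 ^ (l + r)) = ratfun_t ^ 1 + (v\<^sup>2 + v)"
      using power_t_Artin_Schreier by blast
    ultimately have "(b ^ (2 ^ m)) ^ (2 ^ r) = to_ac (ratfun_t + (v\<^sup>2 + v))" by (simp only: power_one_right)
    then show ?thesis by (intro exI[of _ X2] exI[of _ v]) simp
  next
    assume b: "b ^ (2 ^ m) = t_gen ^ (3 * 2 ^ n) + e * t_gen ^ (2 ^ l)"
    obtain v where v: "ratfun_t ^ (3 * 2 ^ (n + r)) = ratfun_t ^ 3 + (v\<^sup>2 + v)"
      using power_t_Artin_Schreier by blast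
    obtain w where w: "ratfun_t ^ (1 * 2 ^ (l + r)) = ratfun_t ^ 1 + (w\<^sup>2 + w)"
      using power_t_Artin_Schreier by blast
    have e2: "e ^ (2 ^ r) = e" using assms(4) by (auto simp: power_0_left)
    have "(b ^ (2 ^ m)) ^ (2 ^ r) = to_ac (ratfun_t ^ (3 * 2 ^ (n + r))) + e * to_ac (ratfun_t ^ (1 * 2 ^ (l + r)))"
      unfolding b by (simp add: t_gen_eq power_add power_mult frobenius_add power_mult_distrib e2)
    also have "\<dots> = to_ac (ratfun_t ^ 3 + (v\<^sup>2 + v)) + e * to_ac (ratfun_t + (w\<^sup>2 + w))"
      unfolding v w by simp
    finally have eq: "(b ^ (2 ^ m)) ^ (2 ^ r) = \<dots>" .
    show ?thesis
    proof (cases "e = 0")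
      case True
      then show ?thesis unfolding eq
        by (intro exI[of _ "X2 ^ 3"] exI[of _ v]) (simp add: degree_power_eq)
    next
      case False
      then have "e = 1" using assms(4) by simp
      moreover have "degree (X2 ^ 3 + X2) = 3"
        by (subst degree_add_eq_left) (simp_all add: degree_power_eq)
      ultimately show ?thesis unfolding eq
        by (intro exI[of _ "X2 ^ 3 + X2"] exI[of _ "v + w"]) (simp add: add_ac)
    qed
  qed
  then obtain d g where dg: "(b ^ (2 ^ m)) ^ (2 ^ r) = to_ac (to_fract d + (g\<^sup>2 + g))" "odd (degree d)" by blast
  from f2 have "f\<^sup>2 + f = to_fract d + (g\<^sup>2 + g)" unfolding dg(1) by (simp only: to_ac_eq_iff)
  then have "(f + g)\<^sup>2 + (f + g) = to_fract d" unfolding Artin_Schreier_add by (simp add: add_ac)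
  then show False using Artin_Schreier_odd_degree dg(2) by blast
qed

text \<open>Square roots are unique in characteristic two, so nothing depends on the choice.\<close>

definition c0 :: F2t_bar where "c0 = (SOME s. s\<^sup>2 = t_gen ^ 3)"

lemma c0_square: "c0\<^sup>2 = t_gen ^ 3"
  unfolding c0_def using nth_root_exists[of 2 "t_gen ^ 3"] by (metis (mono_tags, lifting) someI_ex zero_less_numeral)

lemma t_gen_nz [simp]: "t_gen \<noteq> 0"
  unfolding t_gen_eq by simp

lemma c0_nz [simp]: "c0 \<noteq> 0"
  using c0_square t_gen_nz by (metis power_not_zero zero_neq_numeral power_zero_numeral)

lemma c0_perf [simp]: "c0 \<in> F2t_perf"
  using perf_sqrt c0_square perf_power perf_t by metis

text \<open>The two roots differ by one; \<open>conjL\<close> will exchange them.\<close>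

definition \<theta> :: F2t_bar where "\<theta> = (SOME s. s\<^sup>2 + s = t_gen)"

lemma theta: "\<theta>\<^sup>2 + \<theta> = t_gen"
proof -
  have "\<exists>s. poly [:t_gen, 1, 1:] s = 0" by (rule alg_closed_imp_poly_has_root) simp
  then obtain s where "t_gen + s * (1 + s) = 0" by auto
  then have "s\<^sup>2 + s = t_gen" by (simp add: add_eq_0_iff_eq algebra_simps power2_eq_square)
  then show ?thesis unfolding \<theta>_def by (metis (mono_tags, lifting) someI)
qed

lemma theta_not_perf: "\<theta> \<notin> F2t_perf"
  using Artin_Schreier_perf_odd[of \<theta> t_gen 0 0 0 0] theta by auto

definition Lfield :: "F2t_bar set" where "Lfield = {a + b * \<theta> | a b. a \<in> F2t_perf \<and> b \<in> F2t_perf}"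

text \<open>For \<open>w = a + b \<theta>\<close> the coefficient of \<open>\<theta>\<close> in
  \<open>w^2 + w\<close> is \<open>b^2 + b\<close>, so \<open>b\<close> is zero or one and
  \<open>a^2 + a\<close> equals \<open>c0\<close> or \<open>c0 + t_gen\<close>. The squares of these
  are \<open>t^3\<close> and \<open>t^3 + t^2\<close>, which the odd degree excludes.\<close>

lemma c0_not_Artin_Schreier:
  assumes "w \<in> Lfield"
  shows "w\<^sup>2 + w \<noteq> c0"
proof
  assume eq: "w\<^sup>2 + w = c0"
  obtain a b where w: "w = a + b * \<theta>" "a \<in> F2t_perf" "b \<in> F2t_perf" using assms unfolding Lfield_def by blast
  have th: "\<theta>\<^sup>2 = \<theta> + t_gen" using theta by (rule char2_eq) (simp add: add_ac)
  have eq': "c0 = (a\<^sup>2 + a + b\<^sup>2 * t_gen) + (b\<^sup>2 + b) * \<theta>"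
    unfolding eq[symmetric] w(1) by (simp add: power_mult_distrib th algebra_simps)
  have b: "b\<^sup>2 + b = 0"
  proof (rule ccontr)
    assume "b\<^sup>2 + b \<noteq> 0"
    have "c0 + (a\<^sup>2 + a + b\<^sup>2 * t_gen) = (b\<^sup>2 + b) * \<theta>" by (subst eq') (simp add: add_ac)
    with \<open>b\<^sup>2 + b \<noteq> 0\<close> have "\<theta> = (c0 + (a\<^sup>2 + a + b\<^sup>2 * t_gen)) / (b\<^sup>2 + b)"
      by (metis nonzero_mult_div_cancel_left)
    then show False using theta_not_perf w(2,3) by (metis c0_perf perf_add perf_divide perf_mult perf_power perf_t)
  qed
  then have "b * (b + 1) = 0" by (simp add: algebra_simps power2_eq_square)
  then have b01: "b = 0 \<or> b = 1" by (auto simp: add_eq_0_iff_eq)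
  define e where "e = b\<^sup>2"
  have e: "e \<in> {0, 1}" unfolding e_def using b01 by auto
  have "a\<^sup>2 + a = c0 + e * t_gen" by (rule char2_eq[OF eq']) (simp only: b e_def mult_zero_left add_0_right, simp add: add_ac)
  moreover have "(c0 + e * t_gen) ^ (2 ^ 1) = t_gen ^ (3 * 2 ^ 0) + e * t_gen ^ (2 ^ 1)"
    using e by (auto simp: power_mult_distrib c0_square)
  ultimately show False using Artin_Schreier_perf_odd[OF w(2)] e by blast
qed

lemma F2t_descent:
  fixes x y :: "bit poly fract"
  assumes "y\<^sup>2 + x * y = x ^ 3 + ratfun_t ^ (2 ^ n) * x\<^sup>2 + ratfun_t ^ (6 * 2 ^ n)"
  shows "\<exists>x1 y1. x = x1 ^ (2 ^ n) \<and> y = y1 ^ (2 ^ n) \<and> y1\<^sup>2 + x1 * y1 = x1 ^ 3 + ratfun_t * x1\<^sup>2 + ratfun_t ^ 6"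
  using assms
proof (induction n arbitrary: x y)
  case 0
  then show ?case by auto
next
  case (Suc n)
  have q: "2 ^ n = (1::nat) \<or> even (2 ^ n :: nat)" by (cases n) auto
  have p: "y\<^sup>2 + x * y = x ^ 3 + ratfun_t ^ (2 * 2 ^ n) * x\<^sup>2 + ratfun_t ^ (12 * 2 ^ n)"
    using Suc.prems by simp
  obtain x1 y1 where 1: "x = x1\<^sup>2" "y = y1\<^sup>2" "y1\<^sup>2 + x1 * y1 = x1 ^ 3 + ratfun_t ^ (2 ^ n) * x1\<^sup>2 + ratfun_t ^ (6 * 2 ^ n)"
    using Frobenius_descent[OF q _ p] by auto
  obtain x2 y2 where 2: "x1 = x2 ^ (2 ^ n)" "y1 = y2 ^ (2 ^ n)" "y2\<^sup>2 + x2 * y2 = x2 ^ 3 + ratfun_t * x2\<^sup>2 + ratfun_t ^ 6"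
    using Suc.IH[OF 1(3)] by blast
  have "x = x2 ^ (2 ^ Suc n)" "y = y2 ^ (2 ^ Suc n)" unfolding 1 2 by (simp_all add: mult_ac flip: power_mult)
  with 2(3) show ?case by blast
qed

text \<open>A power of Frobenius carries the point to one over the rational function field, on the
  curve with parameter \<open>t^(2^n)\<close>. Descent and injectivity of Frobenius then show that
  \<open>x\<close> already lay in the rational function field.\<close>

lemma perf_point_Artin_Schreier_class:
  assumes "x \<in> F2t_perf" "y \<in> F2t_perf" "y\<^sup>2 + x * y = x ^ 3 + t_gen * x\<^sup>2 + t_gen ^ 6"
  shows "\<exists>w\<in>F2t_perf. x = w\<^sup>2 + w \<or> x = w\<^sup>2 + w + t_gen"
proof -
  obtain n f g where fg: "x ^ (2 ^ n) = to_ac f" "y ^ (2 ^ n) = to_ac g"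
    using F2t_perf_common[OF assms(1,2)] by blast
  have comm: "(a ^ k) ^ (2 ^ n) = (a ^ (2 ^ n)) ^ k" for a :: F2t_bar and k
    by (simp add: mult.commute flip: power_mult)
  have "to_ac (g\<^sup>2 + f * g) = (y\<^sup>2 + x * y) ^ (2 ^ n)"
    by (simp add: frobenius_add power_mult_distrib fg comm)
  also have "\<dots> = to_ac (f ^ 3 + ratfun_t ^ (2 ^ n) * f\<^sup>2 + ratfun_t ^ (6 * 2 ^ n))"
    unfolding assms(3) by (simp add: frobenius_add power_mult_distrib fg comm t_gen_eq) (simp flip: power_mult add: mult.commute)
  finally have "g\<^sup>2 + f * g = f ^ 3 + ratfun_t ^ (2 ^ n) * f\<^sup>2 + ratfun_t ^ (6 * 2 ^ n)"
    by (simp only: to_ac_eq_iff)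
  from F2t_descent[OF this] obtain x1 y1 where xy: "f = x1 ^ (2 ^ n)" "y1\<^sup>2 + x1 * y1 = x1 ^ 3 + ratfun_t * x1\<^sup>2 + ratfun_t ^ 6"
    by blast
  have x: "x = to_ac x1" using fg(1) unfolding xy(1) to_ac_power frobenius_inj .
  obtain w where "x1 = w\<^sup>2 + w \<or> x1 = w\<^sup>2 + w + ratfun_t" using point_Artin_Schreier_class[OF xy(2)] by blast
  then have "x = (to_ac w)\<^sup>2 + to_ac w \<or> x = (to_ac w)\<^sup>2 + to_ac w + t_gen"
    unfolding x t_gen_eq by (metis to_ac_add to_ac_power)
  then show ?thesis using perf_to_ac by blast
qed

section \<open>Orders of Laurent series\<close>

text \<open>Zero satisfies every bound; with \<open>fls_subdegree\<close>, whose value at zero is a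
  default, it would have to be set apart each time.\<close>

definition ordge :: "int \<Rightarrow> 'a::zero fls \<Rightarrow> bool" where
  "ordge n w \<longleftrightarrow> (\<forall>i<n. fls_nth w i = 0)"

text \<open>The coefficient \<open>a\<close> may be zero; only together with
  \<open>a \<noteq> 0\<close> is the order determined.\<close>

definition leading :: "'a::zero fls \<Rightarrow> int \<Rightarrow> 'a \<Rightarrow> bool" where
  "leading w n a \<longleftrightarrow> ordge n w \<and> fls_nth w n = a"

lemma ordge_0 [simp]: "ordge n 0"
  by (simp add: ordge_def)

lemma ordge_mono: "ordge n w \<Longrightarrow> m \<le> n \<Longrightarrow> ordge m w"
  by (auto simp: ordge_def)

lemma ordge_subdegree: "ordge (fls_subdegree w) w"
  by (simp add: ordge_def)

lemma ordge_iff: "w \<noteq> 0 \<Longrightarrow> ordge n w \<longleftrightarrow> n \<le> fls_subdegree w"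
  using fls_subdegree_geI[of w n] by (auto simp: ordge_def)

lemma ordge_add: "ordge n v \<Longrightarrow> ordge n w \<Longrightarrow> ordge n (v + w)"
  by (auto simp: ordge_def)

lemma ordge_sum: "(\<And>a. a \<in> A \<Longrightarrow> ordge n (f a)) \<Longrightarrow> ordge n (sum f A)"
  by (induction A rule: infinite_finite_induct) (auto intro: ordge_add)

lemma ordge_Suc: "ordge (n + 1) w \<longleftrightarrow> ordge n w \<and> fls_nth w n = 0"
  by (auto simp: ordge_def order_le_less)

lemma ordge_mult:
  fixes v w :: "'a::semiring_no_zero_divisors fls"
  assumes "ordge m v" "ordge n w"
  shows "ordge (m + n) (v * w)"
proof (cases "v = 0 \<or> w = 0")
  case False
  with assms have "m \<le> fls_subdegree v" "n \<le> fls_subdegree w" by (auto simp: ordge_iff)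
  then show ?thesis using False by (simp add: ordge_iff)
qed auto

lemma nth_mult_ordge:
  fixes v w :: "'a::semiring_no_zero_divisors fls"
  assumes "ordge m v" "ordge n w"
  shows "fls_nth (v * w) (m + n) = fls_nth v m * fls_nth w n"
proof (cases "v = 0 \<or> w = 0")
  case False
  with assms have mn: "m \<le> fls_subdegree v" "n \<le> fls_subdegree w" by (auto simp: ordge_iff)
  show ?thesis
  proof (cases "m = fls_subdegree v \<and> n = fls_subdegree w")
    case True
    then show ?thesis by (simp add: fls_times_base)
  next
    case False
    then have "m + n < fls_subdegree v + fls_subdegree w" "fls_nth v m = 0 \<or> fls_nth w n = 0"
      using mn by (auto simp: fls_eq0_below_subdegree)
    then show ?thesis by (auto simp: fls_times_nth_eq0)
  qed
qed auto

lemma ordge_const: "ordge 0 (fls_const a)"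
  by (simp add: ordge_def)

lemma leading_mult:
  fixes v w :: "'a::semiring_no_zero_divisors fls"
  shows "leading v m a \<Longrightarrow> leading w n b \<Longrightarrow> leading (v * w) (m + n) (a * b)"
  by (auto simp: leading_def ordge_mult nth_mult_ordge)

lemma leading_1: "leading 1 0 1"
  by (simp add: leading_def ordge_def)

lemma leading_power:
  fixes w :: "'a::semiring_1_no_zero_divisors fls"
  shows "leading w n a \<Longrightarrow> leading (w ^ k) (int k * n) (a ^ k)"
proof (induction k)
  case (Suc k)
  then show ?case using leading_mult[of w n a "w ^ k" "int k * n" "a ^ k"] by (simp add: algebra_simps)
qed (simp add: leading_1)

lemma leading_const: "leading (fls_const a) 0 a"
  by (simp add: leading_def ordge_def)

lemma leading_add: "leading v n a \<Longrightarrow> ordge (n + 1) w \<Longrightarrow> leading (v + w) n a"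
  unfolding leading_def ordge_Suc by (auto intro: ordge_add)

lemma leading_ordge: "leading w n a \<Longrightarrow> m \<le> n \<Longrightarrow> ordge m w"
  by (auto simp: leading_def ordge_def)

lemma leading_subdegree: "leading w n a \<Longrightarrow> a \<noteq> 0 \<Longrightarrow> fls_subdegree w = n"
  by (auto simp: leading_def ordge_def intro: fls_subdegree_eqI)

lemma leading_nz: "leading w n a \<Longrightarrow> a \<noteq> 0 \<Longrightarrow> w \<noteq> 0"
  by (auto simp: leading_def)

lemma leading_self: "leading w (fls_subdegree w) (fls_nth w (fls_subdegree w))"
  by (simp add: leading_def ordge_subdegree)

lemma leading_inverse:
  fixes w :: "'a::field fls"
  assumes "leading w n a" "a \<noteq> 0"
  shows "leading (inverse w) (- n) (inverse a)"
proof -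
  have w: "w \<noteq> 0" "fls_subdegree w = n" using assms leading_nz leading_subdegree by blast+
  have "fls_subdegree (inverse w) = - n" using w by simp
  then have l: "leading (inverse w) (- n) (fls_nth (inverse w) (- n))" using leading_self by metis
  from leading_mult[OF assms(1) this] have "leading 1 0 (a * fls_nth (inverse w) (- n))" using w by simp
  then have "a * fls_nth (inverse w) (- n) = 1" by (simp add: leading_def)
  with l assms(2) show ?thesis by (metis field_class.field_inverse inverse_unique)
qed

definition pe :: "'a::{comm_ring_1} poly \<Rightarrow> 'a fls \<Rightarrow> 'a fls" where
  "pe p w = poly (map_poly fls_const p) w"

lemma pe_0 [simp]: "pe 0 w = 0"
  by (simp add: pe_def)

lemma pe_pCons [simp]: "pe (pCons a p) w = fls_const a + w * pe p w"
  by (simp add: pe_def map_poly_pCons)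

lemma pe_1 [simp]: "pe 1 w = 1"
  by (simp add: one_pCons del: pCons_one)

lemma fls_const_add: "fls_const (a + b) = fls_const a + fls_const b"
  by (simp add: fls_plus_const)

lemma pe_add [simp]: "pe (p + q) w = pe p w + pe q w"
  by (induction p q rule: poly_induct2) (simp_all add: fls_const_add algebra_simps)

lemma pe_smult [simp]: "pe (Polynomial.smult a p) w = fls_const a * pe p w"
  by (induction p) (simp_all add: algebra_simps)

lemma pe_mult [simp]: "pe (p * q) w = pe p w * pe q w"
  by (induction p) (simp_all add: algebra_simps)

lemma pe_power [simp]: "pe (p ^ n) w = pe p w ^ n"
  by (induction n) simp_all

lemma pe_monom: "pe (Polynomial.monom a n) w = fls_const a * w ^ n"
  by (induction n) (simp_all add: monom_0 monom_Suc mult_ac)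

lemma pe_const: "pe p (fls_const a) = fls_const (poly p a)"
  by (induction p) (simp_all add: fls_const_add)

lemma pe_leading:
  fixes p :: "'a::field poly"
  assumes "leading x (- 2) 1" "p \<noteq> 0"
  shows "leading (pe p x) (- 2 * int (degree p)) (lead_coeff p)"
  using assms(2)
proof (induction p)
  case (pCons a p)
  show ?case
  proof (cases "p = 0")
    case True
    then show ?thesis by (simp add: leading_const)
  next
    case False
    with pCons have "leading (x * pe p x) (- 2 + - 2 * int (degree p)) (1 * lead_coeff p)"
      using leading_mult[OF assms(1)] by blast
    moreover have "ordge (- 2 + - 2 * int (degree p) + 1) (fls_const a)"
      by (rule ordge_mono[OF ordge_const]) simp
    ultimately have "leading (x * pe p x + fls_const a) (- 2 + - 2 * int (degree p)) (1 * lead_coeff p)"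
      by (rule leading_add)
    then show ?thesis using False by (simp add: add.commute)
  qed
qed simp

section \<open>Semilinear lattices\<close>

text \<open>The set \<open>I\<close> is an ideal of the coordinate ring over \<open>L\<close>, expanded at infinity up to a common factor,
  and the order of the pole serves as degree.\<close>

locale semilinear_lattice =
  fixes x y :: "'a::{field, char2} fls" and I :: "'a fls set" and \<Phi> :: "'a fls \<Rightarrow> 'a fls"
    and L :: "'a set" and \<sigma> :: "'a \<Rightarrow> 'a" and c t a6 :: 'a
  assumes L: "0 \<in> L" "1 \<in> L" "\<And>a b. a \<in> L \<Longrightarrow> b \<in> L \<Longrightarrow> a + b \<in> L" "\<And>a b. a \<in> L \<Longrightarrow> b \<in> L \<Longrightarrow> a * b \<in> L"
      "\<And>a. a \<in> L \<Longrightarrow> inverse a \<in> L"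
    and sigma: "\<And>a. a \<in> L \<Longrightarrow> \<sigma> a \<in> L" "\<And>a b. a \<in> L \<Longrightarrow> b \<in> L \<Longrightarrow> \<sigma> (a + b) = \<sigma> a + \<sigma> b"
      "\<And>a b. a \<in> L \<Longrightarrow> b \<in> L \<Longrightarrow> \<sigma> (a * b) = \<sigma> a * \<sigma> b" "\<sigma> 1 = 1"
    and lx: "leading x (- 2) 1" and ly: "leading y (- 3) 1"
    and curve: "y\<^sup>2 + x * y = x ^ 3 + fls_const t * x\<^sup>2 + fls_const a6"
    and I: "\<exists>w\<in>I. w \<noteq> 0" "\<And>w. w \<in> I \<Longrightarrow> w \<noteq> 0 \<Longrightarrow> fls_subdegree w \<le> 0"
      "\<And>v w. v \<in> I \<Longrightarrow> w \<in> I \<Longrightarrow> v + w \<in> I" "\<And>a w. a \<in> L \<Longrightarrow> w \<in> I \<Longrightarrow> fls_const a * w \<in> I"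
      "\<And>w. w \<in> I \<Longrightarrow> x * w \<in> I" "\<And>w. w \<in> I \<Longrightarrow> y * w \<in> I"
      "\<And>w. w \<in> I \<Longrightarrow> fls_nth w (fls_subdegree w) \<in> L"
    and Phi: "\<And>w. w \<in> I \<Longrightarrow> \<Phi> w \<in> I" "\<And>v w. v \<in> I \<Longrightarrow> w \<in> I \<Longrightarrow> \<Phi> (v + w) = \<Phi> v + \<Phi> w"
      "\<And>a w. a \<in> L \<Longrightarrow> w \<in> I \<Longrightarrow> \<Phi> (fls_const a * w) = fls_const (\<sigma> a) * \<Phi> w"
      "\<And>w. w \<in> I \<Longrightarrow> \<Phi> (x * w) = x * \<Phi> w" "\<And>w. w \<in> I \<Longrightarrow> \<Phi> (y * w) = y * \<Phi> w"
      "\<And>w. w \<in> I \<Longrightarrow> \<Phi> (\<Phi> w) = x * (x + fls_const c) * w"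
      "\<And>w. w \<in> I \<Longrightarrow> w \<noteq> 0 \<Longrightarrow> fls_subdegree (\<Phi> w) = fls_subdegree w - 2"
    and c: "c \<noteq> 0"
begin

lemma power_x_I: "w \<in> I \<Longrightarrow> x ^ i * w \<in> I"
  by (induction i) (auto simp: I(5) mult.assoc)

text \<open>A basis of \<open>I\<close> over the polynomials in \<open>x\<close>, adapted to the
  pole at infinity: as \<open>x\<close> has a double pole, each parity of the pole order requires
  one generator, chosen of least pole order.\<close>

definition reduced :: "'a fls \<Rightarrow> 'a fls \<Rightarrow> bool" where
  "reduced w1 w2 \<longleftrightarrow> w1 \<in> I \<and> w1 \<noteq> 0 \<and> w2 \<in> I \<and> w2 \<noteq> 0 \<and> odd (fls_subdegree w2 - fls_subdegree w1) \<and>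
     (\<forall>w\<in>I. w \<noteq> 0 \<longrightarrow> fls_subdegree w \<le> fls_subdegree w1) \<and>
     (\<forall>w\<in>I. w \<noteq> 0 \<longrightarrow> odd (fls_subdegree w - fls_subdegree w1) \<longrightarrow> fls_subdegree w \<le> fls_subdegree w2)"

lemma reduced_exists: "\<exists>w1 w2. reduced w1 w2"
proof -
  let ?D = "\<lambda>w. nat (- fls_subdegree w)"
  obtain w1 where w1: "w1 \<in> I" "w1 \<noteq> 0" "\<And>w. w \<in> I \<Longrightarrow> w \<noteq> 0 \<Longrightarrow> ?D w1 \<le> ?D w"
    using ex_has_least_nat[of "\<lambda>w. w \<in> I \<and> w \<noteq> 0" _ ?D] I(1) by blast
  have y0: "y \<noteq> 0" "fls_subdegree y = - 3" using ly leading_nz leading_subdegree by force+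
  have "y * w1 \<in> I \<and> y * w1 \<noteq> 0 \<and> odd (fls_subdegree (y * w1) - fls_subdegree w1)"
    using w1 y0 I(6) by simp
  then obtain w2 where w2: "w2 \<in> I" "w2 \<noteq> 0" "odd (fls_subdegree w2 - fls_subdegree w1)"
    "\<And>w. w \<in> I \<Longrightarrow> w \<noteq> 0 \<Longrightarrow> odd (fls_subdegree w - fls_subdegree w1) \<Longrightarrow> ?D w2 \<le> ?D w"
    using ex_has_least_nat[of "\<lambda>w. w \<in> I \<and> w \<noteq> 0 \<and> odd (fls_subdegree w - fls_subdegree w1)" _ ?D] by blast
  have le: "fls_subdegree v \<le> fls_subdegree w" if "v \<in> I" "v \<noteq> 0" "w \<in> I" "w \<noteq> 0" "?D w \<le> ?D v" for v w
    using I(2)[OF that(1,2)] I(2)[OF that(3,4)] that(5) by linarith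
  have "reduced w1 w2" unfolding reduced_def using w1 w2 le by blast
  then show ?thesis by blast
qed

lemma reduced_scale:
  assumes "reduced w1 w2" "a \<in> L" "a \<noteq> 0"
  shows "reduced w1 (fls_const a * w2)"
proof -
  have "fls_subdegree (fls_const a * w2) = fls_subdegree w2" "fls_const a * w2 \<noteq> 0"
    using assms unfolding reduced_def by auto
  then show ?thesis using assms I(4) unfolding reduced_def by auto
qed

text \<open>For a basis vector \<open>w\<close> of order \<open>s\<close> this says that each
  nonzero term of \<open>p\<close>, multiplied by \<open>w\<close>, has a pole of order less than
  \<open>M\<close>.\<close>

definition bounded_coeffs :: "'a poly \<Rightarrow> int \<Rightarrow> nat \<Rightarrow> bool" where
  "bounded_coeffs p s M \<longleftrightarrow> (\<forall>i. coeff p i \<in> L) \<and> (\<forall>i. coeff p i \<noteq> 0 \<longrightarrow> 2 * int i - s < int M)"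

lemma bounded_coeffs_0: "bounded_coeffs 0 s M"
  by (simp add: bounded_coeffs_def L)

lemma bounded_coeffs_Suc: "bounded_coeffs p s M \<Longrightarrow> bounded_coeffs p s (Suc M)"
  by (force simp: bounded_coeffs_def)

lemma bounded_coeffs_add_monom:
  assumes "bounded_coeffs p s M" "a \<in> L" "2 * int i - s = int M"
  shows "bounded_coeffs (p + Polynomial.monom a i) s (Suc M)"
  unfolding bounded_coeffs_def
proof (intro conjI allI impI)
  fix j
  show "coeff (p + Polynomial.monom a i) j \<in> L"
    using assms L by (auto simp: bounded_coeffs_def)
  assume "coeff (p + Polynomial.monom a i) j \<noteq> 0"
  then have "j = i \<or> coeff p j \<noteq> 0" by (auto split: if_splits)
  then show "2 * int j - s < int (Suc M)" using assms by (force simp: bounded_coeffs_def)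
qed

text \<open>Division with remainder: the leading term of \<open>w\<close> is cancelled by a constant
  times a power of \<open>x\<close> times the generator whose pole order has the same parity, and
  minimality of that generator keeps the exponent nonnegative.\<close>

lemma reduced_span:
  assumes "reduced w1 w2" "w \<in> I" "ordge (1 - int M) w"
  shows "\<exists>p q. w = pe p x * w1 + pe q x * w2 \<and>
    bounded_coeffs p (fls_subdegree w1) M \<and> bounded_coeffs q (fls_subdegree w2) M"
  using assms(2,3)
proof (induction M arbitrary: w)
  case 0
  \<comment> \<open>No nonzero element of \<open>I\<close> vanishes at infinity; this is where the
    induction starts.\<close>
  then have "w = 0" using I(2)[of w] by (cases "w = 0") (auto simp: ordge_iff)
  then show ?case by (intro exI[of _ 0]) (simp add: bounded_coeffs_0)
next
  case (Suc M)
  note red = assms(1)[unfolded reduced_def]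
  show ?case
  proof (cases "fls_nth w (- int M) = 0")
    case True
    with Suc.prems have "ordge (1 - int M) w" using ordge_Suc[of "- int M" w] by simp
    from Suc.IH[OF Suc.prems(1) this] show ?thesis using bounded_coeffs_Suc by blast
  next
    case False
    have ld: "leading w (- int M) (fls_nth w (- int M))" using Suc.prems(2) by (simp add: leading_def)
    have sd: "fls_subdegree w = - int M" "w \<noteq> 0"
      using leading_subdegree[OF ld False] leading_nz[OF ld False] by auto
    have step: "\<exists>a\<in>L. \<exists>i. 2 * int i - fls_subdegree v = int M \<and> w + fls_const a * x ^ i * v \<in> I \<and>
        ordge (1 - int M) (w + fls_const a * x ^ i * v)"
      if v: "v \<in> I" "v \<noteq> 0" "fls_subdegree w \<le> fls_subdegree v" "even (fls_subdegree w - fls_subdegree v)" for v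
    proof -
      define i where "i = nat ((fls_subdegree v + int M) div 2)"
      have i: "2 * int i - fls_subdegree v = int M" unfolding i_def using v(3,4) sd(1) by auto
      define a where "a = fls_nth w (- int M) * inverse (fls_nth v (fls_subdegree v))"
      have v0: "fls_nth v (fls_subdegree v) \<noteq> 0" using v(2) by simp
      have a: "a \<in> L" unfolding a_def using I(7)[OF Suc.prems(1)] I(7)[OF v(1)] L sd(1) by auto
      have "leading (fls_const a * x ^ i * v) (0 + int i * (- 2) + fls_subdegree v) (a * 1 ^ i * fls_nth v (fls_subdegree v))"
        by (intro leading_mult leading_const leading_power lx leading_self)
      moreover have "0 + int i * (- 2) + fls_subdegree v = - int M" using i by simp
      moreover have "a * 1 ^ i * fls_nth v (fls_subdegree v) = fls_nth w (- int M)"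
        unfolding a_def using v0 by simp
      ultimately have l2: "leading (fls_const a * x ^ i * v) (- int M) (fls_nth w (- int M))" by simp
      have "ordge (- int M + 1) (w + fls_const a * x ^ i * v)"
        unfolding ordge_Suc using ld l2 ordge_add by (auto simp: leading_def)
      moreover have "w + fls_const a * x ^ i * v \<in> I"
        using I(3)[OF Suc.prems(1) I(4)[OF a power_x_I[OF v(1), of i]]] by (simp add: mult.assoc)
      ultimately show ?thesis using a i by (intro bexI[of _ a] exI[of _ i]) auto
    qed
    show ?thesis
    proof (cases "even (fls_subdegree w - fls_subdegree w1)")
      case True
      obtain a i where ai: "a \<in> L" "2 * int i - fls_subdegree w1 = int M" "w + fls_const a * x ^ i * w1 \<in> I"
        "ordge (1 - int M) (w + fls_const a * x ^ i * w1)"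
        using step[of w1] red True Suc.prems(1) sd(2) by blast
      obtain p q where pq: "bounded_coeffs p (fls_subdegree w1) M" "bounded_coeffs q (fls_subdegree w2) M"
        "w + fls_const a * x ^ i * w1 = pe p x * w1 + pe q x * w2"
        using Suc.IH[OF ai(3,4)] by blast
      have "w = pe (p + Polynomial.monom a i) x * w1 + pe q x * w2"
        by (rule char2_eq[OF pq(3)]) (simp add: pe_monom algebra_simps)
      then show ?thesis using bounded_coeffs_add_monom[OF pq(1) ai(1,2)] bounded_coeffs_Suc[OF pq(2)] by blast
    next
      case False
      moreover have "odd (fls_subdegree w2 - fls_subdegree w1)" using red by blast
      ultimately have "even (fls_subdegree w - fls_subdegree w2)" by presburger
      then obtain a i where ai: "a \<in> L" "2 * int i - fls_subdegree w2 = int M" "w + fls_const a * x ^ i * w2 \<in> I"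
        "ordge (1 - int M) (w + fls_const a * x ^ i * w2)"
        using step[of w2] red False Suc.prems(1) sd(2) by blast
      obtain p q where pq: "bounded_coeffs p (fls_subdegree w1) M" "bounded_coeffs q (fls_subdegree w2) M"
        "w + fls_const a * x ^ i * w2 = pe p x * w1 + pe q x * w2"
        using Suc.IH[OF ai(3,4)] by blast
      have "w = pe p x * w1 + pe (q + Polynomial.monom a i) x * w2"
        by (rule char2_eq[OF pq(3)]) (simp add: pe_monom algebra_simps)
      then show ?thesis using bounded_coeffs_add_monom[OF pq(2) ai(1,2)] bounded_coeffs_Suc[OF pq(1)] by blast
    qed
  qed
qed

text \<open>The two summands have pole orders of opposite parity and cannot cancel.\<close>

lemma reduced_indep:
  assumes "reduced w1 w2" "pe p x * w1 + pe q x * w2 = 0"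
  shows "p = 0 \<and> q = 0"
proof -
  note red = assms(1)[unfolded reduced_def]
  have x: "fls_subdegree (pe r x * v) = - 2 * int (degree r) + fls_subdegree v \<and> pe r x * v \<noteq> 0" if "r \<noteq> 0" "v \<noteq> 0" for r v
    using pe_leading[OF lx that(1)] that leading_subdegree leading_nz
    by (metis fls_subdegree_mult leading_coeff_neq_0 mult_eq_0_iff)
  have eq: "pe p x * w1 = pe q x * w2" using assms(2) by (simp add: add_eq_0_iff_eq)
  show ?thesis
  proof (cases "p = 0 \<or> q = 0")
    case True
    then show ?thesis using eq x red by (metis mult_zero_left pe_0)
  next
    case False
    then have "- 2 * int (degree p) + fls_subdegree w1 = - 2 * int (degree q) + fls_subdegree w2"
      using eq x red by metis
    then have "even (fls_subdegree w2 - fls_subdegree w1)" by presburger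
    then show ?thesis using red by blast
  qed
qed

lemma reduced_eq:
  assumes "reduced w1 w2" "pe p x * w1 + pe q x * w2 = pe p' x * w1 + pe q' x * w2"
  shows "p = p' \<and> q = q'"
proof -
  have "pe (p + p') x * w1 + pe (q + q') x * w2 = 0"
    by (rule char2_eq[OF assms(2)]) (simp add: algebra_simps)
  then show ?thesis using reduced_indep[OF assms(1)] add_eq_0_iff_eq by blast
qed

lemma Phi_linear:
  assumes "a \<in> L" "b \<in> L" "w \<in> I"
  shows "\<Phi> (pe [:a, b:] x * w) = pe [:\<sigma> a, \<sigma> b:] x * \<Phi> w"
proof -
  have "pe [:a, b:] x * w = fls_const a * w + x * (fls_const b * w)"
    by (simp add: algebra_simps)
  then have "\<Phi> (pe [:a, b:] x * w) = fls_const (\<sigma> a) * \<Phi> w + x * (fls_const (\<sigma> b) * \<Phi> w)"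
    using assms by (simp add: Phi I)
  then show ?thesis by (simp add: algebra_simps)
qed

lemma linear_poly_eq:
  assumes "\<And>i. i > 1 \<Longrightarrow> coeff p i = 0"
  shows "p = [:coeff p 0, coeff p 1:]"
  using assms by (intro poly_eqI) (auto simp: coeff_pCons split: nat.split)

lemma quadratic_poly_eq:
  assumes "\<And>i. i > 2 \<Longrightarrow> coeff p i = 0"
  shows "p = [:coeff p 0, coeff p 1, coeff p 2:]"
  using assms by (intro poly_eqI) (auto simp: coeff_pCons numeral_2_eq_2 split: nat.split)

lemma bounded_coeffs_linear:
  assumes "bounded_coeffs p s M" "int M \<le> 4 - s"
  shows "\<exists>a\<in>L. \<exists>b\<in>L. p = [:a, b:]"
proof -
  have "coeff p i = 0" if "i > 1" for i
    using assms that by (force simp: bounded_coeffs_def)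
  from linear_poly_eq[OF this] show ?thesis using assms(1) unfolding bounded_coeffs_def by blast
qed

lemma bounded_coeffs_const:
  assumes "bounded_coeffs p s M" "int M \<le> 2 - s"
  shows "\<exists>a\<in>L. p = [:a:]"
proof -
  have *: "coeff p i = 0" if "i > 0" for i
    using assms that by (force simp: bounded_coeffs_def)
  have "p = [:coeff p 0:]" using * by (intro poly_eqI) (auto simp: coeff_pCons split: nat.split)
  then show ?thesis using assms(1) unfolding bounded_coeffs_def by blast
qed

lemma bounded_coeffs_quadratic:
  assumes "bounded_coeffs p s M" "int M \<le> 6 - s"
  shows "\<exists>a\<in>L. \<exists>b\<in>L. \<exists>d\<in>L. p = [:a, b, d:]"
proof -
  have "coeff p i = 0" if "i > 2" for i
    using assms that by (force simp: bounded_coeffs_def)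
  from quadratic_poly_eq[OF this] show ?thesis using assms(1) unfolding bounded_coeffs_def by blast
qed

lemma span_of_subdegree:
  assumes "reduced w1 w2" "w \<in> I" "w \<noteq> 0"
  shows "\<exists>p q. w = pe p x * w1 + pe q x * w2 \<and>
    bounded_coeffs p (fls_subdegree w1) (nat (1 - fls_subdegree w)) \<and> bounded_coeffs q (fls_subdegree w2) (nat (1 - fls_subdegree w))"
proof (rule reduced_span[OF assms(1,2)])
  show "ordge (1 - int (nat (1 - fls_subdegree w))) w"
    using I(2)[OF assms(2,3)] by (simp add: ordge_subdegree)
qed

lemma Phi_zero_iff: "w \<in> I \<Longrightarrow> w \<noteq> 0 \<Longrightarrow> \<Phi> w \<noteq> 0"
proof
  assume w: "w \<in> I" "w \<noteq> 0" "\<Phi> w = 0"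
  have "\<Phi> (\<Phi> w) = 0" using Phi(2)[OF w(1) w(1)] w(3) by (metis add_self)
  then have "x * (x + fls_const c) * w = 0" using Phi(6)[OF w(1)] by simp
  moreover have "leading (x + fls_const c) (- 2) 1" by (rule leading_add[OF lx]) (simp add: ordge_def)
  ultimately show False using w(2) lx leading_nz[of _ "- 2" "1 :: 'a"] by auto
qed

text \<open>\<open>\<Phi>\<close> raises the pole order by two. If \<open>w2\<close> occurs in
  \<open>\<Phi> w1\<close>, the parity condition forces its pole order to be one more than that of
  \<open>w1\<close>, so the pole of \<open>\<Phi> w1\<close> has to come from the term with
  \<open>x * w1\<close>.\<close>

lemma Phi_w1:
  assumes red: "reduced w1 w2"
  shows "\<exists>u0\<in>L. \<exists>u1\<in>L. \<exists>b\<in>L. \<Phi> w1 = pe [:u0, u1:] x * w1 + pe [:b:] x * w2 \<and> b \<noteq> 0 \<and> u1 \<noteq> 0 \<and>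
    fls_subdegree w2 = fls_subdegree w1 - 1"
proof -
  have r: "w1 \<in> I" "w1 \<noteq> 0" "w2 \<in> I" "w2 \<noteq> 0" "odd (fls_subdegree w2 - fls_subdegree w1)" "fls_subdegree w2 \<le> fls_subdegree w1"
    using red unfolding reduced_def by blast+
  then have lt: "fls_subdegree w2 < fls_subdegree w1" by (metis even_zero diff_self order_le_less)
  have s1: "fls_subdegree w1 \<le> 0" using I(2) r by blast
  have P1: "\<Phi> w1 \<in> I" "\<Phi> w1 \<noteq> 0" "fls_subdegree (\<Phi> w1) = fls_subdegree w1 - 2"
    using Phi(1,7) Phi_zero_iff r by blast+
  obtain p q where pq: "\<Phi> w1 = pe p x * w1 + pe q x * w2"
    "bounded_coeffs p (fls_subdegree w1) (nat (3 - fls_subdegree w1))"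
    "bounded_coeffs q (fls_subdegree w2) (nat (3 - fls_subdegree w1))"
    using span_of_subdegree[OF red P1(1,2)] unfolding P1(3) by auto
  obtain u0 u1 where p: "u0 \<in> L" "u1 \<in> L" "p = [:u0, u1:]"
    using bounded_coeffs_linear[OF pq(2)] s1 by auto
  obtain b where q: "b \<in> L" "q = [:b:]"
    using bounded_coeffs_const[OF pq(3)] s1 lt by auto
  have eq: "\<Phi> w1 = pe [:u0, u1:] x * w1 + pe [:b:] x * w2" using pq(1) p q by simp
  \<comment> \<open>Otherwise \<open>w1\<close> would be an eigenvector and
    \<open>x * (x + c)\<close> a product of \<open>u0 + u1 x\<close> and its conjugate. The constant
    term forces \<open>u0 = 0\<close>, and then the middle coefficient \<open>c\<close> would
    vanish.\<close>
  have b: "b \<noteq> 0"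
  proof
    assume "b = 0"
    then have e1: "\<Phi> w1 = pe [:u0, u1:] x * w1" using eq by simp
    have "pe [:0, c, 1:] x * w1 + pe 0 x * w2 = \<Phi> (\<Phi> w1)"
      using Phi(6)[OF r(1)] by (simp add: algebra_simps)
    also have "\<dots> = pe ([:\<sigma> u0, \<sigma> u1:] * [:u0, u1:]) x * w1 + pe 0 x * w2"
      by (subst e1) (simp only: Phi_linear[OF p(1,2) r(1)] e1 pe_mult mult.assoc pe_0 mult_zero_left add_0_right)
    finally have "[:0, c, 1:] = [:\<sigma> u0, \<sigma> u1:] * [:u0, u1:]" using reduced_eq[OF red] by blast
    then have e: "\<sigma> u0 * u0 = 0" "\<sigma> u0 * u1 + u0 * \<sigma> u1 = c" by (auto simp: algebra_simps)
    have s0: "\<sigma> 0 = 0" using sigma(2)[OF L(1) L(1)] by simp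
    have "u0 = 0"
    proof (rule ccontr)
      assume "u0 \<noteq> 0"
      then have "\<sigma> (u0 * inverse u0) = 1" using sigma(4) by simp
      then have "\<sigma> u0 \<noteq> 0" using sigma(3)[OF p(1) L(5)[OF p(1)]] by auto
      with e(1) \<open>u0 \<noteq> 0\<close> show False by simp
    qed
    with e(2) s0 c show False by simp
  qed
  have "coeff q 0 \<noteq> 0" using q b by simp
  then have "- fls_subdegree w2 < 3 - fls_subdegree w1"
    using pq(3) s1 unfolding bounded_coeffs_def by force
  with lt r(5) have s2: "fls_subdegree w2 = fls_subdegree w1 - 1" by presburger
  have "u1 \<noteq> 0"
  proof
    assume u1: "u1 = 0"
    have "ordge (fls_subdegree w1 - 1) (fls_const u0 * w1 + fls_const b * w2)"
      using ordge_mult[OF ordge_const ordge_subdegree[of w1], of u0] ordge_mult[OF ordge_const ordge_subdegree[of w2], of b] s2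
      by (intro ordge_add) (auto elim: ordge_mono)
    then have "ordge (fls_subdegree w1 - 1) (\<Phi> w1)" using eq u1 by simp
    then show False using P1(3) ordge_iff[OF P1(2)] by simp
  qed
  with b s2 eq p q show ?thesis by blast
qed

text \<open>The elimination that produces \<open>\<rho> = b / u1\<close>. The names
  \<open>su0\<close>, \<open>su1\<close>, \<open>sb\<close>, \<open>sn\<close> stand for the
  conjugates of \<open>u0\<close>, \<open>u1\<close>, \<open>b\<close>, \<open>n\<close>, and
  \<open>x2\<close> for that of \<open>\<xi>\<close>; the equations are coefficients of the square
  of \<open>\<Phi>\<close> and of its commutation with \<open>y\<close>.\<close>

lemma Phi_matrix_identity:
  fixes b g1 \<xi> x2 :: 'a
  assumes "u1 \<noteq> 0" "b \<noteq> 0"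
    and "su1 * u1 = 1" "su0 * u1 + su1 * u0 + sb * g1 = c"
    and "su1 * b = sb * u1" "su0 * b = sb * e0"
    and "u1 * \<xi> + u0 + b * (n + 1) = sn * b + x2 * u1 + e0"
    and "u1 * n + b = sn * u1 + g1"
  shows "(b / u1)\<^sup>2 + b / u1 = \<xi> + x2 + c"
proof -
  have g1: "g1 = u1 * (n + sn) + b" by (rule char2_eq[OF assms(8)]) (simp add: algebra_simps)
  have 1: "u1 * (\<xi> + x2) = u0 + e0 + b * (n + 1 + sn)" by (rule char2_eq[OF assms(7)]) (simp add: algebra_simps)
  have "c * b = sb * e0 * u1 + (su1 * b) * u0 + b * (sb * g1)"
    unfolding assms(4)[symmetric] assms(6)[symmetric] by (simp add: algebra_simps)
  also have "\<dots> = sb * (u1 * (e0 + u0) + b * g1)" unfolding assms(5) by (simp add: algebra_simps)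
  finally have cb: "c * b = sb * (u1 * (e0 + u0) + b * g1)" .
  have "sb * u1\<^sup>2 = b * (su1 * u1)" using assms(5) by (simp add: power2_eq_square mult_ac)
  then have sb: "sb * u1\<^sup>2 = b" using assms(3) by simp
  have "b * (c * u1\<^sup>2) = b * (u1 * (e0 + u0) + b * g1)"
  proof -
    have "b * (c * u1\<^sup>2) = (c * b) * u1\<^sup>2" by (simp only: mult_ac)
    also have "\<dots> = (sb * u1\<^sup>2) * (u1 * (e0 + u0) + b * g1)" unfolding cb by (simp only: mult_ac)
    finally show ?thesis unfolding sb .
  qed
  then have c: "c * u1\<^sup>2 = u1 * (e0 + u0) + b * g1" using assms(2) by simp
  have "u1\<^sup>2 * (\<xi> + x2 + c) = u1 * (u1 * (\<xi> + x2)) + c * u1\<^sup>2" by (simp add: algebra_simps power2_eq_square)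
  also have "\<dots> = b\<^sup>2 + b * u1" unfolding 1 c g1 by (simp add: algebra_simps power2_eq_square)
  finally have "\<xi> + x2 + c = (b\<^sup>2 + b * u1) / u1\<^sup>2" using assms(1) by (simp add: nonzero_eq_divide_eq mult.commute)
  then show ?thesis using assms(1) by (simp add: add_divide_distrib power_divide power2_eq_square)
qed

text \<open>In a reduced basis the coefficient of \<open>w2\<close> in \<open>y * w1\<close> is
  linear in \<open>x\<close>. At its zero \<open>\<xi>\<close> the matrix of \<open>y\<close> is
  triangular, so its eigenvalue there, together with \<open>\<xi>\<close>, satisfies the equation of
  the curve. The class of \<open>\<xi> + \<sigma> \<xi> + c\<close> is read off from the matrix of
  \<open>\<Phi>\<close>.\<close>

theorem lattice_point:
  "\<exists>\<xi>\<in>L. \<exists>Y\<in>L. \<exists>\<rho>\<in>L. Y\<^sup>2 + \<xi> * Y = \<xi> ^ 3 + t * \<xi>\<^sup>2 + a6 \<and> \<rho>\<^sup>2 + \<rho> = \<xi> + \<sigma> \<xi> + c"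
proof -
  obtain w1 v2 where red0: "reduced w1 v2" using reduced_exists by blast
  have w1: "w1 \<in> I" "w1 \<noteq> 0" using red0 unfolding reduced_def by blast+
  have s1: "fls_subdegree w1 \<le> 0" using I(2) w1 by blast
  have v2: "v2 \<in> I" "v2 \<noteq> 0" using red0 unfolding reduced_def by blast+
  have sv2: "fls_subdegree v2 = fls_subdegree w1 - 1" using Phi_w1[OF red0] by blast
  have y0: "y \<noteq> 0" "fls_subdegree y = - 3" using ly leading_nz leading_subdegree by force+
  have yw1: "y * w1 \<in> I" "y * w1 \<noteq> 0" "fls_subdegree (y * w1) = fls_subdegree w1 - 3"
    using I(6) w1 y0 by auto
  obtain p q where pq: "y * w1 = pe p x * w1 + pe q x * v2"
    "bounded_coeffs p (fls_subdegree w1) (nat (4 - fls_subdegree w1))"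
    "bounded_coeffs q (fls_subdegree v2) (nat (4 - fls_subdegree w1))"
    using span_of_subdegree[OF red0 yw1(1,2)] unfolding yw1(3) by auto
  obtain o' n where p: "o' \<in> L" "n \<in> L" "p = [:o', n:]" using bounded_coeffs_linear[OF pq(2)] s1 by auto
  obtain m0 m1 where q: "m0 \<in> L" "m1 \<in> L" "q = [:m0, m1:]" using bounded_coeffs_linear[OF pq(3)] s1 sv2 by auto
  \<comment> \<open>Multiplication by \<open>y\<close> raises the pole order by three, and the
    remaining terms reach only two above \<open>w1\<close>.\<close>
  have m1: "m1 \<noteq> 0"
  proof
    assume a: "m1 = 0"
    have "ordge (fls_subdegree w1 - 2) (fls_const o' * w1 + x * (fls_const n * w1) + fls_const m0 * v2)"
      using ordge_mult[OF ordge_const ordge_subdegree[of w1], of o'] ordge_mult[OF ordge_const ordge_subdegree[of v2], of m0] sv2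
        ordge_mult[OF leading_ordge[OF lx order_refl] ordge_mult[OF ordge_const ordge_subdegree[of w1], of n]]
      by (intro ordge_add) (auto elim: ordge_mono)
    then have "ordge (fls_subdegree w1 - 2) (y * w1)" unfolding pq(1) p(3) q(3) a by (simp add: algebra_simps)
    then show False using yw1(3) ordge_iff[OF yw1(2)] by simp
  qed
  \<comment> \<open>The scaling makes the linear coefficient of \<open>w2\<close> in
    \<open>y * w1\<close> monic, namely \<open>x + \<xi>\<close>.\<close>
  define w2 where "w2 = fls_const m1 * v2"
  define \<xi> where "\<xi> = m0 * inverse m1"
  have \<xi>: "\<xi> \<in> L" unfolding \<xi>_def using q L by blast
  have red: "reduced w1 w2" unfolding w2_def by (rule reduced_scale[OF red0 q(2) m1])
  have w2: "w2 \<in> I" "w2 \<noteq> 0" using red unfolding reduced_def by blast+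
  have m0: "m0 = \<xi> * m1" unfolding \<xi>_def using m1 by simp
  have yeq1: "y * w1 = pe [:o', n:] x * w1 + pe [:\<xi>, 1:] x * w2"
    unfolding pq(1) p(3) q(3) w2_def m0 by (simp add: algebra_simps flip: fls_const_mult_const)
  obtain u0 u1 b where Pw1: "u0 \<in> L" "u1 \<in> L" "b \<in> L" "\<Phi> w1 = pe [:u0, u1:] x * w1 + pe [:b:] x * w2" "b \<noteq> 0" "u1 \<noteq> 0"
    and s2: "fls_subdegree w2 = fls_subdegree w1 - 1"
    using Phi_w1[OF red] by blast
  have P2: "\<Phi> w2 \<in> I" "\<Phi> w2 \<noteq> 0" "fls_subdegree (\<Phi> w2) = fls_subdegree w1 - 3"
    using Phi(1,7) Phi_zero_iff w2 s2 by auto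
  obtain pg qg where pqg: "\<Phi> w2 = pe pg x * w1 + pe qg x * w2"
    "bounded_coeffs pg (fls_subdegree w1) (nat (4 - fls_subdegree w1))"
    "bounded_coeffs qg (fls_subdegree w2) (nat (4 - fls_subdegree w1))"
    using span_of_subdegree[OF red P2(1,2)] unfolding P2(3) by auto
  obtain g0 g1 where g: "g0 \<in> L" "g1 \<in> L" "pg = [:g0, g1:]" using bounded_coeffs_linear[OF pqg(2)] s1 by auto
  obtain e0 e1 where e: "e0 \<in> L" "e1 \<in> L" "qg = [:e0, e1:]" using bounded_coeffs_linear[OF pqg(3)] s1 s2 by auto
  have Pw2: "\<Phi> w2 = pe [:g0, g1:] x * w1 + pe [:e0, e1:] x * w2" using pqg(1) g e by simp
  have yw2: "y * w2 \<in> I" "y * w2 \<noteq> 0" "fls_subdegree (y * w2) = fls_subdegree w1 - 4"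
    using I(6) w2 y0 s2 by auto
  obtain pk ql where pqk: "y * w2 = pe pk x * w1 + pe ql x * w2"
    "bounded_coeffs pk (fls_subdegree w1) (nat (5 - fls_subdegree w1))"
    "bounded_coeffs ql (fls_subdegree w2) (nat (5 - fls_subdegree w1))"
    using span_of_subdegree[OF red yw2(1,2)] unfolding yw2(3) by auto
  obtain k0 k1 k2 where k: "pk = [:k0, k1, k2:]" using bounded_coeffs_quadratic[OF pqk(2)] s1 by auto
  obtain l0 l1 where l: "ql = [:l0, l1:]" using bounded_coeffs_linear[OF pqk(3)] s1 s2 by auto
  have yeq2: "y * w2 = pe [:k0, k1, k2:] x * w1 + pe [:l0, l1:] x * w2" using pqk(1) k l by simp
  have s0: "\<sigma> 0 = 0" using sigma(2)[OF L(1) L(1)] by simp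
  have in_I: "pe [:u, v:] x * w \<in> I" if "u \<in> L" "v \<in> L" "w \<in> I" for u v w
  proof -
    have "pe [:u, v:] x * w = fls_const u * w + x * (fls_const v * w)" by (simp add: algebra_simps)
    then show ?thesis using that I by auto
  qed
  have b1: "[:b:] = [:b, 0:]" by simp
  have "pe [:0, c, 1:] x * w1 + pe 0 x * w2 = \<Phi> (\<Phi> w1)"
    using Phi(6)[OF w1(1)] by (simp add: algebra_simps)
  also have "\<dots> = pe [:\<sigma> u0, \<sigma> u1:] x * \<Phi> w1 + pe [:\<sigma> b, 0:] x * \<Phi> w2"
    unfolding Pw1(4) b1 using Phi(2)[OF in_I[OF Pw1(1,2) w1(1)] in_I[OF Pw1(3) L(1) w2(1)]]
      Phi_linear[OF Pw1(1,2) w1(1)] Phi_linear[OF Pw1(3) L(1) w2(1)] s0 unfolding Pw1(4) b1 by metis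
  also have "\<dots> = pe ([:\<sigma> u0, \<sigma> u1:] * [:u0, u1:] + [:\<sigma> b, 0:] * [:g0, g1:]) x * w1
      + pe ([:\<sigma> u0, \<sigma> u1:] * [:b:] + [:\<sigma> b, 0:] * [:e0, e1:]) x * w2"
    unfolding Pw1(4) Pw2 pe_mult pe_add by (simp only: distrib_left distrib_right mult.assoc add_ac)
  finally have "[:0, c, 1:] = [:\<sigma> u0, \<sigma> u1:] * [:u0, u1:] + [:\<sigma> b, 0:] * [:g0, g1:] \<and>
      0 = [:\<sigma> u0, \<sigma> u1:] * [:b:] + [:\<sigma> b, 0:] * [:e0, e1:]"
    by (rule reduced_eq[OF red])
  then have E1: "\<sigma> u1 * u1 = 1" "\<sigma> u0 * u1 + \<sigma> u1 * u0 + \<sigma> b * g1 = c"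
    and E2: "\<sigma> u1 * b = \<sigma> b * e1" "\<sigma> u0 * b = \<sigma> b * e0"
    by (simp_all add: algebra_simps add_eq_0_iff_eq eq_commute[of 0])
  have "pe ([:u0, u1:] * [:o', n:] + [:b:] * [:k0, k1, k2:]) x * w1 + pe ([:u0, u1:] * [:\<xi>, 1:] + [:b:] * [:l0, l1:]) x * w2
      = pe [:u0, u1:] x * (y * w1) + pe [:b:] x * (y * w2)"
    unfolding yeq1 yeq2 pe_mult pe_add by (simp only: distrib_left distrib_right mult.assoc add_ac)
  also have "\<dots> = y * \<Phi> w1" unfolding Pw1(4) by (simp only: distrib_left mult_ac)
  also have "\<dots> = \<Phi> (y * w1)" using Phi(5)[OF w1(1)] by simp
  also have "\<dots> = pe [:\<sigma> o', \<sigma> n:] x * \<Phi> w1 + pe [:\<sigma> \<xi>, 1:] x * \<Phi> w2"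
    unfolding yeq1 using Phi(2)[OF in_I[OF p(1,2) w1(1)] in_I[OF \<xi> L(2) w2(1)]]
      Phi_linear[OF p(1,2) w1(1)] Phi_linear[OF \<xi> L(2) w2(1)] sigma(4) by metis
  also have "\<dots> = pe ([:\<sigma> o', \<sigma> n:] * [:u0, u1:] + [:\<sigma> \<xi>, 1:] * [:g0, g1:]) x * w1
     + pe ([:\<sigma> o', \<sigma> n:] * [:b:] + [:\<sigma> \<xi>, 1:] * [:e0, e1:]) x * w2"
    unfolding Pw1(4) Pw2 pe_mult pe_add by (simp only: distrib_left distrib_right mult.assoc add_ac)
  finally have "[:u0, u1:] * [:o', n:] + [:b:] * [:k0, k1, k2:] = [:\<sigma> o', \<sigma> n:] * [:u0, u1:] + [:\<sigma> \<xi>, 1:] * [:g0, g1:] \<and>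
     [:u0, u1:] * [:\<xi>, 1:] + [:b:] * [:l0, l1:] = [:\<sigma> o', \<sigma> n:] * [:b:] + [:\<sigma> \<xi>, 1:] * [:e0, e1:]"
    by (rule reduced_eq[OF red])
  then have E3: "u1 * n + b * k2 = \<sigma> n * u1 + g1"
    and E4: "u1 = e1" "u1 * \<xi> + u0 + b * l1 = \<sigma> n * b + \<sigma> \<xi> * e1 + e0"
    by (auto simp: algebra_simps)
  have "pe [:a6, 0, t, 1:] x * w1 + pe 0 x * w2 = (x ^ 3 + fls_const t * x\<^sup>2 + fls_const a6) * w1"
    by (simp add: algebra_simps power2_eq_square power3_eq_cube)
  also have "\<dots> = y * (y * w1) + x * (y * w1)"
    unfolding curve[symmetric] by (simp add: algebra_simps power2_eq_square)
  also have "\<dots> = pe [:o', n:] x * (y * w1) + pe [:\<xi>, 1:] x * (y * w2) + x * (y * w1)"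
  proof -
    have "y * (y * w1) = y * (pe [:o', n:] x * w1 + pe [:\<xi>, 1:] x * w2)" by (simp only: yeq1)
    then show ?thesis by (simp only: distrib_left mult_ac)
  qed
  also have "\<dots> = pe ([:o', n:] * [:o', n:] + [:\<xi>, 1:] * [:k0, k1, k2:] + [:0, 1:] * [:o', n:]) x * w1
     + pe ([:o', n:] * [:\<xi>, 1:] + [:\<xi>, 1:] * [:l0, l1:] + [:0, 1:] * [:\<xi>, 1:]) x * w2"
    unfolding yeq1 yeq2 pe_mult pe_add by (simp add: algebra_simps)
  finally have E: "[:a6, 0, t, 1:] = [:o', n:] * [:o', n:] + [:\<xi>, 1:] * [:k0, k1, k2:] + [:0, 1:] * [:o', n:] \<and>
     0 = [:o', n:] * [:\<xi>, 1:] + [:\<xi>, 1:] * [:l0, l1:] + [:0, 1:] * [:\<xi>, 1:]"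
    by (rule reduced_eq[OF red])
  have k2: "k2 = 1" using E by simp
  \<comment> \<open>The other factor says that multiplication by \<open>y\<close> has trace
    \<open>x\<close>.\<close>
  have "[:\<xi>, 1:] * ([:o', n:] + [:l0, l1:] + [:0, 1:]) = 0"
    using E by (simp only: distrib_left mult.commute)
  then have "n + l1 + 1 = 0" by simp
  then have l1: "l1 = n + 1" by (metis add.commute add.left_commute add_eq_0_iff_eq)
  define Y where "Y = o' + n * \<xi>"
  have Y: "Y \<in> L" unfolding Y_def using p \<xi> L by blast
  have "poly [:a6, 0, t, 1:] \<xi> = Y * Y + \<xi> * Y"
    unfolding E[THEN conjunct1] poly_add poly_mult Y_def by (simp add: algebra_simps)
  then have "Y\<^sup>2 + \<xi> * Y = \<xi> ^ 3 + t * \<xi>\<^sup>2 + a6"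
    by (simp add: algebra_simps power2_eq_square power3_eq_cube)
  moreover have "(b / u1)\<^sup>2 + b / u1 = \<xi> + \<sigma> \<xi> + c"
  proof (rule Phi_matrix_identity[OF Pw1(6,5) E1])
    show "\<sigma> u1 * b = \<sigma> b * u1" "\<sigma> u0 * b = \<sigma> b * e0" using E2 E4(1) by auto
    show "u1 * \<xi> + u0 + b * (n + 1) = \<sigma> n * b + \<sigma> \<xi> * u1 + e0" using E4 l1 by simp
    show "u1 * n + b = \<sigma> n * u1 + g1" using E3 k2 by simp
  qed
  moreover have "b / u1 \<in> L" using Pw1 L unfolding divide_inverse by blast
  ultimately show ?thesis using \<xi> Y by blast
qed

end

text \<open>The terms at \<open>i\<close> and \<open>n - i\<close> cancel in pairs; only a middle
  term can survive.\<close>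

lemma sum_symmetric_char2:
  fixes g :: "int \<Rightarrow> 'a::char2"
  assumes "\<And>i. g (n - i) = g i"
  shows "(\<Sum>i=a..n - a. g i) = (if even n \<and> a \<le> n div 2 then g (n div 2) else 0)"
proof -
  let ?S = "{a..n - a}"
  let ?A = "{i \<in> ?S. 2 * i < n}" and ?B = "{i \<in> ?S. n < 2 * i}" and ?C = "{i \<in> ?S. 2 * i = n}"
  have fin: "finite ?A" "finite ?B" "finite ?C" by (rule finite_subset[of _ ?S]; auto)+
  have "?S = ?A \<union> (?B \<union> ?C)" by auto
  then have "sum g ?S = sum g (?A \<union> (?B \<union> ?C))" by (rule arg_cong)
  also have "\<dots> = sum g ?A + sum g (?B \<union> ?C)" by (rule sum.union_disjoint) (use fin in auto)
  also have "sum g (?B \<union> ?C) = sum g ?B + sum g ?C" by (rule sum.union_disjoint) (use fin in auto)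
  also have "sum g ?B = sum g ?A"
    by (rule sum.reindex_bij_witness[of _ "\<lambda>i. n - i" "\<lambda>i. n - i"]) (auto simp: assms)
  finally have s: "sum g ?S = sum g ?C" by simp
  have "?C = (if even n \<and> a \<le> n div 2 then {n div 2} else {})" by auto
  then show ?thesis unfolding s by simp
qed

lemma fls_square_nth:
  fixes w :: "'a::{idom, char2} fls"
  shows "fls_nth (w\<^sup>2) n = (if even n then (fls_nth w (n div 2))\<^sup>2 else 0)"
proof -
  have "fls_nth (w\<^sup>2) n = (\<Sum>i=fls_subdegree w..n - fls_subdegree w. fls_nth w i * fls_nth w (n - i))"
    by (simp add: power2_eq_square fls_times_nth(2))
  also have "\<dots> = (if even n \<and> fls_subdegree w \<le> n div 2 then fls_nth w (n div 2) * fls_nth w (n - n div 2) else 0)"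
    by (rule sum_symmetric_char2) (simp add: mult.commute)
  also have "\<dots> = (if even n then (fls_nth w (n div 2))\<^sup>2 else 0)"
    by (auto simp: power2_eq_square elim!: evenE)
  finally show ?thesis .
qed

lemma fls_fourth_power_nth:
  fixes w :: "'a::{idom, char2} fls"
  shows "fls_nth (w ^ 4) n = (if 4 dvd n then (fls_nth w (n div 4)) ^ 4 else 0)"
proof -
  have *: "w ^ 4 = (w\<^sup>2)\<^sup>2" by (simp flip: power_mult)
  show ?thesis
  proof (cases "4 dvd n")
    case True
    then obtain m where "n = 4 * m" by blast
    then show ?thesis unfolding * fls_square_nth by (simp flip: power_mult)
  next
    case False
    then have "odd n \<or> odd (n div 2)" by presburger
    then show ?thesis unfolding * fls_square_nth using False by auto
  qed
qed

section \<open>Artin-Schreier equations in power series\<close>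

text \<open>The coefficients of the solution of \<open>\<eta>^2 + \<eta> = \<psi>\<close> without
  constant term. The coefficient of \<open>\<eta>^2\<close> at an even index is the square of that
  of \<open>\<eta>\<close> at half the index, so the equation determines them recursively.\<close>

function as_coeff :: "(nat \<Rightarrow> 'a::char2) \<Rightarrow> nat \<Rightarrow> 'a" where
  "as_coeff f n = (if n = 0 then 0 else f n + (if even n then (as_coeff f (n div 2))\<^sup>2 else 0))"
  by pat_completeness auto
termination by (relation "measure snd") auto

declare as_coeff.simps [simp del]

lemma Artin_Schreier_series:
  fixes \<psi> :: "'a::{idom, char2} fls"
  assumes "ordge 1 \<psi>"
  shows "\<exists>\<eta>. ordge 1 \<eta> \<and> \<eta>\<^sup>2 + \<eta> = \<psi>"
proof -
  let ?g = "as_coeff (\<lambda>n. fls_nth \<psi> (int n))"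
  define \<eta> where "\<eta> = fps_to_fls (Abs_fps ?g)"
  have nth: "fls_nth \<eta> n = (if n < 0 then 0 else ?g (nat n))" for n
    by (simp add: \<eta>_def)
  have z: "?g 0 = 0" by (simp add: as_coeff.simps)
  have "fls_nth (\<eta>\<^sup>2 + \<eta>) n = fls_nth \<psi> n" for n
  proof (cases "n \<le> 0")
    case True
    then have "fls_nth \<psi> n = 0" using assms by (simp add: ordge_def)
    moreover have "fls_nth \<eta> n = 0" using True z by (simp add: nth)
    moreover have "fls_nth \<eta> (n div 2) = 0" using True z by (simp add: nth)
    ultimately show ?thesis by (simp add: fls_square_nth)
  next
    case False
    then obtain m where m: "n = int m" "m > 0" by (metis not_le zero_less_imp_eq_int)
    have "fls_nth \<eta> n = fls_nth \<psi> n + (if even n then (fls_nth \<eta> (n div 2))\<^sup>2 else 0)"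
      unfolding nth m(1) using m(2) by (subst as_coeff.simps) (auto simp: nat_div_distrib zdiv_int[symmetric])
    then show ?thesis by (simp add: fls_square_nth add_ac)
  qed
  then have "\<eta>\<^sup>2 + \<eta> = \<psi>" by (rule fls_eqI)
  moreover have "ordge 1 \<eta>" using z by (auto simp: ordge_def nth)
  ultimately show ?thesis by blast
qed

lemma leading_unique: "leading w m a \<Longrightarrow> leading w n b \<Longrightarrow> a \<noteq> 0 \<Longrightarrow> b \<noteq> 0 \<Longrightarrow> m = n \<and> a = b"
  by (metis leading_def leading_subdegree)

lemma Artin_Schreier_leading:
  fixes \<psi> :: "'a::{idom, char2} fls"
  assumes "leading \<psi> n a" "a \<noteq> 0" "ordge 1 \<eta>" "\<eta>\<^sup>2 + \<eta> = \<psi>"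
  shows "leading \<eta> n a"
proof -
  have e: "\<eta> \<noteq> 0" using assms leading_nz by fastforce
  let ?m = "fls_subdegree \<eta>"
  have m: "?m \<ge> 1" using assms(3) ordge_iff[OF e] by simp
  have "ordge (?m + ?m) (\<eta>\<^sup>2)" unfolding power2_eq_square by (intro ordge_mult ordge_subdegree)
  then have "ordge (?m + 1) (\<eta>\<^sup>2)" using m by (auto elim: ordge_mono)
  then have "leading (\<eta> + \<eta>\<^sup>2) ?m (fls_nth \<eta> ?m)" by (intro leading_add leading_self)
  then have "leading \<psi> ?m (fls_nth \<eta> ?m)" using assms(4) by (simp add: add.commute)
  then show ?thesis using leading_unique[OF _ assms(1) _ assms(2)] e leading_self by (metis nth_fls_subdegree_nonzero)
qed

section \<open>Formal points of the curve\<close>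

abbreviation tt :: "F2t_bar fls" where "tt \<equiv> fls_const t_gen"
abbreviation cc :: "F2t_bar fls" where "cc \<equiv> fls_const c0"

lemma c0_fourth: "c0 ^ 4 = t_gen ^ 6"
proof -
  have "c0 ^ 4 = (c0\<^sup>2)\<^sup>2" by (simp flip: power_mult)
  then show ?thesis unfolding c0_square by (simp flip: power_mult)
qed

lemma cc_fourth: "cc ^ 4 = tt ^ 6"
  by (simp flip: fls_const_power add: c0_fourth)

lemma curve_of_U:
  fixes x U t c :: "'a::char2"
  assumes "x\<^sup>2 + c\<^sup>2 = x * (U\<^sup>2 + U + t)"
  shows "(x * U + c\<^sup>2)\<^sup>2 + x * (x * U + c\<^sup>2) = x ^ 3 + t * x\<^sup>2 + c ^ 4"
proof -
  have "(x * U + c\<^sup>2)\<^sup>2 + x * (x * U + c\<^sup>2) = x * (x * (U\<^sup>2 + U + t)) + t * x\<^sup>2 + c\<^sup>2 * x + c ^ 4"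
    by (simp add: algebra_simps power2_eq_square power4_eq_xxxx)
  also have "\<dots> = x ^ 3 + t * x\<^sup>2 + c ^ 4"
    unfolding assms[symmetric] by (simp add: algebra_simps power2_eq_square power3_eq_cube)
  finally show ?thesis .
qed

text \<open>The curve equation in terms of \<open>U = (y + c0\<^sup>2) / x\<close>; the function \<open>1 / U\<close> is a uniformizer at infinity
  and at the point \<open>T = (0, c0\<^sup>2)\<close> of order two.\<close>

definition formal_point :: "F2t_bar fls \<Rightarrow> F2t_bar fls \<Rightarrow> F2t_bar fls \<Rightarrow> bool" where
  "formal_point x y U \<longleftrightarrow> (\<forall>r. x \<noteq> fls_const r) \<and> y = x * U + cc\<^sup>2 \<and> x\<^sup>2 + cc\<^sup>2 = x * (U\<^sup>2 + U + tt)"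

lemma formal_point_curve:
  "formal_point x y U \<Longrightarrow> y\<^sup>2 + x * y = x ^ 3 + tt * x\<^sup>2 + tt ^ 6"
  unfolding formal_point_def cc_fourth[symmetric] using curve_of_U by metis

lemma leading_X_inv: "leading fls_X_inv (- 1) (1 :: 'a::{zero_neq_one})"
  by (auto simp: leading_def ordge_def)

text \<open>The expansion of \<open>x\<close> is \<open>h (1 + xi)\<close> at infinity and \<open>h xi\<close> at \<open>T\<close>.\<close>

lemma infinity_and_T_exist:
  obtains xi h :: "F2t_bar fls" where "h = fls_X_inv\<^sup>2 + fls_X_inv + tt" "leading h (- 2) 1"
    "leading xi 4 (c0\<^sup>2)" "h\<^sup>2 * (xi\<^sup>2 + xi) = cc\<^sup>2"
proof -
  let ?U = "fls_X_inv :: F2t_bar fls"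
  define h where "h = ?U\<^sup>2 + ?U + tt"
  have U2: "leading (?U\<^sup>2) (- 2) 1" using leading_power[OF leading_X_inv, of 2] by simp
  have lh: "leading h (- 2) 1" unfolding h_def add.assoc
    by (rule leading_add[OF U2]) (auto intro!: ordge_add intro: leading_ordge[OF leading_X_inv] leading_ordge[OF leading_const])
  then have h0: "h \<noteq> 0" by (rule leading_nz) simp
  have "leading (cc\<^sup>2 * inverse (h\<^sup>2)) (0 + - (- 4)) (c0\<^sup>2 * inverse 1)"
    by (intro leading_mult leading_inverse) (use leading_const[of "c0\<^sup>2"] leading_power[OF lh, of 2] in \<open>simp_all add: fls_const_power\<close>)
  then have l: "leading (cc\<^sup>2 * inverse (h\<^sup>2)) 4 (c0\<^sup>2)" by simp
  \<comment> \<open>Substituting \<open>x = h * v\<close> in \<open>x^2 + cc^2 = x * h\<close> gives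
    \<open>h^2 * (v^2 + v) = cc^2\<close>, whose two solutions \<open>xi\<close> and
    \<open>1 + xi\<close> belong to \<open>T\<close> and to infinity.\<close>
  then obtain xi where xi: "ordge 1 xi" "xi\<^sup>2 + xi = cc\<^sup>2 * inverse (h\<^sup>2)"
    using Artin_Schreier_series[of "cc\<^sup>2 * inverse (h\<^sup>2)"] leading_ordge[OF l, of 1] by auto
  have "leading xi 4 (c0\<^sup>2)" by (rule Artin_Schreier_leading[OF l _ xi]) simp
  moreover have "h\<^sup>2 * (xi\<^sup>2 + xi) = cc\<^sup>2" unfolding xi(2) using h0 by (simp add: field_simps)
  ultimately show thesis using that h_def lh by blast
qed

lemma formal_point_infinity:
  obtains x y where "formal_point x y fls_X_inv" "leading x (- 2) 1" "leading y (- 3) 1"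
proof -
  obtain xi h :: "F2t_bar fls" where h: "h = fls_X_inv\<^sup>2 + fls_X_inv + tt" "leading h (- 2) 1"
    "leading xi 4 (c0\<^sup>2)" "h\<^sup>2 * (xi\<^sup>2 + xi) = cc\<^sup>2" by (rule infinity_and_T_exist)
  define x where "x = h * (1 + xi)"
  define y where "y = x * fls_X_inv + cc\<^sup>2"
  have "leading (1 + xi) 0 1" by (rule leading_add[OF leading_1]) (rule leading_ordge[OF h(3)], simp)
  then have lx: "leading x (- 2) 1" unfolding x_def using leading_mult[OF h(2)] by fastforce
  have "leading (x * fls_X_inv) (- 3) 1" using leading_mult[OF lx leading_X_inv] by simp
  then have ly: "leading y (- 3) 1" unfolding y_def
    by (rule leading_add) (use leading_ordge[OF leading_const[of "c0\<^sup>2"]] in \<open>simp add: fls_const_power\<close>)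
  have "x \<noteq> fls_const r" for r using leading_subdegree[OF lx] by auto
  moreover have "x\<^sup>2 + cc\<^sup>2 = x * h" unfolding x_def h(4)[symmetric] by (simp add: algebra_simps power2_eq_square)
  ultimately have "formal_point x y fls_X_inv" unfolding formal_point_def y_def h(1) by blast
  with lx ly that show thesis by blast
qed

lemma formal_point_T:
  obtains x y where "formal_point x y fls_X_inv" "leading x 2 (c0\<^sup>2)" "leading (y + cc\<^sup>2) 1 (c0\<^sup>2)"
proof -
  obtain xi h :: "F2t_bar fls" where h: "h = fls_X_inv\<^sup>2 + fls_X_inv + tt" "leading h (- 2) 1"
    "leading xi 4 (c0\<^sup>2)" "h\<^sup>2 * (xi\<^sup>2 + xi) = cc\<^sup>2" by (rule infinity_and_T_exist)
  define x where "x = h * xi"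
  define y where "y = x * fls_X_inv + cc\<^sup>2"
  have lx: "leading x 2 (c0\<^sup>2)" unfolding x_def using leading_mult[OF h(2,3)] by simp
  have ly: "leading (y + cc\<^sup>2) 1 (c0\<^sup>2)" unfolding y_def using leading_mult[OF lx leading_X_inv] by (simp add: add.assoc)
  have "x \<noteq> fls_const r" for r using leading_subdegree[OF lx] by auto
  moreover have "x\<^sup>2 + cc\<^sup>2 = x * h" unfolding x_def h(4)[symmetric] by (simp add: algebra_simps power2_eq_square)
  ultimately have "formal_point x y fls_X_inv" unfolding formal_point_def y_def h(1) by blast
  with lx ly that show thesis by blast
qed

text \<open>With \<open>x\<close> given as a series, the equation for \<open>U\<close> is of
  Artin-Schreier type with a power series on the right. The constant term \<open>U0\<close> selects
  which of the two points with abscissa \<open>a\<close> is expanded.\<close>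

lemma formal_point_affine:
  assumes "a \<noteq> 0" "b\<^sup>2 + a * b = a ^ 3 + t_gen * a\<^sup>2 + t_gen ^ 6"
  obtains y U where "formal_point (fls_const a + fls_X) y U" "ordge 0 y" "fls_nth y 0 = b"
proof -
  define x :: "F2t_bar fls" where "x = fls_const a + fls_X"
  have lx: "leading x 0 a" unfolding x_def by (rule leading_add[OF leading_const]) (auto simp: ordge_def)
  then have x0: "x \<noteq> 0" using assms(1) leading_nz by blast
  define U0 where "U0 = (b + c0\<^sup>2) / a"
  have U0: "a * U0 = b + c0\<^sup>2" unfolding U0_def using assms(1) by simp
  have "a * (a * (U0\<^sup>2 + U0 + t_gen)) = (a * U0)\<^sup>2 + a * (a * U0) + t_gen * a\<^sup>2"
    by (simp add: algebra_simps power2_eq_square)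
  also have "\<dots> = (b\<^sup>2 + a * b) + c0 ^ 4 + a * c0\<^sup>2 + t_gen * a\<^sup>2"
    unfolding U0 by (simp add: algebra_simps flip: power_mult)
  also have "\<dots> = a * (a\<^sup>2 + c0\<^sup>2)" unfolding assms(2) c0_fourth
    by (simp add: algebra_simps power2_eq_square power3_eq_cube)
  finally have U0': "a * (U0\<^sup>2 + U0 + t_gen) = a\<^sup>2 + c0\<^sup>2" using assms(1) by simp
  let ?g = "fls_const (U0\<^sup>2 + U0 + t_gen)"
  define \<psi> where "\<psi> = (x\<^sup>2 + cc\<^sup>2) * inverse x + ?g"
  have "ordge 0 \<psi>" "fls_nth \<psi> 0 = 0"
  proof -
    have 1: "leading (inverse x) 0 (inverse a)" using leading_inverse[OF lx assms(1)] by simp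
    have 2: "ordge 0 (x\<^sup>2 + cc\<^sup>2)" using leading_ordge[OF leading_power[OF lx, of 2]] leading_ordge[OF leading_const[of "c0\<^sup>2"]]
      by (simp add: ordge_add fls_const_power)
    show "ordge 0 \<psi>" unfolding \<psi>_def using ordge_mult[OF 2 leading_ordge[OF 1 order_refl]] ordge_const
      by (auto intro: ordge_add)
    have "fls_nth (x\<^sup>2) 0 = a\<^sup>2" using leading_power[OF lx, of 2] by (simp add: leading_def)
    then have "fls_nth (x\<^sup>2 + cc\<^sup>2) 0 = a\<^sup>2 + c0\<^sup>2" by (simp flip: fls_const_power)
    then have "fls_nth \<psi> 0 = (a\<^sup>2 + c0\<^sup>2) * inverse a + (U0\<^sup>2 + U0 + t_gen)"
      unfolding \<psi>_def using nth_mult_ordge[OF 2 leading_ordge[OF 1 order_refl]] 1 by (simp add: leading_def)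
    then show "fls_nth \<psi> 0 = 0" unfolding U0'[symmetric]
      by (simp only: mult.commute[of a] mult.assoc left_inverse[OF assms(1)] mult_1_right add_self)
  qed
  then have "ordge (0 + 1) \<psi>" by (subst ordge_Suc) simp
  then obtain \<eta> where eta: "ordge 1 \<eta>" "\<eta>\<^sup>2 + \<eta> = \<psi>" using Artin_Schreier_series[of \<psi>] by auto
  define U where "U = fls_const U0 + \<eta>"
  define y where "y = x * U + cc\<^sup>2"
  have "U\<^sup>2 + U + tt = ?g + \<psi>"
    unfolding U_def Artin_Schreier_add eta(2) by (simp add: fls_const_add fls_const_power add_ac)
  then have "x * (U\<^sup>2 + U + tt) = x\<^sup>2 + cc\<^sup>2" unfolding \<psi>_def using x0 by (simp add: add_ac mult.commute[of x])
  moreover have "x \<noteq> fls_const r" for r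
  proof
    assume "x = fls_const r"
    then have "fls_nth x 1 = fls_nth (fls_const r) 1" by simp
    then show False unfolding x_def by simp
  qed
  ultimately have "formal_point x y U" unfolding formal_point_def y_def by simp
  moreover have oU: "ordge 0 U" "fls_nth U 0 = U0" unfolding U_def using eta(1)
    by (auto intro!: ordge_add ordge_const elim: ordge_mono) (auto simp: ordge_def)
  moreover have "fls_nth y 0 = b" unfolding y_def
    using nth_mult_ordge[OF leading_ordge[OF lx order_refl] oU(1)] oU(2) lx U0
    by (simp add: leading_def add.assoc flip: fls_const_power)
  moreover have "ordge 0 y" unfolding y_def
    using ordge_mult[OF leading_ordge[OF lx order_refl] oU(1)] ordge_const[of "c0\<^sup>2"] by (auto intro: ordge_add simp: fls_const_power)
  ultimately show thesis using that unfolding x_def by blast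
qed

text \<open>Over an algebraically closed field a polynomial splits into linear factors, and none of
  them vanishes at a series that is not constant.\<close>

lemma pe_transcendental:
  fixes p :: "'a::{alg_closed_field, char2} poly"
  assumes "\<And>r. x \<noteq> fls_const r" "pe p x = 0"
  shows "p = 0"
  using assms(2)
proof (induction "degree p" arbitrary: p)
  case 0
  then obtain a where "p = [:a:]" by (metis degree_eq_zeroE)
  with 0(2) show ?case by simp
next
  case (Suc n)
  then obtain r where "poly p r = 0" using alg_closed_imp_poly_has_root[of p] by auto
  then obtain q where q: "p = [:- r, 1:] * q" by (metis dvdE poly_eq_0_iff_dvd)
  have "q \<noteq> 0" using q Suc(2) by auto
  then have "degree p = 1 + degree q" unfolding q by (subst degree_mult_eq) auto
  then have "degree q = n" using Suc(2) by simp
  have "pe p x = (x - fls_const r) * pe q x" unfolding q by (simp add: algebra_simps)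
  then have "pe q x = 0" using Suc(3) assms(1)[of r] by (simp add: add_eq_0_iff_eq)
  with Suc(1)[of q] \<open>degree q = n\<close> \<open>q \<noteq> 0\<close> show ?case by simp
qed

definition curve_poly :: "F2t_bar poly" where "curve_poly = [:t_gen ^ 6, 0, t_gen, 1:]"

lemma pe_curve_poly: "pe curve_poly x = x ^ 3 + tt * x\<^sup>2 + tt ^ 6"
  by (simp add: curve_poly_def algebra_simps power2_eq_square power3_eq_cube fls_const_power)

text \<open>The norm of \<open>p + q y\<close> down to the polynomials in \<open>x\<close>; the
  conjugate of \<open>y\<close> is \<open>y + x\<close>.\<close>

definition norm_poly :: "F2t_bar poly \<Rightarrow> F2t_bar poly \<Rightarrow> F2t_bar poly" where
  "norm_poly p q = p\<^sup>2 + p * q * [:0, 1:] + q\<^sup>2 * curve_poly"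

text \<open>The first term has even degree, the last one odd degree, and the larger of these exceeds
  the degree of the mixed term.\<close>

lemma norm_poly_eq_0: "norm_poly p q = 0 \<Longrightarrow> p = 0 \<and> q = 0"
proof (rule ccontr)
  assume n: "norm_poly p q = 0" "\<not> (p = 0 \<and> q = 0)"
  have c: "degree curve_poly = 3" "curve_poly \<noteq> 0" by (simp_all add: curve_poly_def)
  have pq: "p \<noteq> 0" "q \<noteq> 0" using n c by (auto simp: norm_poly_def)
  have d: "degree (p\<^sup>2) = 2 * degree p" "degree (p * q * [:0, 1:]) = degree p + degree q + 1"
    "degree (q\<^sup>2 * curve_poly) = 2 * degree q + 3"
    using pq c by (simp_all add: degree_mult_eq degree_power_eq)
  show False
  proof (cases "degree p \<ge> degree q + 2")
    case True
    then have "degree (p * q * [:0, 1:] + q\<^sup>2 * curve_poly) < degree (p\<^sup>2)" unfolding d(1)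
      by (intro degree_add_less) (use d in auto)
    then have "degree (norm_poly p q) = 2 * degree p" unfolding norm_poly_def add.assoc d(1)[symmetric] by (rule degree_add_eq_left)
    with n True show False by simp
  next
    case False
    then have "degree (p\<^sup>2 + p * q * [:0, 1:]) < degree (q\<^sup>2 * curve_poly)" unfolding d(3)
      by (intro degree_add_less) (use d in auto)
    then have "degree (norm_poly p q) = 2 * degree q + 3" unfolding norm_poly_def d(3)[symmetric] by (rule degree_add_eq_right)
    with n show False by simp
  qed
qed

lemma pe_norm_poly:
  assumes "y\<^sup>2 + x * y = x ^ 3 + tt * x\<^sup>2 + tt ^ 6"
  shows "pe (norm_poly p q) x = (pe p x + pe q x * y) * (pe p x + pe q x * (y + x))"
proof -
  have "(pe p x + pe q x * y) * (pe p x + pe q x * (y + x)) = (pe p x)\<^sup>2 + pe p x * pe q x * x + (pe q x)\<^sup>2 * (y\<^sup>2 + x * y)"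
    by (simp add: algebra_simps power2_eq_square)
  then show ?thesis unfolding assms by (simp add: norm_poly_def pe_curve_poly)
qed

lemma formal_point_indep:
  assumes "formal_point x y U" "pe p x + pe q x * y = 0"
  shows "p = 0 \<and> q = 0"
proof -
  have "pe (norm_poly p q) x = 0" using pe_norm_poly[OF formal_point_curve[OF assms(1)]] assms(2) by simp
  then have "norm_poly p q = 0" using assms(1) unfolding formal_point_def by (metis pe_transcendental)
  then show ?thesis by (rule norm_poly_eq_0)
qed

section \<open>The conic over the function field\<close>

definition perf_poly :: "F2t_bar poly \<Rightarrow> bool" where
  "perf_poly p \<longleftrightarrow> (\<forall>i. coeff p i \<in> F2t_perf)"

lemma perf_poly_add: "perf_poly p \<Longrightarrow> perf_poly q \<Longrightarrow> perf_poly (p + q)"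
  by (simp add: perf_poly_def)

lemma perf_poly_mult: "perf_poly p \<Longrightarrow> perf_poly q \<Longrightarrow> perf_poly (p * q)"
  by (auto simp: perf_poly_def coeff_mult intro!: perf_sum)

lemma perf_poly_const: "a \<in> F2t_perf \<Longrightarrow> perf_poly [:a:]"
  by (auto simp: perf_poly_def coeff_pCons split: nat.split)

lemma perf_poly_pCons: "a \<in> F2t_perf \<Longrightarrow> perf_poly p \<Longrightarrow> perf_poly (pCons a p)"
  by (auto simp: perf_poly_def coeff_pCons split: nat.split)

lemma perf_poly_0: "perf_poly 0" and perf_poly_1: "perf_poly 1"
  by (auto simp: perf_poly_def)

lemma perf_poly_curve: "perf_poly curve_poly"
  unfolding curve_poly_def by (intro perf_poly_pCons perf_poly_0) auto

text \<open>The affine coordinate ring over the perfect closure, rather than its field of fractions: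
  the coefficients of the conic are taken with denominators cleared.\<close>

definition kE :: "F2t_bar fls \<Rightarrow> F2t_bar fls \<Rightarrow> F2t_bar fls set" where
  "kE x y = {pe p x + pe q x * y | p q. perf_poly p \<and> perf_poly q}"

lemma kE_I: "perf_poly p \<Longrightarrow> perf_poly q \<Longrightarrow> pe p x + pe q x * y \<in> kE x y"
  by (auto simp: kE_def)

lemma kE_add: "v \<in> kE x y \<Longrightarrow> w \<in> kE x y \<Longrightarrow> v + w \<in> kE x y"
proof -
  assume "v \<in> kE x y" "w \<in> kE x y"
  then obtain p q p' q' where *: "v = pe p x + pe q x * y" "w = pe p' x + pe q' x * y"
    "perf_poly p" "perf_poly q" "perf_poly p'" "perf_poly q'" unfolding kE_def by blast
  then have "v + w = pe (p + p') x + pe (q + q') x * y" by (simp add: algebra_simps)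
  then show ?thesis using * by (metis kE_I perf_poly_add)
qed

lemma kE_const: "a \<in> F2t_perf \<Longrightarrow> fls_const a \<in> kE x y"
  using kE_I[of "[:a:]" 0 x y] by (simp add: perf_poly_const perf_poly_0)

lemma kE_x: "x \<in> kE x y" and kE_y: "y \<in> kE x y"
  using kE_I[of "[:0, 1:]" 0 x y] kE_I[of 0 1 x y] by (simp_all add: perf_poly_pCons perf_poly_0 perf_poly_1)

lemma kE_mult:
  assumes "y\<^sup>2 + x * y = x ^ 3 + tt * x\<^sup>2 + tt ^ 6" "v \<in> kE x y" "w \<in> kE x y"
  shows "v * w \<in> kE x y"
proof -
  obtain p q p' q' where *: "v = pe p x + pe q x * y" "w = pe p' x + pe q' x * y"
    "perf_poly p" "perf_poly q" "perf_poly p'" "perf_poly q'" using assms(2,3) unfolding kE_def by blast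
  have y2: "y * y = pe curve_poly x + x * y"
    unfolding pe_curve_poly by (rule char2_eq[OF assms(1)]) (simp add: power2_eq_square)
  have "v * w = pe p x * pe p' x + (pe p x * pe q' x + pe q x * pe p' x) * y + pe q x * pe q' x * (y * y)"
    unfolding * by (simp add: algebra_simps)
  also have "\<dots> = pe (p * p' + q * q' * curve_poly) x + pe (p * q' + q * p' + q * q' * [:0, 1:]) x * y"
    unfolding y2 by (simp add: algebra_simps)
  finally have eq: "v * w = \<dots>" .
  show ?thesis unfolding eq
    by (intro kE_I perf_poly_add perf_poly_mult perf_poly_curve perf_poly_pCons perf_poly_0 *(3-6) perf_0 perf_1)
qed

section \<open>Conjugation on the quadratic extension of the constants\<close>

lemma theta_indep:
  assumes "a \<in> F2t_perf" "b \<in> F2t_perf" "a + b * \<theta> = 0"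
  shows "a = 0 \<and> b = 0"
proof (rule ccontr)
  assume n: "\<not> (a = 0 \<and> b = 0)"
  have b: "b \<noteq> 0" using n assms(3) by auto
  have "b * \<theta> = a" using assms(3) by (simp add: add_eq_0_iff_eq)
  then have "\<theta> = a / b" using b by (metis nonzero_mult_div_cancel_left)
  then show False using theta_not_perf perf_divide[OF assms(1,2)] by metis
qed

abbreviation th :: "F2t_bar fls" where "th \<equiv> fls_const \<theta>"

lemma th: "th\<^sup>2 + th = tt"
  using theta by (metis fls_const_add fls_const_power)

text \<open>Conjugation sends \<open>\<theta>\<close> to \<open>\<theta> + 1\<close>, so it adds the
  coordinate of \<open>u\<close> at \<open>\<theta>\<close>. That coordinate is unique by
  \<open>theta_indep\<close>.\<close>

definition conjL :: "F2t_bar \<Rightarrow> F2t_bar" where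
  "conjL u = u + (THE b. b \<in> F2t_perf \<and> (\<exists>a\<in>F2t_perf. u = a + b * \<theta>))"

lemma conjL_eq:
  assumes "a \<in> F2t_perf" "b \<in> F2t_perf"
  shows "conjL (a + b * \<theta>) = a + b + b * \<theta>"
proof -
  have "(THE b'. b' \<in> F2t_perf \<and> (\<exists>a'\<in>F2t_perf. a + b * \<theta> = a' + b' * \<theta>)) = b"
  proof (rule the_equality)
    fix b' assume "b' \<in> F2t_perf \<and> (\<exists>a'\<in>F2t_perf. a + b * \<theta> = a' + b' * \<theta>)"
    then obtain a' where a': "b' \<in> F2t_perf" "a' \<in> F2t_perf" "a + b * \<theta> = a' + b' * \<theta>" by blast
    have "(a + a') + (b + b') * \<theta> = 0" by (rule char2_eq[OF a'(3)]) (simp add: algebra_simps)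
    from theta_indep[OF _ _ this] have "b + b' = 0" using a' assms by auto
    then show "b' = b" by (simp add: add_eq_0_iff_eq)
  qed (use assms in auto)
  then show ?thesis unfolding conjL_def by (simp add: add_ac)
qed

lemma LfieldI: "a \<in> F2t_perf \<Longrightarrow> b \<in> F2t_perf \<Longrightarrow> a + b * \<theta> \<in> Lfield"
  by (auto simp: Lfield_def)

lemma LfieldE:
  assumes "u \<in> Lfield" obtains a b where "a \<in> F2t_perf" "b \<in> F2t_perf" "u = a + b * \<theta>"
  using assms by (auto simp: Lfield_def)

lemma theta_sq: "\<theta>\<^sup>2 = \<theta> + t_gen"
  using theta by (rule char2_eq) (simp add: add_ac)

lemma theta_mult: "(a + b * \<theta>) * (a' + b' * \<theta>) = (a * a' + b * b' * t_gen) + (a * b' + b * a' + b * b') * \<theta>"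
proof -
  have "(a + b * \<theta>) * (a' + b' * \<theta>) = a * a' + (a * b' + b * a') * \<theta> + b * b' * \<theta>\<^sup>2"
    by (simp add: algebra_simps power2_eq_square)
  then show ?thesis unfolding theta_sq by (simp add: algebra_simps)
qed

lemma Lfield_perf: "a \<in> F2t_perf \<Longrightarrow> a \<in> Lfield"
  using LfieldI[of a 0] by simp

lemma Lfield_add: "u \<in> Lfield \<Longrightarrow> v \<in> Lfield \<Longrightarrow> u + v \<in> Lfield"
proof (elim LfieldE)
  fix a b a' b' assume *: "a \<in> F2t_perf" "b \<in> F2t_perf" "u = a + b * \<theta>" "a' \<in> F2t_perf" "b' \<in> F2t_perf" "v = a' + b' * \<theta>"
  have "u + v = (a + a') + (b + b') * \<theta>" unfolding * by (simp add: algebra_simps)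
  then show ?thesis using LfieldI[of "a + a'" "b + b'"] * by (metis perf_add)
qed

lemma Lfield_mult: "u \<in> Lfield \<Longrightarrow> v \<in> Lfield \<Longrightarrow> u * v \<in> Lfield"
  by (elim LfieldE) (auto simp: theta_mult intro!: LfieldI)

lemma conjL_closed: "u \<in> Lfield \<Longrightarrow> conjL u \<in> Lfield"
  by (elim LfieldE) (auto simp: conjL_eq intro!: LfieldI)

lemma conjL_add: "u \<in> Lfield \<Longrightarrow> v \<in> Lfield \<Longrightarrow> conjL (u + v) = conjL u + conjL v"
proof (elim LfieldE)
  fix a b a' b' assume *: "a \<in> F2t_perf" "b \<in> F2t_perf" "u = a + b * \<theta>" "a' \<in> F2t_perf" "b' \<in> F2t_perf" "v = a' + b' * \<theta>"
  have "u + v = (a + a') + (b + b') * \<theta>" using * by (simp add: algebra_simps)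
  then have "conjL (u + v) = (a + a') + (b + b') + (b + b') * \<theta>" using * by (simp only: conjL_eq perf_add)
  moreover have "conjL u = a + b + b * \<theta>" "conjL v = a' + b' + b' * \<theta>" using * by (simp_all only: conjL_eq)
  ultimately show ?thesis by (simp add: algebra_simps)
qed

lemma conjL_mult: "u \<in> Lfield \<Longrightarrow> v \<in> Lfield \<Longrightarrow> conjL (u * v) = conjL u * conjL v"
proof (elim LfieldE)
  fix a b a' b' assume *: "a \<in> F2t_perf" "b \<in> F2t_perf" "u = a + b * \<theta>" "a' \<in> F2t_perf" "b' \<in> F2t_perf" "v = a' + b' * \<theta>"
  have "conjL (u * v) = (a * a' + b * b' * t_gen) + (a * b' + b * a' + b * b') + (a * b' + b * a' + b * b') * \<theta>"
    unfolding * theta_mult by (subst conjL_eq) (use * in auto)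
  also have "\<dots> = (a + b + b * \<theta>) * (a' + b' + b' * \<theta>)"
    unfolding theta_mult by (simp add: algebra_simps)
  finally show ?thesis using * by (simp add: conjL_eq)
qed

lemma conjL_perf: "a \<in> F2t_perf \<Longrightarrow> conjL a = a"
  using conjL_eq[of a 0] by simp

lemma conjL_fixed: "u \<in> Lfield \<Longrightarrow> conjL u = u \<Longrightarrow> u \<in> F2t_perf"
  by (elim LfieldE) (auto simp: conjL_eq)

lemma conjL_conjL: "u \<in> Lfield \<Longrightarrow> conjL (conjL u) = u"
  by (elim LfieldE) (auto simp: conjL_eq)

lemma Lfield_inverse: "u \<in> Lfield \<Longrightarrow> inverse u \<in> Lfield"
proof -
  assume u: "u \<in> Lfield"
  show ?thesis
  proof (cases "u = 0")
    case False
    have n: "conjL (u * conjL u) = u * conjL u" using u by (simp add: conjL_mult conjL_closed conjL_conjL mult.commute)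
    then have N: "u * conjL u \<in> F2t_perf" using u by (intro conjL_fixed Lfield_mult conjL_closed)
    have c: "conjL u \<noteq> 0" using conjL_conjL[OF u] conjL_perf[OF perf_0] False by auto
    have "inverse u = conjL u * inverse (u * conjL u)" using False c by simp
    then show ?thesis using N u by (metis Lfield_mult Lfield_perf conjL_closed perf_inverse)
  qed (simp add: Lfield_perf)
qed

lemma conjL_inverse: "u \<in> Lfield \<Longrightarrow> conjL (inverse u) = inverse (conjL u)"
proof -
  assume u: "u \<in> Lfield"
  show ?thesis
  proof (cases "u = 0")
    case False
    have "conjL u * conjL (inverse u) = 1"
      using u False by (simp add: conjL_perf Lfield_inverse flip: conjL_mult)
    then show ?thesis by (metis inverse_unique)
  qed (simp add: conjL_perf)
qed

text \<open>The roots of the cubic add up to \<open>e\<close>. Distinctness of \<open>r\<close> and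
  \<open>s\<close> permits division of the difference of the two equations by
  \<open>r + s\<close>.\<close>

lemma line_third_point:
  fixes r s e n m :: "'a::{idom, char2}"
  assumes "r ^ 3 + e * r\<^sup>2 + n * r + m = 0" "s ^ 3 + e * s\<^sup>2 + n * s + m = 0" "r \<noteq> s"
  shows "(e + r + s) ^ 3 + e * (e + r + s)\<^sup>2 + n * (e + r + s) + m = 0"
proof -
  let ?q = "e + r + s"
  have "(r + s) * (r\<^sup>2 + r * s + s\<^sup>2 + e * (r + s) + n) = (r ^ 3 + e * r\<^sup>2 + n * r + m) + (s ^ 3 + e * s\<^sup>2 + n * s + m)"
    by (simp add: algebra_simps power2_eq_square power3_eq_cube)
  then have z: "r\<^sup>2 + r * s + s\<^sup>2 + e * (r + s) + n = 0" using assms by (simp add: add_eq_0_iff_eq)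
  have "?q ^ 3 + e * ?q\<^sup>2 + n * ?q + m + (r ^ 3 + e * r\<^sup>2 + n * r + m) = (?q + r) * (r\<^sup>2 + r * s + s\<^sup>2 + e * (r + s) + n)"
    by (simp add: algebra_simps power2_eq_square power3_eq_cube)
  then show ?thesis using z assms(1) by simp
qed

text \<open>If \<open>R\<close> and its conjugate \<open>R'\<close> are distinct, the line through them is defined over the perfect
  field, so it meets the curve in a rational point with abscissa congruent to \<open>x(R) + x(R') + t\<close>.\<close>

lemma no_conjugate_point:
  assumes "X0 \<in> Lfield" "Y0 \<in> Lfield" "\<rho> \<in> Lfield"
    "Y0\<^sup>2 + X0 * Y0 = X0 ^ 3 + t_gen * X0\<^sup>2 + t_gen ^ 6" "\<rho>\<^sup>2 + \<rho> = X0 + conjL X0 + c0"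
  shows False
proof (cases "conjL X0 = X0")
  case True
  then show False using assms(3,5) c0_not_Artin_Schreier by simp
next
  case False
  let ?X = "conjL X0" and ?Y = "conjL Y0"
  have L: "?X \<in> Lfield" "?Y \<in> Lfield" using assms conjL_closed by auto
  have pw: "conjL (u ^ n) = conjL u ^ n \<and> u ^ n \<in> Lfield" if "u \<in> Lfield" for u n
    by (induction n) (use that in \<open>auto simp: conjL_mult Lfield_mult conjL_perf Lfield_perf\<close>)
  have curve': "?Y\<^sup>2 + ?X * ?Y = ?X ^ 3 + t_gen * ?X\<^sup>2 + t_gen ^ 6"
  proof -
    have "conjL (Y0\<^sup>2 + X0 * Y0) = conjL (X0 ^ 3 + t_gen * X0\<^sup>2 + t_gen ^ 6)" using assms(4) by simp
    then show ?thesis using assms(1,2) pw by (simp add: conjL_add conjL_mult Lfield_add Lfield_mult Lfield_perf conjL_perf)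
  qed
  have XX: "X0 + ?X \<noteq> 0" using False by (simp add: add_eq_0_iff_eq)
  define l where "l = (Y0 + ?Y) * inverse (X0 + ?X)"
  have lL: "l \<in> Lfield" unfolding l_def using assms L by (intro Lfield_mult Lfield_add Lfield_inverse)
  have "conjL l = l" unfolding l_def using assms L
    by (simp add: conjL_mult conjL_add conjL_inverse conjL_conjL Lfield_add Lfield_inverse add.commute)
  then have l: "l \<in> F2t_perf" using lL conjL_fixed by blast
  define \<nu> where "\<nu> = Y0 + l * X0"
  have lX: "l * (X0 + ?X) = Y0 + ?Y" unfolding l_def using XX by simp
  have nu2: "\<nu> = ?Y + l * ?X" unfolding \<nu>_def by (rule char2_eq[OF lX]) (simp add: algebra_simps)
  have "conjL \<nu> = ?Y + l * ?X" unfolding \<nu>_def using assms(1,2) lL \<open>conjL l = l\<close>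
    by (simp add: conjL_add conjL_mult Lfield_mult)
  then have "conjL \<nu> = \<nu>" using nu2 by simp
  moreover have "\<nu> \<in> Lfield" unfolding \<nu>_def using assms lL by (intro Lfield_add Lfield_mult)
  ultimately have nu: "\<nu> \<in> F2t_perf" using conjL_fixed by blast
  \<comment> \<open>The coefficients of the cubic satisfied by the abscissas of the points of the
    curve on the line \<open>y = \<nu> + l x\<close>.\<close>
  let ?e = "t_gen + l\<^sup>2 + l" and ?m = "\<nu>\<^sup>2 + t_gen ^ 6"
  have Y: "Y0 = \<nu> + l * X0" "?Y = \<nu> + l * ?X" proof -
    show "Y0 = \<nu> + l * X0" unfolding \<nu>_def by (simp add: add.assoc)
    show "?Y = \<nu> + l * ?X" by (rule char2_eq[OF nu2]) (simp add: add_ac)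
  qed
  have on_line: "r ^ 3 + ?e * r\<^sup>2 + \<nu> * r + ?m = 0 \<longleftrightarrow> (\<nu> + l * r)\<^sup>2 + r * (\<nu> + l * r) = r ^ 3 + t_gen * r\<^sup>2 + t_gen ^ 6" for r
    unfolding add_eq_0_iff_eq[of "(\<nu> + l * r)\<^sup>2 + r * (\<nu> + l * r)", symmetric]
    by (rule arg_cong[of _ _ "\<lambda>z. z = 0"]) (simp add: algebra_simps power2_eq_square power3_eq_cube)
  have 1: "X0 ^ 3 + ?e * X0\<^sup>2 + \<nu> * X0 + ?m = 0" unfolding on_line Y(1)[symmetric] by (rule assms(4))
  have 2: "?X ^ 3 + ?e * ?X\<^sup>2 + \<nu> * ?X + ?m = 0" unfolding on_line Y(2)[symmetric] by (rule curve')
  define xP where "xP = ?e + X0 + ?X"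
  have "xP ^ 3 + ?e * xP\<^sup>2 + \<nu> * xP + ?m = 0" unfolding xP_def
    by (rule line_third_point[OF 1 2]) (use False in auto)
  then have P: "(\<nu> + l * xP)\<^sup>2 + xP * (\<nu> + l * xP) = xP ^ 3 + t_gen * xP\<^sup>2 + t_gen ^ 6" unfolding on_line .
  have XXk: "X0 + ?X \<in> F2t_perf"
    using assms L by (intro conjL_fixed) (auto simp: conjL_add conjL_conjL Lfield_add add.commute)
  then have xPk: "xP \<in> F2t_perf" unfolding xP_def using l by (metis add.assoc perf_add perf_power perf_t)
  obtain w where w: "w \<in> F2t_perf" "xP = w\<^sup>2 + w \<or> xP = w\<^sup>2 + w + t_gen"
    using perf_point_Artin_Schreier_class[OF xPk _ P] nu l xPk by auto
  have c: "c0 = (\<rho>\<^sup>2 + \<rho>) + (xP + (t_gen + (l\<^sup>2 + l)))"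
    unfolding assms(5) xP_def by (simp add: add_ac)
  from w(2) show False
  proof
    assume "xP = w\<^sup>2 + w"
    \<comment> \<open>The summand \<open>t_gen\<close> left over in \<open>c\<close> is
      \<open>\<theta>^2 + \<theta>\<close>, which is where \<open>\<theta>\<close> enters.\<close>
    then have "c0 = (\<rho> + w + l + \<theta>)\<^sup>2 + (\<rho> + w + l + \<theta>)"
      unfolding c by (simp add: add_ac flip: theta)
    moreover have "\<rho> + w + l + \<theta> \<in> Lfield" using LfieldI[of 0 1] assms(3) w(1) l by (simp add: Lfield_add Lfield_perf)
    ultimately show False using c0_not_Artin_Schreier by metis
  next
    assume "xP = w\<^sup>2 + w + t_gen"
    then have "c0 = (\<rho> + w + l)\<^sup>2 + (\<rho> + w + l)"
      unfolding c by (simp add: add_ac)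
    moreover have "\<rho> + w + l \<in> Lfield" using assms(3) w(1) l by (simp add: Lfield_add Lfield_perf)
    ultimately show False using c0_not_Artin_Schreier by metis
  qed
qed

section \<open>The coordinate ring over the quadratic extension, with its conjugation\<close>

definition LE :: "F2t_bar fls \<Rightarrow> F2t_bar fls \<Rightarrow> F2t_bar fls set" where
  "LE x y = {a + b * th | a b. a \<in> kE x y \<and> b \<in> kE x y}"

definition conjLE :: "F2t_bar fls \<Rightarrow> F2t_bar fls \<Rightarrow> F2t_bar fls \<Rightarrow> F2t_bar fls" where
  "conjLE x y u = u + (THE b. b \<in> kE x y \<and> (\<exists>a\<in>kE x y. u = a + b * th))"

text \<open>The expansion at infinity serves as generic point: it embeds the coordinate ring into
  the Laurent series and makes the pole order at infinity available as a degree.\<close>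

locale generic_point =
  fixes x y :: "F2t_bar fls"
  assumes fp: "formal_point x y fls_X_inv" and lx: "leading x (- 2) 1" and ly: "leading y (- 3) 1"
begin

abbreviation "A \<equiv> LE x y"
abbreviation "k \<equiv> kE x y"
abbreviation "cj \<equiv> conjLE x y"

lemma curve: "y\<^sup>2 + x * y = x ^ 3 + tt * x\<^sup>2 + tt ^ 6"
  using formal_point_curve[OF fp] .

lemma k_mult: "a \<in> k \<Longrightarrow> b \<in> k \<Longrightarrow> a * b \<in> k"
  by (rule kE_mult[OF curve])

lemma k_indep:
  assumes "a \<in> k" "b \<in> k" "a + b * th = 0"
  shows "a = 0 \<and> b = 0"
proof -
  obtain p q p' q' where *: "a = pe p x + pe q x * y" "b = pe p' x + pe q' x * y"
    "perf_poly p" "perf_poly q" "perf_poly p'" "perf_poly q'" using assms(1,2) unfolding kE_def by blast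
  have "pe (p + Polynomial.smult \<theta> p') x + pe (q + Polynomial.smult \<theta> q') x * y = 0"
    using assms(3) unfolding * by (simp add: algebra_simps)
  from formal_point_indep[OF fp this] have z: "p + Polynomial.smult \<theta> p' = 0" "q + Polynomial.smult \<theta> q' = 0" by auto
  have zero: "r = 0 \<and> r' = 0" if "r + Polynomial.smult \<theta> r' = 0" "perf_poly r" "perf_poly r'" for r r'
  proof -
    have "coeff r i = 0 \<and> coeff r' i = 0" for i
    proof (rule theta_indep)
      show "coeff r i + coeff r' i * \<theta> = 0" using arg_cong[OF that(1), of "\<lambda>p. coeff p i"] by (simp add: mult.commute)
    qed (use that in \<open>auto simp: perf_poly_def\<close>)
    then show ?thesis by (simp add: poly_eq_iff)
  qed
  show ?thesis unfolding *(1,2) using zero[OF z(1) *(3,5)] zero[OF z(2) *(4,6)] by simp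
qed

lemma cj_eq:
  assumes "a \<in> k" "b \<in> k"
  shows "cj (a + b * th) = a + b + b * th"
proof -
  have "(THE b'. b' \<in> k \<and> (\<exists>a'\<in>k. a + b * th = a' + b' * th)) = b"
  proof (rule the_equality)
    fix b' assume "b' \<in> k \<and> (\<exists>a'\<in>k. a + b * th = a' + b' * th)"
    then obtain a' where a': "b' \<in> k" "a' \<in> k" "a + b * th = a' + b' * th" by blast
    have "(a + a') + (b + b') * th = 0" by (rule char2_eq[OF a'(3)]) (simp add: algebra_simps)
    from k_indep[OF _ _ this] have "b + b' = 0" using a' assms kE_add by auto
    then show "b' = b" by (simp add: add_eq_0_iff_eq)
  qed (use assms in auto)
  then show ?thesis unfolding conjLE_def by (simp add: add_ac)
qed

lemma AI: "a \<in> k \<Longrightarrow> b \<in> k \<Longrightarrow> a + b * th \<in> A"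
  by (auto simp: LE_def)

lemma AE: assumes "u \<in> A" obtains a b where "a \<in> k" "b \<in> k" "u = a + b * th"
  using assms by (auto simp: LE_def)

lemma k_0: "0 \<in> k" using kE_const[of 0] by simp

lemma k_A: "a \<in> k \<Longrightarrow> a \<in> A" using AI[of a 0] k_0 by simp

lemma th_mult: "(a + b * th) * (a' + b' * th) = (a * a' + b * b' * tt) + (a * b' + b * a' + b * b') * th"
proof -
  have th2: "th\<^sup>2 = th + tt" using th by (rule char2_eq) (simp add: add_ac)
  have "(a + b * th) * (a' + b' * th) = a * a' + (a * b' + b * a') * th + b * b' * th\<^sup>2"
    by (simp add: algebra_simps power2_eq_square)
  then show ?thesis unfolding th2 by (simp add: algebra_simps)
qed

lemma k_tt: "tt \<in> k" and k_cc: "cc \<in> k" by (simp_all add: kE_const)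

lemma A_add: "u \<in> A \<Longrightarrow> v \<in> A \<Longrightarrow> u + v \<in> A"
proof (elim AE)
  fix a b a' b' assume *: "a \<in> k" "b \<in> k" "u = a + b * th" "a' \<in> k" "b' \<in> k" "v = a' + b' * th"
  have "u + v = (a + a') + (b + b') * th" unfolding * by (simp add: algebra_simps)
  then show ?thesis using AI[of "a + a'" "b + b'"] * by (metis kE_add)
qed

lemma A_mult: "u \<in> A \<Longrightarrow> v \<in> A \<Longrightarrow> u * v \<in> A"
  by (elim AE) (auto simp: th_mult intro!: AI kE_add k_mult k_tt)

lemma cj_A: "u \<in> A \<Longrightarrow> cj u \<in> A"
  by (elim AE) (auto simp: cj_eq intro!: AI kE_add)

lemma cj_add: "u \<in> A \<Longrightarrow> v \<in> A \<Longrightarrow> cj (u + v) = cj u + cj v"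
proof (elim AE)
  fix a b a' b' assume *: "a \<in> k" "b \<in> k" "u = a + b * th" "a' \<in> k" "b' \<in> k" "v = a' + b' * th"
  have "u + v = (a + a') + (b + b') * th" using * by (simp add: algebra_simps)
  then have "cj (u + v) = (a + a') + (b + b') + (b + b') * th" using * by (simp only: cj_eq kE_add)
  moreover have "cj u = a + b + b * th" "cj v = a' + b' + b' * th" using * by (simp_all only: cj_eq)
  ultimately show ?thesis by (simp add: algebra_simps)
qed

lemma cj_mult: "u \<in> A \<Longrightarrow> v \<in> A \<Longrightarrow> cj (u * v) = cj u * cj v"
proof (elim AE)
  fix a b a' b' assume *: "a \<in> k" "b \<in> k" "u = a + b * th" "a' \<in> k" "b' \<in> k" "v = a' + b' * th"
  have "cj (u * v) = (a * a' + b * b' * tt) + (a * b' + b * a' + b * b') + (a * b' + b * a' + b * b') * th"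
    unfolding *(3,6) th_mult by (subst cj_eq) (use * in \<open>auto intro!: kE_add k_mult k_tt\<close>)
  also have "\<dots> = (a + b + b * th) * (a' + b' + b' * th)"
    unfolding th_mult by (simp add: algebra_simps)
  finally show ?thesis using * by (simp add: cj_eq)
qed

lemma cj_k: "a \<in> k \<Longrightarrow> cj a = a"
  using cj_eq[of a 0] k_0 by simp

lemma cj_cj: "u \<in> A \<Longrightarrow> cj (cj u) = u"
  by (elim AE) (auto simp: cj_eq kE_add)

lemma cj_const: "u \<in> Lfield \<Longrightarrow> cj (fls_const u) = fls_const (conjL u) \<and> fls_const u \<in> A"
proof (elim LfieldE)
  fix a b assume *: "a \<in> F2t_perf" "b \<in> F2t_perf" "u = a + b * \<theta>"
  have "fls_const u = fls_const a + fls_const b * th" unfolding * by (simp add: fls_const_add)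
  moreover have "fls_const (conjL u) = fls_const a + fls_const b + fls_const b * th"
    using * by (simp add: conjL_eq fls_const_add)
  ultimately show ?thesis using cj_eq[of "fls_const a" "fls_const b"] AI[of "fls_const a" "fls_const b"] *
    by (simp add: kE_const)
qed

text \<open>The pole order of \<open>P + Q y\<close> at infinity. The contributions of
  \<open>P\<close> and \<open>Q\<close> have different parity, so their leading terms do not
  cancel.\<close>

definition deg2 :: "F2t_bar poly \<Rightarrow> F2t_bar poly \<Rightarrow> int" where
  "deg2 P Q = max (if P = 0 then 0 else 2 * int (degree P)) (if Q = 0 then 0 else 2 * int (degree Q) + 3)"

lemma subdegree_PQ:
  assumes "P \<noteq> 0 \<or> Q \<noteq> 0"
  shows "fls_subdegree (pe P x + pe Q x * y) = - deg2 P Q"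
    "fls_nth (pe P x + pe Q x * y) (- deg2 P Q) \<in> {lead_coeff P, lead_coeff Q}"
proof -
  have l1: "leading (pe P x) (- 2 * int (degree P)) (lead_coeff P)" if "P \<noteq> 0" using pe_leading[OF lx that] .
  have l2: "leading (pe Q x * y) (- 2 * int (degree Q) - 3) (lead_coeff Q)" if "Q \<noteq> 0"
    using leading_mult[OF pe_leading[OF lx that] ly] by simp
  have "\<exists>c\<in>{lead_coeff P, lead_coeff Q}. c \<noteq> 0 \<and> leading (pe P x + pe Q x * y) (- deg2 P Q) c"
  proof (cases "P = 0 \<or> Q = 0")
    case True
    then show ?thesis using l1 l2 assms by (auto simp: deg2_def)
  next
    case False
    then have PQ: "P \<noteq> 0" "Q \<noteq> 0" by auto
    show ?thesis
    proof (cases "2 * degree P > 2 * degree Q + 3")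
      case True
      then have "leading (pe P x + pe Q x * y) (- 2 * int (degree P)) (lead_coeff P)"
        by (intro leading_add l1 PQ leading_ordge[OF l2[OF PQ(2)]]) auto
      moreover have "deg2 P Q = 2 * int (degree P)" using True PQ by (simp add: deg2_def)
      ultimately show ?thesis using PQ by auto
    next
      case F: False
      then have F': "2 * degree P < 2 * degree Q + 3" by presburger
      then have "leading (pe Q x * y + pe P x) (- 2 * int (degree Q) - 3) (lead_coeff Q)"
        by (intro leading_add l2 PQ leading_ordge[OF l1[OF PQ(1)]]) auto
      moreover have "- deg2 P Q = - 2 * int (degree Q) - 3" using F' PQ by (simp add: deg2_def)
      ultimately show ?thesis using PQ by (auto simp: add.commute)
    qed
  qed
  then obtain c where c: "c \<in> {lead_coeff P, lead_coeff Q}" "c \<noteq> 0" "leading (pe P x + pe Q x * y) (- deg2 P Q) c" by blast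
  show "fls_subdegree (pe P x + pe Q x * y) = - deg2 P Q" using leading_subdegree[OF c(3,2)] .
  show "fls_nth (pe P x + pe Q x * y) (- deg2 P Q) \<in> {lead_coeff P, lead_coeff Q}" using c by (simp add: leading_def)
qed

text \<open>Conjugation acts on coefficients and keeps nonzero ones nonzero, so the pole order at
  infinity is preserved.\<close>

lemma A_PQ:
  assumes "u \<in> A" "u \<noteq> 0"
  obtains P Q P' Q' where "P \<noteq> 0 \<or> Q \<noteq> 0" "u = pe P x + pe Q x * y" "cj u = pe P' x + pe Q' x * y"
    "\<forall>i. coeff P i \<in> Lfield" "\<forall>i. coeff Q i \<in> Lfield" "P' \<noteq> 0 \<or> Q' \<noteq> 0" "deg2 P' Q' = deg2 P Q"
proof -
  obtain a b where ab: "a \<in> k" "b \<in> k" "u = a + b * th" using assms(1) by (rule AE)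
  obtain p q p' q' where *: "a = pe p x + pe q x * y" "b = pe p' x + pe q' x * y"
    "perf_poly p" "perf_poly q" "perf_poly p'" "perf_poly q'" using ab unfolding kE_def by blast
  define S where "S = (\<lambda>r r'. r + Polynomial.smult \<theta> r')"
  have nz: "coeff (S r r') i = 0 \<longleftrightarrow> coeff r i = 0 \<and> coeff r' i = 0" if "perf_poly r" "perf_poly r'" for r r' i
    using theta_indep[of "coeff r i" "coeff r' i"] that by (auto simp: S_def perf_poly_def mult.commute)
  have deg: "degree (S (r + r') r') = degree (S r r')" "S (r + r') r' = 0 \<longleftrightarrow> S r r' = 0" if "perf_poly r" "perf_poly r'" for r r'
  proof -
    have *: "coeff (S (r + r') r') i = 0 \<longleftrightarrow> coeff (S r r') i = 0" for i
      using nz[OF that, of i] nz[OF perf_poly_add[OF that] that(2), of i] by (auto simp: add_eq_0_iff_eq)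
    show "degree (S (r + r') r') = degree (S r r')" unfolding degree_def using * by simp
    show "S (r + r') r' = 0 \<longleftrightarrow> S r r' = 0" using * by (simp add: poly_eq_iff)
  qed
  have L: "coeff (S r r') i \<in> Lfield" if "perf_poly r" "perf_poly r'" for r r' i
    using that LfieldI[of "coeff r i" "coeff r' i"] by (simp add: S_def perf_poly_def mult.commute)
  show thesis
  proof (rule that[of "S p p'" "S q q'" "S (p + p') p'" "S (q + q') q'"])
    show u: "u = pe (S p p') x + pe (S q q') x * y" unfolding ab(3) * S_def by (simp add: algebra_simps)
    show "cj u = pe (S (p + p') p') x + pe (S (q + q') q') x * y"
      unfolding ab(3) cj_eq[OF ab(1,2)] unfolding * S_def by (simp add: algebra_simps)
    show n: "S p p' \<noteq> 0 \<or> S q q' \<noteq> 0" using u assms(2) by auto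
    show "\<forall>i. coeff (S p p') i \<in> Lfield" "\<forall>i. coeff (S q q') i \<in> Lfield" using L * by auto
    show "S (p + p') p' \<noteq> 0 \<or> S (q + q') q' \<noteq> 0" "deg2 (S (p + p') p') (S (q + q') q') = deg2 (S p p') (S q q')"
      using n deg[OF *(3,5)] deg[OF *(4,6)] by (auto simp: deg2_def)
  qed
qed

lemma A_subdegree:
  assumes "u \<in> A" "u \<noteq> 0"
  shows "fls_subdegree u \<le> 0" "fls_nth u (fls_subdegree u) \<in> Lfield" "fls_subdegree (cj u) = fls_subdegree u" "cj u \<noteq> 0"
proof -
  obtain P Q P' Q' where *: "P \<noteq> 0 \<or> Q \<noteq> 0" "u = pe P x + pe Q x * y" "cj u = pe P' x + pe Q' x * y"
    "\<forall>i. coeff P i \<in> Lfield" "\<forall>i. coeff Q i \<in> Lfield" "P' \<noteq> 0 \<or> Q' \<noteq> 0" "deg2 P' Q' = deg2 P Q"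
    by (rule A_PQ[OF assms]) (rule that)
  show "fls_subdegree u \<le> 0" unfolding *(2) subdegree_PQ(1)[OF *(1)] by (simp add: deg2_def max_def)
  show "fls_nth u (fls_subdegree u) \<in> Lfield"
    unfolding *(2) subdegree_PQ(1)[OF *(1)] using subdegree_PQ(2)[OF *(1)] *(4,5) by auto
  show "fls_subdegree (cj u) = fls_subdegree u" unfolding *(3) subdegree_PQ(1)[OF *(6)] *(7) unfolding *(2) subdegree_PQ(1)[OF *(1)] ..
  show "cj u \<noteq> 0" using cj_cj[OF assms(1)] cj_k[OF k_0] assms(2) by auto
qed

text \<open>A solution of the conic gives an element \<open>\<gamma>\<close> of norm \<open>x (x + cc) A2\<^sup>2\<close>; then \<open>w \<mapsto> \<sigma> (\<gamma> w / A2)\<close> is a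
  semilinear endomorphism with square \<open>x (x + cc)\<close>.\<close>

theorem no_conic:
  assumes "A1 \<in> k" "A2 \<in> k" "A3 \<in> k"
    and conic: "x * (A1 * A3 + A2\<^sup>2) = (x + cc) * (A1\<^sup>2 + A3\<^sup>2 * x)"
  shows "A1 = 0 \<and> A3 = 0"
proof (rule ccontr)
  assume nz: "\<not> (A1 = 0 \<and> A3 = 0)"
  have x0: "x \<noteq> 0" using lx leading_nz by force
  have lxc: "leading (x + cc) (- 2) 1" by (rule leading_add[OF lx]) (simp add: ordge_def)
  have xc: "x + cc \<noteq> 0" "fls_subdegree (x + cc) = - 2" "fls_subdegree x = - 2"
    using leading_nz[OF lxc] leading_subdegree[OF lxc] leading_subdegree[OF lx] by auto
  \<comment> \<open>Put \<open>z = (x + cc) * A1\<close> and \<open>w = x * A3\<close>. The conic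
    multiplied by \<open>x + cc\<close> reads
    \<open>z^2 + z w + (U^2 + U + tt) w^2 = x (x + cc) A2^2\<close>, and the substitution
    \<open>a = z + U w\<close>, \<open>b = w\<close> turns the left side into the norm form
    \<open>a^2 + a b + tt b^2\<close>.\<close>
  define a where "a = (x + cc) * A1 + (y + cc\<^sup>2) * A3"
  define b where "b = x * A3"
  have ccc: "cc\<^sup>2 \<in> k" unfolding power2_eq_square by (intro k_mult k_cc)
  have xk: "x \<in> k" "y \<in> k" "x + cc \<in> k" by (auto intro: kE_add kE_x kE_y k_cc)
  have ab: "a \<in> k" "b \<in> k" unfolding a_def b_def by (intro kE_add k_mult assms xk ccc)+
  define \<gamma> where "\<gamma> = a + b * th"
  have g: "\<gamma> \<in> A" unfolding \<gamma>_def using ab by (rule AI)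
  have g0: "\<gamma> \<noteq> 0"
  proof
    assume "\<gamma> = 0"
    then have "a = 0" "b = 0" using k_indep[OF ab] unfolding \<gamma>_def by auto
    then show False using nz x0 xc unfolding a_def b_def by auto
  qed
  have norm: "\<gamma> * cj \<gamma> = x * (x + cc) * A2\<^sup>2"
  proof -
    have "\<gamma> * cj \<gamma> = (a + b * th) * (a + b + b * th)" unfolding \<gamma>_def cj_eq[OF ab] ..
    also have "\<dots> = a\<^sup>2 + a * b + b\<^sup>2 * tt" unfolding th_mult by (simp add: algebra_simps power2_eq_square)
    also have "\<dots> = (x + cc)\<^sup>2 * A1\<^sup>2 + x * (x + cc) * (A1 * A3) + ((y + cc\<^sup>2)\<^sup>2 + x * (y + cc\<^sup>2) + x\<^sup>2 * tt) * A3\<^sup>2"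
      unfolding a_def b_def by (simp add: algebra_simps power_mult_distrib) (simp add: power2_eq_square algebra_simps)
    also have "(y + cc\<^sup>2)\<^sup>2 + x * (y + cc\<^sup>2) + x\<^sup>2 * tt = (y\<^sup>2 + x * y) + cc ^ 4 + x * cc\<^sup>2 + x\<^sup>2 * tt"
      by (simp add: algebra_simps flip: power_mult)
    also have "\<dots> = x * (x + cc)\<^sup>2" unfolding curve cc_fourth by (simp add: algebra_simps power2_eq_square power3_eq_cube)
    also have "(x + cc)\<^sup>2 * A1\<^sup>2 + x * (x + cc) * (A1 * A3) + x * (x + cc)\<^sup>2 * A3\<^sup>2
       = (x + cc) * ((x + cc) * (A1\<^sup>2 + A3\<^sup>2 * x) + x * (A1 * A3))"
      by (simp only: power2_eq_square distrib_left mult_ac add_ac)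
    also have "\<dots> = x * (x + cc) * A2\<^sup>2" unfolding conic[symmetric] by (simp add: algebra_simps)
    finally show ?thesis .
  qed
  have A2: "A2 \<noteq> 0" using norm g0 A_subdegree(4)[OF g g0] by auto
  \<comment> \<open>All elements that \<open>\<gamma> / A2\<close> multiplies into the coordinate
    ring; \<open>A2\<close> is one of them, so the ideal is not zero.\<close>
  define I where "I = {w \<in> A. \<exists>v\<in>A. \<gamma> * w = A2 * v}"
  define \<Phi> where "\<Phi> = (\<lambda>w. cj (\<gamma> * w / A2))"
  have A2A: "A2 \<in> A" "x \<in> A" "y \<in> A" "x + cc \<in> A" using assms(2) k_A xk by auto
  have Phi_eq: "\<Phi> w = cj v" if "\<gamma> * w = A2 * v" for w v
    unfolding \<Phi>_def that using A2 by simp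
  have Phi_I: "\<Phi> w \<in> I \<and> \<Phi> (\<Phi> w) = x * (x + cc) * w" if w: "w \<in> I" for w
  proof -
    obtain v where v: "w \<in> A" "v \<in> A" "\<gamma> * w = A2 * v" using w unfolding I_def by blast
    have "cj \<gamma> * cj w = A2 * cj v"
      using cj_mult[OF g v(1)] cj_mult[OF A2A(1) v(2)] cj_k[OF assms(2)] v(3) by simp
    then have "\<gamma> * (cj \<gamma> * cj w) = \<gamma> * (A2 * cj v)" by simp
    then have "A2 * (\<gamma> * cj v) = (\<gamma> * cj \<gamma>) * cj w" by (simp only: mult_ac)
    also have "\<dots> = A2 * (A2 * (x * (x + cc) * cj w))" unfolding norm by (simp only: power2_eq_square mult_ac)
    finally have eq: "\<gamma> * cj v = A2 * (x * (x + cc) * cj w)" using A2 by simp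
    have in_A: "x * (x + cc) * cj w \<in> A" using A2A v cj_A by (intro A_mult) auto
    have "\<Phi> w = cj v" by (rule Phi_eq[OF v(3)])
    moreover have "cj v \<in> I" unfolding I_def using eq in_A cj_A[OF v(2)] by blast
    moreover have "\<Phi> (cj v) = cj (x * (x + cc) * cj w)" by (rule Phi_eq[OF eq])
    moreover have "\<dots> = x * (x + cc) * w"
      using cj_mult[OF A_mult[OF A2A(2,4)] cj_A[OF v(1)]] cj_cj[OF v(1)] cj_k[OF k_mult[OF xk(1,3)]] by simp
    ultimately show ?thesis by simp
  qed
  interpret semilinear_lattice x y I \<Phi> Lfield conjL c0 t_gen "t_gen ^ 6"
  proof
    show "conjL 1 = 1" by (simp add: conjL_perf)
    show "\<exists>w\<in>I. w \<noteq> 0"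
    proof
      show "A2 \<in> I" unfolding I_def using A2A g by (auto simp: mult.commute)
      show "A2 \<noteq> 0" by (rule A2)
    qed
    show "y\<^sup>2 + x * y = x ^ 3 + fls_const t_gen * x\<^sup>2 + fls_const (t_gen ^ 6)" using curve by (simp add: fls_const_power)
    show "fls_subdegree w \<le> 0" if "w \<in> I" "w \<noteq> 0" for w using that A_subdegree unfolding I_def by blast
    show "fls_nth w (fls_subdegree w) \<in> Lfield" if "w \<in> I" for w
      using that A_subdegree[of w] Lfield_perf[OF perf_0] unfolding I_def by (cases "w = 0") auto
    show "v + w \<in> I" if vw: "v \<in> I" "w \<in> I" for v w
    proof -
      obtain v' w' where "v \<in> A" "w \<in> A" "v' \<in> A" "w' \<in> A" "\<gamma> * v = A2 * v'" "\<gamma> * w = A2 * w'" using vw unfolding I_def by blast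
      then show ?thesis unfolding I_def by (auto intro!: A_add bexI[of _ "v' + w'"] simp: distrib_left)
    qed
    have scale: "s * w \<in> I \<and> \<Phi> (s * w) = cj s * \<Phi> w" if s: "s \<in> A" and w: "w \<in> I" for s w
    proof -
      obtain w' where w': "w \<in> A" "w' \<in> A" "\<gamma> * w = A2 * w'" using w unfolding I_def by blast
      have eq: "\<gamma> * (s * w) = A2 * (s * w')" using w'(3) by (metis mult.left_commute)
      then have "s * w \<in> I" unfolding I_def using w' s A_mult by blast
      moreover have "\<Phi> (s * w) = cj s * \<Phi> w"
        unfolding Phi_eq[OF eq] Phi_eq[OF w'(3)] by (rule cj_mult[OF s w'(2)])
      ultimately show ?thesis by blast
    qed
    show "fls_const a * w \<in> I" if "a \<in> Lfield" "w \<in> I" for a w using scale cj_const[OF that(1)] that(2) by blast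
    show "x * w \<in> I" "y * w \<in> I" if "w \<in> I" for w using scale A2A that by blast+
    show "\<Phi> w \<in> I" "\<Phi> (\<Phi> w) = x * (x + cc) * w" if "w \<in> I" for w using Phi_I[OF that] by auto
    show "\<Phi> (v + w) = \<Phi> v + \<Phi> w" if vw: "v \<in> I" "w \<in> I" for v w
    proof -
      obtain v' w' where *: "v' \<in> A" "w' \<in> A" "\<gamma> * v = A2 * v'" "\<gamma> * w = A2 * w'" using vw unfolding I_def by blast
      then have "\<gamma> * (v + w) = A2 * (v' + w')" by (simp add: distrib_left)
      from Phi_eq[OF this] show ?thesis using cj_add[OF *(1,2)] Phi_eq[OF *(3)] Phi_eq[OF *(4)] by simp
    qed
    show "\<Phi> (fls_const a * w) = fls_const (conjL a) * \<Phi> w" if "a \<in> Lfield" "w \<in> I" for a w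
      using scale[of "fls_const a" w] cj_const[OF that(1)] that(2) by simp
    show "\<Phi> (x * w) = x * \<Phi> w" "\<Phi> (y * w) = y * \<Phi> w" if "w \<in> I" for w
      using scale[OF A2A(2) that] scale[OF A2A(3) that] cj_k xk by auto
    \<comment> \<open>\<open>\<gamma>\<close> and its conjugate have the same order, so the order of
      \<open>\<gamma> / A2\<close> is half that of \<open>x * (x + cc)\<close>, namely
      \<open>- 2\<close>.\<close>
    show "fls_subdegree (\<Phi> w) = fls_subdegree w - 2" if w: "w \<in> I" "w \<noteq> 0" for w
    proof -
      obtain v where v: "w \<in> A" "v \<in> A" "\<gamma> * w = A2 * v" using w(1) unfolding I_def by blast
      have v0: "v \<noteq> 0" using v(3) g0 w(2) by auto
      have "fls_subdegree \<gamma> + fls_subdegree w = fls_subdegree A2 + fls_subdegree v"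
        using arg_cong[OF v(3), of fls_subdegree] g0 w(2) A2 v0 by simp
      moreover have "fls_subdegree \<gamma> + fls_subdegree \<gamma> = - 4 + 2 * fls_subdegree A2"
        using arg_cong[OF norm, of fls_subdegree] g0 A_subdegree(3,4)[OF g g0] A2 x0 xc by (simp add: power2_eq_square)
      moreover have "fls_subdegree (\<Phi> w) = fls_subdegree v" unfolding Phi_eq[OF v(3)] using A_subdegree(3)[OF v(2) v0] .
      ultimately show ?thesis by simp
    qed
  qed (use lx ly in \<open>auto simp: Lfield_add Lfield_mult Lfield_inverse Lfield_perf conjL_closed conjL_add conjL_mult\<close>)
  show False using lattice_point no_conjugate_point by metis
qed

end

text \<open>The pair \<open>(p, q)\<close> stands for the function \<open>p + q y\<close>.\<close>

type_synonym cfun = "F2t_bar poly \<times> F2t_bar poly"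

definition ev :: "cfun \<Rightarrow> F2t_bar fls \<Rightarrow> F2t_bar fls \<Rightarrow> F2t_bar fls" where
  "ev u x y = pe (fst u) x + pe (snd u) x * y"

definition cf_add :: "cfun \<Rightarrow> cfun \<Rightarrow> cfun" where
  "cf_add u v = (fst u + fst v, snd u + snd v)"

definition cf_mult :: "cfun \<Rightarrow> cfun \<Rightarrow> cfun" where
  "cf_mult u v = (fst u * fst v + snd u * snd v * curve_poly, fst u * snd v + snd u * fst v + snd u * snd v * [:0, 1:])"

definition cf_perf :: "cfun \<Rightarrow> bool" where
  "cf_perf u \<longleftrightarrow> perf_poly (fst u) \<and> perf_poly (snd u)"

lemma ev_add: "ev (cf_add u v) x y = ev u x y + ev v x y"
  by (simp add: ev_def cf_add_def algebra_simps)

lemma ev_mult: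
  assumes "y\<^sup>2 + x * y = x ^ 3 + tt * x\<^sup>2 + tt ^ 6"
  shows "ev (cf_mult u v) x y = ev u x y * ev v x y"
proof -
  have y2: "y * y = pe curve_poly x + x * y"
    unfolding pe_curve_poly by (rule char2_eq[OF assms]) (simp add: power2_eq_square)
  have "ev u x y * ev v x y = pe (fst u) x * pe (fst v) x + (pe (fst u) x * pe (snd v) x + pe (snd u) x * pe (fst v) x) * y
      + pe (snd u) x * pe (snd v) x * (y * y)"
    unfolding ev_def by (simp add: algebra_simps)
  then show ?thesis unfolding y2 by (simp add: ev_def cf_mult_def algebra_simps)
qed

lemma cf_perf_mult: "cf_perf u \<Longrightarrow> cf_perf v \<Longrightarrow> cf_perf (cf_mult u v)"
  by (auto simp: cf_perf_def cf_mult_def intro!: perf_poly_add perf_poly_mult perf_poly_curve perf_poly_pCons perf_poly_0)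

lemma cf_perf_kE: "cf_perf u \<Longrightarrow> ev u x y \<in> kE x y"
  by (simp add: cf_perf_def ev_def kE_I)

lemma ev_eq_0: "formal_point x y U \<Longrightarrow> ev u x y = 0 \<longleftrightarrow> u = (0, 0)"
  using formal_point_indep[of x y U "fst u" "snd u"] by (auto simp: ev_def prod_eq_iff)

text \<open>The point at infinity, the point \<open>T\<close>, and the affine points with abscissa \<open>a \<noteq> 0\<close>.\<close>

definition std_point :: "F2t_bar fls \<Rightarrow> F2t_bar fls \<Rightarrow> F2t_bar fls \<Rightarrow> bool" where
  "std_point x y U \<longleftrightarrow> formal_point x y U \<and>
    ((U = fls_X_inv \<and> leading x (- 2) 1 \<and> leading y (- 3) 1) \<or>
     (U = fls_X_inv \<and> leading x 2 (c0\<^sup>2) \<and> leading (y + cc\<^sup>2) 1 (c0\<^sup>2)) \<or>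
     (\<exists>a. a \<noteq> 0 \<and> x = fls_const a + fls_X \<and> ordge 0 y))"

section \<open>Decomposition over the fourth powers\<close>

text \<open>Multiplication by the variable permutes the four parts cyclically, and a new constant
  term is a fourth power because the field is perfect.\<close>

lemma poly_fourth_power_parts:
  assumes "perf_poly p"
  shows "\<exists>r0 r1 r2 r3. perf_poly r0 \<and> perf_poly r1 \<and> perf_poly r2 \<and> perf_poly r3 \<and>
    p = r0 ^ 4 + [:0, 1:] * r1 ^ 4 + [:0, 1:]\<^sup>2 * r2 ^ 4 + [:0, 1:] ^ 3 * r3 ^ 4"
  using assms
proof (induction p)
  case 0
  then show ?case by (intro exI[of _ 0]) (simp add: perf_poly_0)
next
  case (pCons a p)
  have ap: "a \<in> F2t_perf" "perf_poly p"
  proof -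
    show "a \<in> F2t_perf" using pCons(3) unfolding perf_poly_def by (metis coeff_pCons_0)
    show "perf_poly p" using pCons(3) unfolding perf_poly_def by (metis coeff_pCons_Suc)
  qed
  obtain r0 r1 r2 r3 where r: "perf_poly r0" "perf_poly r1" "perf_poly r2" "perf_poly r3"
    "p = r0 ^ 4 + [:0, 1:] * r1 ^ 4 + [:0, 1:]\<^sup>2 * r2 ^ 4 + [:0, 1:] ^ 3 * r3 ^ 4"
    using pCons.IH[OF ap(2)] by blast
  obtain b where b: "b ^ 4 = a" using nth_root_exists[of 4 a] by auto
  then have bp: "b \<in> F2t_perf" using perf_root[of b 2] ap(1) by simp
  have gen: "a' + z * (s0 + z * s1 + z\<^sup>2 * s2 + z ^ 3 * s3 ^ 4) = (a' + (z * s3) ^ 4) + z * s0 + z\<^sup>2 * s1 + z ^ 3 * s2"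
    for a' z s0 s1 s2 s3 :: "F2t_bar poly"
    by (simp add: algebra_simps power2_eq_square power3_eq_cube power4_eq_xxxx)
  have "pCons a p = [:b:] ^ 4 + [:0, 1:] * p" using b by (simp add: poly_const_pow)
  also have "\<dots> = ([:b:] + [:0, 1:] * r3) ^ 4 + [:0, 1:] * r0 ^ 4 + [:0, 1:]\<^sup>2 * r1 ^ 4 + [:0, 1:] ^ 3 * r2 ^ 4"
    unfolding r(5) gen fourth_power_add by (rule refl)
  finally have "pCons a p = \<dots>" .
  moreover have "perf_poly ([:b:] + [:0, 1:] * r3)"
    using r bp by (intro perf_poly_add perf_poly_mult perf_poly_pCons perf_poly_0) auto
  ultimately show ?case using r(1-3) by blast
qed

text \<open>Squaring \<open>x y = y^2 + f\<close> and eliminating \<open>y^2\<close> gives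
  \<open>x^3 y = y^4 + f^2 + x^2 f\<close>. The further factor \<open>x^5\<close> makes the term
  with \<open>y\<close> a fourth power times \<open>x\<close>, and \<open>x^8\<close> is itself a
  fourth power.\<close>

lemma y_fourth_power:
  fixes x y f :: "'a::char2"
  assumes "y\<^sup>2 + x * y = f"
  shows "x ^ 8 * y = x * (x * y) ^ 4 + (x ^ 5 * f\<^sup>2 + x ^ 7 * f)"
proof -
  have "x ^ 5 * f\<^sup>2 + x ^ 7 * f = x ^ 5 * y ^ 4 + x ^ 7 * y\<^sup>2 + x ^ 7 * y\<^sup>2 + x ^ 8 * y"
    unfolding assms[symmetric] by (simp add: algebra_simps power_mult_distrib) (simp add: eval_nat_numeral algebra_simps)
  then show ?thesis by (simp add: power_mult_distrib add_ac) (simp add: eval_nat_numeral algebra_simps)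
qed

lemma cfun_fourth_power_parts:
  assumes "cf_perf u"
  obtains A0 A1 A2 A3 where "cf_perf A0" "cf_perf A1" "cf_perf A2" "cf_perf A3"
    "\<forall>x y U. formal_point x y U \<longrightarrow>
      x ^ 8 * ev u x y = ev A0 x y ^ 4 + ev A1 x y ^ 4 * x + ev A2 x y ^ 4 * x\<^sup>2 + ev A3 x y ^ 4 * x ^ 3"
proof -
  let ?X = "[:0, 1:] :: F2t_bar poly"
  obtain p q where u: "u = (p, q)" "perf_poly p" "perf_poly q" using assms unfolding cf_perf_def by (cases u) auto
  have pX: "perf_poly ?X" by (intro perf_poly_pCons perf_poly_0) auto
  have pw: "perf_poly (s ^ n)" if "perf_poly s" for s n
    by (induction n) (use that in \<open>auto intro: perf_poly_mult perf_poly_1\<close>)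
  obtain s0 s1 s2 s3 where s: "perf_poly s0" "perf_poly s1" "perf_poly s2" "perf_poly s3"
    "q = s0 ^ 4 + ?X * s1 ^ 4 + ?X\<^sup>2 * s2 ^ 4 + ?X ^ 3 * s3 ^ 4"
    using poly_fourth_power_parts[OF u(3)] by blast
  define R where "R = ?X ^ 8 * p + q * (?X ^ 5 * curve_poly\<^sup>2 + ?X ^ 7 * curve_poly)"
  have "perf_poly R" unfolding R_def by (intro perf_poly_add perf_poly_mult pw pX u perf_poly_curve)
  then obtain r0 r1 r2 r3 where r: "perf_poly r0" "perf_poly r1" "perf_poly r2" "perf_poly r3"
    "R = r0 ^ 4 + ?X * r1 ^ 4 + ?X\<^sup>2 * r2 ^ 4 + ?X ^ 3 * r3 ^ 4"
    using poly_fourth_power_parts by blast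
  show thesis
  proof (rule that[of "(r0, ?X\<^sup>2 * s3)" "(r1, ?X * s0)" "(r2, ?X * s1)" "(r3, ?X * s2)"])
    show "cf_perf (r0, ?X\<^sup>2 * s3)" "cf_perf (r1, ?X * s0)" "cf_perf (r2, ?X * s1)" "cf_perf (r3, ?X * s2)"
      unfolding cf_perf_def using r s pX pw[OF pX] perf_poly_mult by (auto simp: perf_poly_pCons)
    show "\<forall>x y U. formal_point x y U \<longrightarrow> x ^ 8 * ev u x y = ev (r0, ?X\<^sup>2 * s3) x y ^ 4 + ev (r1, ?X * s0) x y ^ 4 * x
      + ev (r2, ?X * s1) x y ^ 4 * x\<^sup>2 + ev (r3, ?X * s2) x y ^ 4 * x ^ 3"
    proof (intro allI impI)
    fix x y U assume "formal_point x y U"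
    from formal_point_curve[OF this] have f: "y\<^sup>2 + x * y = pe curve_poly x" by (simp add: pe_curve_poly)
    have X: "pe ?X x = x" by simp
    have "x ^ 8 * ev u x y = x ^ 8 * pe p x + pe q x * (x ^ 8 * y)" unfolding u ev_def by (simp add: algebra_simps)
    also have "\<dots> = pe R x + pe q x * (x * (x * y) ^ 4)"
      unfolding y_fourth_power[OF f] R_def pe_add pe_mult pe_power X by (simp only: distrib_left add_ac)
    also have "\<dots> = (pe r0 x ^ 4 + x * pe r1 x ^ 4 + x\<^sup>2 * pe r2 x ^ 4 + x ^ 3 * pe r3 x ^ 4)
        + (pe s0 x ^ 4 + x * pe s1 x ^ 4 + x\<^sup>2 * pe s2 x ^ 4 + x ^ 3 * pe s3 x ^ 4) * (x * (x * y) ^ 4)"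
      unfolding r(5) s(5) pe_add pe_mult pe_power X by (rule refl)
    also have "\<dots> = (pe r0 x + x\<^sup>2 * pe s3 x * y) ^ 4 + (pe r1 x + x * pe s0 x * y) ^ 4 * x
        + (pe r2 x + x * pe s1 x * y) ^ 4 * x\<^sup>2 + (pe r3 x + x * pe s2 x * y) ^ 4 * x ^ 3"
      unfolding fourth_power_add power_mult_distrib by (simp add: algebra_simps) (simp add: eval_nat_numeral algebra_simps)
    finally show "x ^ 8 * ev u x y = ev (r0, ?X\<^sup>2 * s3) x y ^ 4 + ev (r1, ?X * s0) x y ^ 4 * x
      + ev (r2, ?X * s1) x y ^ 4 * x\<^sup>2 + ev (r3, ?X * s2) x y ^ 4 * x ^ 3"
      unfolding ev_def fst_conv snd_conv pe_mult pe_power X .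
    qed
  qed
qed

text \<open>Away from the poles of \<open>w\<close> the constant \<open>a\<close> must be the value of \<open>w\<close>; at a pole it plays no role.\<close>

definition odd_order :: "F2t_bar fls \<Rightarrow> bool" where
  "odd_order w \<longleftrightarrow> (\<exists>a. w + fls_const a \<noteq> 0 \<and> odd (fls_subdegree (w + fls_const a)))"

lemma nth_fourth_shift:
  fixes b :: "'a::{idom, char2} fls"
  shows "fls_nth (b ^ 4 * fls_X_intpow i) n = (if 4 dvd (n - i) then (fls_nth b ((n - i) div 4)) ^ 4 else 0)"
  by (simp add: fls_X_intpow_times_conv_shift fls_fourth_power_nth)

text \<open>The exponents in the four terms lie in the classes of \<open>0\<close>,
  \<open>\<epsilon>\<close>, \<open>2 \<epsilon>\<close>, \<open>3 \<epsilon>\<close> modulo four,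
  which are distinct; so each coefficient of \<open>f\<close> comes from a single term. The sign
  \<open>\<epsilon> = - 1\<close> is for a generator with a pole.\<close>

lemma fourth_power_coeffs:
  fixes f b0 b1 b2 b3 :: "'a::{idom, char2} fls"
  assumes f: "f = b0 ^ 4 + b1 ^ 4 * fls_X_intpow \<epsilon> + b2 ^ 4 * fls_X_intpow (2 * \<epsilon>) + b3 ^ 4 * fls_X_intpow (3 * \<epsilon>)"
    and e: "\<epsilon> = 1 \<or> \<epsilon> = - 1" and f0: "f \<noteq> 0" and n: "fls_subdegree f = n"
  shows "4 * m + \<epsilon> < n \<Longrightarrow> fls_nth b1 m = 0" "4 * m + 2 * \<epsilon> < n \<Longrightarrow> fls_nth b2 m = 0" "4 * m + 3 * \<epsilon> < n \<Longrightarrow> fls_nth b3 m = 0"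
    "4 * m + \<epsilon> = n \<Longrightarrow> fls_nth b1 m \<noteq> 0" "4 * m + 3 * \<epsilon> = n \<Longrightarrow> fls_nth b3 m \<noteq> 0"
proof -
  have b0: "b0 ^ 4 = b0 ^ 4 * fls_X_intpow 0" by simp
  have nth: "fls_nth f k = (if 4 dvd k then fls_nth b0 (k div 4) ^ 4 else 0) + (if 4 dvd (k - \<epsilon>) then fls_nth b1 ((k - \<epsilon>) div 4) ^ 4 else 0)
     + (if 4 dvd (k - 2 * \<epsilon>) then fls_nth b2 ((k - 2 * \<epsilon>) div 4) ^ 4 else 0) + (if 4 dvd (k - 3 * \<epsilon>) then fls_nth b3 ((k - 3 * \<epsilon>) div 4) ^ 4 else 0)" for k
    unfolding f by (subst b0) (simp only: fls_plus_nth nth_fourth_shift diff_0_right)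
  have 1: "fls_nth f (4 * m + \<epsilon>) = fls_nth b1 m ^ 4"
  proof -
    have "\<not> 4 dvd (4 * m + \<epsilon>)" "4 dvd (4 * m + \<epsilon> - \<epsilon>)" "\<not> 4 dvd (4 * m + \<epsilon> - 2 * \<epsilon>)" "\<not> 4 dvd (4 * m + \<epsilon> - 3 * \<epsilon>)"
      using e by (auto, presburger+)
    then show ?thesis unfolding nth by (simp only: if_True if_False) simp
  qed
  have 2: "fls_nth f (4 * m + 2 * \<epsilon>) = fls_nth b2 m ^ 4"
  proof -
    have "\<not> 4 dvd (4 * m + 2 * \<epsilon>)" "\<not> 4 dvd (4 * m + 2 * \<epsilon> - \<epsilon>)" "4 dvd (4 * m + 2 * \<epsilon> - 2 * \<epsilon>)" "\<not> 4 dvd (4 * m + 2 * \<epsilon> - 3 * \<epsilon>)"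
      using e by (auto, presburger+)
    then show ?thesis unfolding nth by (simp only: if_True if_False) simp
  qed
  have 3: "fls_nth f (4 * m + 3 * \<epsilon>) = fls_nth b3 m ^ 4"
  proof -
    have "\<not> 4 dvd (4 * m + 3 * \<epsilon>)" "\<not> 4 dvd (4 * m + 3 * \<epsilon> - \<epsilon>)" "\<not> 4 dvd (4 * m + 3 * \<epsilon> - 2 * \<epsilon>)" "4 dvd (4 * m + 3 * \<epsilon> - 3 * \<epsilon>)"
      using e by (auto, presburger+)
    then show ?thesis unfolding nth by (simp only: if_True if_False) simp
  qed
  have lt: "fls_nth f k = 0" if "k < n" for k using that n by simp
  have eq: "fls_nth f n \<noteq> 0" using f0 n by auto
  show "4 * m + \<epsilon> < n \<Longrightarrow> fls_nth b1 m = 0" using lt[of "4 * m + \<epsilon>"] 1 by simp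
  show "4 * m + 2 * \<epsilon> < n \<Longrightarrow> fls_nth b2 m = 0" using lt[of "4 * m + 2 * \<epsilon>"] 2 by simp
  show "4 * m + 3 * \<epsilon> < n \<Longrightarrow> fls_nth b3 m = 0" using lt[of "4 * m + 3 * \<epsilon>"] 3 by simp
  show "4 * m + \<epsilon> = n \<Longrightarrow> fls_nth b1 m \<noteq> 0" using eq 1 by auto
  show "4 * m + 3 * \<epsilon> = n \<Longrightarrow> fls_nth b3 m \<noteq> 0" using eq 3 by auto
qed

lemma ordge_square: "ordge m (w :: 'a::idom fls) \<Longrightarrow> ordge (2 * m) (w\<^sup>2)"
  using ordge_mult[of m w m w] by (simp add: power2_eq_square)

lemma leading_square: "leading (w :: 'a::idom fls) m a \<Longrightarrow> leading (w\<^sup>2) (2 * m) (a\<^sup>2)"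
  using leading_mult[of w m a w m a] by (simp add: power2_eq_square)

lemma leading_X: "leading fls_X 1 (1 :: 'a::zero_neq_one)"
  by (auto simp: leading_def ordge_def)

text \<open>The fourth powers make the orders of the four terms of \<open>f\<close> distinct modulo four, so an odd order of
  \<open>f\<close> is that of the second or the fourth term.\<close>

lemma tame_zero:
  fixes f b0 b1 b2 b3 :: "'a::{idom, char2} fls"
  assumes f: "f = b0 ^ 4 + b1 ^ 4 * fls_X + b2 ^ 4 * fls_X\<^sup>2 + b3 ^ 4 * fls_X ^ 3" and f0: "f \<noteq> 0" "odd (fls_subdegree f)"
  defines "D \<equiv> b1\<^sup>2 + b3\<^sup>2 * fls_X"
  shows "D \<noteq> 0" "ordge (fls_subdegree D) (b1 * b3 + b2\<^sup>2)"
proof -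
  have f': "f = b0 ^ 4 + b1 ^ 4 * fls_X_intpow 1 + b2 ^ 4 * fls_X_intpow (2 * 1) + b3 ^ 4 * fls_X_intpow (3 * 1)"
  proof -
    have p: "fls_X ^ k = (fls_X_intpow (int k) :: 'a fls)" for k by (rule fls_X_power_conv_shift_1)
    show ?thesis unfolding f p using p[of 1] by simp
  qed
  note co = fourth_power_coeffs[OF f' disjI1[OF refl] f0(1) refl]
  have "\<exists>n a. a \<noteq> 0 \<and> leading D n a \<and> ordge n (b1 * b3 + b2\<^sup>2)"
  proof (cases "fls_subdegree f mod 4 = 1")
    case True
    define m where "m = fls_subdegree f div 4"
    have e: "fls_subdegree f = 4 * m + 1" unfolding m_def using True by presburger
    have l1: "leading b1 m (fls_nth b1 m)" "fls_nth b1 m \<noteq> 0"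
      using co(1,4) by (auto simp: leading_def ordge_def e)
    have o: "ordge m b2" "ordge m b3" using co(2,3) by (auto simp: ordge_def e)
    have "ordge (2 * m + 1) (b3\<^sup>2 * fls_X)"
      using ordge_mult[OF ordge_square[OF o(2)] leading_ordge[OF leading_X order_refl]] by simp
    then have "leading D (2 * m) ((fls_nth b1 m)\<^sup>2)" unfolding D_def by (rule leading_add[OF leading_square[OF l1(1)]])
    moreover have "ordge (2 * m) (b1 * b3 + b2\<^sup>2)"
      using ordge_mult[OF leading_ordge[OF l1(1) order_refl] o(2)] ordge_square[OF o(1)] by (auto intro: ordge_add)
    ultimately show ?thesis using l1(2) by (intro exI[of _ "2 * m"] exI[of _ "(fls_nth b1 m)\<^sup>2"]) auto
  next
    case False
    define m where "m = fls_subdegree f div 4"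
    have e: "fls_subdegree f = 4 * m + 3" unfolding m_def using False f0(2) by presburger
    have l3: "leading b3 m (fls_nth b3 m)" "fls_nth b3 m \<noteq> 0"
      using co(3,5) by (auto simp: leading_def ordge_def e)
    have o: "ordge (m + 1) b2" "ordge (m + 1) b1" using co(1,2) by (auto simp: ordge_def e)
    have "leading (b3\<^sup>2 * fls_X) (2 * m + 1) ((fls_nth b3 m)\<^sup>2)"
      using leading_mult[OF leading_square[OF l3(1)] leading_X] by simp
    then have "leading (b3\<^sup>2 * fls_X + b1\<^sup>2) (2 * m + 1) ((fls_nth b3 m)\<^sup>2)"
      by (rule leading_add) (use ordge_square[OF o(2)] in \<open>simp add: algebra_simps\<close>)
    then have "leading D (2 * m + 1) ((fls_nth b3 m)\<^sup>2)" unfolding D_def by (simp add: add.commute)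
    moreover have "ordge (2 * m + 1) (b1 * b3 + b2\<^sup>2)"
      using ordge_mult[OF o(2) leading_ordge[OF l3(1) order_refl]] ordge_square[OF o(1)]
      by (intro ordge_add) (auto elim: ordge_mono)
    ultimately show ?thesis using l3(2) by (intro exI[of _ "2 * m + 1"] exI[of _ "(fls_nth b3 m)\<^sup>2"]) auto
  qed
  then show "D \<noteq> 0" "ordge (fls_subdegree D) (b1 * b3 + b2\<^sup>2)"
    using leading_nz leading_subdegree by metis+
qed

lemma X_inv_intpow: "fls_X_inv = (fls_X_intpow (- 1) :: 'a::{comm_ring_1} fls)"
  by (simp add: fls_X_inv_conv_shift_1)

text \<open>As in \<open>tame_zero\<close> the term with \<open>b1\<close> or \<open>b3\<close>
  decides the order of \<open>f\<close>, but negative exponents strengthen the bounds on the others: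
  \<open>b1 * b3 + b2^2\<close> has order at least one more than \<open>D\<close>. This extra order
  gives the vanishing at \<open>T\<close> and limits the pole at infinity to a simple one.\<close>

lemma tame_pole:
  fixes f b0 b1 b2 b3 :: "'a::{idom, char2} fls"
  assumes f: "f = b0 ^ 4 + b1 ^ 4 * fls_X_inv + b2 ^ 4 * fls_X_inv\<^sup>2 + b3 ^ 4 * fls_X_inv ^ 3" and f0: "f \<noteq> 0" "odd (fls_subdegree f)"
  defines "D \<equiv> b1\<^sup>2 + b3\<^sup>2 * fls_X_inv"
  shows "D \<noteq> 0" "ordge (fls_subdegree D + 1) (b1 * b3 + b2\<^sup>2)"
proof -
  have p: "fls_X_inv ^ k = (fls_X_intpow (int k * - 1) :: 'a fls)" for k
    unfolding X_inv_intpow by (rule fls_X_intpow_power)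
  have f': "f = b0 ^ 4 + b1 ^ 4 * fls_X_intpow (- 1) + b2 ^ 4 * fls_X_intpow (2 * - 1) + b3 ^ 4 * fls_X_intpow (3 * - 1)"
    unfolding f p using p[of 1] by simp
  note co = fourth_power_coeffs[OF f' disjI2[OF refl] f0(1) refl]
  have "\<exists>n a. a \<noteq> 0 \<and> leading D n a \<and> ordge (n + 1) (b1 * b3 + b2\<^sup>2)"
  proof (cases "fls_subdegree f mod 4 = 3")
    case True
    define m where "m = fls_subdegree f div 4 + 1"
    have e: "fls_subdegree f = 4 * m - 1" unfolding m_def using True by presburger
    have l1: "leading b1 m (fls_nth b1 m)" "fls_nth b1 m \<noteq> 0"
      using co(1,4) by (auto simp: leading_def ordge_def e)
    have o: "ordge (m + 1) b2" "ordge (m + 1) b3" using co(2,3) by (auto simp: ordge_def e)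
    have "ordge (2 * m + 1) (b3\<^sup>2 * fls_X_inv)"
      using ordge_mult[OF ordge_square[OF o(2)] leading_ordge[OF leading_X_inv order_refl]] by (simp add: algebra_simps)
    then have "leading D (2 * m) ((fls_nth b1 m)\<^sup>2)" unfolding D_def by (rule leading_add[OF leading_square[OF l1(1)]])
    moreover have "ordge (2 * m + 1) (b1 * b3 + b2\<^sup>2)"
      using ordge_mult[OF leading_ordge[OF l1(1) order_refl] o(2)] ordge_square[OF o(1)]
      by (intro ordge_add) (auto elim: ordge_mono)
    ultimately show ?thesis using l1(2) by (intro exI[of _ "2 * m"] exI[of _ "(fls_nth b1 m)\<^sup>2"]) auto
  next
    case False
    define m where "m = fls_subdegree f div 4 + 1"
    have e: "fls_subdegree f = 4 * m - 3" unfolding m_def using False f0(2) by presburger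
    have l3: "leading b3 m (fls_nth b3 m)" "fls_nth b3 m \<noteq> 0"
      using co(3,5) by (auto simp: leading_def ordge_def e)
    have o: "ordge m b2" "ordge m b1" using co(1,2) by (auto simp: ordge_def e)
    have "leading (b3\<^sup>2 * fls_X_inv) (2 * m - 1) ((fls_nth b3 m)\<^sup>2)"
      using leading_mult[OF leading_square[OF l3(1)] leading_X_inv] by simp
    then have "leading (b3\<^sup>2 * fls_X_inv + b1\<^sup>2) (2 * m - 1) ((fls_nth b3 m)\<^sup>2)"
      by (rule leading_add) (use ordge_square[OF o(2)] in \<open>simp\<close>)
    then have "leading D (2 * m - 1) ((fls_nth b3 m)\<^sup>2)" unfolding D_def by (simp add: add.commute)
    moreover have "ordge (2 * m - 1 + 1) (b1 * b3 + b2\<^sup>2)"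
      using ordge_mult[OF o(2) leading_ordge[OF l3(1) order_refl]] ordge_square[OF o(1)]
      by (intro ordge_add) (auto elim: ordge_mono)
    ultimately show ?thesis using l3(2) by (intro exI[of _ "2 * m - 1"] exI[of _ "(fls_nth b3 m)\<^sup>2"]) auto
  qed
  then show "D \<noteq> 0" "ordge (fls_subdegree D + 1) (b1 * b3 + b2\<^sup>2)"
    using leading_nz leading_subdegree by metis+
qed

lemma std_point_formal: "std_point x y U \<Longrightarrow> formal_point x y U"
  by (simp add: std_point_def)

text \<open>The expansion of \<open>U\<close> in fourth powers with respect to \<open>x\<close>, and the effect of the change of
  generator from \<open>x\<close> to \<open>U\<close>.\<close>

lemma change_of_generator:
  fixes x U c s t t2 t4 :: "'a::{field, char2}"
  assumes x: "x \<noteq> 0" "x + c \<noteq> 0" and xU: "x\<^sup>2 + c\<^sup>2 = x * (U\<^sup>2 + U + t)"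
    and s: "s\<^sup>2 = c" and t2: "t2\<^sup>2 = t" and t4: "t4\<^sup>2 = t2"
    and f: "f = e0 ^ 4 + e1 ^ 4 * x + e2 ^ 4 * x\<^sup>2 + e3 ^ 4 * x ^ 3"
  obtains b0 b1 b2 b3 where "f = b0 ^ 4 + b1 ^ 4 * U + b2 ^ 4 * U\<^sup>2 + b3 ^ 4 * U ^ 3"
    "x * (e1\<^sup>2 + e3\<^sup>2 * x) = (x + c) * (b1\<^sup>2 + b3\<^sup>2 * U)"
    "x\<^sup>2 * (x * (e1 * e3 + e2\<^sup>2) + (x + c) * (e1\<^sup>2 + e3\<^sup>2 * x)) = x * (x + c)\<^sup>2 * (b1 * b3 + b2\<^sup>2) + x\<^sup>2 * s * (b1\<^sup>2 + b3\<^sup>2 * U)"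
proof -
  \<comment> \<open>The square of \<open>g\<close> is the derivative of \<open>U\<close> with
    respect to \<open>x\<close>.\<close>
  define g where "g = (x + c) / x"
  define h where "h = s / x"
  define T where "T = U + t2"
  have gx: "g * x = x + c" and hx: "h * x = s" unfolding g_def h_def using x by simp_all
  have g0: "g \<noteq> 0" unfolding g_def using x by simp
  have g1: "g = 1 + s * h" unfolding g_def h_def using x(1) s by (simp add: field_simps power2_eq_square)
  have R: "U\<^sup>2 + U + t = g\<^sup>2 * x"
  proof -
    have "x * (U\<^sup>2 + U + t) = x * (g\<^sup>2 * x)" unfolding xU[symmetric] by (simp add: gx power_mult_distrib[symmetric] mult_ac flip: square_add power2_eq_square)
        (metis gx mult.commute mult.left_commute power2_eq_square square_add)
    then show ?thesis using x(1) by simp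
  qed
  \<comment> \<open>Together with \<open>b1\<close> this inverts the linear system stated as
    \<open>A1\<close> and \<open>A3\<close> below; its determinant is \<open>g^2\<close>.\<close>
  define b3 where "b3 = (e3 + h * e1) / g\<^sup>2"
  define b1 where "b1 = ((h * T + g) * e1 + (T + s * g) * e3) / g\<^sup>2"
  define b2 where "b2 = e2 / g + b1 + t4 * b3"
  have det: "(h * T + g) + h * (T + s * g) = g\<^sup>2"
  proof -
    have "(h * T + g) + h * (T + s * g) = g * (1 + s * h)" by (simp add: algebra_simps)
    then show ?thesis unfolding g1[symmetric] by (simp add: power2_eq_square)
  qed
  have gb: "g\<^sup>2 * b1 = (h * T + g) * e1 + (T + s * g) * e3" "g\<^sup>2 * b3 = e3 + h * e1"
    unfolding b1_def b3_def using g0 by simp_all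
  have A1: "e1 = b1 + b3 * (T + s * g)"
  proof -
    have "g\<^sup>2 * (b1 + b3 * (T + s * g)) = g\<^sup>2 * b1 + (g\<^sup>2 * b3) * (T + s * g)"
      by (simp only: distrib_left mult.assoc)
    also have "\<dots> = e1 * ((h * T + g) + h * (T + s * g))" unfolding gb by (simp add: algebra_simps)
    finally have "g\<^sup>2 * (b1 + b3 * (T + s * g)) = e1 * ((h * T + g) + h * (T + s * g))" .
    then show ?thesis unfolding det using g0 by simp
  qed
  have A3: "e3 = b1 * h + b3 * (h * T + g)"
  proof -
    have "g\<^sup>2 * (b1 * h + b3 * (h * T + g)) = (g\<^sup>2 * b1) * h + (g\<^sup>2 * b3) * (h * T + g)"
      by (simp only: distrib_left mult.assoc)
    also have "\<dots> = e3 * ((h * T + g) + h * (T + s * g))" unfolding gb by (simp add: algebra_simps)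
    finally have "g\<^sup>2 * (b1 * h + b3 * (h * T + g)) = e3 * ((h * T + g) + h * (T + s * g))" .
    then show ?thesis unfolding det using g0 by simp
  qed
  have A2: "e2 = g * (b1 + b2 + t4 * b3)" unfolding b2_def using g0 by (simp add: add_ac)
  have T2: "T\<^sup>2 = U\<^sup>2 + t" unfolding T_def by (simp add: t2)
  have hs: "h * s = g + 1" unfolding g1 by (simp add: mult.commute)
  have h2x: "h\<^sup>2 * x = g + 1" using hs hx by (simp add: power2_eq_square mult.assoc)
  have sx: "s\<^sup>2 + x = g * x" unfolding s gx by (simp add: add.commute)
  have UT: "T\<^sup>2 + g\<^sup>2 * x = U" unfolding T2 R[symmetric] by (simp add: add_ac)
  have D: "e1\<^sup>2 + e3\<^sup>2 * x = g * (b1\<^sup>2 + b3\<^sup>2 * U)"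
  proof -
    have "e1\<^sup>2 + e3\<^sup>2 * x = b1\<^sup>2 * (1 + h\<^sup>2 * x) + b3\<^sup>2 * (T\<^sup>2 * (1 + h\<^sup>2 * x) + g\<^sup>2 * (s\<^sup>2 + x))"
      unfolding A1 A3 square_add power_mult_distrib by (simp only: distrib_left distrib_right mult_ac add_ac mult_1_right mult_1_left)
    also have "\<dots> = g * (b1\<^sup>2 + b3\<^sup>2 * (T\<^sup>2 + g\<^sup>2 * x))"
      unfolding h2x sx by (simp add: algebra_simps power2_eq_square)
    finally show ?thesis unfolding UT .
  qed
  \<comment> \<open>Divided by \<open>D\<close>, this is the affine transformation law of
    \<open>N / D\<close>: scaling by \<open>g\<close> and a shift by \<open>g + h / g\<close>, which
    depends only on \<open>x\<close> and \<open>U\<close>.\<close>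
  have N: "e1 * e3 + e2\<^sup>2 = g\<^sup>2 * (b1 * b3 + b2\<^sup>2) + (g\<^sup>2 + h) * (b1\<^sup>2 + b3\<^sup>2 * U)"
  proof -
    have "e1 * e3 + e2\<^sup>2 = b1\<^sup>2 * h + b1 * b3 * (g + (h * s) * g) + b3\<^sup>2 * (h * T\<^sup>2 + T * g * (1 + h * s) + s * g\<^sup>2) + g\<^sup>2 * (b1\<^sup>2 + b2\<^sup>2 + t2 * b3\<^sup>2)"
      unfolding A1 A3 A2 square_add power_mult_distrib t4 by (simp add: algebra_simps power2_eq_square)
    also have "\<dots> = g\<^sup>2 * (b1 * b3 + b2\<^sup>2) + (g\<^sup>2 + h) * b1\<^sup>2 + b3\<^sup>2 * (h * T\<^sup>2 + g\<^sup>2 * (T + t2) + s * g\<^sup>2)"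
      unfolding hs by (simp add: algebra_simps power2_eq_square)
    also have "T + t2 = U" unfolding T_def by (simp add: add_ac)
    also have "h * T\<^sup>2 + g\<^sup>2 * U + s * g\<^sup>2 = (g\<^sup>2 + h) * U"
    proof -
      have "s * g\<^sup>2 = h * (g\<^sup>2 * x)" using hx by (metis mult.commute mult.left_commute)
      then have "h * T\<^sup>2 + g\<^sup>2 * U + s * g\<^sup>2 = h * (T\<^sup>2 + g\<^sup>2 * x) + g\<^sup>2 * U" by (simp add: algebra_simps)
      then show ?thesis unfolding UT by (simp add: algebra_simps)
    qed
    finally show ?thesis by (simp add: algebra_simps)
  qed
  have gx4: "g ^ 4 * x\<^sup>2 = U ^ 4 + U\<^sup>2 + t\<^sup>2"
  proof -
    have "g ^ 4 * x\<^sup>2 = (g\<^sup>2 * x)\<^sup>2" by (simp add: power_mult_distrib flip: power_mult)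
    then show ?thesis unfolding R[symmetric] by (simp flip: power_mult)
  qed
  define G0 where "G0 = T + t4"
  have T4: "T ^ 4 = U ^ 4 + t\<^sup>2" unfolding T_def fourth_power_add using t2 by (simp flip: power_mult) (metis power2_eq_square power4_eq_xxxx mult.assoc)
  have U2: "U\<^sup>2 = T ^ 4 + g ^ 4 * x\<^sup>2" unfolding gx4 T4 by (simp add: add_ac)
  have t44: "t4 ^ 4 = t" using t4 t2 by (metis power2_eq_square power4_eq_xxxx mult.assoc)
  \<comment> \<open>The expansions of \<open>U\<close>, \<open>U^2\<close> and \<open>U^3\<close> in
    fourth powers with respect to \<open>x\<close> are the columns of the linear system that relates
    the \<open>e\<close> to the \<open>b\<close>.\<close>
  have U1: "U = G0 ^ 4 + x + g ^ 4 * x\<^sup>2 + h ^ 4 * x ^ 3"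
  proof -
    have "g\<^sup>2 * x = x + (h\<^sup>2 * x)\<^sup>2 * x" unfolding h2x by (simp add: algebra_simps)
    then have "U\<^sup>2 + U + t = x + h ^ 4 * x ^ 3" unfolding R by (simp add: power2_eq_square power3_eq_cube power4_eq_xxxx mult_ac)
    then show ?thesis unfolding gx4 G0_def fourth_power_add T4 t44 by (rule char2_eq) (simp add: add_ac)
  qed
  have U3: "U ^ 3 = (G0 ^ 4 * T ^ 4 + (g\<^sup>2 * x) ^ 4) + (T + s * g) ^ 4 * x + (g * (T + G0)) ^ 4 * x\<^sup>2 + (h * T + g) ^ 4 * x ^ 3"
  proof -
    have "U ^ 3 = U * U\<^sup>2" by (simp add: power3_eq_cube power2_eq_square)
    also have "\<dots> = (G0 ^ 4 + x + g ^ 4 * x\<^sup>2 + h ^ 4 * x ^ 3) * (T ^ 4 + g ^ 4 * x\<^sup>2)"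
      using U1 U2 by simp
    also have "\<dots> = (G0 ^ 4 * T ^ 4 + (g\<^sup>2 * x) ^ 4) + (T ^ 4 + ((h * x) * g) ^ 4) * x + (g * (T + G0)) ^ 4 * x\<^sup>2 + (h * T + g) ^ 4 * x ^ 3"
      unfolding fourth_power_add power_mult_distrib by (simp add: algebra_simps) (simp add: eval_nat_numeral algebra_simps)
    finally show ?thesis unfolding hx fourth_power_add .
  qed
  define b0 where "b0 = e0 + b1 * G0 + b2 * T + b3 * (G0 * T + g\<^sup>2 * x)"
  have TG: "T + G0 = t4" unfolding G0_def by simp
  have "b0 ^ 4 + b1 ^ 4 * U + b2 ^ 4 * U\<^sup>2 + b3 ^ 4 * U ^ 3 = f"
  proof -
    have "b0 ^ 4 + b1 ^ 4 * U + b2 ^ 4 * U\<^sup>2 + b3 ^ 4 * U ^ 3 =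
      e0 ^ 4 + (b1 + b3 * (T + s * g)) ^ 4 * x + (g * (b1 + b2 + t4 * b3)) ^ 4 * x\<^sup>2 + (b1 * h + b3 * (h * T + g)) ^ 4 * x ^ 3"
      unfolding U3 TG unfolding b0_def fourth_power_add power_mult_distrib
      by (subst U1, subst U2) (simp add: algebra_simps)
    then show ?thesis unfolding f A1[symmetric] A2[symmetric] A3[symmetric] .
  qed
  moreover have "x * (e1\<^sup>2 + e3\<^sup>2 * x) = (x + c) * (b1\<^sup>2 + b3\<^sup>2 * U)"
    unfolding D gx[symmetric] by (simp only: mult_ac)
  moreover have "x\<^sup>2 * (x * (e1 * e3 + e2\<^sup>2) + (x + c) * (e1\<^sup>2 + e3\<^sup>2 * x)) = x * (x + c)\<^sup>2 * (b1 * b3 + b2\<^sup>2) + x\<^sup>2 * s * (b1\<^sup>2 + b3\<^sup>2 * U)"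
  proof -
    let ?D = "b1\<^sup>2 + b3\<^sup>2 * U" and ?N = "b1 * b3 + b2\<^sup>2"
    have "x * (e1 * e3 + e2\<^sup>2) + (x + c) * (e1\<^sup>2 + e3\<^sup>2 * x) = x * (g\<^sup>2 * ?N + (g\<^sup>2 + h) * ?D) + (g * x) * (g * ?D)"
      unfolding N D gx ..
    also have "\<dots> = x * g\<^sup>2 * ?N + (h * x) * ?D" by (simp add: algebra_simps power2_eq_square)
    finally have "x\<^sup>2 * (x * (e1 * e3 + e2\<^sup>2) + (x + c) * (e1\<^sup>2 + e3\<^sup>2 * x)) = x * (g * x)\<^sup>2 * ?N + x\<^sup>2 * (h * x) * ?D"
      by (simp add: distrib_left power_mult_distrib mult_ac)
    then show ?thesis unfolding gx hx .
  qed
  ultimately show thesis using that by metis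
qed

lemma pe_nth_0:
  fixes p :: "'a::{idom, char2} poly"
  assumes "ordge 0 x"
  shows "ordge 0 (pe p x) \<and> fls_nth (pe p x) 0 = poly p (fls_nth x 0)"
proof (induction p)
  case (pCons a p)
  have "ordge 0 (x * pe p x)" "fls_nth (x * pe p x) 0 = fls_nth x 0 * fls_nth (pe p x) 0"
    using ordge_mult[OF assms, of 0 "pe p x"] nth_mult_ordge[OF assms, of 0 "pe p x"] pCons by simp_all
  then show ?case using pCons ordge_const[of a] by (auto intro: ordge_add)
qed auto

lemma ordge_cancel:
  fixes v :: "'a::field fls"
  assumes "v \<noteq> 0" "d \<noteq> 0" "ordge (fls_subdegree (v * d) + k) (v * w)"
  shows "ordge (fls_subdegree d + k) w"
proof (cases "w = 0")
  case False
  then show ?thesis using assms by (simp add: ordge_iff)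
qed simp

lemma ordge_scale:
  fixes v :: "'a::field fls"
  assumes "v \<noteq> 0" "d \<noteq> 0" "ordge (fls_subdegree d + k) w"
  shows "ordge (fls_subdegree (v * d) + k) (v * w)"
proof (cases "w = 0")
  case False
  then show ?thesis using assms by (simp add: ordge_iff)
qed simp

lemma pe_formal_nz: "formal_point x y U \<Longrightarrow> p \<noteq> 0 \<Longrightarrow> pe p x \<noteq> 0"
  using pe_transcendental unfolding formal_point_def by metis

text \<open>A function without affine poles that vanishes at \<open>T\<close> and has at most a simple pole at
  infinity is zero.  The function is \<open>u / d\<close> with \<open>d\<close> a polynomial in \<open>x\<close>; the roots of \<open>d\<close> are
  cancelled one at a time.\<close>

lemma regular_function_zero:
  fixes d :: "F2t_bar poly" and u :: cfun
  assumes "d \<noteq> 0"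
    "\<And>x y. formal_point x y fls_X_inv \<Longrightarrow> leading x (- 2) 1 \<Longrightarrow> leading y (- 3) 1 \<Longrightarrow> ordge (fls_subdegree (pe d x) + - 1) (ev u x y)"
    "\<And>x y. formal_point x y fls_X_inv \<Longrightarrow> leading x 2 (c0\<^sup>2) \<Longrightarrow> leading (y + cc\<^sup>2) 1 (c0\<^sup>2) \<Longrightarrow> ordge (fls_subdegree (pe d x) + 1) (ev u x y)"
    "\<And>a x y U. a \<noteq> 0 \<Longrightarrow> x = fls_const a + fls_X \<Longrightarrow> formal_point x y U \<Longrightarrow> ordge 0 y \<Longrightarrow> ordge (fls_subdegree (pe d x) + 0) (ev u x y)"
  shows "u = (0, 0)"
  using assms
proof (induction "degree d" arbitrary: d u)
  case 0
  then obtain a where d: "d = [:a:]" by (metis degree_eq_zeroE)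
  obtain x y where O: "formal_point x y fls_X_inv" "leading x (- 2) 1" "leading y (- 3) 1" by (rule formal_point_infinity)
  interpret generic_point x y by unfold_locales (fact O)+
  show ?case
  proof (cases "u = (0, 0)")
    case False
    then have nz: "fst u \<noteq> 0 \<or> snd u \<noteq> 0" by (auto simp: prod_eq_iff)
    have "ordge (- 1) (ev u x y)" using "0.prems"(2)[OF O] d by simp
    moreover have "ev u x y \<noteq> 0" using ev_eq_0[OF O(1)] False by simp
    \<comment> \<open>The possible pole orders at infinity are zero, two, three and so on; a pole
      that is at most simple leaves only constants, which the zero at \<open>T\<close> then
      excludes.\<close>
    ultimately have "- 1 \<le> - deg2 (fst u) (snd u)" using subdegree_PQ(1)[OF nz] by (simp add: ordge_iff ev_def)
    then have "snd u = 0" "degree (fst u) = 0" by (auto simp: deg2_def max_def split: if_splits)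
    then obtain e where u: "u = ([:e:], 0)" by (metis degree_eq_zeroE prod.collapse)
    obtain x' y' where T: "formal_point x' y' fls_X_inv" "leading x' 2 (c0\<^sup>2)" "leading (y' + cc\<^sup>2) 1 (c0\<^sup>2)" by (rule formal_point_T)
    have "ordge 1 (ev u x' y')" using "0.prems"(3)[OF T] d by simp
    then have "ordge 1 (fls_const e)" by (simp add: u ev_def)
    then have "fls_nth (fls_const e) 0 = 0" unfolding ordge_def by (meson zero_less_one)
    then show ?thesis using u by simp
  qed
next
  case (Suc n)
  then obtain r where r: "poly d r = 0" using alg_closed_imp_poly_has_root[of d] by auto
  then obtain d' where d: "d = [:r, 1:] * d'" using poly_eq_0_iff_dvd[of d r] by (auto elim!: dvdE)
  have d'0: "d' \<noteq> 0" using d Suc.prems(1) by auto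
  have "degree d = 1 + degree d'" unfolding d using d'0 by (subst degree_mult_eq) auto
  then have deg: "n = degree d'" using Suc.hyps(2) by simp
  have "\<exists>u'. fst u = [:r, 1:] * fst u' \<and> snd u = [:r, 1:] * snd u'"
  proof (cases "r = 0")
    case False
    obtain b where "poly [:poly curve_poly r, r, 1:] b = 0"
      using alg_closed_imp_poly_has_root[of "[:poly curve_poly r, r, 1:]"] by auto
    then have "poly curve_poly r + b * (r + b) = 0" by simp
    then have b: "b\<^sup>2 + r * b = r ^ 3 + t_gen * r\<^sup>2 + t_gen ^ 6"
      by (simp add: add_eq_0_iff_eq curve_poly_def algebra_simps power2_eq_square power3_eq_cube)
    \<comment> \<open>The second point with abscissa \<open>r\<close>. Vanishing at both points
      makes both components of \<open>u\<close> vanish at \<open>r\<close>, since the ordinates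
      differ by \<open>r \<noteq> 0\<close>.\<close>
    have b': "(b + r)\<^sup>2 + r * (b + r) = r ^ 3 + t_gen * r\<^sup>2 + t_gen ^ 6"
      unfolding b[symmetric] by (simp add: algebra_simps power2_eq_square)
    have val: "poly (fst u) r + poly (snd u) r * e = 0" if e: "e\<^sup>2 + r * e = r ^ 3 + t_gen * r\<^sup>2 + t_gen ^ 6" for e
    proof -
      obtain y U where P: "formal_point (fls_const r + fls_X) y U" "ordge 0 y" "fls_nth y 0 = e"
        by (rule formal_point_affine[OF False e])
      let ?x = "fls_const r + fls_X :: F2t_bar fls"
      have ox: "ordge 0 ?x" "fls_nth ?x 0 = r" by (auto simp: ordge_def)
      have pn: "pe d' ?x \<noteq> 0" using pe_formal_nz[OF P(1) d'0] .
      have "pe d ?x = fls_X * pe d' ?x" unfolding d by (simp add: algebra_simps)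
      then have "fls_subdegree (pe d ?x) = 1 + fls_subdegree (pe d' ?x)" using pn by simp
      moreover have "fls_subdegree (pe d' ?x) \<ge> 0" using pe_nth_0[OF ox(1), of d'] ordge_iff[OF pn] by simp
      ultimately have "ordge 1 (ev u ?x y)" using Suc.prems(4)[OF False refl P(1,2)] by (auto elim: ordge_mono)
      then have "fls_nth (ev u ?x y) 0 = 0" unfolding ordge_def by (meson zero_less_one)
      moreover have "fls_nth (ev u ?x y) 0 = poly (fst u) r + poly (snd u) r * e"
        unfolding ev_def using nth_mult_ordge[of 0 "pe (snd u) ?x" 0 y] pe_nth_0[OF ox(1)] P ox(2) by simp
      ultimately show ?thesis by simp
    qed
    have e1: "poly (fst u) r + poly (snd u) r * b = 0" by (rule val[OF b])
    have e2: "poly (fst u) r + poly (snd u) r * (b + r) = 0" by (rule val[OF b'])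
    have "poly (snd u) r * r = (poly (fst u) r + poly (snd u) r * b) + (poly (fst u) r + poly (snd u) r * (b + r))"
      by (simp add: algebra_simps)
    then have "poly (snd u) r = 0" using False e1 e2 by simp
    moreover from this e1 have "poly (fst u) r = 0" by simp
    ultimately obtain p q where "fst u = [:- r, 1:] * p" "snd u = [:- r, 1:] * q"
      by (metis dvdE poly_eq_0_iff_dvd)
    then show ?thesis by (intro exI[of _ "(p, q)"]) simp
  next
    case True
    obtain x y where T: "formal_point x y fls_X_inv" "leading x 2 (c0\<^sup>2)" "leading (y + cc\<^sup>2) 1 (c0\<^sup>2)" by (rule formal_point_T)
    obtain p0 p1 where p: "fst u = pCons p0 p1" by (cases "fst u")
    obtain q0 q1 where q: "snd u = pCons q0 q1" by (cases "snd u")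
    have x0: "x \<noteq> 0" "fls_subdegree x = 2" using leading_nz[OF T(2)] leading_subdegree[OF T(2)] by auto
    have ox: "ordge 0 x" "ordge 2 x" using leading_ordge[OF T(2)] by auto
    have oy: "ordge 0 y"
    proof -
      have eq: "y = (y + cc\<^sup>2) + fls_const (c0\<^sup>2)" by (simp add: fls_const_power add.assoc)
      show ?thesis by (subst eq) (intro ordge_add ordge_const leading_ordge[OF T(3)], simp)
    qed
    have pn: "pe d' x \<noteq> 0" using pe_formal_nz[OF T(1) d'0] .
    have "pe d x = x * pe d' x" unfolding d True by simp
    then have "fls_subdegree (pe d x) = 2 + fls_subdegree (pe d' x)" using pn x0 by simp
    moreover have "fls_subdegree (pe d' x) \<ge> 0" using pe_nth_0[OF ox(1), of d'] ordge_iff[OF pn] by simp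
    \<comment> \<open>At \<open>T\<close> the function \<open>x\<close> has a double and
      \<open>y + cc^2\<close> a simple zero, so the coefficients of index zero and one determine the
      constant terms \<open>p0\<close> and \<open>q0\<close>.\<close>
    ultimately have o3: "ordge 3 (ev u x y)" using Suc.prems(3)[OF T] by (auto elim: ordge_mono)
    have eq: "ev u x y = (fls_const (p0 + q0 * c0\<^sup>2) + fls_const q0 * (y + cc\<^sup>2)) + x * (pe p1 x + pe q1 x * y)"
      unfolding ev_def p q by (simp add: algebra_simps fls_const_add fls_const_power flip: fls_const_mult_const)
    have o2: "ordge 2 (x * (pe p1 x + pe q1 x * y))"
      using ordge_mult[OF ox(2) ordge_add[of 0 "pe p1 x" "pe q1 x * y"]] pe_nth_0[OF ox(1)] ordge_mult[of 0 "pe q1 x" 0 y] oy by simp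
    have n1: "fls_nth (ev u x y) 1 = q0 * c0\<^sup>2"
      unfolding eq using o2 T(3) nth_mult_ordge[OF ordge_const leading_ordge[OF T(3) order_refl], of q0] by (simp add: ordge_def leading_def)
    have "fls_nth (ev u x y) 1 = 0" using o3 by (simp add: ordge_def)
    then have q0: "q0 = 0" using n1 by simp
    have "fls_nth (ev u x y) 0 = p0" unfolding eq q0 using o2 by (simp add: ordge_def)
    then have p0: "p0 = 0" using o3 by (simp add: ordge_def)
    show ?thesis unfolding True p q p0 q0 by (intro exI[of _ "(p1, q1)"]) simp
  qed
  then obtain u' where u': "fst u = [:r, 1:] * fst u'" "snd u = [:r, 1:] * snd u'" by blast
  have evu: "ev u x y = pe [:r, 1:] x * ev u' x y" "pe d x = pe [:r, 1:] x * pe d' x" for x y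
    unfolding ev_def u' d pe_mult by (simp_all only: distrib_left mult.assoc)
  have cancel: "ordge (fls_subdegree (pe d' x) + k) (ev u' x y)"
    if "formal_point x y U" "ordge (fls_subdegree (pe d x) + k) (ev u x y)" for x y U k
    by (rule ordge_cancel[OF _ pe_formal_nz[OF that(1) d'0] that(2)[unfolded evu]])
      (rule pe_formal_nz[OF that(1)], simp)
  have "u' = (0, 0)"
  proof (rule Suc.hyps(1)[OF deg d'0])
    show "ordge (fls_subdegree (pe d' x) + - 1) (ev u' x y)"
      if "formal_point x y fls_X_inv" "leading x (- 2) 1" "leading y (- 3) 1" for x y
      by (rule cancel[OF that(1) Suc.prems(2)[OF that]])
    show "ordge (fls_subdegree (pe d' x) + 1) (ev u' x y)"
      if "formal_point x y fls_X_inv" "leading x 2 (c0\<^sup>2)" "leading (y + cc\<^sup>2) 1 (c0\<^sup>2)" for x y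
      by (rule cancel[OF that(1) Suc.prems(3)[OF that]])
    show "ordge (fls_subdegree (pe d' x) + 0) (ev u' x y)"
      if "a \<noteq> 0" "x = fls_const a + fls_X" "formal_point x y U" "ordge 0 y" for a x y U
      by (rule cancel[OF that(3) Suc.prems(4)[OF that]])
  qed
  then show ?case using u' by (simp add: prod_eq_iff)
qed

theorem no_tame_function:
  assumes "cf_perf u" "cf_perf v" "v \<noteq> (0, 0)"
    and tame: "\<And>x y U. std_point x y U \<Longrightarrow> odd_order (ev u x y / ev v x y)"
  shows False
proof -
  \<comment> \<open>Since \<open>u / v = u v^3 / v^4\<close>, only the numerator has to be
    decomposed over the fourth powers.\<close>
  define w where "w = cf_mult u (cf_mult v (cf_mult v v))"
  have "cf_perf w" unfolding w_def using assms by (intro cf_perf_mult)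
  then obtain A0 A1 A2 A3 where A: "cf_perf A0" "cf_perf A1" "cf_perf A2" "cf_perf A3"
    "\<forall>x y U. formal_point x y U \<longrightarrow>
      x ^ 8 * ev w x y = ev A0 x y ^ 4 + ev A1 x y ^ 4 * x + ev A2 x y ^ 4 * x\<^sup>2 + ev A3 x y ^ 4 * x ^ 3"
    by (rule cfun_fourth_power_parts) (rule that)
  define xp where "xp = ([:0, 1:] :: F2t_bar poly, 0 :: F2t_bar poly)"
  define xcp where "xcp = ([:c0, 1:] :: F2t_bar poly, 0 :: F2t_bar poly)"
  define N where "N = cf_add (cf_mult A1 A3) (cf_mult A2 A2)"
  define D where "D = cf_add (cf_mult A1 A1) (cf_mult (cf_mult A3 A3) xp)"
  define K where "K = cf_add (cf_mult xp N) (cf_mult xcp D)"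
  \<comment> \<open>The conjugate of \<open>D\<close>: the product of both is a polynomial in
    \<open>x\<close>, so that \<open>K / D\<close> gets the kind of denominator required by
    \<open>regular_function_zero\<close>.\<close>
  define D' where "D' = (fst D + snd D * [:0, 1:], snd D)"
  have evs: "ev N x y = ev A1 x y * ev A3 x y + (ev A2 x y)\<^sup>2" "ev D x y = (ev A1 x y)\<^sup>2 + (ev A3 x y)\<^sup>2 * x"
    "ev K x y = x * ev N x y + (x + cc) * ev D x y" "pe (norm_poly (fst D) (snd D)) x = ev D' x y * ev D x y"
    "ev (cf_mult D' K) x y = ev D' x y * ev K x y"
    if "formal_point x y U" for x y U
  proof -
    note f = formal_point_curve[OF that]
    have e: "ev xp x y = x" "ev xcp x y = x + cc" by (simp_all add: ev_def xp_def xcp_def add.commute)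
    show "ev N x y = ev A1 x y * ev A3 x y + (ev A2 x y)\<^sup>2" "ev D x y = (ev A1 x y)\<^sup>2 + (ev A3 x y)\<^sup>2 * x"
      "ev K x y = x * ev N x y + (x + cc) * ev D x y" "ev (cf_mult D' K) x y = ev D' x y * ev K x y"
      unfolding N_def D_def K_def ev_add ev_mult[OF f] e by (simp_all add: power2_eq_square)
    show "pe (norm_poly (fst D) (snd D)) x = ev D' x y * ev D x y"
      unfolding pe_norm_poly[OF f] by (simp add: ev_def D'_def algebra_simps)
  qed
  \<comment> \<open>Division of the \<open>A\<close> by \<open>d\<close> changes \<open>N\<close>
    and \<open>D\<close> by the common factor \<open>d^2\<close>, and the constant that makes the
    order odd is absorbed into the fourth power \<open>e0\<close>.\<close>
  have local: "\<exists>z e0 e1 e2 e3 f. z \<noteq> 0 \<and> f \<noteq> 0 \<and> odd (fls_subdegree f) \<and> f = e0 ^ 4 + e1 ^ 4 * x + e2 ^ 4 * x\<^sup>2 + e3 ^ 4 * x ^ 3 \<and>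
      ev D x y = z * (e1\<^sup>2 + e3\<^sup>2 * x) \<and> ev N x y = z * (e1 * e3 + e2\<^sup>2)"
    if std: "std_point x y U" for x y U
  proof -
    have fp: "formal_point x y U" using std by (rule std_point_formal)
    have x0: "x \<noteq> 0" using fp unfolding formal_point_def by (metis fls_const_0)
    have v0: "ev v x y \<noteq> 0" using ev_eq_0[OF fp] assms(3) by simp
    define d where "d = x\<^sup>2 * ev v x y"
    have d0: "d \<noteq> 0" unfolding d_def using x0 v0 by simp
    obtain a where a: "ev u x y / ev v x y + fls_const a \<noteq> 0" "odd (fls_subdegree (ev u x y / ev v x y + fls_const a))"
      using tame[OF std] unfolding odd_order_def by blast
    obtain b where b: "b ^ 4 = a" using nth_root_exists[of 4 a] by auto
    have "ev u x y / ev v x y = (x ^ 8 * ev w x y) / d ^ 4"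
    proof -
      have "x ^ 8 * ev w x y = x ^ 8 * (ev u x y * ev v x y ^ 3)"
        unfolding w_def ev_mult[OF formal_point_curve[OF fp]] by (simp add: power3_eq_cube)
      moreover have "d ^ 4 = x ^ 8 * ev v x y ^ 4" unfolding d_def by (simp add: power_mult_distrib flip: power_mult)
      ultimately show ?thesis using x0 v0 by (simp add: field_simps power3_eq_cube power4_eq_xxxx)
    qed
    also have "\<dots> = (ev A0 x y / d) ^ 4 + (ev A1 x y / d) ^ 4 * x + (ev A2 x y / d) ^ 4 * x\<^sup>2 + (ev A3 x y / d) ^ 4 * x ^ 3"
      unfolding A(5)[rule_format, OF fp] by (simp add: add_divide_distrib power_divide)
    finally have eF: "ev u x y / ev v x y + fls_const a = (ev A0 x y / d + fls_const b) ^ 4 + (ev A1 x y / d) ^ 4 * x + (ev A2 x y / d) ^ 4 * x\<^sup>2 + (ev A3 x y / d) ^ 4 * x ^ 3"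
      unfolding b[symmetric] by (simp add: fls_const_power add_ac)
    have eD: "ev D x y = d\<^sup>2 * ((ev A1 x y / d)\<^sup>2 + (ev A3 x y / d)\<^sup>2 * x)"
      and eN: "ev N x y = d\<^sup>2 * (ev A1 x y / d * (ev A3 x y / d) + (ev A2 x y / d)\<^sup>2)"
      unfolding evs(1,2)[OF fp] using d0 by (simp_all add: distrib_left power_divide power2_eq_square)
    have zz: "d\<^sup>2 \<noteq> 0" using d0 by simp
    show ?thesis by (intro exI conjI) (rule zz, rule a(1), rule a(2), rule eF, rule eD, rule eN)
  qed
  have affine: "ev D x y \<noteq> 0 \<and> ordge (fls_subdegree (ev D x y) + 0) (ev K x y)"
    if P: "a \<noteq> 0" "x = fls_const a + fls_X" "formal_point x y U" "ordge 0 y" for a x y U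
  proof -
    have "std_point x y U" using P unfolding std_point_def by blast
    from local[OF this] obtain z e0 e1 e2 e3 f where z: "z \<noteq> 0" "f \<noteq> 0" "odd (fls_subdegree f)"
      "f = e0 ^ 4 + e1 ^ 4 * x + e2 ^ 4 * x\<^sup>2 + e3 ^ 4 * x ^ 3" "ev D x y = z * (e1\<^sup>2 + e3\<^sup>2 * x)" "ev N x y = z * (e1 * e3 + e2\<^sup>2)"
      by blast
    \<comment> \<open>The passage from \<open>x\<close> to the uniformizer
      \<open>x + fls_const a\<close> is a shift by the fourth power \<open>r ^ 4\<close>; it changes
      the coefficients but neither \<open>D\<close> nor \<open>N\<close>.\<close>
    obtain r' where r': "r' ^ 4 = a" using nth_root_exists[of 4 a] by auto
    define r where "r = fls_const r'"
    have x: "x = r ^ 4 + fls_X" unfolding P(2) r_def r'[symmetric] by (simp add: fls_const_power)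
    have gen: "e0 ^ 4 + e1 ^ 4 * (r ^ 4 + h) + e2 ^ 4 * (r ^ 4 + h)\<^sup>2 + e3 ^ 4 * (r ^ 4 + h) ^ 3
       = (e0 + e1 * r + e2 * r\<^sup>2 + e3 * r ^ 3) ^ 4 + (e1 + e3 * r\<^sup>2) ^ 4 * h + (e2 + e3 * r) ^ 4 * h\<^sup>2 + e3 ^ 4 * h ^ 3" for h :: "F2t_bar fls"
      by (simp add: algebra_simps power_mult_distrib flip: power_mult) (simp add: eval_nat_numeral algebra_simps)
    have f: "f = (e0 + e1 * r + e2 * r\<^sup>2 + e3 * r ^ 3) ^ 4 + (e1 + e3 * r\<^sup>2) ^ 4 * fls_X + (e2 + e3 * r) ^ 4 * fls_X\<^sup>2 + e3 ^ 4 * fls_X ^ 3"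
      unfolding z(4) x gen ..
    have D: "(e1 + e3 * r\<^sup>2)\<^sup>2 + e3\<^sup>2 * fls_X = e1\<^sup>2 + e3\<^sup>2 * x"
      unfolding x by (simp add: algebra_simps power_mult_distrib flip: power_mult)
    have N: "(e1 + e3 * r\<^sup>2) * e3 + (e2 + e3 * r)\<^sup>2 = e1 * e3 + e2\<^sup>2"
      by (simp add: algebra_simps power2_eq_square)
    from tame_zero[OF f z(2,3)] have t: "e1\<^sup>2 + e3\<^sup>2 * x \<noteq> 0" "ordge (fls_subdegree (e1\<^sup>2 + e3\<^sup>2 * x)) (e1 * e3 + e2\<^sup>2)"
      unfolding D N by auto
    have o1: "ordge (fls_subdegree (ev D x y)) (ev N x y)"
      unfolding z(5,6) using ordge_scale[OF z(1) t(1), of 0] t(2) by simp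
    have ox: "ordge 0 x" "ordge 0 (x + cc)" unfolding P(2) by (auto simp: ordge_def)
    have "ordge (fls_subdegree (ev D x y)) (ev K x y)" unfolding evs(3)[OF P(3)]
      using ordge_mult[OF ox(1) o1] ordge_mult[OF ox(2) ordge_subdegree[of "ev D x y"]] by (auto intro: ordge_add)
    then show ?thesis using t(1) z(1,5) by simp
  qed
  \<comment> \<open>Here \<open>m\<close> and \<open>n\<close> are the orders of \<open>x\<close>
    and \<open>x + cc\<close>, and \<open>k\<close> is the bound wanted for \<open>K / D\<close>. In
    terms of \<open>U\<close> that quotient is
    \<open>(x + cc) * ?N / ?D + fls_const s' * x / (x + cc)\<close>, where \<open>?N / ?D\<close>
    has order at least one.\<close>
  have pole: "ev D x y \<noteq> 0 \<and> ordge (fls_subdegree (ev D x y) + k) (ev K x y)"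
    if P: "std_point x y fls_X_inv" "fls_subdegree x = m" "fls_subdegree (x + cc) = n" "x + cc \<noteq> 0"
      "m = - 2 \<and> n = - 2 \<and> k = - 1 \<or> m = 2 \<and> n = 0 \<and> k = 1" for x y m n k
  proof -
    have fp: "formal_point x y fls_X_inv" using P(1) by (rule std_point_formal)
    have x0: "x \<noteq> 0" using fp unfolding formal_point_def by (metis fls_const_0)
    obtain z e0 e1 e2 e3 f where z: "z \<noteq> 0" "f \<noteq> 0" "odd (fls_subdegree f)"
      "f = e0 ^ 4 + e1 ^ 4 * x + e2 ^ 4 * x\<^sup>2 + e3 ^ 4 * x ^ 3" "ev D x y = z * (e1\<^sup>2 + e3\<^sup>2 * x)" "ev N x y = z * (e1 * e3 + e2\<^sup>2)"
      using local[OF P(1)] by blast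
    obtain s' t2' t4' where "s'\<^sup>2 = c0" "t2'\<^sup>2 = t_gen" "t4'\<^sup>2 = t2'"
      using nth_root_exists[of 2] by (metis zero_less_numeral)
    then have roots: "(fls_const s')\<^sup>2 = cc" "(fls_const t2')\<^sup>2 = tt" "(fls_const t4')\<^sup>2 = fls_const t2'"
      by (simp_all flip: fls_const_power)
    have xU: "x\<^sup>2 + cc\<^sup>2 = x * (fls_X_inv\<^sup>2 + fls_X_inv + tt)" using fp unfolding formal_point_def by blast
    obtain b0 b1 b2 b3 where b: "f = b0 ^ 4 + b1 ^ 4 * fls_X_inv + b2 ^ 4 * fls_X_inv\<^sup>2 + b3 ^ 4 * fls_X_inv ^ 3"
      "x * (e1\<^sup>2 + e3\<^sup>2 * x) = (x + cc) * (b1\<^sup>2 + b3\<^sup>2 * fls_X_inv)"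
      "x\<^sup>2 * (x * (e1 * e3 + e2\<^sup>2) + (x + cc) * (e1\<^sup>2 + e3\<^sup>2 * x)) = x * (x + cc)\<^sup>2 * (b1 * b3 + b2\<^sup>2) + x\<^sup>2 * fls_const s' * (b1\<^sup>2 + b3\<^sup>2 * fls_X_inv)"
      using change_of_generator[OF x0 P(4) xU roots z(4)] by blast
    let ?D = "b1\<^sup>2 + b3\<^sup>2 * fls_X_inv" and ?E = "e1\<^sup>2 + e3\<^sup>2 * x" and ?N = "b1 * b3 + b2\<^sup>2"
    have t: "?D \<noteq> 0" "ordge (fls_subdegree ?D + 1) ?N" using tame_pole[OF b(1) z(2,3)] by auto
    have E0: "?E \<noteq> 0" using b(2) t(1) P(4) by auto
    have sE: "m + fls_subdegree ?E = n + fls_subdegree ?D"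
      using arg_cong[OF b(2), of fls_subdegree] E0 t(1) P(2-4) x0 by simp
    let ?M = "x * (e1 * e3 + e2\<^sup>2) + (x + cc) * ?E"
    have "ordge (2 * m + fls_subdegree ?E + k) (x\<^sup>2 * ?M)" unfolding b(3)
    proof (rule ordge_add)
      have "ordge (m + 2 * n + (fls_subdegree ?D + 1)) (x * (x + cc)\<^sup>2 * ?N)"
        using ordge_mult[OF ordge_mult[OF ordge_subdegree[of x] ordge_square[OF ordge_subdegree[of "x + cc"]]] t(2)] P(2,3) by simp
      then show "ordge (2 * m + fls_subdegree ?E + k) (x * (x + cc)\<^sup>2 * ?N)"
        by (rule ordge_mono) (use sE P(5) in auto)
      have "ordge (2 * m + 0 + fls_subdegree ?D) (x\<^sup>2 * fls_const s' * ?D)"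
        using ordge_mult[OF ordge_mult[OF ordge_square[OF ordge_subdegree[of x]] ordge_const[of s']] ordge_subdegree[of ?D]] P(2) by simp
      then show "ordge (2 * m + fls_subdegree ?E + k) (x\<^sup>2 * fls_const s' * ?D)"
        by (rule ordge_mono) (use sE P(5) in auto)
    qed
    then have "ordge (fls_subdegree (x\<^sup>2 * ?E) + k) (x\<^sup>2 * ?M)" using E0 x0 P(2) by (simp add: power2_eq_square)
    then have "ordge (fls_subdegree ?E + k) ?M" by (rule ordge_cancel[rotated 2]) (use x0 E0 in auto)
    then have "ordge (fls_subdegree (z * ?E) + k) (z * ?M)" by (rule ordge_scale[OF z(1) E0])
    moreover have "z * ?M = ev K x y" unfolding evs(3)[OF fp] z(5,6) by (simp add: algebra_simps)
    ultimately show ?thesis using z(1,5) E0 by simp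
  qed
  have inf: "ev D x y \<noteq> 0 \<and> ordge (fls_subdegree (ev D x y) + - 1) (ev K x y)"
    if P: "formal_point x y fls_X_inv" "leading x (- 2) 1" "leading y (- 3) 1" for x y
  proof (rule pole)
    have "leading (x + cc) (- 2) 1" by (rule leading_add[OF P(2)]) (simp add: ordge_def)
    then show "fls_subdegree (x + cc) = - 2" "x + cc \<noteq> 0" using leading_nz leading_subdegree by force+
    show "fls_subdegree x = - 2" using leading_subdegree[OF P(2)] by simp
    show "std_point x y fls_X_inv" using P by (simp add: std_point_def)
  qed auto
  have T: "ev D x y \<noteq> 0 \<and> ordge (fls_subdegree (ev D x y) + 1) (ev K x y)"
    if P: "formal_point x y fls_X_inv" "leading x 2 (c0\<^sup>2)" "leading (y + cc\<^sup>2) 1 (c0\<^sup>2)" for x y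
  proof (rule pole)
    have "leading (cc + x) 0 c0" by (rule leading_add[OF leading_const]) (use leading_ordge[OF P(2)] in simp)
    then have "leading (x + cc) 0 c0" by (simp add: add.commute)
    then show "fls_subdegree (x + cc) = 0" "x + cc \<noteq> 0" using leading_nz leading_subdegree c0_nz by blast+
    show "fls_subdegree x = 2" using leading_subdegree[OF P(2)] by simp
    show "std_point x y fls_X_inv" using P by (simp add: std_point_def)
  qed auto
  obtain x y where O: "formal_point x y fls_X_inv" "leading x (- 2) 1" "leading y (- 3) 1" by (rule formal_point_infinity)
  have D0: "D \<noteq> (0, 0)" using inf[OF O] ev_eq_0[OF O(1)] by blast
  let ?n = "norm_poly (fst D) (snd D)"
  have n0: "?n \<noteq> 0" using norm_poly_eq_0[of "fst D" "snd D"] D0 by (auto simp: prod_eq_iff)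
  have scale: "ordge (fls_subdegree (pe ?n x) + k) (ev (cf_mult D' K) x y)"
    if "formal_point x y U" "ev D x y \<noteq> 0 \<and> ordge (fls_subdegree (ev D x y) + k) (ev K x y)" for x y U k
  proof -
    have "ev D' x y \<noteq> 0" using pe_formal_nz[OF that(1) n0] unfolding evs(4)[OF that(1)] by auto
    then show ?thesis unfolding evs(4,5)[OF that(1)] using that(2) by (intro ordge_scale) auto
  qed
  have "cf_mult D' K = (0, 0)"
  proof (rule regular_function_zero[OF n0])
    show "ordge (fls_subdegree (pe ?n x) + - 1) (ev (cf_mult D' K) x y)"
      if "formal_point x y fls_X_inv" "leading x (- 2) 1" "leading y (- 3) 1" for x y
      by (rule scale[OF that(1) inf[OF that]])
    show "ordge (fls_subdegree (pe ?n x) + 1) (ev (cf_mult D' K) x y)"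
      if "formal_point x y fls_X_inv" "leading x 2 (c0\<^sup>2)" "leading (y + cc\<^sup>2) 1 (c0\<^sup>2)" for x y
      by (rule scale[OF that(1) T[OF that]])
    show "ordge (fls_subdegree (pe ?n x) + 0) (ev (cf_mult D' K) x y)"
      if "a \<noteq> 0" "x = fls_const a + fls_X" "formal_point x y U" "ordge 0 y" for a x y U
      by (rule scale[OF that(3) affine[OF that]])
  qed
  then have "ev (cf_mult D' K) x y = 0" by (simp add: ev_def)
  moreover have "ev D' x y \<noteq> 0" using pe_formal_nz[OF O(1) n0] unfolding evs(4)[OF O(1)] by auto
  ultimately have "ev K x y = 0" unfolding evs(5)[OF O(1)] by simp
  then have conic: "x * (ev A1 x y * ev A3 x y + (ev A2 x y)\<^sup>2) = (x + cc) * ((ev A1 x y)\<^sup>2 + (ev A3 x y)\<^sup>2 * x)"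
    unfolding evs(1-3)[OF O(1)] by (simp add: add_eq_0_iff_eq)
  interpret generic_point x y by unfold_locales (fact O)+
  have "ev A1 x y = 0 \<and> ev A3 x y = 0" by (rule no_conic[OF _ _ _ conic]) (use A cf_perf_kE in auto)
  then have "ev D x y = 0" unfolding evs(2)[OF O(1)] by simp
  then show False using inf[OF O] by blast
qed

section \<open>Forms\<close>

text \<open>The value of the form with coefficients \<open>c\<close> in an algebra with structure map \<open>j\<close>.\<close>

definition geval :: "('a \<Rightarrow> 'b::comm_ring_1) \<Rightarrow> nat \<Rightarrow> nat \<Rightarrow> ((nat \<Rightarrow> nat) \<Rightarrow> 'a) \<Rightarrow> (nat \<Rightarrow> 'b) \<Rightarrow> 'b" where
  "geval j n d c v = (\<Sum>m\<in>monomials n d. j (c m) * (\<Prod>i\<le>n. v i ^ m i))"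

text \<open>Two structure maps occur: the identity, for values at geometric points, and
  \<open>fls_const\<close>, for values at points with Laurent series as coordinates.\<close>

definition rhom :: "('a::comm_ring_1 \<Rightarrow> 'b::comm_ring_1) \<Rightarrow> bool" where
  "rhom j \<longleftrightarrow> j 0 = 0 \<and> j 1 = 1 \<and> (\<forall>a b. j (a + b) = j a + j b) \<and> (\<forall>a b. j (a * b) = j a * j b)"

lemma rhom_id: "rhom (\<lambda>x. x)"
  by (simp add: rhom_def)

lemma rhom_const: "rhom fls_const"
  by (simp add: rhom_def fls_const_add)

lemma rhom_sum: "rhom j \<Longrightarrow> j (sum f A) = (\<Sum>a\<in>A. j (f a))"
  by (induction A rule: infinite_finite_induct) (auto simp: rhom_def)

lemma in_form_iff: "G \<in> form K n d \<longleftrightarrow> (\<exists>c. (\<forall>m. c m \<in> K) \<and> G = geval (\<lambda>x. x) n d c)"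
  unfolding form_def geval_def by blast

lemma finite_monomials: "finite (monomials n d)"
proof (rule finite_subset)
  show "monomials n d \<subseteq> {f. \<forall>i. (i \<in> {..n} \<longrightarrow> f i \<in> {..d}) \<and> (i \<notin> {..n} \<longrightarrow> f i = 0)}"
  proof
    fix m assume m: "m \<in> monomials n d"
    have "m i \<le> d" if "i \<le> n" for i
      using m that member_le_sum[of i "{..n}" m] unfolding monomials_def by auto
    then show "m \<in> {f. \<forall>i. (i \<in> {..n} \<longrightarrow> f i \<in> {..d}) \<and> (i \<notin> {..n} \<longrightarrow> f i = 0)}"
      using m unfolding monomials_def by auto
  qed
  show "finite {f. \<forall>i. (i \<in> {..n} \<longrightarrow> f i \<in> {..d}) \<and> (i \<notin> {..n} \<longrightarrow> f i = (0::nat))}"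
    by (rule finite_set_of_finite_funs) auto
qed

lemma geval_cong: "(\<And>i. i \<le> n \<Longrightarrow> v i = w i) \<Longrightarrow> geval j n d c v = geval j n d c w"
  unfolding geval_def by (intro sum.cong refl arg_cong2[of _ _ _ _ "(*)"] prod.cong) auto

lemma geval_add:
  assumes "rhom j"
  shows "geval j n d (\<lambda>m. c m + c' m) v = geval j n d c v + geval j n d c' v"
  using assms unfolding geval_def rhom_def by (simp add: sum.distrib distrib_right)

lemma geval_cmult:
  assumes "rhom j"
  shows "geval j n d (\<lambda>m. a * c m) v = j a * geval j n d c v"
  using assms unfolding geval_def rhom_def by (simp add: sum_distrib_left mult.assoc)

lemma geval_sum:
  assumes "rhom j"
  shows "geval j n d (\<lambda>m. \<Sum>a\<in>A. c a m) v = (\<Sum>a\<in>A. geval j n d (c a) v)"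
  unfolding geval_def rhom_sum[OF assms] sum_distrib_right by (rule sum.swap)

lemma geval_scale: "geval j n d c (\<lambda>i. l * v i) = l ^ d * geval j n d c v"
proof -
  have "(\<Prod>i\<le>n. (l * v i) ^ m i) = l ^ d * (\<Prod>i\<le>n. v i ^ m i)" if "m \<in> monomials n d" for m
  proof -
    have "(\<Prod>i\<le>n. (l * v i) ^ m i) = (\<Prod>i\<le>n. l ^ m i) * (\<Prod>i\<le>n. v i ^ m i)"
      by (simp add: power_mult_distrib prod.distrib)
    also have "(\<Prod>i\<le>n. l ^ m i) = l ^ d" using that unfolding monomials_def by (auto simp: power_sum)
    finally show ?thesis .
  qed
  then show ?thesis unfolding geval_def by (simp add: sum_distrib_left mult_ac)
qed

lemma geval_hom:
  assumes "rhom j"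
  shows "geval j n d c (\<lambda>i. j (v i)) = j (geval (\<lambda>x. x) n d c v)"
proof -
  have pw: "j (a ^ k) = j a ^ k" for a k by (induction k) (use assms in \<open>auto simp: rhom_def\<close>)
  have pr: "j (prod f A) = (\<Prod>a\<in>A. j (f a))" for f :: "nat \<Rightarrow> 'a" and A
    by (induction A rule: infinite_finite_induct) (use assms in \<open>auto simp: rhom_def\<close>)
  show ?thesis unfolding geval_def rhom_sum[OF assms] using assms by (simp add: rhom_def pr pw)
qed

text \<open>A form is given as a function on vectors over the field, but its value at Laurent series
  requires coefficients. Products are therefore formed on the coefficient functions.\<close>

definition cmul :: "nat \<Rightarrow> nat \<Rightarrow> nat \<Rightarrow> ((nat \<Rightarrow> nat) \<Rightarrow> 'a::comm_ring_1) \<Rightarrow> ((nat \<Rightarrow> nat) \<Rightarrow> 'a) \<Rightarrow> (nat \<Rightarrow> nat) \<Rightarrow> 'a" where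
  "cmul n d e c c' m = (\<Sum>p\<in>{p \<in> monomials n d \<times> monomials n e. (\<lambda>i. fst p i + snd p i) = m}. c (fst p) * c' (snd p))"

lemma geval_cmul:
  assumes "rhom j"
  shows "geval j n (d + e) (cmul n d e c c') v = geval j n d c v * geval j n e c' v"
proof -
  let ?S = "monomials n d \<times> monomials n e" and ?g = "\<lambda>p::(nat \<Rightarrow> nat) \<times> (nat \<Rightarrow> nat). \<lambda>i. fst p i + snd p i"
  let ?h = "\<lambda>p. (j (c (fst p)) * (\<Prod>i\<le>n. v i ^ fst p i)) * (j (c' (snd p)) * (\<Prod>i\<le>n. v i ^ snd p i))"
  have "geval j n d c v * geval j n e c' v = (\<Sum>p\<in>?S. ?h p)"
    unfolding geval_def sum_product sum.cartesian_product by (simp add: case_prod_unfold)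
  also have "\<dots> = (\<Sum>m\<in>monomials n (d + e). \<Sum>p\<in>{p \<in> ?S. ?g p = m}. ?h p)"
  proof (rule sum.group[symmetric])
    show "?g ` ?S \<subseteq> monomials n (d + e)" unfolding monomials_def by (auto simp: sum.distrib)
  qed (auto simp: finite_monomials)
  also have "\<dots> = geval j n (d + e) (cmul n d e c c') v"
    unfolding geval_def
  proof (rule sum.cong[OF refl])
    fix m assume "m \<in> monomials n (d + e)"
    have "?h p = j (c (fst p) * c' (snd p)) * (\<Prod>i\<le>n. v i ^ m i)" if "?g p = m" for p
    proof -
      have "(\<Prod>i\<le>n. v i ^ m i) = (\<Prod>i\<le>n. v i ^ fst p i) * (\<Prod>i\<le>n. v i ^ snd p i)"
        unfolding that[symmetric] by (simp add: power_add prod.distrib)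
      then show ?thesis using assms unfolding rhom_def by (simp add: mult_ac)
    qed
    then show "(\<Sum>p\<in>{p \<in> ?S. ?g p = m}. ?h p) = j (cmul n d e c c' m) * (\<Prod>i\<le>n. v i ^ m i)"
      unfolding cmul_def rhom_sum[OF assms] sum_distrib_right by (intro sum.cong refl) auto
  qed
  finally show ?thesis by simp
qed

lemma monomials_0: "monomials n 0 = {\<lambda>_. 0}"
  by (auto simp: monomials_def fun_eq_iff) (metis atMost_iff not_le)

lemma geval_degree_0: "rhom j \<Longrightarrow> geval j n 0 c v = j (c (\<lambda>_. 0))"
  by (simp add: geval_def monomials_0)

definition cvar :: "nat \<Rightarrow> (nat \<Rightarrow> nat) \<Rightarrow> 'a::comm_ring_1" where
  "cvar i m = (if m = (\<lambda>k. if k = i then 1 else 0) then 1 else 0)"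

lemma geval_cvar:
  assumes "rhom j" "i \<le> n"
  shows "geval j n 1 (cvar i) v = v i"
proof -
  let ?e = "\<lambda>k. if k = i then 1 else (0::nat)"
  have e: "?e \<in> monomials n 1" using assms(2) by (auto simp: monomials_def)
  have "geval j n 1 (cvar i) v = (\<Sum>m\<in>monomials n 1. if m = ?e then (\<Prod>i\<le>n. v i ^ ?e i) else 0)"
    unfolding geval_def cvar_def using assms(1) by (intro sum.cong refl) (auto simp: rhom_def)
  also have "\<dots> = (\<Prod>k\<le>n. v k ^ ?e k)" using e by (simp add: finite_monomials)
  also have "\<dots> = (\<Prod>k\<le>n. if k = i then v i else 1)" by (intro prod.cong refl) auto
  also have "\<dots> = v i" using assms(2) by (simp add: prod.delta')
  finally show ?thesis .
qed

primrec cpow :: "nat \<Rightarrow> nat \<Rightarrow> ((nat \<Rightarrow> nat) \<Rightarrow> 'a::comm_ring_1) \<Rightarrow> nat \<Rightarrow> (nat \<Rightarrow> nat) \<Rightarrow> 'a" where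
  "cpow n d c 0 = (\<lambda>_. 1)"
| "cpow n d c (Suc k) = cmul n d (d * k) c (cpow n d c k)"

lemma geval_cpow: "rhom j \<Longrightarrow> geval j n (d * k) (cpow n d c k) v = geval j n d c v ^ k"
proof (induction k)
  case 0
  then show ?case by (simp add: geval_degree_0) (simp add: rhom_def)
next
  case (Suc k)
  then show ?case using geval_cmul[OF Suc.prems, of n d "d * k"] by simp
qed

text \<open>The coefficients of the binary form \<open>g\<close> of degree \<open>e\<close> after
  substitution of the forms \<open>F 0\<close> and \<open>F 1\<close> of degree
  \<open>d\<close>.\<close>

definition ccomp :: "nat \<Rightarrow> nat \<Rightarrow> nat \<Rightarrow> ((nat \<Rightarrow> nat) \<Rightarrow> 'a::comm_ring_1) \<Rightarrow> (nat \<Rightarrow> (nat \<Rightarrow> nat) \<Rightarrow> 'a) \<Rightarrow> (nat \<Rightarrow> nat) \<Rightarrow> 'a" where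
  "ccomp n d e g F = (\<lambda>m. \<Sum>\<mu>\<in>monomials 1 e. g \<mu> * cmul n (d * \<mu> 0) (d * \<mu> 1) (cpow n d (F 0) (\<mu> 0)) (cpow n d (F 1) (\<mu> 1)) m)"

lemma geval_ccomp:
  assumes "rhom j"
  shows "geval j n (d * e) (ccomp n d e g F) v = geval j 1 e g (\<lambda>i. geval j n d (F i) v)"
proof -
  have "geval j n (d * e) (ccomp n d e g F) v = (\<Sum>\<mu>\<in>monomials 1 e. j (g \<mu>) *
     geval j n (d * e) (cmul n (d * \<mu> 0) (d * \<mu> 1) (cpow n d (F 0) (\<mu> 0)) (cpow n d (F 1) (\<mu> 1))) v)"
    unfolding ccomp_def geval_sum[OF assms] geval_cmult[OF assms] ..
  also have "\<dots> = geval j 1 e g (\<lambda>i. geval j n d (F i) v)"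
    unfolding geval_def[of j 1]
  proof (rule sum.cong[OF refl])
    fix \<mu> :: "nat \<Rightarrow> nat" assume "\<mu> \<in> monomials 1 e"
    then have "d * e = d * \<mu> 0 + d * \<mu> 1" by (auto simp: monomials_def add_mult_distrib2[symmetric])
    then show "j (g \<mu>) * geval j n (d * e) (cmul n (d * \<mu> 0) (d * \<mu> 1) (cpow n d (F 0) (\<mu> 0)) (cpow n d (F 1) (\<mu> 1))) v
       = j (g \<mu>) * (\<Prod>i\<le>1. geval j n d (F i) v ^ \<mu> i)"
      by (simp add: geval_cmul[OF assms] geval_cpow[OF assms])
  qed
  finally show ?thesis .
qed

section \<open>Projective points and open sets\<close>

lemma proj_point_self: "v \<in> proj_point v"
  unfolding proj_point_def by (rule CollectI, rule exI[of _ 1]) simp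

lemma proj_pointE:
  assumes "w \<in> proj_point v" obtains l where "l \<noteq> 0" "w = (\<lambda>i. l * v i)"
  using assms unfolding proj_point_def by blast

lemma proj_point_eq: "w \<in> proj_point v \<Longrightarrow> proj_point w = proj_point v"
proof -
  assume "w \<in> proj_point v"
  then obtain l where l: "l \<noteq> 0" "w = (\<lambda>i. l * v i)" by (rule proj_pointE)
  show ?thesis
  proof (rule Set.set_eqI)
    fix u
    have "(\<exists>k. k \<noteq> 0 \<and> u = (\<lambda>i. k * w i)) \<longleftrightarrow> (\<exists>k. k \<noteq> 0 \<and> u = (\<lambda>i. k * v i))"
    proof
      assume "\<exists>k. k \<noteq> 0 \<and> u = (\<lambda>i. k * w i)"
      then obtain k where "k \<noteq> 0" "u = (\<lambda>i. k * w i)" by blast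
      then show "\<exists>k. k \<noteq> 0 \<and> u = (\<lambda>i. k * v i)" using l by (intro exI[of _ "k * l"]) (simp add: mult.assoc)
    next
      assume "\<exists>k. k \<noteq> 0 \<and> u = (\<lambda>i. k * v i)"
      then obtain k where "k \<noteq> 0" "u = (\<lambda>i. k * v i)" by blast
      then show "\<exists>k. k \<noteq> 0 \<and> u = (\<lambda>i. k * w i)" using l by (intro exI[of _ "k / l"]) simp
    qed
    then show "u \<in> proj_point w \<longleftrightarrow> u \<in> proj_point v" unfolding proj_point_def by auto
  qed
qed

lemma proj_spaceE:
  assumes "P \<in> proj_space n" "v \<in> P"
  shows "P = proj_point v" "\<forall>i>n. v i = 0" "\<exists>i\<le>n. v i \<noteq> 0"
proof -
  obtain w where w: "P = proj_point w" "\<forall>i>n. w i = 0" "\<exists>i. w i \<noteq> 0"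
    using assms(1) unfolding proj_space_def by blast
  then obtain l where l: "l \<noteq> 0" "v = (\<lambda>i. l * w i)" using assms(2) proj_pointE by metis
  show "P = proj_point v" using w(1) assms(2) proj_point_eq by metis
  show v: "\<forall>i>n. v i = 0" using l w(2) by simp
  have "\<exists>i. v i \<noteq> 0" using l w(3) by auto
  then show "\<exists>i\<le>n. v i \<noteq> 0" using v by (metis not_le)
qed

lemma proj_space_nonempty: "P \<in> proj_space n \<Longrightarrow> \<exists>v. v \<in> P"
  unfolding proj_space_def using proj_point_self by blast

lemma geval_proj:
  assumes "P \<in> proj_space n" "v \<in> P" "w \<in> P"
  obtains l where "l \<noteq> 0" "w = (\<lambda>i. l * v i)" "\<And>d c. geval (\<lambda>x. x) n d c w = l ^ d * geval (\<lambda>x. x) n d c v"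
proof -
  have "w \<in> proj_point v" using proj_spaceE(1)[OF assms(1,2)] assms(3) by simp
  then obtain l where "l \<noteq> 0" "w = (\<lambda>i. l * v i)" by (rule proj_pointE)
  with that geval_scale show thesis by blast
qed

lemma geval_nz_proj:
  assumes "P \<in> proj_space n" "v \<in> P" "w \<in> P"
  shows "geval (\<lambda>x. x) n d c v \<noteq> 0 \<longleftrightarrow> geval (\<lambda>x. x) n d c w \<noteq> 0"
  by (rule geval_proj[OF assms]) simp

lemma geval_ratio_proj:
  fixes v :: "nat \<Rightarrow> 'a::alg_closed_field"
  assumes "P \<in> proj_space n" "v \<in> P" "w \<in> P"
  shows "geval (\<lambda>x. x) n d c v / geval (\<lambda>x. x) n d c' v = geval (\<lambda>x. x) n d c w / geval (\<lambda>x. x) n d c' w"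
  by (rule geval_proj[OF assms]) simp

text \<open>The condition behind \<open>zar_open\<close>, with degrees and coefficients recorded. At
  a projective point a form is nonzero on all homogeneous coordinate vectors or on none, which
  reconciles the universal quantifier with the existential one there.\<close>

definition nzlocus :: "nat \<Rightarrow> (nat \<times> ((nat \<Rightarrow> nat) \<Rightarrow> 'a::alg_closed_field)) set \<Rightarrow> 'a ppoint \<Rightarrow> bool" where
  "nzlocus n C P \<longleftrightarrow> (\<exists>(d, c)\<in>C. \<forall>v\<in>P. geval (\<lambda>x. x) n d c v \<noteq> 0)"

lemma zar_open_iff:
  fixes A :: "'a::alg_closed_field ppoint set"
  assumes "A \<subseteq> proj_space n"
  shows "zar_open K n A U \<longleftrightarrow> (\<exists>C. (\<forall>(d, c)\<in>C. \<forall>m. c m \<in> K) \<and> U = {P \<in> A. nzlocus n C P})"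
proof
  assume "zar_open K n A U"
  then obtain S where S: "S \<subseteq> (\<Union>d. form K n d)" "U = {P \<in> A. \<exists>G\<in>S. \<exists>v\<in>P. G v \<noteq> 0}"
    unfolding zar_open_def by blast
  let ?C = "{(d, c). (\<forall>m. c m \<in> K) \<and> geval (\<lambda>x. x) n d c \<in> S}"
  have "(\<exists>G\<in>S. \<exists>v\<in>P. G v \<noteq> 0) \<longleftrightarrow> nzlocus n ?C P" if PA: "P \<in> A" for P
  proof
    assume "\<exists>G\<in>S. \<exists>v\<in>P. G v \<noteq> 0"
    then obtain G v where G: "G \<in> S" "v \<in> P" "G v \<noteq> 0" by blast
    then obtain d where "G \<in> form K n d" using S(1) by blast
    then obtain c where c: "\<forall>m. c m \<in> K" "G = geval (\<lambda>x. x) n d c" unfolding in_form_iff by blast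
    have "\<forall>w\<in>P. geval (\<lambda>x. x) n d c w \<noteq> 0" using G c geval_nz_proj[of P n v] PA assms by blast
    then show "nzlocus n ?C P" unfolding nzlocus_def using c G(1) by blast
  next
    assume "nzlocus n ?C P"
    then obtain d c where "geval (\<lambda>x. x) n d c \<in> S" "\<forall>v\<in>P. geval (\<lambda>x. x) n d c v \<noteq> 0"
      unfolding nzlocus_def by blast
    moreover obtain v where "v \<in> P" using proj_space_nonempty PA assms by blast
    ultimately show "\<exists>G\<in>S. \<exists>v\<in>P. G v \<noteq> 0" by blast
  qed
  then have "U = {P \<in> A. nzlocus n ?C P}" unfolding S(2) by (intro Collect_cong conj_cong refl)
  moreover have "\<forall>(d, c)\<in>?C. \<forall>m. c m \<in> K" by blast
  ultimately show "\<exists>C. (\<forall>(d, c)\<in>C. \<forall>m. c m \<in> K) \<and> U = {P \<in> A. nzlocus n C P}" by (intro exI conjI)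
next
  assume "\<exists>C. (\<forall>(d, c)\<in>C. \<forall>m. c m \<in> K) \<and> U = {P \<in> A. nzlocus n C P}"
  then obtain C where C: "\<And>d c m. (d, c) \<in> C \<Longrightarrow> c m \<in> K" "U = {P \<in> A. nzlocus n C P}" by blast
  let ?S = "{geval (\<lambda>x. x) n d c | d c. (d, c) \<in> C}"
  have "(\<exists>G\<in>?S. \<exists>v\<in>P. G v \<noteq> 0) \<longleftrightarrow> nzlocus n C P" if PA: "P \<in> A" for P
  proof
    assume "\<exists>G\<in>?S. \<exists>v\<in>P. G v \<noteq> 0"
    then obtain d c v where c: "(d, c) \<in> C" "v \<in> P" "geval (\<lambda>x. x) n d c v \<noteq> 0" by blast
    have "\<forall>w\<in>P. geval (\<lambda>x. x) n d c w \<noteq> 0" using c geval_nz_proj[of P n v] PA assms by blast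
    then show "nzlocus n C P" unfolding nzlocus_def using c(1) by blast
  next
    assume "nzlocus n C P"
    then obtain d c where "(d, c) \<in> C" "\<forall>v\<in>P. geval (\<lambda>x. x) n d c v \<noteq> 0"
      unfolding nzlocus_def by blast
    moreover obtain v where "v \<in> P" using proj_space_nonempty PA assms by blast
    ultimately show "\<exists>G\<in>?S. \<exists>v\<in>P. G v \<noteq> 0" by blast
  qed
  then have "U = {P \<in> A. \<exists>G\<in>?S. \<exists>v\<in>P. G v \<noteq> 0}" unfolding C(2) by (intro Collect_cong conj_cong refl) simp
  moreover have "?S \<subseteq> (\<Union>d. form K n d)"
  proof
    fix G assume "G \<in> ?S"
    then obtain d c where c: "G = geval (\<lambda>x. x) n d c" "(d, c) \<in> C" by blast
    then have "G \<in> form K n d" unfolding in_form_iff using C(1)[OF c(2)] by (intro exI[of _ c]) simp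
    then show "G \<in> (\<Union>d. form K n d)" by blast
  qed
  ultimately show "zar_open K n A U" unfolding zar_open_def by (intro exI conjI)
qed

definition cprod :: "nat \<Rightarrow> (nat \<times> ((nat \<Rightarrow> nat) \<Rightarrow> 'a::alg_closed_field)) set \<Rightarrow> (nat \<times> ((nat \<Rightarrow> nat) \<Rightarrow> 'a)) set \<Rightarrow> (nat \<times> ((nat \<Rightarrow> nat) \<Rightarrow> 'a)) set" where
  "cprod n C C' = {(d + e, cmul n d e c c') | d e c c'. (d, c) \<in> C \<and> (e, c') \<in> C'}"

lemma nzlocus_cprod:
  assumes "P \<in> proj_space n"
  shows "nzlocus n (cprod n C C') P \<longleftrightarrow> nzlocus n C P \<and> nzlocus n C' P"
proof
  assume "nzlocus n (cprod n C C') P"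
  then obtain d e c c' where "(d, c) \<in> C" "(e, c') \<in> C'" "\<forall>v\<in>P. geval (\<lambda>x. x) n (d + e) (cmul n d e c c') v \<noteq> 0"
    unfolding nzlocus_def cprod_def by blast
  then show "nzlocus n C P \<and> nzlocus n C' P" unfolding nzlocus_def geval_cmul[OF rhom_id] by auto
next
  assume "nzlocus n C P \<and> nzlocus n C' P"
  then obtain d e c c' where *: "(d, c) \<in> C" "(e, c') \<in> C'" "\<forall>v\<in>P. geval (\<lambda>x. x) n d c v \<noteq> 0" "\<forall>v\<in>P. geval (\<lambda>x. x) n e c' v \<noteq> 0"
    unfolding nzlocus_def by blast
  then have "\<forall>v\<in>P. geval (\<lambda>x. x) n (d + e) (cmul n d e c c') v \<noteq> 0" unfolding geval_cmul[OF rhom_id] by auto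
  then show "nzlocus n (cprod n C C') P" unfolding nzlocus_def cprod_def using * by blast
qed

lemma zar_open_subset: "zar_open K n A U \<Longrightarrow> U \<subseteq> A"
  unfolding zar_open_def by blast

lemma zar_open_UNIV: "zar_open K n A U \<Longrightarrow> zar_open UNIV n A U"
proof -
  assume "zar_open K n A U"
  then obtain S where S: "S \<subseteq> (\<Union>d. form K n d)" "U = {P \<in> A. \<exists>G\<in>S. \<exists>v\<in>P. G v \<noteq> 0}"
    unfolding zar_open_def by blast
  have "form K n d \<subseteq> form UNIV n d" for d unfolding form_def by blast
  with S(1) have "S \<subseteq> (\<Union>d. form UNIV n d)" by (meson SUP_mono UNIV_I subset_trans)
  then show ?thesis unfolding zar_open_def using S(2) by (intro exI conjI)
qed

lemma zar_open_Int:
  assumes "A \<subseteq> proj_space n" "zar_open UNIV n A U" "zar_open UNIV n B V" "B \<subseteq> proj_space n"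
  shows "zar_open UNIV n (A \<inter> B) (U \<inter> V)"
proof -
  obtain C where "U = {P \<in> A. nzlocus n C P}" using assms(2) unfolding zar_open_iff[OF assms(1)] by blast
  moreover obtain C' where "V = {P \<in> B. nzlocus n C' P}" using assms(3) unfolding zar_open_iff[OF assms(4)] by blast
  ultimately have "U \<inter> V = {P \<in> A \<inter> B. nzlocus n (cprod n C C') P}"
    using assms(1) by (auto simp: nzlocus_cprod)
  moreover have "A \<inter> B \<subseteq> proj_space n" using assms(1) by blast
  ultimately show ?thesis using zar_open_iff[of "A \<inter> B" n UNIV "U \<inter> V"] by blast
qed

lemma zar_open_trans:
  assumes "A \<subseteq> proj_space n" "zar_open UNIV n A U" "zar_open UNIV n U V"
  shows "zar_open UNIV n A V"
proof -
  have U: "U \<subseteq> proj_space n" using assms(1) zar_open_subset[OF assms(2)] by blast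
  obtain C where "U = {P \<in> A. nzlocus n C P}" using assms(2) unfolding zar_open_iff[OF assms(1)] by blast
  moreover obtain C' where "V = {P \<in> U. nzlocus n C' P}" using assms(3) unfolding zar_open_iff[OF U] by blast
  ultimately have "V = {P \<in> A. nzlocus n (cprod n C C') P}"
    using assms(1) by (auto simp: nzlocus_cprod)
  then show ?thesis using zar_open_iff[OF assms(1), of UNIV V] by blast
qed

lemma zar_open_self: "A \<subseteq> proj_space n \<Longrightarrow> zar_open UNIV n A A"
proof -
  assume A: "A \<subseteq> proj_space n"
  have "A = {P \<in> A. nzlocus n {(0, \<lambda>_. 1)} P}" by (auto simp: nzlocus_def geval_degree_0[OF rhom_id])
  then show ?thesis using zar_open_iff[OF A, of UNIV A] by blast
qed

section \<open>Geometric points of the curve\<close>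

abbreviation E where "E \<equiv> weierstrass_curve E_curve"

abbreviation gval :: "nat \<Rightarrow> nat \<Rightarrow> ((nat \<Rightarrow> nat) \<Rightarrow> 'a::comm_ring_1) \<Rightarrow> (nat \<Rightarrow> 'a) \<Rightarrow> 'a" where
  "gval \<equiv> geval (\<lambda>x. x)"

definition vec :: "'a::zero \<Rightarrow> 'a \<Rightarrow> 'a \<Rightarrow> nat \<Rightarrow> 'a" where
  "vec a b e i = (if i = 0 then a else if i = 1 then b else if i = 2 then e else 0)"

lemma vec_simps [simp]: "vec a b e 0 = a" "vec a b e 1 = b" "vec a b e (Suc 0) = b" "vec a b e 2 = e" "i > 2 \<Longrightarrow> vec a b e i = 0"
  by (simp_all add: vec_def)

definition on_curve :: "F2t_bar \<Rightarrow> F2t_bar \<Rightarrow> bool" where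
  "on_curve a b \<longleftrightarrow> b\<^sup>2 + a * b = a ^ 3 + t_gen * a\<^sup>2 + t_gen ^ 6"

definition pt :: "F2t_bar \<Rightarrow> F2t_bar \<Rightarrow> F2t_bar ppoint" where
  "pt a b = proj_point (vec a b 1)"

definition pt_inf :: "F2t_bar ppoint" where
  "pt_inf = proj_point (vec 0 1 0)"

definition wform :: "(nat \<Rightarrow> F2t_bar) \<Rightarrow> bool" where
  "wform v \<longleftrightarrow> (v 1)\<^sup>2 * v 2 + v 0 * v 1 * v 2 = (v 0) ^ 3 + t_gen * (v 0)\<^sup>2 * v 2 + t_gen ^ 6 * (v 2) ^ 3"

lemma E_iff: "P \<in> E \<longleftrightarrow> P \<in> proj_space 2 \<and> (\<forall>v\<in>P. wform v)"
  unfolding weierstrass_curve_def wform_def E_curve_def Let_def by simp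

lemma E_sub: "E \<subseteq> proj_space 2"
  using E_iff by blast

lemma wform_scale: "l \<noteq> 0 \<Longrightarrow> wform (\<lambda>i. l * v i) \<longleftrightarrow> wform v"
proof -
  assume l: "l \<noteq> 0"
  have "wform (\<lambda>i. l * v i) \<longleftrightarrow> l ^ 3 * ((v 1)\<^sup>2 * v 2 + v 0 * v 1 * v 2) = l ^ 3 * ((v 0) ^ 3 + t_gen * (v 0)\<^sup>2 * v 2 + t_gen ^ 6 * (v 2) ^ 3)"
    unfolding wform_def by (intro arg_cong2[of _ _ _ _ "(=)"]; simp add: algebra_simps power2_eq_square power3_eq_cube)
  then show ?thesis using l unfolding wform_def by simp
qed

lemma proj_point_in_space: "(\<And>i. i > n \<Longrightarrow> v i = 0) \<Longrightarrow> v i \<noteq> 0 \<Longrightarrow> proj_point v \<in> proj_space n"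
  unfolding proj_space_def by blast

lemma proj_point_in_E:
  assumes "\<And>i. i > 2 \<Longrightarrow> v i = 0" "v i \<noteq> 0" "wform v"
  shows "proj_point v \<in> E"
  unfolding E_iff
proof (intro conjI ballI)
  show "proj_point v \<in> proj_space 2" using proj_point_in_space[of 2 v i] assms(1,2) by blast
  fix w assume "w \<in> proj_point v"
  then obtain l where "l \<noteq> 0" "w = (\<lambda>i. l * v i)" by (rule proj_pointE)
  then show "wform w" using assms(3) wform_scale by blast
qed

lemma pt_in_E: "on_curve a b \<Longrightarrow> pt a b \<in> E"
  unfolding pt_def by (rule proj_point_in_E[of _ 2]) (auto simp: wform_def on_curve_def)

lemma pt_inf_in_E: "pt_inf \<in> E"
  unfolding pt_inf_def by (rule proj_point_in_E[of _ 1]) (auto simp: wform_def)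

lemma vec_in_pt: "vec a b 1 \<in> pt a b"
  unfolding pt_def by (rule proj_point_self)

lemma E_cases:
  assumes "P \<in> E"
  shows "P = pt_inf \<or> (\<exists>a b. on_curve a b \<and> P = pt a b)"
proof -
  have P: "P \<in> proj_space 2" using assms E_sub by blast
  then obtain v where v: "v \<in> P" using proj_space_nonempty by blast
  have w: "wform v" using assms v unfolding E_iff by blast
  have Pv: "P = proj_point v" "\<forall>i>2. v i = 0" "\<exists>i\<le>2. v i \<noteq> 0" using proj_spaceE[OF P v] by auto
  have v2: "v = vec (v 0) (v 1) (v 2)"
  proof
    fix i show "v i = vec (v 0) (v 1) (v 2) i"
      using Pv(2) by (cases "i > 2") (auto simp: vec_def le_Suc_eq not_less numeral_2_eq_2)
  qed
  show ?thesis
  proof (cases "v 2 = 0")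
    case True
    then have v0: "v 0 = 0" using w unfolding wform_def by simp
    then have v1: "v 1 \<noteq> 0" using Pv(3) True by (auto simp: le_Suc_eq numeral_2_eq_2)
    have "v = (\<lambda>i. v 1 * vec 0 1 0 i)" by (subst v2) (auto simp: vec_def True v0)
    then have "v \<in> proj_point (vec 0 1 0)" using v1 unfolding proj_point_def by blast
    then show ?thesis using Pv(1) proj_point_eq unfolding pt_inf_def by metis
  next
    case False
    let ?a = "v 0 / v 2" and ?b = "v 1 / v 2"
    have eq: "v = (\<lambda>i. v 2 * vec ?a ?b 1 i)" by (subst v2) (use False in \<open>auto simp: vec_def\<close>)
    then have "v \<in> proj_point (vec ?a ?b 1)" using False unfolding proj_point_def by blast
    then have "P = pt ?a ?b" using Pv(1) proj_point_eq unfolding pt_def by metis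
    moreover have "wform (vec ?a ?b 1)" using w wform_scale[OF False, of "vec ?a ?b 1"] eq by simp
    then have "on_curve ?a ?b" by (simp add: wform_def on_curve_def)
    ultimately show ?thesis by blast
  qed
qed

section \<open>Specialization from formal points to geometric points\<close>

definition fv :: "F2t_bar fls \<Rightarrow> F2t_bar fls \<Rightarrow> F2t_bar fls \<Rightarrow> nat \<Rightarrow> F2t_bar fls" where
  "fv x y l = vec (l * x) (l * y) l"

text \<open>The coordinates of the point over the field of Laurent series, scaled by \<open>l\<close>, specialize to the
  coordinates \<open>v\<close> of \<open>P\<close>.\<close>

definition fdata :: "F2t_bar ppoint \<Rightarrow> F2t_bar fls \<Rightarrow> F2t_bar fls \<Rightarrow> F2t_bar fls \<Rightarrow> (nat \<Rightarrow> F2t_bar) \<Rightarrow> bool" where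
  "fdata P x y l v \<longleftrightarrow> l \<noteq> 0 \<and> v \<in> P \<and> (\<forall>i. ordge 0 (fv x y l i) \<and> fls_nth (fv x y l i) 0 = v i)"

lemma fdataI:
  assumes "l \<noteq> 0" "vec a b e \<in> P" "ordge 0 (l * x)" "ordge 0 (l * y)" "ordge 0 l"
    "fls_nth (l * x) 0 = a" "fls_nth (l * y) 0 = b" "fls_nth l 0 = e"
  shows "fdata P x y l (vec a b e)"
  using assms unfolding fdata_def fv_def vec_def by auto

lemma fdata_infinity:
  assumes "leading x (- 2) 1" "leading y (- 3) 1"
  shows "fdata pt_inf x y (fls_X ^ 3) (vec 0 1 0)"
proof -
  have l: "leading (fls_X ^ 3 :: F2t_bar fls) 3 1" using leading_power[OF leading_X, of 3] by simp
  have lx: "leading (fls_X ^ 3 * x) 1 1" using leading_mult[OF l assms(1)] by simp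
  have ly: "leading (fls_X ^ 3 * y) 0 1" using leading_mult[OF l assms(2)] by simp
  show ?thesis
  proof (rule fdataI)
    show "fls_X ^ 3 \<noteq> (0 :: F2t_bar fls)" by simp
    show "vec 0 1 0 \<in> pt_inf" unfolding pt_inf_def by (rule proj_point_self)
    show "ordge 0 (fls_X ^ 3 * x)" "ordge 0 (fls_X ^ 3 * y)" "ordge 0 (fls_X ^ 3 :: F2t_bar fls)"
      using leading_ordge[OF lx] leading_ordge[OF ly] leading_ordge[OF l] by auto
    show "fls_nth (fls_X ^ 3 * x) 0 = 0" "fls_nth (fls_X ^ 3 * y) 0 = 1" "fls_nth (fls_X ^ 3 :: F2t_bar fls) 0 = 0"
      using lx ly l by (auto simp: leading_def ordge_def)
  qed
qed

lemma fdata_affine: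
  assumes "ordge 0 x" "ordge 0 y"
  shows "fdata (pt (fls_nth x 0) (fls_nth y 0)) x y 1 (vec (fls_nth x 0) (fls_nth y 0) 1)"
  by (rule fdataI) (use assms vec_in_pt in \<open>auto simp: ordge_def\<close>)

lemma on_curve_nth_0:
  assumes "formal_point x y U" "ordge 0 x" "ordge 0 y"
  shows "on_curve (fls_nth x 0) (fls_nth y 0)"
proof -
  have o: "ordge 0 (v * w) \<and> fls_nth (v * w) 0 = fls_nth v 0 * fls_nth w 0" if "ordge 0 v" "ordge 0 w" for v w :: "F2t_bar fls"
    using ordge_mult[OF that] nth_mult_ordge[OF that] by simp
  have "fls_nth (y\<^sup>2 + x * y) 0 = fls_nth (x ^ 3 + tt * x\<^sup>2 + tt ^ 6) 0" using formal_point_curve[OF assms(1)] by simp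
  then show ?thesis unfolding on_curve_def using assms(2,3)
    by (simp add: power2_eq_square power3_eq_cube o ordge_const flip: fls_const_power)
qed

lemma T_ordge:
  assumes "leading x 2 (c0\<^sup>2)" "leading (y + cc\<^sup>2) 1 (c0\<^sup>2)"
  shows "ordge 0 x" "fls_nth x 0 = 0" "ordge 0 y" "fls_nth y 0 = c0\<^sup>2"
proof -
  have e: "y = (y + cc\<^sup>2) + fls_const (c0\<^sup>2)" by (simp add: fls_const_power add.assoc)
  show "ordge 0 x" "fls_nth x 0 = 0" using assms(1) by (auto simp: leading_def ordge_def)
  show "ordge 0 y" by (subst e) (intro ordge_add ordge_const leading_ordge[OF assms(2)], simp)
  have "fls_nth (y + cc\<^sup>2) 0 = 0" using assms(2) by (simp add: leading_def ordge_def)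
  then show "fls_nth y 0 = c0\<^sup>2" by (subst e) simp
qed

lemma std_point_fdata:
  assumes "std_point x y U"
  shows "\<exists>P\<in>E. \<exists>l v. fdata P x y l v"
proof -
  have fp: "formal_point x y U" using assms by (rule std_point_formal)
  consider "leading x (- 2) 1" "leading y (- 3) 1" | "leading x 2 (c0\<^sup>2)" "leading (y + cc\<^sup>2) 1 (c0\<^sup>2)"
    | a where "x = fls_const a + fls_X" "ordge 0 y"
    using assms unfolding std_point_def by blast
  then show ?thesis
  proof cases
    case 1
    then show ?thesis using fdata_infinity pt_inf_in_E by blast
  next
    case 2
    then show ?thesis using fdata_affine on_curve_nth_0[OF fp] T_ordge[OF 2] pt_in_E by blast
  next
    case 3
    then have "ordge 0 x" by (auto simp: ordge_def)
    then show ?thesis using fdata_affine on_curve_nth_0[OF fp] 3 pt_in_E by blast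
  qed
qed

lemma point_std:
  assumes "P \<in> E"
  shows "\<exists>x y U l v. std_point x y U \<and> fdata P x y l v"
proof -
  consider "P = pt_inf" | b where "on_curve 0 b" "P = pt 0 b" | a b where "a \<noteq> 0" "on_curve a b" "P = pt a b"
    using E_cases[OF assms] by metis
  then show ?thesis
  proof cases
    case 1
    obtain x y where "formal_point x y fls_X_inv" "leading x (- 2) 1" "leading y (- 3) 1" by (rule formal_point_infinity)
    then have "std_point x y fls_X_inv \<and> fdata P x y (fls_X ^ 3) (vec 0 1 0)"
      unfolding 1 std_point_def using fdata_infinity by blast
    then show ?thesis by blast
  next
    case 2
    \<comment> \<open>At abscissa zero the equation of the curve has a single root in characteristic
      two, so \<open>T\<close> is the only such point.\<close>
    have "b\<^sup>2 = (c0\<^sup>2)\<^sup>2" using 2(1) unfolding on_curve_def c0_fourth[symmetric] by (simp flip: power_mult)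
    then have b: "b = c0\<^sup>2" by (simp only: square_inj)
    obtain x y where T: "formal_point x y fls_X_inv" "leading x 2 (c0\<^sup>2)" "leading (y + cc\<^sup>2) 1 (c0\<^sup>2)" by (rule formal_point_T)
    then have "std_point x y fls_X_inv" unfolding std_point_def by blast
    moreover have "fdata P x y 1 (vec (fls_nth x 0) (fls_nth y 0) 1)"
      using fdata_affine[OF T_ordge(1,3)[OF T(2,3)]] unfolding 2(2) b T_ordge[OF T(2,3)] .
    ultimately show ?thesis by blast
  next
    case 3
    obtain y U where P: "formal_point (fls_const a + fls_X) y U" "ordge 0 y" "fls_nth y 0 = b"
      by (rule formal_point_affine[OF 3(1) 3(2)[unfolded on_curve_def]])
    let ?x = "fls_const a + fls_X :: F2t_bar fls"
    have "std_point ?x y U" unfolding std_point_def using P 3(1) by blast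
    moreover have "ordge 0 ?x" "fls_nth ?x 0 = a" by (auto simp: ordge_def)
    then have "fdata P ?x y 1 (vec a b 1)" using fdata_affine[of ?x y] P 3(3) by simp
    ultimately show ?thesis by blast
  qed
qed

lemma ordge_prod:
  fixes f :: "'b \<Rightarrow> 'a::idom fls"
  assumes "\<And>a. a \<in> A \<Longrightarrow> ordge 0 (f a)"
  shows "ordge 0 (prod f A) \<and> fls_nth (prod f A) 0 = (\<Prod>a\<in>A. fls_nth (f a) 0)"
  using assms
proof (induction A rule: infinite_finite_induct)
  case (insert a A)
  then show ?case using ordge_mult[of 0 "f a" 0 "prod f A"] nth_mult_ordge[of 0 "f a" 0 "prod f A"] by simp
qed (auto simp: ordge_def)

lemma ordge_power:
  fixes w :: "'a::idom fls"
  assumes "ordge 0 w"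
  shows "ordge 0 (w ^ k) \<and> fls_nth (w ^ k) 0 = fls_nth w 0 ^ k"
  using ordge_prod[of "{..<k}" "\<lambda>_. w"] assms by simp

lemma geval_ordge:
  fixes w :: "nat \<Rightarrow> F2t_bar fls"
  assumes "\<And>i. ordge 0 (w i)"
  shows "ordge 0 (geval fls_const n d c w) \<and> fls_nth (geval fls_const n d c w) 0 = gval n d c (\<lambda>i. fls_nth (w i) 0)"
proof -
  have t: "ordge 0 (fls_const (c m) * (\<Prod>i\<le>n. w i ^ m i)) \<and>
      fls_nth (fls_const (c m) * (\<Prod>i\<le>n. w i ^ m i)) 0 = c m * (\<Prod>i\<le>n. fls_nth (w i) 0 ^ m i)" for m
  proof -
    have p: "ordge 0 (\<Prod>i\<le>n. w i ^ m i)" "fls_nth (\<Prod>i\<le>n. w i ^ m i) 0 = (\<Prod>i\<le>n. fls_nth (w i) 0 ^ m i)"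
      using ordge_prod[of "{..n}" "\<lambda>i. w i ^ m i"] ordge_power[OF assms] by auto
    show ?thesis using ordge_mult[OF ordge_const p(1)] nth_mult_ordge[OF ordge_const p(1)] p(2) by simp
  qed
  have "fls_nth (sum f A) 0 = (\<Sum>a\<in>A. fls_nth (f a) 0)" for f :: "(nat \<Rightarrow> nat) \<Rightarrow> F2t_bar fls" and A
    by (induction A rule: infinite_finite_induct) auto
  then have "fls_nth (geval fls_const n d c w) 0 = gval n d c (\<lambda>i. fls_nth (w i) 0)"
    unfolding geval_def using t by (simp only:)
  moreover have "ordge 0 (geval fls_const n d c w)" unfolding geval_def using t by (intro ordge_sum) blast
  ultimately show ?thesis by blast
qed

primrec ypow :: "nat \<Rightarrow> cfun" where
  "ypow 0 = (1, 0)"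
| "ypow (Suc k) = cf_mult (0, 1) (ypow k)"

lemma ypow_perf: "cf_perf (ypow k)"
proof (induction k)
  case (Suc k)
  then show ?case unfolding ypow.simps by (intro cf_perf_mult) (auto simp: cf_perf_def perf_poly_0 perf_poly_1)
qed (simp add: cf_perf_def perf_poly_0 perf_poly_1)

lemma ev_ypow: "y\<^sup>2 + x * y = x ^ 3 + tt * x\<^sup>2 + tt ^ 6 \<Longrightarrow> ev (ypow k) x y = y ^ k"
proof (induction k)
  case (Suc k)
  then show ?case unfolding ypow.simps ev_mult[OF Suc.prems] by (simp add: ev_def)
qed (simp add: ev_def)

definition dterm :: "((nat \<Rightarrow> nat) \<Rightarrow> F2t_bar) \<Rightarrow> (nat \<Rightarrow> nat) \<Rightarrow> cfun" where
  "dterm c m = cf_mult (Polynomial.monom (c m) (m 0), 0) (ypow (m 1))"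

text \<open>The restriction of a form to the affine part \<open>z = 1\<close> of the curve, as a pair.\<close>

definition deh :: "nat \<Rightarrow> ((nat \<Rightarrow> nat) \<Rightarrow> F2t_bar) \<Rightarrow> cfun" where
  "deh d c = (\<Sum>m\<in>monomials 2 d. fst (dterm c m), \<Sum>m\<in>monomials 2 d. snd (dterm c m))"

lemma deh_perf: "(\<And>m. c m \<in> F2t_perf) \<Longrightarrow> cf_perf (deh d c)"
proof -
  assume c: "\<And>m. c m \<in> F2t_perf"
  have s: "perf_poly (sum f A)" if "\<And>a. perf_poly (f a)" for f :: "(nat \<Rightarrow> nat) \<Rightarrow> F2t_bar poly" and A
    by (induction A rule: infinite_finite_induct) (auto simp: that perf_poly_0 perf_poly_add)
  have "perf_poly (Polynomial.monom (c m) i)" for m i using c[of m] by (auto simp: perf_poly_def)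
  then have "cf_perf (dterm c m)" for m
    unfolding dterm_def by (intro cf_perf_mult ypow_perf) (simp add: cf_perf_def perf_poly_0)
  then show ?thesis unfolding deh_def cf_perf_def by (auto intro!: s)
qed

lemma ev_deh:
  assumes "y\<^sup>2 + x * y = x ^ 3 + tt * x\<^sup>2 + tt ^ 6"
  shows "ev (deh d c) x y = geval fls_const 2 d c (vec x y 1)"
proof -
  have s: "pe (sum f A) x = (\<Sum>a\<in>A. pe (f a) x)" for f :: "(nat \<Rightarrow> nat) \<Rightarrow> F2t_bar poly" and A
    by (induction A rule: infinite_finite_induct) auto
  have "ev (deh d c) x y = (\<Sum>m\<in>monomials 2 d. ev (dterm c m) x y)"
    unfolding deh_def ev_def by (simp add: s sum.distrib sum_distrib_right)
  also have "\<dots> = geval fls_const 2 d c (vec x y 1)"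
    unfolding geval_def
  proof (rule sum.cong[OF refl])
    fix m :: "nat \<Rightarrow> nat"
    have "ev (dterm c m) x y = fls_const (c m) * x ^ m 0 * y ^ m 1"
      unfolding dterm_def ev_mult[OF assms] ev_ypow[OF assms] by (simp add: ev_def pe_monom)
    also have "\<dots> = fls_const (c m) * (\<Prod>i\<le>2. vec x y 1 i ^ m i)"
      by (simp add: numeral_2_eq_2 mult.assoc vec_def)
    finally show "ev (dterm c m) x y = fls_const (c m) * (\<Prod>i\<le>2. vec x y 1 i ^ m i)" .
  qed
  finally show ?thesis .
qed

lemma geval_fv:
  assumes "y\<^sup>2 + x * y = x ^ 3 + tt * x\<^sup>2 + tt ^ 6"
  shows "geval fls_const 2 d c (fv x y l) = l ^ d * ev (deh d c) x y"
proof -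
  have "fv x y l = (\<lambda>i. l * vec x y 1 i)" unfolding fv_def by (auto simp: vec_def)
  then show ?thesis unfolding ev_deh[OF assms] by (simp add: geval_scale)
qed

definition cv :: "cfun \<Rightarrow> F2t_bar \<Rightarrow> F2t_bar \<Rightarrow> F2t_bar" where
  "cv u a b = poly (fst u) a + poly (snd u) a * b"

lemma ev_const: "ev u (fls_const a) (fls_const b) = fls_const (cv u a b)"
  by (simp add: ev_def cv_def pe_const fls_const_add)

lemma on_curve_const: "on_curve a b \<Longrightarrow> (fls_const b)\<^sup>2 + fls_const a * fls_const b = fls_const a ^ 3 + tt * (fls_const a)\<^sup>2 + tt ^ 6"
  unfolding on_curve_def by (simp flip: fls_const_power fls_const_add)

lemma fls_const_inj: "fls_const a = fls_const b \<longleftrightarrow> a = b"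
proof
  assume "fls_const a = fls_const b"
  then have "fls_nth (fls_const a) 0 = fls_nth (fls_const b) 0" by simp
  then show "a = b" by simp
qed simp

lemma gval_vec: "on_curve a b \<Longrightarrow> gval 2 d c (vec a b 1) = cv (deh d c) a b"
proof -
  assume ab: "on_curve a b"
  have "(\<lambda>i. fls_const (vec a b 1 i)) = vec (fls_const a) (fls_const b) 1" by (auto simp: vec_def)
  then have "fls_const (gval 2 d c (vec a b 1)) = fls_const (cv (deh d c) a b)"
    unfolding geval_hom[OF rhom_const, symmetric] ev_const[symmetric] ev_deh[OF on_curve_const[OF ab]] by simp
  then show ?thesis by (simp only: fls_const_inj)
qed

lemma cv_mult: "on_curve a b \<Longrightarrow> cv (cf_mult u w) a b = cv u a b * cv w a b"
  using ev_mult[OF on_curve_const, of a b u w] unfolding ev_const by (simp add: fls_const_inj)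

lemma cv_add: "cv (cf_add u w) a b = cv u a b + cv w a b"
  by (simp add: cv_def cf_add_def algebra_simps)

text \<open>The abscissa of a zero is a root of the norm, and above each abscissa the ordinate
  satisfies a quadratic equation.\<close>

lemma cf_zeros_finite:
  assumes "u \<noteq> (0, 0)"
  shows "finite {(a, b). on_curve a b \<and> cv u a b = 0}"
proof -
  let ?n = "norm_poly (fst u) (snd u)"
  have n: "?n \<noteq> 0" using norm_poly_eq_0[of "fst u" "snd u"] assms by (auto simp: prod_eq_iff)
  have "{(a, b). on_curve a b \<and> cv u a b = 0} \<subseteq> (\<Union>a\<in>{a. poly ?n a = 0}. {a} \<times> {b. poly [:poly curve_poly a, a, 1:] b = 0})"
  proof
    fix z assume "z \<in> {(a, b). on_curve a b \<and> cv u a b = 0}"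
    then obtain a b where ab: "z = (a, b)" "on_curve a b" "cv u a b = 0" by auto
    have "pe ?n (fls_const a) = 0"
      unfolding pe_norm_poly[OF on_curve_const[OF ab(2)]] using ev_const[of u a b] ab(3) by (simp add: ev_def)
    then have "poly ?n a = 0" by (simp add: pe_const)
    moreover have "poly [:poly curve_poly a, a, 1:] b = 0"
    proof -
      have "poly [:poly curve_poly a, a, 1:] b = (b\<^sup>2 + a * b) + (a ^ 3 + t_gen * a\<^sup>2 + t_gen ^ 6)"
        by (simp add: curve_poly_def algebra_simps power2_eq_square power3_eq_cube)
      then show ?thesis using ab(2) unfolding on_curve_def by simp
    qed
    ultimately show "z \<in> (\<Union>a\<in>{a. poly ?n a = 0}. {a} \<times> {b. poly [:poly curve_poly a, a, 1:] b = 0})"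
      using ab(1) by blast
  qed
  moreover have "finite {b. poly [:poly curve_poly a, a, 1:] b = 0}" for a by (rule poly_roots_finite) simp
  ultimately show ?thesis using poly_roots_finite[OF n] by (auto intro: finite_subset)
qed

lemma curve_infinite: "infinite {(a, b). on_curve a b}"
proof
  assume f: "finite {(a, b). on_curve a b}"
  have "\<exists>b. on_curve a b" for a
  proof -
    obtain b where "poly [:poly curve_poly a, a, 1:] b = 0"
      using alg_closed_imp_poly_has_root[of "[:poly curve_poly a, a, 1:]"] by auto
    then have "on_curve a b"
      unfolding on_curve_def by (simp add: add_eq_0_iff_eq curve_poly_def algebra_simps power2_eq_square power3_eq_cube)
    then show ?thesis by blast
  qed
  then have "fst ` {(a, b). on_curve a b} = UNIV" by (auto simp: image_iff)
  then have "finite (UNIV :: F2t_bar set)" using f by (metis finite_imageI)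
  then have fin: "finite (range (\<lambda>n::nat. to_ac (to_fract (X2 ^ n))))" by (rule finite_subset[rotated]) simp
  moreover have "inj (\<lambda>n::nat. to_ac (to_fract (X2 ^ n)))"
  proof (rule injI)
    fix m n assume "to_ac (to_fract (X2 ^ m)) = to_ac (to_fract (X2 ^ n))"
    then have "degree (X2 ^ m) = degree (X2 ^ n)" by (simp only: to_ac_eq_iff to_fract_eq_iff)
    then show "m = n" by (simp add: degree_power_eq)
  qed
  ultimately show False using finite_imageD by blast
qed

lemma cfun_eqI:
  assumes "finite {(a, b). on_curve a b \<and> cv u a b \<noteq> cv w a b}" "y\<^sup>2 + x * y = x ^ 3 + tt * x\<^sup>2 + tt ^ 6"
  shows "ev u x y = ev w x y"
proof -
  have "cf_add u w = (0, 0)"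
  proof (rule ccontr)
    assume "cf_add u w \<noteq> (0, 0)"
    then have "finite {(a, b). on_curve a b \<and> cv (cf_add u w) a b = 0}" by (rule cf_zeros_finite)
    with assms(1) have "finite ({(a, b). on_curve a b \<and> cv (cf_add u w) a b = 0} \<union> {(a, b). on_curve a b \<and> cv u a b \<noteq> cv w a b})" by simp
    then have "finite {(a, b). on_curve a b}"
      by (rule finite_subset[rotated]) (auto simp: cv_add)
    then show False using curve_infinite by blast
  qed
  then have "ev (cf_add u w) x y = 0" by (simp add: ev_def)
  then show ?thesis by (simp add: ev_add add_eq_0_iff_eq)
qed

text \<open>This contains the irreducibility of the curve. A form that is nonzero at one point of
  \<open>V\<close>, possibly the point at infinity, has a nonzero expansion there; so it restricts
  to a nonzero function and has finitely many affine zeros.\<close>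

lemma open_cofinite:
  assumes "zar_open UNIV 2 E V" "V \<noteq> {}"
  shows "finite {(a, b). on_curve a b \<and> pt a b \<notin> V}"
proof -
  obtain C where C: "V = {P \<in> E. nzlocus 2 C P}" using assms(1) unfolding zar_open_iff[OF E_sub] by blast
  obtain P where P: "P \<in> E" "nzlocus 2 C P" using assms(2) C by blast
  then obtain d c where dc: "(d, c) \<in> C" "\<forall>v\<in>P. gval 2 d c v \<noteq> 0" unfolding nzlocus_def by blast
  obtain x y U l v where f: "std_point x y U" "fdata P x y l v" using point_std[OF P(1)] by blast
  note curve = formal_point_curve[OF std_point_formal[OF f(1)]]
  have "fls_nth (geval fls_const 2 d c (fv x y l)) 0 = gval 2 d c v"
    using geval_ordge[of "fv x y l"] f(2) unfolding fdata_def by auto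
  then have "geval fls_const 2 d c (fv x y l) \<noteq> 0" using dc(2) f(2) unfolding fdata_def by auto
  then have "ev (deh d c) x y \<noteq> 0" unfolding geval_fv[OF curve] by auto
  then have "deh d c \<noteq> (0, 0)" by (auto simp: ev_def)
  then have "finite {(a, b). on_curve a b \<and> cv (deh d c) a b = 0}" by (rule cf_zeros_finite)
  then show ?thesis
  proof (rule finite_subset[rotated], safe)
    fix a b assume ab: "on_curve a b" "pt a b \<notin> V"
    show "cv (deh d c) a b = 0"
    proof (rule ccontr)
      assume "cv (deh d c) a b \<noteq> 0"
      then have "\<forall>v\<in>pt a b. gval 2 d c v \<noteq> 0"
        using geval_nz_proj[OF _ vec_in_pt] pt_in_E[OF ab(1)] E_sub gval_vec[OF ab(1)] by (metis subsetD)
      then have "nzlocus 2 C (pt a b)" unfolding nzlocus_def using dc(1) by blast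
      then show False using ab pt_in_E C by blast
    qed
  qed
qed

lemma opens_meet:
  assumes "zar_open UNIV 2 E V" "V \<noteq> {}" "zar_open UNIV 2 E W" "W \<noteq> {}"
  shows "V \<inter> W \<noteq> {}"
proof
  assume "V \<inter> W = {}"
  then have "{(a, b). on_curve a b} \<subseteq> {(a, b). on_curve a b \<and> pt a b \<notin> V} \<union> {(a, b). on_curve a b \<and> pt a b \<notin> W}" by blast
  then have "finite {(a, b). on_curve a b}" using open_cofinite[OF assms(1,2)] open_cofinite[OF assms(3,4)] finite_subset by blast
  then show False using curve_infinite by blast
qed

section \<open>Ramification in terms of a valuation\<close>

text \<open>The map \<open>h\<close> acts as a valuation and \<open>J n\<close> collects the
  elements of order at least \<open>n\<close>. The power \<open>e\<close> of the maximal ideal lies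
  in the image of \<open>J e\<close>, and it contains the class of a product of \<open>e\<close>
  copies of \<open>p\<close>, whose order is exactly \<open>e\<close>. So the least order on
  \<open>S\<close>, attained at \<open>g0\<close>, is \<open>e\<close>.\<close>

lemma ramification_order:
  fixes R (structure) and h :: "'g \<Rightarrow> 'a::field fls" and e :: nat
  assumes R: "cring R" and N: "ideal N R"
    and h0: "\<And>f. f \<in> carrier R \<Longrightarrow> ordge 0 (h f)"
    and h1: "h \<one> = 1"
    and hadd: "\<And>f g. f \<in> carrier R \<Longrightarrow> g \<in> carrier R \<Longrightarrow> h (f \<oplus> g) = h f + h g"
    and hmult: "\<And>f g. f \<in> carrier R \<Longrightarrow> g \<in> carrier R \<Longrightarrow> h (f \<otimes> g) = h f * h g"
    and hN: "\<And>f. f \<in> N \<Longrightarrow> h f = 0"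
    and M: "M \<subseteq> carrier R" "\<And>f. f \<in> M \<Longrightarrow> ordge 1 (h f)"
    and p: "p \<in> M" "leading (h p) 1 a" "a \<noteq> 0"
    and S: "S \<subseteq> carrier R" "g0 \<in> S" "\<And>n f. ordge n (h g0) \<Longrightarrow> f \<in> S \<Longrightarrow> ordge n (h f)"
    and eq: "Idl\<^bsub>R Quot N\<^esub> ((\<lambda>f. N +> f) ` S) = ((\<lambda>f. N +> f) ` M) [^]\<^bsub>ideals_set (R Quot N)\<^esub> e"
  shows "h g0 \<noteq> 0 \<and> fls_subdegree (h g0) = e"
proof -
  interpret R: cring R by (rule R)
  interpret N: ideal N R by (rule N)
  let ?Q = "R Quot N"
  interpret Q: ring ?Q by (rule N.quotient_is_ring)
  have "h \<zero> + h \<zero> = h \<zero> + 0" using hadd[of \<zero> \<zero>] by simp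
  then have hz: "h \<zero> = 0" by (simp only: add_left_cancel)
  have hm: "h (\<ominus> f) = - h f" if "f \<in> carrier R" for f
    using hadd[OF that R.a_inv_closed[OF that]] that hz by (simp add: R.r_neg eq_neg_iff_add_eq_0 add.commute)
  define J where "J n = {f \<in> carrier R. ordge (int n) (h f)}" for n
  have J: "ideal (J n) R" for n
  proof (rule idealI[OF R.ring_axioms])
    show "subgroup (J n) (add_monoid R)"
    proof (rule R.add.subgroupI)
      show "J n \<subseteq> carrier R" by (auto simp: J_def)
      show "J n \<noteq> {}" using hz by (auto simp: J_def)
    next
      fix f assume "f \<in> J n"
      then show "\<ominus> f \<in> J n" using hm by (auto simp: J_def ordge_def)
    next
      fix f g assume "f \<in> J n" "g \<in> J n"
      then show "f \<oplus> g \<in> J n" using hadd ordge_add by (auto simp: J_def)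
    qed
  next
    fix f g assume f: "f \<in> J n" and g: "g \<in> carrier R"
    then have "ordge (0 + int n) (h g * h f)" unfolding J_def using ordge_mult[OF h0[OF g]] by blast
    then show "g \<otimes> f \<in> J n" using f g hmult by (simp add: J_def)
    then show "f \<otimes> g \<in> J n" using f g by (simp add: J_def R.m_comm)
  qed
  let ?q = "\<lambda>f. N +> f"
  have JQ: "ideal (?q ` J n) ?Q" for n by (rule R.ring_ideal_imp_quot_ideal[OF N J])
  have mem: "ordge (int n) (h f)" if f: "f \<in> carrier R" and in_J: "?q f \<in> ?q ` J n" for f n
  proof -
    obtain g where g: "g \<in> J n" "?q f = ?q g" using in_J by blast
    have "f \<in> ?q g" using N.a_rcos_self[OF f] g(2) by simp
    then have "\<exists>m\<in>N. f = m \<oplus> g" unfolding a_r_coset_def' by (simp only: UN_iff singleton_iff)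
    then obtain m where m: "m \<in> N" "f = m \<oplus> g" by (rule bexE)
    have "h f = h m + h g" unfolding m(2) using hadd g m(1) N.Icarr by (auto simp: J_def)
    then show ?thesis using hN[OF m(1)] g(1) by (simp add: J_def)
  qed
  have qm: "?q f \<otimes>\<^bsub>?Q\<^esub> ?q g = ?q (f \<otimes> g)" if "f \<in> carrier R" "g \<in> carrier R" for f g
    using ring_hom_mult[OF N.rcos_ring_hom that] by simp
  let ?M = "\<lambda>k::nat. (?q ` M) [^]\<^bsub>ideals_set ?Q\<^esub> k"
  \<comment> \<open>The one of \<open>ideals_set\<close> is the whole ring, so exponent zero stands
    for the unit ideal.\<close>
  have M0: "?M 0 = carrier ?Q" by (simp add: nat_pow_def ideals_set_def)
  have MS: "?M (Suc k) = ideal_prod ?Q (?M k) (?q ` M)" for k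
    by (simp add: nat_pow_def ideals_set_def)
  have le: "?M k \<subseteq> ?q ` J k" for k
  proof (induction k)
    case 0
    have "carrier ?Q \<subseteq> ?q ` J 0"
    proof
      fix z assume "z \<in> carrier ?Q"
      then obtain f where "f \<in> carrier R" "z = ?q f" unfolding FactRing_def A_RCOSETS_def' by auto
      then show "z \<in> ?q ` J 0" using h0 by (auto simp: J_def)
    qed
    then show ?case by (simp only: M0)
  next
    case (Suc k)
    show ?case
    proof
      fix z assume "z \<in> ?M (Suc k)"
      then have "z \<in> ideal_prod ?Q (?M k) (?q ` M)" by (simp only: MS)
      then show "z \<in> ?q ` J (Suc k)"
      proof (induction z rule: ideal_prod.induct)
        case (prod i j)
        obtain f where f: "f \<in> J k" "i = ?q f" using prod(1) Suc by blast
        obtain g where g: "g \<in> M" "j = ?q g" using prod(2) by blast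
        have fg: "f \<in> carrier R" "g \<in> carrier R" using f g M(1) by (auto simp: J_def)
        have "ordge (int k + 1) (h f * h g)" using ordge_mult f(1) M(2)[OF g(1)] unfolding J_def by blast
        then have "f \<otimes> g \<in> J (Suc k)" using fg hmult by (simp add: J_def add.commute)
        then show ?case unfolding f(2) g(2) qm[OF fg] by blast
      next
        case (sum s t)
        then show ?case using additive_subgroup.a_closed[OF ideal.axioms(1)[OF JQ]] by blast
      qed
    qed
  qed
  have pc: "p \<in> carrier R" using p(1) M(1) by blast
  have pk: "?q (p [^] k) \<in> ?M k" for k :: nat
  proof (induction k)
    case 0
    have "?q \<one> \<in> carrier ?Q" using ring_hom_closed[OF N.rcos_ring_hom R.one_closed] .
    then show ?case by (simp only: M0 R.nat_pow_0)
  next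
    case (Suc k)
    have "?q (p [^] k) \<otimes>\<^bsub>?Q\<^esub> ?q p \<in> ideal_prod ?Q (?M k) (?q ` M)"
      using Suc p(1) by (intro ideal_prod.prod) auto
    then show ?case unfolding MS qm[OF R.nat_pow_closed[OF pc] pc] by simp
  qed
  have hp: "h (p [^] k) = h p ^ k" for k :: nat
    by (induction k) (auto simp: h1 hmult pc mult.commute)
  have gen: "?q ` S \<subseteq> Idl\<^bsub>?Q\<^esub> (?q ` S)"
    by (rule Q.genideal_self) (use S(1) ring_hom_closed[OF N.rcos_ring_hom] in blast)
  have "?q g0 \<in> ?q ` J e" using gen eq le[of e] S(2) by blast
  then have ge: "ordge (int e) (h g0)" using mem S(1,2) by blast
  moreover have "\<not> ordge (int e + 1) (h g0)"
  proof
    assume "ordge (int e + 1) (h g0)"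
    then have "S \<subseteq> J (Suc e)" using S(1) S(3) by (auto simp: J_def add.commute)
    then have "Idl\<^bsub>?Q\<^esub> (?q ` S) \<subseteq> ?q ` J (Suc e)" by (intro Q.genideal_minimal JQ image_mono)
    then have "?q (p [^] e) \<in> ?q ` J (Suc e)" using eq pk[of e] by blast
    then have "ordge (int (Suc e)) (h p ^ e)" unfolding hp[symmetric] by (rule mem[OF R.nat_pow_closed[OF pc]])
    moreover have "leading (h p ^ e) (int e * 1) (a ^ e)" by (rule leading_power[OF p(2)])
    ultimately show False using p(3) by (auto simp: leading_def ordge_def)
  qed
  ultimately show ?thesis using ordge_iff[of "h g0"] by (cases "h g0 = 0") auto
qed

section \<open>Expansions of regular functions\<close>

text \<open>A single quotient on one nonempty open set is recorded: any two such sets meet in an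
  infinite set, so it already determines the expansion at every formal point.\<close>

definition rep :: "(F2t_bar ppoint \<Rightarrow> F2t_bar) \<Rightarrow> F2t_bar ppoint set \<Rightarrow> nat \<Rightarrow> ((nat \<Rightarrow> nat) \<Rightarrow> F2t_bar) \<Rightarrow> ((nat \<Rightarrow> nat) \<Rightarrow> F2t_bar) \<Rightarrow> bool" where
  "rep h V d c1 c2 \<longleftrightarrow> zar_open UNIV 2 E V \<and> V \<noteq> {} \<and>
     (\<forall>Q\<in>V. \<forall>v\<in>Q. gval 2 d c2 v \<noteq> 0 \<and> h Q = gval 2 d c1 v / gval 2 d c2 v)"

definition fexp :: "F2t_bar fls \<Rightarrow> F2t_bar fls \<Rightarrow> nat \<Rightarrow> ((nat \<Rightarrow> nat) \<Rightarrow> F2t_bar) \<Rightarrow> ((nat \<Rightarrow> nat) \<Rightarrow> F2t_bar) \<Rightarrow> F2t_bar fls" where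
  "fexp x y d c1 c2 = ev (deh d c1) x y / ev (deh d c2) x y"

lemma rep_value: "rep h V d c1 c2 \<Longrightarrow> Q \<in> V \<Longrightarrow> v \<in> Q \<Longrightarrow> gval 2 d c2 v \<noteq> 0 \<and> h Q = gval 2 d c1 v / gval 2 d c2 v"
  unfolding rep_def by blast

lemma rep_nonzero:
  assumes "rep h V d c1 c2"
  shows "deh d c2 \<noteq> (0, 0)"
proof
  assume z: "deh d c2 = (0, 0)"
  have "infinite ({(a, b). on_curve a b} - {(a, b). on_curve a b \<and> pt a b \<notin> V})"
    using curve_infinite open_cofinite[of V] assms unfolding rep_def by (intro Diff_infinite_finite) auto
  then have "{(a, b). on_curve a b} - {(a, b). on_curve a b \<and> pt a b \<notin> V} \<noteq> {}"
    by (rule infinite_imp_nonempty)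
  then obtain a b where ab: "on_curve a b" "pt a b \<in> V" by auto
  then have "gval 2 d c2 (vec a b 1) \<noteq> 0" using rep_value[OF assms ab(2) vec_in_pt] by simp
  then show False using gval_vec[OF ab(1)] z by (simp add: cv_def)
qed

lemma rep_den: "rep h V d c1 c2 \<Longrightarrow> formal_point x y U \<Longrightarrow> ev (deh d c2) x y \<noteq> 0"
  using rep_nonzero ev_eq_0 by blast

lemma rep_unique:
  assumes "rep h V d c1 c2" "rep h' V' d' c1' c2'" "formal_point x y U" "\<And>Q. Q \<in> V \<Longrightarrow> Q \<in> V' \<Longrightarrow> h Q = h' Q"
  shows "fexp x y d c1 c2 = fexp x y d' c1' c2'"
proof -
  note curve = formal_point_curve[OF assms(3)]
  let ?u = "cf_mult (deh d c1) (deh d' c2')" and ?w = "cf_mult (deh d' c1') (deh d c2)"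
  have key: "cv ?u a b = cv ?w a b" if ab: "on_curve a b" and V: "pt a b \<in> V" and V': "pt a b \<in> V'" for a b
    using rep_value[OF assms(1) V vec_in_pt] rep_value[OF assms(2) V' vec_in_pt] assms(4)[OF V V']
    unfolding cv_mult[OF ab] gval_vec[OF ab] by (simp add: field_simps)
  have "ev ?u x y = ev ?w x y"
  proof (rule cfun_eqI[OF _ curve])
    have "finite ({(a, b). on_curve a b \<and> pt a b \<notin> V} \<union> {(a, b). on_curve a b \<and> pt a b \<notin> V'})"
      using open_cofinite assms(1,2) unfolding rep_def by blast
    then show "finite {(a, b). on_curve a b \<and> cv ?u a b \<noteq> cv ?w a b}"
      by (rule finite_subset[rotated]) (use key in auto)
  qed
  then show ?thesis
    unfolding ev_mult[OF curve] fexp_def using rep_den[OF assms(1,3)] rep_den[OF assms(2,3)] by (simp add: field_simps)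
qed

text \<open>Independent of the chosen representation by \<open>rep_unique\<close>.\<close>

definition expo :: "F2t_bar fls \<Rightarrow> F2t_bar fls \<Rightarrow> (F2t_bar ppoint \<Rightarrow> F2t_bar) \<Rightarrow> F2t_bar fls" where
  "expo x y h = (SOME z. \<exists>V d c1 c2. rep h V d c1 c2 \<and> z = fexp x y d c1 c2)"

lemma expo_eq:
  assumes "rep h V d c1 c2" "formal_point x y U"
  shows "expo x y h = fexp x y d c1 c2"
proof -
  have "\<exists>V d c1 c2. rep h V d c1 c2 \<and> expo x y h = fexp x y d c1 c2"
    unfolding expo_def by (rule someI_ex) (use assms(1) in blast)
  then obtain V' d' c1' c2' where "rep h V' d' c1' c2'" "expo x y h = fexp x y d' c1' c2'" by blast
  then show ?thesis using rep_unique[OF _ assms(1) assms(2)] by metis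
qed

lemma expo_cong:
  assumes "rep h V d c1 c2" "rep h' V' d' c1' c2'" "formal_point x y U" "\<And>Q. Q \<in> V \<Longrightarrow> Q \<in> V' \<Longrightarrow> h Q = h' Q"
  shows "expo x y h = expo x y h'"
  unfolding expo_eq[OF assms(1,3)] expo_eq[OF assms(2,3)] by (rule rep_unique[OF assms])

lemma E_open_Int: "zar_open UNIV 2 E V \<Longrightarrow> zar_open UNIV 2 E W \<Longrightarrow> zar_open UNIV 2 E (V \<inter> W)"
  using zar_open_Int[OF E_sub _ _ E_sub] by (metis Int_absorb)

lemma rep_restrict: "rep h V d c1 c2 \<Longrightarrow> zar_open UNIV 2 E W \<Longrightarrow> W \<subseteq> V \<Longrightarrow> W \<noteq> {} \<Longrightarrow> rep h W d c1 c2"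
  unfolding rep_def by blast

lemma rep_const: "rep (\<lambda>_. a) E 0 (\<lambda>_. a) (\<lambda>_. 1)"
  unfolding rep_def using zar_open_self[OF E_sub] pt_inf_in_E by (auto simp: geval_degree_0[OF rhom_id])

lemma rep_add:
  assumes "rep h V d c1 c2" "rep h' V' d' c1' c2'"
  shows "rep (\<lambda>Q. h Q + h' Q) (V \<inter> V') (d + d') (\<lambda>m. cmul 2 d d' c1 c2' m + cmul 2 d d' c2 c1' m) (cmul 2 d d' c2 c2')"
  unfolding rep_def
proof (intro conjI ballI)
  show "zar_open UNIV 2 E (V \<inter> V')" "V \<inter> V' \<noteq> {}"
    using assms E_open_Int opens_meet unfolding rep_def by blast+
  fix Q v assume "Q \<in> V \<inter> V'" "v \<in> Q"
  then have r: "gval 2 d c2 v \<noteq> 0" "h Q = gval 2 d c1 v / gval 2 d c2 v"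
    "gval 2 d' c2' v \<noteq> 0" "h' Q = gval 2 d' c1' v / gval 2 d' c2' v"
    using rep_value[OF assms(1)] rep_value[OF assms(2)] by blast+
  show "gval 2 (d + d') (cmul 2 d d' c2 c2') v \<noteq> 0" unfolding geval_cmul[OF rhom_id] using r by simp
  show "h Q + h' Q = gval 2 (d + d') (\<lambda>m. cmul 2 d d' c1 c2' m + cmul 2 d d' c2 c1' m) v / gval 2 (d + d') (cmul 2 d d' c2 c2') v"
    unfolding geval_add[OF rhom_id] geval_cmul[OF rhom_id] r(2,4) add_frac_eq[OF r(1,3)] by (simp only: mult.commute)
qed

lemma rep_mult:
  assumes "rep h V d c1 c2" "rep h' V' d' c1' c2'"
  shows "rep (\<lambda>Q. h Q * h' Q) (V \<inter> V') (d + d') (cmul 2 d d' c1 c1') (cmul 2 d d' c2 c2')"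
  unfolding rep_def
proof (intro conjI ballI)
  show "zar_open UNIV 2 E (V \<inter> V')" "V \<inter> V' \<noteq> {}"
    using assms E_open_Int opens_meet unfolding rep_def by blast+
  fix Q v assume "Q \<in> V \<inter> V'" "v \<in> Q"
  then have r: "gval 2 d c2 v \<noteq> 0" "h Q = gval 2 d c1 v / gval 2 d c2 v"
    "gval 2 d' c2' v \<noteq> 0" "h' Q = gval 2 d' c1' v / gval 2 d' c2' v"
    using rep_value[OF assms(1)] rep_value[OF assms(2)] by blast+
  show "gval 2 (d + d') (cmul 2 d d' c2 c2') v \<noteq> 0" unfolding geval_cmul[OF rhom_id] using r by simp
  show "h Q * h' Q = gval 2 (d + d') (cmul 2 d d' c1 c1') v / gval 2 (d + d') (cmul 2 d d' c2 c2') v"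
    unfolding geval_cmul[OF rhom_id] r(2,4) by simp
qed

lemma expo_const: "formal_point x y U \<Longrightarrow> expo x y (\<lambda>_. a) = fls_const a"
  unfolding expo_eq[OF rep_const] fexp_def ev_deh[OF formal_point_curve] by (simp add: geval_degree_0[OF rhom_const])

lemma expo_add:
  assumes "rep h V d c1 c2" "rep h' V' d' c1' c2'" "formal_point x y U"
  shows "expo x y (\<lambda>Q. h Q + h' Q) = expo x y h + expo x y h'"
proof -
  note e = ev_deh[OF formal_point_curve[OF assms(3)]]
  note d = rep_den[OF assms(1,3), unfolded e] rep_den[OF assms(2,3), unfolded e]
  show ?thesis
    unfolding expo_eq[OF rep_add[OF assms(1,2)] assms(3)] expo_eq[OF assms(1,3)] expo_eq[OF assms(2,3)] fexp_def e
      geval_add[OF rhom_const] geval_cmul[OF rhom_const] add_frac_eq[OF d]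
    by (simp only: mult.commute)
qed

lemma expo_mult:
  assumes "rep h V d c1 c2" "rep h' V' d' c1' c2'" "formal_point x y U"
  shows "expo x y (\<lambda>Q. h Q * h' Q) = expo x y h * expo x y h'"
  unfolding expo_eq[OF rep_mult[OF assms(1,2)] assms(3)] expo_eq[OF assms(1,3)] expo_eq[OF assms(2,3)] fexp_def
    ev_deh[OF formal_point_curve[OF assms(3)]] geval_cmul[OF rhom_const]
  by simp

lemma ordge_divide:
  fixes w w' :: "'a::field fls"
  assumes "ordge 0 w" "ordge 0 w'" "fls_nth w' 0 \<noteq> 0"
  shows "ordge 0 (w / w') \<and> fls_nth (w / w') 0 = fls_nth w 0 / fls_nth w' 0"
proof -
  have "leading w' 0 (fls_nth w' 0)" using assms(2) by (simp add: leading_def)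
  then have i: "leading (inverse w') 0 (inverse (fls_nth w' 0))" using leading_inverse[OF _ assms(3)] by fastforce
  then have o: "ordge 0 (inverse w')" "fls_nth (inverse w') 0 = inverse (fls_nth w' 0)" by (auto simp: leading_def)
  show ?thesis using ordge_mult[OF assms(1) o(1)] nth_mult_ordge[OF assms(1) o(1)] o(2) by (simp add: divide_inverse)
qed

text \<open>After scaling by \<open>l\<close> the expansion is a quotient of power series whose
  constant terms are the values of the two forms at \<open>v\<close>, and the denominator is nonzero
  there.\<close>

lemma expo_at_point:
  assumes "rep h V d c1 c2" "P \<in> V" "formal_point x y U" "fdata P x y l v"
  shows "ordge 0 (expo x y h) \<and> fls_nth (expo x y h) 0 = h P"
proof -
  note curve = formal_point_curve[OF assms(3)]
  let ?g = "\<lambda>c. geval fls_const 2 d c (fv x y l)"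
  have v: "v \<in> P" "l \<noteq> 0" using assms(4) unfolding fdata_def by auto
  have g: "ordge 0 (?g c) \<and> fls_nth (?g c) 0 = gval 2 d c v" for c
    using geval_ordge[of "fv x y l" 2 d c] assms(4) unfolding fdata_def by simp
  have "expo x y h = ?g c1 / ?g c2"
    unfolding expo_eq[OF assms(1,3)] fexp_def geval_fv[OF curve] using v(2) by simp
  then show ?thesis using ordge_divide[of "?g c1" "?g c2"] g rep_value[OF assms(1,2) v(1)] by simp
qed

section \<open>Local rings of the curve\<close>

abbreviation LR :: "F2t_bar ppoint \<Rightarrow> (F2t_bar ppoint \<Rightarrow> F2t_bar) ring" where
  "LR P \<equiv> fun_ring UNIV 2 (nbhds UNIV 2 E P)"

lemma LR_simps:
  "f \<otimes>\<^bsub>LR P\<^esub> g = (\<lambda>Q. f Q * g Q)" "f \<oplus>\<^bsub>LR P\<^esub> g = (\<lambda>Q. f Q + g Q)" "\<one>\<^bsub>LR P\<^esub> = (\<lambda>_. 1)" "\<zero>\<^bsub>LR P\<^esub> = (\<lambda>_. 0)"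
  by (simp_all add: fun_ring_def)

lemma LR_carrier_iff: "h \<in> carrier (LR P) \<longleftrightarrow> (\<exists>V d c1 c2. rep h V d c1 c2 \<and> P \<in> V)"
proof
  assume "h \<in> carrier (LR P)"
  then obtain W where W: "zar_open UNIV 2 E W" "P \<in> W" "h \<in> regular UNIV 2 W"
    unfolding fun_ring_def nbhds_def by auto
  then obtain V d G H where V: "G \<in> form UNIV 2 d" "H \<in> form UNIV 2 d" "zar_open UNIV 2 W V" "P \<in> V"
    "\<forall>Q\<in>V. \<forall>v\<in>Q. H v \<noteq> 0 \<and> h Q = G v / H v" unfolding regular_def by blast
  obtain c1 where c1: "G = gval 2 d c1" using V(1) unfolding in_form_iff by blast
  obtain c2 where c2: "H = gval 2 d c2" using V(2) unfolding in_form_iff by blast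
  have "rep h V d c1 c2" unfolding rep_def using zar_open_trans[OF E_sub W(1) V(3)] V(4,5) c1 c2 by blast
  then show "\<exists>V d c1 c2. rep h V d c1 c2 \<and> P \<in> V" using V(4) by blast
next
  assume "\<exists>V d c1 c2. rep h V d c1 c2 \<and> P \<in> V"
  then obtain V d c1 c2 where V: "rep h V d c1 c2" "P \<in> V" by blast
  have o: "zar_open UNIV 2 E V" using V(1) unfolding rep_def by blast
  then have s: "zar_open UNIV 2 V V" using zar_open_self zar_open_subset[OF o] E_sub by blast
  have "gval 2 d c1 \<in> form UNIV 2 d" "gval 2 d c2 \<in> form UNIV 2 d" unfolding in_form_iff by blast+
  moreover have "\<forall>Q\<in>V. \<forall>v\<in>Q. gval 2 d c2 v \<noteq> 0 \<and> h Q = gval 2 d c1 v / gval 2 d c2 v" using V(1) unfolding rep_def by blast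
  ultimately have "h \<in> regular UNIV 2 V" unfolding regular_def using s by blast
  then show "h \<in> carrier (LR P)" unfolding fun_ring_def nbhds_def using o V(2) by auto
qed

lemma LR_add:
  assumes "f \<in> carrier (LR P)" "g \<in> carrier (LR P)"
  shows "(\<lambda>Q. f Q + g Q) \<in> carrier (LR P)"
proof -
  obtain V d c1 c2 where V: "rep f V d c1 c2" "P \<in> V" using assms(1) unfolding LR_carrier_iff by blast
  obtain V' d' c1' c2' where V': "rep g V' d' c1' c2'" "P \<in> V'" using assms(2) unfolding LR_carrier_iff by blast
  show ?thesis unfolding LR_carrier_iff by (intro exI conjI, rule rep_add[OF V(1) V'(1)], rule IntI[OF V(2) V'(2)])
qed

lemma LR_mult:
  assumes "f \<in> carrier (LR P)" "g \<in> carrier (LR P)"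
  shows "(\<lambda>Q. f Q * g Q) \<in> carrier (LR P)"
proof -
  obtain V d c1 c2 where V: "rep f V d c1 c2" "P \<in> V" using assms(1) unfolding LR_carrier_iff by blast
  obtain V' d' c1' c2' where V': "rep g V' d' c1' c2'" "P \<in> V'" using assms(2) unfolding LR_carrier_iff by blast
  show ?thesis unfolding LR_carrier_iff by (intro exI conjI, rule rep_mult[OF V(1) V'(1)], rule IntI[OF V(2) V'(2)])
qed

lemma LR_const: "P \<in> E \<Longrightarrow> (\<lambda>_. a) \<in> carrier (LR P)"
  unfolding LR_carrier_iff by (intro exI conjI, rule rep_const)

lemma LR_cring:
  assumes "P \<in> E"
  shows "cring (LR P)"
proof (rule cringI)
  show "abelian_group (LR P)"
  proof (rule abelian_groupI)
    fix f assume "f \<in> carrier (LR P)"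
    then show "\<exists>g\<in>carrier (LR P). g \<oplus>\<^bsub>LR P\<^esub> f = \<zero>\<^bsub>LR P\<^esub>" by (intro bexI[of _ f]) (auto simp: LR_simps)
  qed (auto simp: LR_simps LR_add LR_const[OF assms] add_ac)
  show "Group.comm_monoid (LR P)"
    by (rule comm_monoidI) (auto simp: LR_simps LR_mult LR_const[OF assms] mult_ac)
qed (auto simp: LR_simps algebra_simps)

lemma null_ideal_ideal:
  assumes "P \<in> E"
  shows "ideal (null_ideal UNIV 2 (nbhds UNIV 2 E P)) (LR P)"
proof -
  let ?R = "LR P" and ?N = "null_ideal UNIV 2 (nbhds UNIV 2 E P)"
  interpret R: cring ?R by (rule LR_cring[OF assms])
  have N: "f \<in> ?N \<longleftrightarrow> f \<in> carrier ?R \<and> (\<exists>V. zar_open UNIV 2 E V \<and> P \<in> V \<and> (\<forall>Q\<in>V. f Q = 0))" for f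
    unfolding null_ideal_def nbhds_def by auto
  have m: "(\<lambda>Q. g Q * f Q) \<in> ?N" if "f \<in> ?N" "g \<in> carrier ?R" for f g
    using that LR_mult unfolding N by fastforce
  show ?thesis
  proof (rule idealI[OF R.ring_axioms])
    show "subgroup ?N (add_monoid ?R)"
    proof (rule R.add.subgroupI)
      show "?N \<subseteq> carrier ?R" unfolding null_ideal_def by blast
      have "(\<lambda>_. 0) \<in> ?N" unfolding N using LR_const[OF assms] zar_open_self[OF E_sub] assms by blast
      then show "?N \<noteq> {}" by blast
    next
      fix f assume f: "f \<in> ?N"
      have fc: "f \<in> carrier ?R" using f unfolding N by blast
      have "\<ominus>\<^bsub>?R\<^esub> f = f" by (rule R.minus_equality[OF _ fc fc]) (simp add: LR_simps)
      then show "\<ominus>\<^bsub>?R\<^esub> f \<in> ?N" using f by simp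
    next
      fix f g assume f: "f \<in> ?N" and g: "g \<in> ?N"
      obtain V where V: "zar_open UNIV 2 E V" "P \<in> V" "\<forall>Q\<in>V. f Q = 0" using f unfolding N by blast
      obtain W where W: "zar_open UNIV 2 E W" "P \<in> W" "\<forall>Q\<in>W. g Q = 0" using g unfolding N by blast
      have "(\<lambda>Q. f Q + g Q) \<in> carrier ?R" using f g LR_add unfolding N by blast
      moreover have "\<forall>Q\<in>V \<inter> W. f Q + g Q = 0" using V W by simp
      ultimately show "f \<oplus>\<^bsub>?R\<^esub> g \<in> ?N" unfolding N LR_simps using E_open_Int[OF V(1) W(1)] V(2) W(2) by blast
    qed
  next
    fix f g assume "f \<in> ?N" "g \<in> carrier ?R"
    then show "g \<otimes>\<^bsub>?R\<^esub> f \<in> ?N" "f \<otimes>\<^bsub>?R\<^esub> g \<in> ?N" using m[of f g] by (auto simp: LR_simps mult.commute)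
  qed
qed

lemma expo_null:
  assumes "f \<in> null_ideal UNIV 2 (nbhds UNIV 2 E P)" "formal_point x y U"
  shows "expo x y f = 0"
proof -
  obtain V where V: "zar_open UNIV 2 E V" "P \<in> V" "\<forall>Q\<in>V. f Q = 0" and f: "f \<in> carrier (LR P)"
    using assms(1) unfolding null_ideal_def nbhds_def by blast
  obtain W d c1 c2 where W: "rep f W d c1 c2" using f unfolding LR_carrier_iff by blast
  have "V \<subseteq> E" "V \<noteq> {}" using V zar_open_subset by blast+
  then have r: "rep (\<lambda>_. 0) V 0 (\<lambda>_. 0) (\<lambda>_. 1)" by (rule rep_restrict[OF rep_const V(1)])
  have "expo x y f = expo x y (\<lambda>_. 0)" by (rule expo_cong[OF W r assms(2)]) (use V(3) in blast)
  then show ?thesis using expo_const[OF assms(2)] by simp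
qed

lemma open_nonvanishing:
  assumes "zar_open UNIV 2 E V"
  shows "zar_open UNIV 2 E {Q \<in> V. \<forall>v\<in>Q. gval 2 d c v \<noteq> 0}"
proof -
  have V: "V \<subseteq> proj_space 2" using zar_open_subset[OF assms] E_sub by blast
  have "{Q \<in> V. \<forall>v\<in>Q. gval 2 d c v \<noteq> 0} = {Q \<in> V. nzlocus 2 {(d, c)} Q}" unfolding nzlocus_def by simp
  then have "zar_open UNIV 2 V {Q \<in> V. \<forall>v\<in>Q. gval 2 d c v \<noteq> 0}"
    unfolding zar_open_iff[OF V] by (intro exI[of _ "{(d, c)}"]) simp
  then show ?thesis by (rule zar_open_trans[OF E_sub assms])
qed

lemma rep_form:
  assumes "P \<in> E" "v \<in> P" "gval 2 d c2 v \<noteq> 0"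
  obtains h V where "rep h V d c1 c2" "P \<in> V"
proof -
  let ?V = "{Q \<in> E. \<forall>v\<in>Q. gval 2 d c2 v \<noteq> 0}"
  let ?h = "\<lambda>Q. gval 2 d c1 (SOME v. v \<in> Q) / gval 2 d c2 (SOME v. v \<in> Q)"
  have P: "P \<in> ?V" using assms geval_nz_proj[OF subsetD[OF E_sub assms(1)] assms(2)] by blast
  have "rep ?h ?V d c1 c2"
    unfolding rep_def
  proof (intro conjI ballI)
    show "zar_open UNIV 2 E ?V" by (rule open_nonvanishing[OF zar_open_self[OF E_sub]])
    show "?V \<noteq> {}" using P by blast
    fix Q v assume Q: "Q \<in> ?V" and v: "v \<in> Q"
    show "gval 2 d c2 v \<noteq> 0" using Q v by blast
    have "(SOME v. v \<in> Q) \<in> Q" using someI[of "\<lambda>v. v \<in> Q" v] v by simp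
    then show "?h Q = gval 2 d c1 v / gval 2 d c2 v" using geval_ratio_proj v Q E_sub by blast
  qed
  then show thesis using P that by blast
qed

text \<open>A quotient of linear forms in each case: \<open>x / y\<close> at infinity,
  \<open>y + c0^2\<close> at \<open>T\<close>, and \<open>x + b\<close> at the other affine
  points.\<close>

lemma uniformizer:
  assumes "P \<in> E" "std_point x y U" "fdata P x y l v"
  shows "\<exists>h\<in>max_ideal_funs 2 E P. \<exists>a. a \<noteq> 0 \<and> leading (expo x y h) 1 a"
proof -
  have fp: "formal_point x y U" using assms(2) by (rule std_point_formal)
  note curve = formal_point_curve[OF fp]
  have v: "v \<in> P" "l \<noteq> 0" "\<And>i. ordge 0 (fv x y l i)" "\<And>i. fls_nth (fv x y l i) 0 = v i" using assms(3) unfolding fdata_def by auto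
  have fvec: "fv x y l i = l * vec x y 1 i" for i unfolding fv_def by (auto simp: vec_def)
  \<comment> \<open>The index \<open>j\<close> marks a coordinate of least order. It cannot vanish
    at \<open>P\<close>, since otherwise all coordinates would.\<close>
  have chart: ?thesis if j: "j \<le> 2" "vec x y 1 j \<noteq> 0" "\<And>i. ordge 0 (vec x y 1 i / vec x y 1 j)"
    and lead: "leading (geval fls_const 2 1 c (vec x y 1) / vec x y 1 j) 1 a" "a \<noteq> 0" for j c a
  proof -
    have "v j \<noteq> 0"
    proof
      assume z: "v j = 0"
      have o: "ordge (0 + 1) (fv x y l j)" unfolding ordge_Suc using v(3,4)[of j] z by simp
      have "v i = 0" for i
      proof -
        have "fv x y l i = fv x y l j * (vec x y 1 i / vec x y 1 j)" unfolding fvec using j(2) by simp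
        then have "ordge (0 + 1 + 0) (fv x y l i)" using ordge_mult[OF o j(3)] by simp
        then show ?thesis using v(4)[of i] by (simp add: ordge_def)
      qed
      then show False using proj_spaceE(3)[OF subsetD[OF E_sub assms(1)] v(1)] by blast
    qed
    then have "gval 2 1 (cvar j) v \<noteq> 0" using geval_cvar[OF rhom_id j(1)] by metis
    then obtain h V where h: "rep h V 1 c (cvar j)" "P \<in> V" by (rule rep_form[OF assms(1) v(1)])
    have e: "expo x y h = geval fls_const 2 1 c (vec x y 1) / vec x y 1 j"
      unfolding expo_eq[OF h(1) fp] fexp_def ev_deh[OF curve] geval_cvar[OF rhom_const j(1)] ..
    have "fls_nth (expo x y h) 0 = 0" using lead unfolding e by (simp add: leading_def ordge_def)
    then have "h P = 0" using expo_at_point[OF h fp assms(3)] by simp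
    then have "h \<in> max_ideal_funs 2 E P" unfolding max_ideal_funs_def using h LR_carrier_iff by blast
    then show ?thesis using lead e by metis
  qed
  have o1: "ordge 0 (1 :: F2t_bar fls)" by (auto simp: ordge_def)
  have shift: "geval fls_const 2 1 (\<lambda>m. cvar i m + b * cvar 2 m) (vec x y 1) = vec x y 1 i + fls_const b" if "i \<le> 2" for i b
    unfolding geval_add[OF rhom_const] geval_cmult[OF rhom_const] geval_cvar[OF rhom_const that] geval_cvar[OF rhom_const order_refl] by simp
  have affine: ?thesis if o: "ordge 0 x" "ordge 0 y" and i: "i \<le> 2" and lead: "leading (vec x y 1 i + fls_const b) 1 a" "a \<noteq> 0" for i a b
  proof (rule chart[of 2 "\<lambda>m. cvar i m + b * cvar 2 m" a])
    show "ordge 0 (vec x y 1 i / vec x y 1 2)" for i using o o1 by (simp add: vec_def)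
    show "leading (geval fls_const 2 1 (\<lambda>m. cvar i m + b * cvar 2 m) (vec x y 1) / vec x y 1 2) 1 a"
      unfolding shift[OF i] using lead by simp
  qed (use lead in auto)
  consider "leading x (- 2) 1" "leading y (- 3) 1" | "leading x 2 (c0\<^sup>2)" "leading (y + cc\<^sup>2) 1 (c0\<^sup>2)"
    | b where "x = fls_const b + fls_X" "ordge 0 y"
    using assms(2) unfolding std_point_def by blast
  then show ?thesis
  proof cases
    case 1
    have iy: "leading (inverse y) 3 1" using leading_inverse[OF 1(2)] by simp
    have xy: "leading (x / y) 1 1" using leading_mult[OF 1(1) iy] by (simp add: divide_inverse)
    have y0: "y \<noteq> 0" using leading_nz[OF 1(2)] by simp
    show ?thesis
    proof (rule chart[of 1 "cvar 0" 1])
      show "ordge 0 (vec x y 1 i / vec x y 1 1)" for i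
        using leading_ordge[OF xy, of 0] leading_ordge[OF iy, of 0] y0 o1
        by (auto simp: vec_def divide_inverse)
      show "leading (geval fls_const 2 1 (cvar 0) (vec x y 1) / vec x y 1 1) 1 1"
        using geval_cvar[OF rhom_const, of 0 2 "vec x y 1"] xy by simp
    qed (use y0 in auto)
  next
    case 2
    show ?thesis
    proof (rule affine[of 1 "c0\<^sup>2" "c0\<^sup>2"])
      show "leading (vec x y 1 1 + fls_const (c0\<^sup>2)) 1 (c0\<^sup>2)" using 2(2) by (simp add: fls_const_power)
    qed (use T_ordge[OF 2] c0_nz in auto)
  next
    case 3
    have o: "ordge 0 x" unfolding 3(1) by (auto simp: ordge_def)
    have "x + fls_const b = fls_X" unfolding 3(1) by (rule char2_eq[of 0 0]) (simp_all add: add_ac)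
    then have "leading (vec x y 1 0 + fls_const b) 1 1" using leading_X by simp
    then show ?thesis using affine[of 0 b 1] o 3(2) by simp
  qed
qed

text \<open>The valuation criterion applied to the local ring at \<open>P\<close>, with
  \<open>expo x y\<close> as the valuation: the ramification index is the least order among the
  pulled back functions.\<close>

lemma ramification_expo:
  assumes "P \<in> E" "std_point x y U" "fdata P x y l v"
    and e: "has_ramification_index 2 E m B \<phi> P e"
    and c: "\<And>g. g \<in> max_ideal_funs m B (\<phi> P) \<Longrightarrow> g \<circ> \<phi> \<in> carrier (LR P)"
    and g0: "g0 \<in> max_ideal_funs m B (\<phi> P)"
      "\<And>n g. ordge n (expo x y (g0 \<circ> \<phi>)) \<Longrightarrow> g \<in> max_ideal_funs m B (\<phi> P) \<Longrightarrow> ordge n (expo x y (g \<circ> \<phi>))"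
  shows "expo x y (g0 \<circ> \<phi>) \<noteq> 0 \<and> fls_subdegree (expo x y (g0 \<circ> \<phi>)) = e"
proof -
  have fp: "formal_point x y U" using assms(2) by (rule std_point_formal)
  let ?N = "null_ideal UNIV 2 (nbhds UNIV 2 E P)"
  obtain h a where h: "h \<in> max_ideal_funs 2 E P" "a \<noteq> 0" "leading (expo x y h) 1 a" using uniformizer[OF assms(1-3)] by blast
  have val: "ordge 0 (expo x y f) \<and> fls_nth (expo x y f) 0 = f P" if "f \<in> carrier (LR P)" for f
    using that expo_at_point[OF _ _ fp assms(3)] unfolding LR_carrier_iff by blast
  show ?thesis
  proof (rule ramification_order[OF LR_cring[OF assms(1)] null_ideal_ideal[OF assms(1)], where h = "expo x y" and
        M = "max_ideal_funs 2 E P" and S = "(\<lambda>g. g \<circ> \<phi>) ` max_ideal_funs m B (\<phi> P)"])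
    show "ordge 0 (expo x y f)" if "f \<in> carrier (LR P)" for f using val[OF that] by blast
    show "expo x y \<one>\<^bsub>LR P\<^esub> = 1" unfolding LR_simps expo_const[OF fp] by simp
    show "expo x y (f \<oplus>\<^bsub>LR P\<^esub> g) = expo x y f + expo x y g" if "f \<in> carrier (LR P)" "g \<in> carrier (LR P)" for f g
      using that expo_add[OF _ _ fp] unfolding LR_simps LR_carrier_iff by blast
    show "expo x y (f \<otimes>\<^bsub>LR P\<^esub> g) = expo x y f * expo x y g" if "f \<in> carrier (LR P)" "g \<in> carrier (LR P)" for f g
      using that expo_mult[OF _ _ fp] unfolding LR_simps LR_carrier_iff by blast
    show "expo x y f = 0" if "f \<in> ?N" for f by (rule expo_null[OF that fp])
    show "max_ideal_funs 2 E P \<subseteq> carrier (LR P)" unfolding max_ideal_funs_def by blast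
    show "ordge 1 (expo x y f)" if "f \<in> max_ideal_funs 2 E P" for f
      using val[of f] that ordge_Suc[of 0] unfolding max_ideal_funs_def by auto
    show "h \<in> max_ideal_funs 2 E P" "leading (expo x y h) 1 a" "a \<noteq> 0" using h by auto
    show "(\<lambda>g. g \<circ> \<phi>) ` max_ideal_funs m B (\<phi> P) \<subseteq> carrier (LR P)" using c by blast
    show "g0 \<circ> \<phi> \<in> (\<lambda>g. g \<circ> \<phi>) ` max_ideal_funs m B (\<phi> P)" using g0(1) by blast
    show "ordge n (expo x y f)" if "ordge n (expo x y (g0 \<circ> \<phi>))" "f \<in> (\<lambda>g. g \<circ> \<phi>) ` max_ideal_funs m B (\<phi> P)" for n f
      using g0(2)[OF that(1)] that(2) by blast
    show "Idl\<^bsub>LR P Quot ?N\<^esub> ((\<lambda>f. ?N +>\<^bsub>LR P\<^esub> f) ` (\<lambda>g. g \<circ> \<phi>) ` max_ideal_funs m B (\<phi> P)) =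
      ((\<lambda>f. ?N +>\<^bsub>LR P\<^esub> f) ` max_ideal_funs 2 E P) [^]\<^bsub>ideals_set (LR P Quot ?N)\<^esub> e"
      using e unfolding has_ramification_index_def local_ring_def germ_ring_def max_ideal_def germ_def image_image by simp
  qed
qed

section \<open>Charts of the projective line\<close>

abbreviation P1 :: "F2t_bar ppoint set" where "P1 \<equiv> proj_space 1"

definition chart_set :: "nat \<Rightarrow> F2t_bar ppoint set" where
  "chart_set i = {Q \<in> P1. \<forall>w\<in>Q. w i \<noteq> 0}"

text \<open>For \<open>i \<le> 1\<close> the index \<open>1 - i\<close> is the other coordinate, so
  where both charts are defined their values are inverse to each other.\<close>

definition chart :: "nat \<Rightarrow> F2t_bar ppoint \<Rightarrow> F2t_bar" where
  "chart i Q = (SOME w. w \<in> Q) (1 - i) / (SOME w. w \<in> Q) i"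

definition cvec :: "nat \<Rightarrow> 'a::one \<Rightarrow> nat \<Rightarrow> 'a" where
  "cvec i z k = (if k = i then 1 else z)"

lemma chart_eq:
  assumes "Q \<in> chart_set i" "w \<in> Q"
  shows "chart i Q = w (1 - i) / w i"
proof -
  have s: "(SOME w. w \<in> Q) \<in> Q" using someI[of "\<lambda>w. w \<in> Q" w] assms(2) by simp
  have Q: "Q \<in> P1" using assms(1) unfolding chart_set_def by blast
  obtain c where "c \<noteq> 0" "(SOME w. w \<in> Q) = (\<lambda>i. c * w i)" by (rule geval_proj[OF Q assms(2) s]) (rule that)
  then show ?thesis unfolding chart_def by simp
qed

lemma chart_vector:
  assumes "Q \<in> chart_set i" "w \<in> Q" "i \<le> 1"
  shows "gval 1 e g w = w i ^ e * gval 1 e g (cvec i (chart i Q))"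
proof -
  have nz: "w i \<noteq> 0" using assms unfolding chart_set_def by blast
  have "gval 1 e g w = gval 1 e g (\<lambda>k. w i * cvec i (chart i Q) k)"
  proof (rule geval_cong)
    fix k :: nat assume "k \<le> 1"
    then have "k = i \<or> k = 1 - i" using assms(3) by linarith
    then show "w k = w i * cvec i (chart i Q) k" unfolding chart_eq[OF assms(1,2)] cvec_def using nz by auto
  qed
  then show ?thesis by (simp add: geval_scale)
qed

lemma chart_open: "i \<le> 1 \<Longrightarrow> zar_open F2t_perf 1 P1 (chart_set i)"
proof -
  assume i: "i \<le> 1"
  have "gval 1 1 (cvar i) w = w i" for w :: "nat \<Rightarrow> F2t_bar" by (rule geval_cvar[OF rhom_id i])
  then have "chart_set i = {Q \<in> P1. nzlocus 1 {(1, cvar i)} Q}" unfolding chart_set_def nzlocus_def by simp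
  then show ?thesis unfolding zar_open_iff[OF order_refl]
    by (intro exI[of _ "{(1, cvar i)}"]) (auto simp: cvar_def perf_0 perf_1)
qed

text \<open>Over the perfect closure this is used to pull back the coordinate with rational
  coefficients; over \<open>UNIV\<close> it supplies the element \<open>chart i Q + a\<close> of the
  maximal ideal at a geometric point.\<close>

lemma chart_regular:
  assumes "i \<le> 1" "a \<in> K" "0 \<in> K" "1 \<in> K" "K = F2t_perf \<or> K = UNIV"
  shows "(\<lambda>Q. chart i Q + a) \<in> regular K 1 (chart_set i)"
proof -
  let ?c = "\<lambda>m. cvar (1 - i) m + a * cvar i m"
  have g: "gval 1 1 ?c w = w (1 - i) + a * w i" "gval 1 1 (cvar i) w = w i" for w :: "nat \<Rightarrow> F2t_bar"
    unfolding geval_add[OF rhom_id] geval_cmult[OF rhom_id] by (simp_all add: geval_cvar[OF rhom_id] assms(1) del: One_nat_def)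
  have C: "chart_set i \<subseteq> P1" unfolding chart_set_def by blast
  have z: "zar_open K 1 (chart_set i) (chart_set i)"
    unfolding zar_open_iff[OF C]
    by (intro exI[of _ "{(0, \<lambda>_. 1)}"]) (use assms(4) in \<open>auto simp: nzlocus_def geval_degree_0[OF rhom_id]\<close>)
  have plus: "b + a' \<in> K" if "b \<in> K" "a' \<in> K" for b a' using that assms(5) perf_add by blast
  have cv: "?c m \<in> K" for m by (rule plus) (use assms in \<open>auto simp: cvar_def\<close>)
  have f: "gval 1 1 ?c \<in> form K 1 1" unfolding in_form_iff by (intro exI[of _ ?c]) (use cv in auto)
  have f': "gval 1 1 (cvar i) \<in> form K 1 1"
    unfolding in_form_iff using assms(3,4) by (intro exI[of _ "cvar i"]) (auto simp: cvar_def)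
  have v: "gval 1 1 (cvar i) w \<noteq> 0 \<and> chart i Q + a = gval 1 1 ?c w / gval 1 1 (cvar i) w" if "Q \<in> chart_set i" "w \<in> Q" for Q w
  proof -
    have "w i \<noteq> 0" using that unfolding chart_set_def by blast
    then show ?thesis unfolding g chart_eq[OF that] by (simp add: add_divide_distrib)
  qed
  have "zar_open K 1 (chart_set i) (chart_set i) \<and> P \<in> chart_set i \<and>
      (\<forall>Q\<in>chart_set i. \<forall>w\<in>Q. gval 1 1 (cvar i) w \<noteq> 0 \<and> chart i Q + a = gval 1 1 ?c w / gval 1 1 (cvar i) w)"
    if "P \<in> chart_set i" for P using z v that by blast
  then show ?thesis unfolding regular_def using f f' by blast
qed

lemma geval_cvec_poly:
  fixes c :: "(nat \<Rightarrow> nat) \<Rightarrow> 'a::idom"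
  assumes "i \<le> 1"
  shows "\<exists>p. (\<forall>w. geval fls_const 1 e c (cvec i w) = pe p w) \<and> (\<forall>z. gval 1 e c (cvec i z) = poly p z)"
proof -
  have pr: "(\<Prod>k\<le>1. cvec i w k ^ m k) = w ^ m (1 - i)" for w :: "'b::comm_ring_1" and m :: "nat \<Rightarrow> nat"
    using assms by (cases "i = 0") (auto simp: cvec_def)
  let ?p = "\<Sum>m\<in>monomials 1 e. Polynomial.monom (c m) (m (1 - i))"
  have s: "pe (sum f A) w = (\<Sum>a\<in>A. pe (f a) w)" for f :: "(nat \<Rightarrow> nat) \<Rightarrow> 'a poly" and A w
    by (induction A rule: infinite_finite_induct) auto
  have "geval fls_const 1 e c (cvec i w) = pe ?p w" for w
    unfolding geval_def pr s by (simp add: pe_monom)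
  moreover have "gval 1 e c (cvec i z) = poly ?p z" for z
    unfolding geval_def pr poly_sum by (simp add: poly_monom)
  ultimately show ?thesis by blast
qed

lemma ordge_pe:
  fixes w :: "'a::idom fls"
  assumes "ordge 0 w"
  shows "ordge 0 (pe p w) \<and> fls_nth (pe p w) 0 = poly p (fls_nth w 0)"
proof (induction p)
  case (pCons a p)
  have "ordge 0 (w * pe p w) \<and> fls_nth (w * pe p w) 0 = fls_nth w 0 * poly p (fls_nth w 0)"
    using ordge_mult[of 0 w 0 "pe p w"] nth_mult_ordge[of 0 w 0 "pe p w"] assms pCons by simp
  then show ?case using ordge_add[OF ordge_const] by auto
qed simp

text \<open>Rationality of \<open>\<phi>\<close> enters here: the coordinate pulls back to a
  quotient of forms with coefficients in the perfect closure.\<close>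

lemma pullback_chart:
  assumes "morphism F2t_perf 2 E 1 P1 \<phi>" "i \<le> 1" "P \<in> E" "\<phi> P \<in> chart_set i"
  obtains V d c1 c2 where "rep (\<lambda>Q. chart i (\<phi> Q)) V d c1 c2" "P \<in> V" "\<And>Q. Q \<in> V \<Longrightarrow> \<phi> Q \<in> chart_set i"
    "\<And>m. c1 m \<in> F2t_perf" "\<And>m. c2 m \<in> F2t_perf"
proof -
  let ?W = "{Q \<in> E. \<phi> Q \<in> chart_set i}"
  have r: "(\<lambda>Q. chart i Q + 0) \<in> regular F2t_perf 1 (chart_set i)"
    by (rule chart_regular[OF assms(2)]) (auto simp: perf_0 perf_1)
  have W: "zar_open F2t_perf 2 E ?W" "(\<lambda>Q. chart i Q + 0) \<circ> \<phi> \<in> regular F2t_perf 2 ?W"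
    using assms(1) chart_open[OF assms(2)] r unfolding morphism_def by blast+
  obtain V d G H where V: "G \<in> form F2t_perf 2 d" "H \<in> form F2t_perf 2 d" "zar_open F2t_perf 2 ?W V" "P \<in> V"
    "\<forall>Q\<in>V. \<forall>v\<in>Q. H v \<noteq> 0 \<and> ((\<lambda>Q. chart i Q + 0) \<circ> \<phi>) Q = G v / H v"
    using W(2) assms(3,4) unfolding regular_def by blast
  obtain c1 where c1: "\<forall>m. c1 m \<in> F2t_perf" "G = gval 2 d c1" using V(1) unfolding in_form_iff by blast
  obtain c2 where c2: "\<forall>m. c2 m \<in> F2t_perf" "H = gval 2 d c2" using V(2) unfolding in_form_iff by blast
  have "zar_open UNIV 2 E V" by (rule zar_open_trans[OF E_sub zar_open_UNIV[OF W(1)] zar_open_UNIV[OF V(3)]])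
  then have "rep (\<lambda>Q. chart i (\<phi> Q)) V d c1 c2" unfolding rep_def using V(4,5) c1(2) c2(2) by auto
  moreover have "\<phi> Q \<in> chart_set i" if "Q \<in> V" for Q using zar_open_subset[OF V(3)] that by blast
  ultimately show thesis using that V(4) c1(1) c2(1) by blast
qed

text \<open>A germ at \<open>\<phi> P\<close> is \<open>g / h\<close> for binary forms, which pull back to forms in
  the numerator and denominator of the coordinate function of \<open>\<phi>\<close>.\<close>

lemma pullback_germ:
  assumes phi: "\<phi> ` E \<subseteq> P1" and i: "i \<le> 1" and P: "P \<in> E" "\<phi> P \<in> chart_set i"
    and r: "rep (\<lambda>Q. chart i (\<phi> Q)) V d c1 c2" "P \<in> V" "\<And>Q. Q \<in> V \<Longrightarrow> \<phi> Q \<in> chart_set i"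
    and std: "formal_point x y U" "fdata P x y l v"
    and g: "g \<in> max_ideal_funs 1 P1 (\<phi> P)"
  shows "g \<circ> \<phi> \<in> carrier (LR P) \<and>
    (\<forall>n. ordge n (expo x y (\<lambda>Q. chart i (\<phi> Q)) + fls_const (chart i (\<phi> P))) \<longrightarrow> ordge n (expo x y (g \<circ> \<phi>)))"
proof -
  note curve = formal_point_curve[OF std(1)]
  obtain W where W: "zar_open UNIV 1 P1 W" "\<phi> P \<in> W" "g \<in> regular UNIV 1 W" and gP: "g (\<phi> P) = 0"
    using g unfolding max_ideal_funs_def fun_ring_def nbhds_def by auto
  obtain W' e G H where W': "G \<in> form UNIV 1 e" "H \<in> form UNIV 1 e" "zar_open UNIV 1 W W'" "\<phi> P \<in> W'"
    "\<forall>Q\<in>W'. \<forall>w\<in>Q. H w \<noteq> 0 \<and> g Q = G w / H w" using W(2,3) unfolding regular_def by blast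
  obtain cG where cG: "G = gval 1 e cG" using W'(1) unfolding in_form_iff by blast
  obtain cH where cH: "H = gval 1 e cH" using W'(2) unfolding in_form_iff by blast
  have "zar_open UNIV 1 P1 W'" by (rule zar_open_trans[OF order_refl W(1) W'(3)])
  then obtain C where C: "W' = {Q \<in> P1. nzlocus 1 C Q}" unfolding zar_open_iff[OF order_refl] by blast
  obtain e' c' where c': "(e', c') \<in> C" "\<forall>w\<in>\<phi> P. gval 1 e' c' w \<noteq> 0" using W'(4) unfolding C nzlocus_def by blast
  \<comment> \<open>Homogeneous coordinates of \<open>\<phi>\<close> on \<open>V\<close>: its
    coordinate function is \<open>c1\<close> divided by \<open>c2\<close>, so \<open>c2\<close>
    takes the position \<open>i\<close>.\<close>
  define F where "F k = (if k = i then c2 else c1)" for k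
  have Fv: "gval 2 (d * n) (ccomp 2 d n q F) v = gval 2 d c2 v ^ n * gval 1 n q (cvec i (chart i (\<phi> Q)))"
    if Q: "Q \<in> V" "v \<in> Q" for n q Q v
  proof -
    have "(\<lambda>k. gval 2 d (F k) v) = (\<lambda>k. gval 2 d c2 v * cvec i (chart i (\<phi> Q)) k)"
      using rep_value[OF r(1) Q] by (auto simp: F_def cvec_def)
    then show ?thesis unfolding geval_ccomp[OF rhom_id] by (simp add: geval_scale)
  qed
  have wv: "gval 1 n q w = w i ^ n * gval 1 n q (cvec i (chart i (\<phi> Q)))" "w i \<noteq> 0" if "Q \<in> V" "w \<in> \<phi> Q" for n q Q w
    using chart_vector[OF r(3) _ i] r(3)[OF that(1)] that unfolding chart_set_def by blast+
  \<comment> \<open>A neighbourhood of \<open>P\<close> that \<open>\<phi>\<close> maps into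
    \<open>W'\<close>, because the form \<open>c'\<close> stays nonzero on its image.\<close>
  define M where "M = {Q \<in> V. \<forall>v\<in>Q. gval 2 (d * e') (ccomp 2 d e' c' F) v \<noteq> 0}"
  have V: "zar_open UNIV 2 E V" "V \<subseteq> E" using r(1) zar_open_subset unfolding rep_def by blast+
  have ne: "\<exists>w. w \<in> \<phi> Q" if "Q \<in> V" for Q using that V(2) phi proj_space_nonempty by blast
  have nzV: "gval 2 d c2 v \<noteq> 0" if "Q \<in> V" "v \<in> Q" for Q v using rep_value[OF r(1) that] by simp
  have PM: "P \<in> M"
  proof -
    obtain w where w: "w \<in> \<phi> P" using ne[OF r(2)] by blast
    then have "gval 1 e' c' (cvec i (chart i (\<phi> P))) \<noteq> 0" using c'(2) wv[OF r(2) w] by fastforce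
    then show ?thesis unfolding M_def using r(2) Fv nzV by simp
  qed
  have MW: "\<phi> Q \<in> W'" if "Q \<in> M" for Q
  proof -
    have Q: "Q \<in> V" "Q \<in> E" using that V(2) unfolding M_def by blast+
    obtain v where v: "v \<in> Q" using Q E_sub proj_space_nonempty by blast
    have "gval 2 (d * e') (ccomp 2 d e' c' F) v \<noteq> 0" using that v unfolding M_def by blast
    then have "gval 1 e' c' (cvec i (chart i (\<phi> Q))) \<noteq> 0" using Fv[OF Q(1) v] by simp
    then have "\<forall>w\<in>\<phi> Q. gval 1 e' c' w \<noteq> 0" using wv[OF Q(1)] by simp
    then show ?thesis unfolding C nzlocus_def using c'(1) phi Q(2) by blast
  qed
  have val: "gval 1 e cH (cvec i (chart i (\<phi> Q))) \<noteq> 0 \<and>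
      g (\<phi> Q) = gval 1 e cG (cvec i (chart i (\<phi> Q))) / gval 1 e cH (cvec i (chart i (\<phi> Q)))" if "Q \<in> M" for Q
  proof -
    have Q: "Q \<in> V" using that unfolding M_def by blast
    obtain w where w: "w \<in> \<phi> Q" using ne[OF Q] by blast
    have "H w \<noteq> 0 \<and> g (\<phi> Q) = G w / H w" using W'(5) MW[OF that] w by blast
    then show ?thesis unfolding cG cH wv(1)[OF Q w] using wv(2)[OF Q w] by simp
  qed
  have rg: "rep (g \<circ> \<phi>) M (d * e) (ccomp 2 d e cG F) (ccomp 2 d e cH F)"
    unfolding rep_def
  proof (intro conjI ballI)
    show "zar_open UNIV 2 E M" unfolding M_def by (rule open_nonvanishing[OF V(1)])
    show "M \<noteq> {}" using PM by blast
    fix Q v assume Q: "Q \<in> M" and v: "v \<in> Q"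
    then have QV: "Q \<in> V" unfolding M_def by blast
    show "gval 2 (d * e) (ccomp 2 d e cH F) v \<noteq> 0"
      "(g \<circ> \<phi>) Q = gval 2 (d * e) (ccomp 2 d e cG F) v / gval 2 (d * e) (ccomp 2 d e cH F) v"
      using val[OF Q] nzV[OF QV v] unfolding Fv[OF QV v] by simp_all
  qed
  then have carr: "g \<circ> \<phi> \<in> carrier (LR P)" unfolding LR_carrier_iff using PM by blast
  let ?T = "expo x y (\<lambda>Q. chart i (\<phi> Q))" and ?z = "chart i (\<phi> P)"
  let ?b = "geval fls_const 2 d c2 (vec x y 1)"
  have b0: "?b \<noteq> 0" using rep_den[OF r(1) std(1)] unfolding ev_deh[OF curve] .
  have T: "?T = geval fls_const 2 d c1 (vec x y 1) / ?b" unfolding expo_eq[OF r(1) std(1)] fexp_def ev_deh[OF curve] ..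
  have Fx: "geval fls_const 2 (d * n) (ccomp 2 d n q F) (vec x y 1) = ?b ^ n * geval fls_const 1 n q (cvec i ?T)" for n q
  proof -
    have "(\<lambda>k. geval fls_const 2 d (F k) (vec x y 1)) = (\<lambda>k. ?b * cvec i ?T k)"
      using b0 unfolding T by (auto simp: F_def cvec_def)
    then show ?thesis unfolding geval_ccomp[OF rhom_const] by (simp add: geval_scale)
  qed
  have ex: "expo x y (g \<circ> \<phi>) = geval fls_const 1 e cG (cvec i ?T) / geval fls_const 1 e cH (cvec i ?T)"
    unfolding expo_eq[OF rg std(1)] fexp_def ev_deh[OF curve] Fx using b0 by simp
  obtain p where p: "\<And>w. geval fls_const 1 e cG (cvec i w) = pe p w" "\<And>z. gval 1 e cG (cvec i z) = poly p z"
    using geval_cvec_poly[OF i, of e cG] by blast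
  obtain q where q: "\<And>w. geval fls_const 1 e cH (cvec i w) = pe q w" "\<And>z. gval 1 e cH (cvec i z) = poly q z"
    using geval_cvec_poly[OF i, of e cH] by blast
  have Tz: "ordge 0 ?T" "fls_nth ?T 0 = ?z" using expo_at_point[OF r(1,2) std] by auto
  have "poly p ?z = 0" "poly q ?z \<noteq> 0" using val[OF PM] gP p(2) q(2) by auto
  \<comment> \<open>The germ vanishes at \<open>\<phi> P\<close>, so its numerator has the
    coordinate minus its value \<open>?z\<close> as a factor; the rest of the quotient is a power
    series.\<close>
  then obtain s where s: "p = [:- ?z, 1:] * s" using poly_eq_0_iff_dvd by (metis dvdE)
  have "expo x y (g \<circ> \<phi>) = (?T + fls_const ?z) * (pe s ?T / pe q ?T)"
    unfolding ex p(1) q(1) s pe_mult by (simp add: add.commute)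
  moreover have "ordge 0 (pe s ?T / pe q ?T)"
    using ordge_divide[of "pe s ?T" "pe q ?T"] ordge_pe[OF Tz(1)] Tz(2) \<open>poly q ?z \<noteq> 0\<close> by simp
  ultimately have "ordge n (expo x y (g \<circ> \<phi>))" if "ordge n (?T + fls_const ?z)" for n
    using ordge_mult[OF that, of 0 "pe s ?T / pe q ?T"] by simp
  then show ?thesis using carr by blast
qed

text \<open>Among the functions vanishing at \<open>\<phi> P\<close> the shifted coordinate has a
  pullback of least order, by \<open>pullback_germ\<close>; so this order is the ramification
  index.\<close>

lemma chart_ramification:
  assumes m: "morphism F2t_perf 2 E 1 P1 \<phi>" and i: "i \<le> 1" and P: "P \<in> E" "\<phi> P \<in> chart_set i"
    and std: "std_point x y U" "fdata P x y l v"
    and e: "has_ramification_index 2 E 1 P1 \<phi> P e"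
  shows "expo x y (\<lambda>Q. chart i (\<phi> Q)) + fls_const (chart i (\<phi> P)) \<noteq> 0 \<and>
    fls_subdegree (expo x y (\<lambda>Q. chart i (\<phi> Q)) + fls_const (chart i (\<phi> P))) = e"
proof -
  have fp: "formal_point x y U" using std(1) by (rule std_point_formal)
  obtain V d c1 c2 where r: "rep (\<lambda>Q. chart i (\<phi> Q)) V d c1 c2" "P \<in> V" "\<And>Q. Q \<in> V \<Longrightarrow> \<phi> Q \<in> chart_set i"
    by (rule pullback_chart[OF m i P]) (rule that)
  have phi: "\<phi> ` E \<subseteq> P1" using m unfolding morphism_def by blast
  note germ = pullback_germ[OF phi i P r fp std(2)]
  let ?z = "chart i (\<phi> P)"
  let ?g0 = "\<lambda>Q. chart i Q + ?z"
  have "?g0 \<in> regular UNIV 1 (chart_set i)" by (rule chart_regular[OF i]) auto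
  moreover have "chart_set i \<in> nbhds UNIV 1 P1 (\<phi> P)" unfolding nbhds_def using zar_open_UNIV[OF chart_open[OF i]] P(2) by blast
  ultimately have g0: "?g0 \<in> max_ideal_funs 1 P1 (\<phi> P)" unfolding max_ideal_funs_def fun_ring_def by auto
  have "?g0 \<circ> \<phi> = (\<lambda>Q. chart i (\<phi> Q) + ?z)" by auto
  then have ex: "expo x y (?g0 \<circ> \<phi>) = expo x y (\<lambda>Q. chart i (\<phi> Q)) + fls_const ?z"
    using expo_add[OF r(1) rep_const fp] expo_const[OF fp] by simp
  show ?thesis unfolding ex[symmetric]
    by (rule ramification_expo[OF P(1) std e _ g0]) (use germ ex in auto)
qed

text \<open>The morphism is replaced by its coordinate in one chart, a rational function on the
  curve. Where this coordinate has a pole, the other chart supplies its inverse, whose order is the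
  ramification index.\<close>

theorem no_tame_morphism:
  assumes m: "morphism F2t_perf 2 E 1 P1 \<phi>"
    and dom: "\<forall>V \<in> dense_opens F2t_perf 1 P1. \<exists>P\<in>E. \<phi> P \<in> V"
    and tame: "tame 2 E 1 P1 \<phi>"
  shows False
proof -
  let ?T = "\<lambda>i Q. chart i (\<phi> Q)"
  have phi: "\<phi> ` E \<subseteq> P1" using m unfolding morphism_def by blast
  have "proj_point (\<lambda>k. if k = 1 then 1 else 0) \<in> chart_set 1"
    unfolding chart_set_def using proj_point_in_space[of 1 "\<lambda>k. if k = 1 then 1 else 0" 1] by (auto simp: proj_point_def)
  then have "chart_set 1 \<in> dense_opens F2t_perf 1 P1" unfolding dense_opens_def using chart_open[of 1] by auto
  \<comment> \<open>Dominance ensures that some point of the curve maps into the chart, so the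
    coordinate function is defined on a nonempty open set.\<close>
  then obtain P0 where P0: "P0 \<in> E" "\<phi> P0 \<in> chart_set 1" using dom by blast
  obtain V d c1 c2 where r: "rep (?T 1) V d c1 c2" "P0 \<in> V" "\<And>Q. Q \<in> V \<Longrightarrow> \<phi> Q \<in> chart_set 1"
    "\<And>m. c1 m \<in> F2t_perf" "\<And>m. c2 m \<in> F2t_perf"
    by (rule pullback_chart[OF m order_refl P0]) (rule that)
  show False
  proof (rule no_tame_function)
    show "cf_perf (deh d c1)" "cf_perf (deh d c2)" by (rule deh_perf[OF r(4)], rule deh_perf[OF r(5)])
    show "deh d c2 \<noteq> (0, 0)" by (rule rep_nonzero[OF r(1)])
    fix x y U assume std: "std_point x y U"
    have fp: "formal_point x y U" using std by (rule std_point_formal)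
    obtain P l v where P: "P \<in> E" "fdata P x y l v" using std_point_fdata[OF std] by blast
    obtain e where e: "has_ramification_index 2 E 1 P1 \<phi> P e" "\<not> CHAR(F2t_bar) dvd e"
      using tame P(1) unfolding tame_def by blast
    have odd: "odd (int e)" using e(2) unfolding CHAR_F2t_bar by simp
    have T1: "expo x y (?T 1) = ev (deh d c1) x y / ev (deh d c2) x y" unfolding expo_eq[OF r(1) fp] fexp_def ..
    show "odd_order (ev (deh d c1) x y / ev (deh d c2) x y)"
    proof (cases "\<phi> P \<in> chart_set 1")
      case True
      show ?thesis unfolding odd_order_def T1[symmetric]
        using chart_ramification[OF m order_refl P(1) True std P(2) e(1)] odd by metis
    next
      case False
      have Q: "\<phi> P \<in> P1" using P(1) phi by blast
      obtain w where w: "w \<in> \<phi> P" "w 1 = 0" using False Q unfolding chart_set_def by blast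
      have w0: "w 0 \<noteq> 0" using proj_spaceE(3)[OF Q w(1)] w(2) by (auto simp: le_Suc_eq)
      have in0: "\<phi> P \<in> chart_set 0"
      proof -
        have "w' 0 \<noteq> 0" if w': "w' \<in> \<phi> P" for w'
        proof -
          obtain c where "c \<noteq> 0" "w' = (\<lambda>i. c * w i)" by (rule geval_proj[OF Q w(1) w']) (rule that)
          then show ?thesis using w0 by simp
        qed
        then show ?thesis unfolding chart_set_def using Q by blast
      qed
      have z: "chart 0 (\<phi> P) = 0" using chart_eq[OF in0 w(1)] w(2) by simp
      have T0: "expo x y (?T 0) \<noteq> 0" "fls_subdegree (expo x y (?T 0)) = e"
        using chart_ramification[OF m _ P(1) in0 std P(2) e(1)] z by simp_all
      obtain V' d' c1' c2' where r': "rep (?T 0) V' d' c1' c2'" "\<And>Q. Q \<in> V' \<Longrightarrow> \<phi> Q \<in> chart_set 0"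
        by (rule pullback_chart[OF m zero_le P(1) in0]) (rule that)
      \<comment> \<open>The two representations need not share the point \<open>P\<close>; equality
        on the overlap of their open sets is enough to compare expansions.\<close>
      have "expo x y (\<lambda>Q. ?T 0 Q * ?T 1 Q) = expo x y (\<lambda>_. 1)"
      proof (rule expo_cong[OF rep_mult[OF r'(1) r(1)] rep_const fp])
        fix Q assume "Q \<in> V' \<inter> V"
        then have in_charts: "\<phi> Q \<in> chart_set 0" "\<phi> Q \<in> chart_set 1" using r(3) r'(2) by blast+
        then obtain w where w: "w \<in> \<phi> Q" using proj_space_nonempty unfolding chart_set_def by blast
        then have "w 0 \<noteq> 0" "w 1 \<noteq> 0" using in_charts unfolding chart_set_def by blast+
        then show "?T 0 Q * ?T 1 Q = 1" unfolding chart_eq[OF in_charts(1) w] chart_eq[OF in_charts(2) w] by simp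
      qed
      then have prod: "expo x y (?T 0) * expo x y (?T 1) = 1"
        unfolding expo_mult[OF r'(1) r(1) fp] expo_const[OF fp] by simp
      then have T1n: "expo x y (?T 1) \<noteq> 0" by auto
      have "fls_subdegree (expo x y (?T 0)) + fls_subdegree (expo x y (?T 1)) = 0"
        using fls_subdegree_mult[OF T0(1) T1n] prod by simp
      then have "odd (fls_subdegree (expo x y (?T 1)))" using T0(2) odd by presburger
      then show ?thesis unfolding odd_order_def T1[symmetric] using T1n by (intro exI[of _ 0]) simp
    qed
  qed
qed

section \<open>The curve is elliptic and ordinary\<close>

lemma elliptic_E_curve: "elliptic_curve F2t_perf E_curve"
  unfolding elliptic_curve_def
proof (intro conjI ballI notI)
  show "{a1 E_curve, a2 E_curve, a3 E_curve, a4 E_curve, a6 E_curve} \<subseteq> F2t_perf"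
    by (simp add: E_curve_def)
  fix P assume P: "P \<in> E" "singular_point E_curve P"
  have Q: "P \<in> proj_space 2" using P(1) E_sub by blast
  obtain v where v: "v \<in> P" using proj_space_nonempty[OF Q] by blast
  have e: "v 1 * v 2 = (v 0)\<^sup>2" "v 0 * v 2 = 0"
    "(v 1)\<^sup>2 + v 0 * v 1 = t_gen * (v 0)\<^sup>2 + t_gen ^ 6 * (v 2)\<^sup>2"
    using P(2) v unfolding singular_point_def Let_def E_curve_def by auto
  have "v 0 = 0 \<and> v 1 = 0 \<and> v 2 = 0"
  proof (cases "v 2 = 0")
    case True
    then have "v 0 = 0" using e(1) by simp
    then show ?thesis using e(3) True by simp
  next
    case False
    then have "v 0 = 0" "v 1 = 0" using e(1,2) by auto
    then have "t_gen ^ 6 * (v 2)\<^sup>2 = 0" using e(3) by simp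
    then show ?thesis using False t_gen_nz by simp
  qed
  moreover obtain i where "i \<le> 2" "v i \<noteq> 0" using proj_spaceE(3)[OF Q v] by blast
  ultimately show False by (auto simp: le_Suc_eq numeral_2_eq_2)
qed

text \<open>A finite point is killed by doubling exactly if \<open>2 y + a1 x + a3\<close>, which
  here is \<open>x\<close>, vanishes; abscissa zero leaves the ordinate \<open>t^3\<close>
  alone.\<close>

lemma ordinary_E_curve: "ordinary E_curve"
proof -
  have "{P \<in> ec_points E_curve. ec_mult E_curve 2 P = None} = {None, Some (0, t_gen ^ 3)}"
  proof (intro equalityI subsetI)
    fix P assume P: "P \<in> {P \<in> ec_points E_curve. ec_mult E_curve 2 P = None}"
    show "P \<in> {None, Some (0, t_gen ^ 3)}"
    proof (cases P)
      case (Some q)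
      obtain a b where q: "P = Some (a, b)" using Some by (cases q) auto
      have a: "a = 0" using P unfolding q numeral_2_eq_2 by (auto simp: E_curve_def Let_def split: if_splits)
      have "b\<^sup>2 = (t_gen ^ 3)\<^sup>2" using P unfolding q a ec_points_def by (auto simp: E_curve_def simp flip: power_mult)
      then show ?thesis unfolding q a by (simp only: square_inj) simp
    qed simp
  next
    fix P assume P: "P \<in> {None, Some (0 :: F2t_bar, t_gen ^ 3)}"
    then show "P \<in> {P \<in> ec_points E_curve. ec_mult E_curve 2 P = None}"
      unfolding numeral_2_eq_2 ec_points_def by (auto simp: E_curve_def simp flip: power_mult)
  qed
  then show ?thesis unfolding ordinary_def CHAR_F2t_bar by simp
qed

theorem theorem8p2:
  shows "CHAR(F2t_bar) = 2 \<and> perfect_subfield F2t_perf \<and>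
    elliptic_curve F2t_perf E_curve \<and> ordinary E_curve \<and>
    \<not> admits_tame_map_to_P1 F2t_perf 2 (weierstrass_curve E_curve)"
proof (intro conjI notI)
  assume "admits_tame_map_to_P1 F2t_perf 2 E"
  then obtain \<phi> where "morphism F2t_perf 2 E 1 P1 \<phi>" "separable_morphism F2t_perf 2 E 1 P1 \<phi>" "tame 2 E 1 P1 \<phi>"
    unfolding admits_tame_map_to_P1_def finite_morphism_def by blast
  then show False using no_tame_morphism unfolding separable_morphism_def by blast
qed (rule CHAR_F2t_bar perfect_subfield_F2t_perf elliptic_E_curve ordinary_E_curve)+

end
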